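(* Let $M=U/K$ be a compact Riemannian symmetric space such that $U$ is a semisimple compact Lie group, let $o=eK$, and let $\mathfrak{p}_*$ (identified with $T_oM$), $\Sigma$ and $\triangle'\subset\mathfrak{h}_{\mathfrak{p}_0}=\sqrt{-1}\,\mathfrak{h}_{\mathfrak{p}_*}$ be as defined in the context. Then the first conjugate locus $K(o)$ of $o$ in $T_oM=\mathfrak{p}_*$ is $$K(o)=\mathrm{Ad}(K)\big(\pi\sqrt{-1}\,\triangle'\big)=\{\mathrm{Ad}(k)(\pi\sqrt{-1}\,x):k\in K,\ x\in\triangle'\}.$$
   Context: Setting. $U$ is a compact semisimple Lie group with Lie algebra $\mathfrak{u}$, $M=U/K$ is a Riemannian symmetric space with $U$-invariant metric $g$, and $\theta$ is the corresponding involutive automorphism of $\mathfrak{u}$; thus $\mathfrak{u}=\mathfrak{k}_0\oplus\mathfrak{p}_*$, where $\mathfrak{k}_0=\{X\in\mathfrak{u}:\theta X=X\}$ is the Lie algebra of $K$ and $\mathfrak{p}_*=\{X\in\mathfrak{u}:\theta X=-X\}$. The tangent space $T_oM$ at $o=eK$ is identified with $\mathfrak{p}_*$; the metric at $o$ is an inner product $\langle\cdot,\cdot\rangle$ on $\mathfrak{p}_*$ invariant under $\mathrm{Ad}(K)$. Restricted roots. $\mathfrak{g}=\mathfrak{u}\otimes\mathbb{C}$, $\theta$ is extended complex linearly, and $(\cdot,\cdot)$ is the Killing form. $\mathfrak{h}_{\mathfrak{p}_*}$ is a maximal abelian subspace of $\mathfrak{p}_*$; $\mathfrak{h}_{\mathfrak{k}_0}\subset\mathfrak{k}_0$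 is an abelian subalgebra such that $\mathfrak{h}_{\mathfrak{k}_0}\oplus\mathfrak{h}_{\mathfrak{p}_*}$ is a maximal abelian subalgebra of $\mathfrak{u}$; $\mathfrak{h}$ is the complex span of this subalgebra. $\mathfrak{h}_{\mathfrak{p}_0}=\sqrt{-1}\,\mathfrak{h}_{\mathfrak{p}_*}$, and $(\cdot,\cdot)$ is positive definite on $\mathfrak{h}_{\mathbb{R}}=\sqrt{-1}\,\mathfrak{h}_{\mathfrak{k}_0}\oplus\mathfrak{h}_{\mathfrak{p}_0}$. $\Delta\subset\mathfrak{h}_{\mathbb{R}}$ is the root system of $\mathfrak{g}$ with respect to $\mathfrak{h}$, where a root is identified with the vector $\alpha\in\mathfrak{h}_{\mathbb R}$ for which $H\mapsto(H,\alpha)$ is the root functional. For $\alpha\in\Delta$ put $\bar\alpha=\tfrac12(\alpha-\theta(\alpha))$, the orthogonal projection of $\alpha$ to $\mathfrak{h}_{\mathfrak{p}_0}$. The restricted root system is $\Sigma=\{\bar\alpha:\alpha\in\Delta,\ \bar\alpha\neq0\}\subset\mathfrak{h}_{\mathfrak{p}_0}$ (possibly nonreduced). $\Sigma$ is given an ordering, with positive roots $\Sigma^+$ and simple roots $\Pi$. Cartan polyhedron. Let $B$ be the set of maximal roots of $\Sigma$ (the highest roots of the irreducible components of $\Sigma$). Put $$\triangle=\{x\in\mathfrak{h}_{\mathfrak{p}_0}:(x,\gamma)\ge0\ \text{for all }\gamma\in\Pi,\ (x,\beta)\le1\ \text{for all }\beta\in B\},\qquad \triangle'=\{x\in\triangle:(x,\beta)=1\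 \text{for some }\beta\in B\}.$$ Conjugate points. $X\in T_oM$ is a conjugate point in $T_oM$ if there is a nonzero Jacobi field $V$ along $\gamma(t)=\exp_o(tX)$ with $V(0)=V(1)=0$. The first conjugate locus $K(o)$ is the set of conjugate points $X\in T_oM$ such that $tX$ is not a conjugate point for every $t\in(0,1)$. *)

theory Defs
  imports "HOL-Analysis.Analysis" "HOL-Algebra.Coset"
begin

section \<open>Smooth manifolds\<close>

primrec Ck_on :: "nat \<Rightarrow> 'a::real_normed_vector set \<Rightarrow> ('a \<Rightarrow> 'b::real_normed_vector) \<Rightarrow> bool" where
  "Ck_on 0 S f \<longleftrightarrow> continuous_on S f"
| "Ck_on (Suc k) S f \<longleftrightarrow> (\<forall>x\<in>S. f differentiable (at x)) \<and>
     (\<forall>v. Ck_on k S (\<lambda>x. frechet_derivative f (at x) v))"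

text \<open>Meant for open \<open>S\<close> in a finite-dimensional space.\<close>
definition smooth_on :: "'a::real_normed_vector set \<Rightarrow> ('a \<Rightarrow> 'b::real_normed_vector) \<Rightarrow> bool" where
  "smooth_on S f \<longleftrightarrow> (\<forall>k. Ck_on k S f)"

text \<open>
  A manifold modelled on the Euclidean space \<open>'e\<close> comes with a preferred chart
  \<open>chart M p\<close>, with domain \<open>chart_dom M p\<close>, around each of its points \<open>p\<close>; these charts form the
  atlas that generates the smooth structure. The tangent space at \<open>p\<close> is identified with \<open>'e\<close>
  by means of the preferred chart at \<open>p\<close>. Thus an element of \<open>'e\<close> is a tangent vector only
  together with a base point, and tangent vectors at different points are compared only
  after a change to a common chart.\<close>
record ('m, 'e) manifold =
  points :: "'m set"
  chart_dom :: "'m \<Rightarrow> 'm set"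
  chart :: "'m \<Rightarrow> 'm \<Rightarrow> 'e"

definition chart_inv :: "('m, 'e) manifold \<Rightarrow> 'm \<Rightarrow> 'e \<Rightarrow> 'm" where
  "chart_inv M p = inv_into (chart_dom M p) (chart M p)"

definition chart_open :: "('m, 'e::euclidean_space) manifold \<Rightarrow> 'm set \<Rightarrow> bool" where
  "chart_open M W \<longleftrightarrow> W \<subseteq> points M \<and>
     (\<forall>p\<in>points M. open (chart M p ` (W \<inter> chart_dom M p)))"

definition manifold_topology :: "('m, 'e::euclidean_space) manifold \<Rightarrow> 'm topology" where
  "manifold_topology M = topology (chart_open M)"

definition smooth_manifold :: "('m, 'e::euclidean_space) manifold \<Rightarrow> bool" where
  "smooth_manifold M \<longleftrightarrow>
     (\<forall>p\<in>points M. p \<in> chart_dom M p \<and> chart_dom M p \<subseteq> points M \<and>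
        inj_on (chart M p) (chart_dom M p) \<and> open (chart M p ` chart_dom M p)) \<and>
     (\<forall>p\<in>points M. \<forall>q\<in>points M.
        open (chart M p ` (chart_dom M p \<inter> chart_dom M q)) \<and>
        smooth_on (chart M p ` (chart_dom M p \<inter> chart_dom M q)) (chart M q \<circ> chart_inv M p)) \<and>
     Hausdorff_space (manifold_topology M) \<and>
     second_countable (manifold_topology M)"

lemma openin_manifold_topology:
  assumes "\<And>p. p \<in> points M \<Longrightarrow> inj_on (chart M p) (chart_dom M p)"
  shows "openin (manifold_topology M) W \<longleftrightarrow> chart_open M W"
proof -
  have "istopology (chart_open M)"
    unfolding istopology_def
  proof (intro conjI allI impI)
    fix S T assume S: "chart_open M S" and T: "chart_open M T"
    show "chart_open M (S \<inter> T)"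
      unfolding chart_open_def
    proof (intro conjI ballI)
      show "S \<inter> T \<subseteq> points M" using S by (auto simp: chart_open_def)
      fix p assume p: "p \<in> points M"
      have "chart M p ` (S \<inter> T \<inter> chart_dom M p) =
            chart M p ` (S \<inter> chart_dom M p) \<inter> chart M p ` (T \<inter> chart_dom M p)"
        using assms[OF p] unfolding inj_on_def by blast
      then show "open (chart M p ` (S \<inter> T \<inter> chart_dom M p))"
        using S T p by (simp add: chart_open_def open_Int)
    qed
  next
    fix \<K> assume K: "\<forall>W\<in>\<K>. chart_open M W"
    show "chart_open M (\<Union>\<K>)"
      unfolding chart_open_def
    proof (intro conjI ballI)
      show "\<Union>\<K> \<subseteq> points M" using K by (auto simp: chart_open_def)
      fix p assume p: "p \<in> points M"
      have "chart M p ` (\<Union>\<K> \<inter> chart_dom M p) = (\<Union>W\<in>\<K>. chart M p ` (W \<inter> chart_dom M p))"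
        by blast
      then show "open (chart M p ` (\<Union>\<K> \<inter> chart_dom M p))"
        using K p by (auto simp: chart_open_def)
    qed
  qed
  then show ?thesis
    unfolding manifold_topology_def by (simp add: topology_inverse')
qed

definition smooth_map ::
    "('m, 'e::euclidean_space) manifold \<Rightarrow> ('n, 'f::euclidean_space) manifold \<Rightarrow> ('m \<Rightarrow> 'n) \<Rightarrow> bool" where
  "smooth_map M N F \<longleftrightarrow> F ` points M \<subseteq> points N \<and>
     (\<forall>p\<in>points M. \<forall>q\<in>points N.
        open (chart M p ` {r \<in> chart_dom M p. F r \<in> chart_dom N q}) \<and>
        smooth_on (chart M p ` {r \<in> chart_dom M p. F r \<in> chart_dom N q})
          (chart N q \<circ> F \<circ> chart_inv M p))"

definition differential ::
    "('m, 'e::euclidean_space) manifold \<Rightarrow> ('n, 'f::euclidean_space) manifold \<Rightarrow>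
       ('m \<Rightarrow> 'n) \<Rightarrow> 'm \<Rightarrow> 'e \<Rightarrow> 'f" where
  "differential M N F p =
     frechet_derivative (chart N (F p) \<circ> F \<circ> chart_inv M p) (at (chart M p p))"

text \<open>Passage, for a tangent vector at \<open>r\<close>, from its components in the chart at \<open>p\<close> to its
  components in the chart at \<open>q\<close>.\<close>
definition tangent_change ::
    "('m, 'e::euclidean_space) manifold \<Rightarrow> 'm \<Rightarrow> 'm \<Rightarrow> 'm \<Rightarrow> 'e \<Rightarrow> 'e" where
  "tangent_change M p q r =
     frechet_derivative (chart M q \<circ> chart_inv M p) (at (chart M p r))"

definition real_line :: "(real, real) manifold" where
  "real_line = \<lparr>points = UNIV, chart_dom = (\<lambda>_. UNIV), chart = (\<lambda>_ t. t)\<rparr>"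

definition prod_manifold ::
    "('m, 'e) manifold \<Rightarrow> ('n, 'f) manifold \<Rightarrow> ('m \<times> 'n, 'e \<times> 'f) manifold" where
  "prod_manifold M N =
     \<lparr>points = points M \<times> points N,
      chart_dom = (\<lambda>(p, q). chart_dom M p \<times> chart_dom N q),
      chart = (\<lambda>(p, q) (x, y). (chart M p x, chart N q y))\<rparr>"

definition velocity :: "('m, 'e::euclidean_space) manifold \<Rightarrow> (real \<Rightarrow> 'm) \<Rightarrow> real \<Rightarrow> 'e" where
  "velocity M \<gamma> t = differential real_line M \<gamma> t 1"

text \<open>Lie bracket \<open>[V, W]\<close> at \<open>p\<close> of vector fields, from the coordinate formula \<open>DW(V) - DV(W)\<close>.\<close>
definition vector_field_rep ::
    "('m, 'e::euclidean_space) manifold \<Rightarrow> 'm \<Rightarrow> ('m \<Rightarrow> 'e) \<Rightarrow> 'e \<Rightarrow> 'e" where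
  "vector_field_rep M p V x =
     tangent_change M (chart_inv M p x) p (chart_inv M p x) (V (chart_inv M p x))"

definition vector_field_bracket ::
    "('m, 'e::euclidean_space) manifold \<Rightarrow> ('m \<Rightarrow> 'e) \<Rightarrow> ('m \<Rightarrow> 'e) \<Rightarrow> 'm \<Rightarrow> 'e" where
  "vector_field_bracket M V W p =
     frechet_derivative (vector_field_rep M p W) (at (chart M p p)) (V p) -
     frechet_derivative (vector_field_rep M p V) (at (chart M p p)) (W p)"


section \<open>Riemannian manifolds and Jacobi fields\<close>

type_synonym ('m, 'e) metric = "'m \<Rightarrow> 'e \<Rightarrow> 'e \<Rightarrow> real"

text \<open>The metric at the point with coordinates \<open>x\<close> in the chart at \<open>p\<close>, evaluated on vectors given
  by their components in that chart.\<close>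
definition metric_rep ::
    "('m, 'e::euclidean_space) manifold \<Rightarrow> ('m, 'e) metric \<Rightarrow> 'm \<Rightarrow> 'e \<Rightarrow> 'e \<Rightarrow> 'e \<Rightarrow> real" where
  "metric_rep M g p x v w =
     (let q = chart_inv M p x in g q (tangent_change M p q q v) (tangent_change M p q q w))"

definition riemannian_metric :: "('m, 'e::euclidean_space) manifold \<Rightarrow> ('m, 'e) metric \<Rightarrow> bool" where
  "riemannian_metric M g \<longleftrightarrow>
     (\<forall>p\<in>points M. bilinear (g p) \<and> (\<forall>v w. g p v w = g p w v) \<and> (\<forall>v. v \<noteq> 0 \<longrightarrow> g p v v > 0) \<and>
        (\<forall>v w. smooth_on (chart M p ` chart_dom M p) (\<lambda>x. metric_rep M g p x v w)))"

text \<open>Levi-Civita connection in the chart at \<open>p\<close>: \<open>christoffel M g p x v w = \<Gamma>\<^sub>x(v, w)\<close> is determined by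
  \<open>2 G\<^sub>x(\<Gamma>\<^sub>x(v, w), u) = (D\<^sub>v G)(w, u) + (D\<^sub>w G)(v, u) - (D\<^sub>u G)(v, w)\<close> for all \<open>u\<close>, where \<open>G\<close> is the
  metric in the chart.\<close>
definition christoffel ::
    "('m, 'e::euclidean_space) manifold \<Rightarrow> ('m, 'e) metric \<Rightarrow> 'm \<Rightarrow> 'e \<Rightarrow> 'e \<Rightarrow> 'e \<Rightarrow> 'e" where
  "christoffel M g p x v w = (THE z. \<forall>u.
     2 * metric_rep M g p x z u =
       frechet_derivative (\<lambda>y. metric_rep M g p y w u) (at x) v +
       frechet_derivative (\<lambda>y. metric_rep M g p y v u) (at x) w -
       frechet_derivative (\<lambda>y. metric_rep M g p y v w) (at x) u)"

text \<open>Curvature at \<open>p\<close>, with the sign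
  \<open>R(u, v) w = \<nabla>\<^sub>u \<nabla>\<^sub>v w - \<nabla>\<^sub>v \<nabla>\<^sub>u w - \<nabla>\<^bsub>[u, v]\<^esub> w\<close>.\<close>
definition curvature ::
    "('m, 'e::euclidean_space) manifold \<Rightarrow> ('m, 'e) metric \<Rightarrow> 'm \<Rightarrow> 'e \<Rightarrow> 'e \<Rightarrow> 'e \<Rightarrow> 'e" where
  "curvature M g p u v w =
     (let x = chart M p p; \<Gamma> = christoffel M g p in
       frechet_derivative (\<lambda>y. \<Gamma> y v w) (at x) u - frechet_derivative (\<lambda>y. \<Gamma> y u w) (at x) v +
       \<Gamma> x u (\<Gamma> x v w) - \<Gamma> x v (\<Gamma> x u w))"

text \<open>A vector field along a curve \<open>\<gamma>\<close> assigns to \<open>t\<close> a tangent vector at \<open>\<gamma> t\<close>;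
  \<open>along_rep M \<gamma> V p s\<close> is its component vector at time \<open>s\<close> in the chart at \<open>p\<close>.\<close>
definition along_rep ::
    "('m, 'e::euclidean_space) manifold \<Rightarrow> (real \<Rightarrow> 'm) \<Rightarrow> (real \<Rightarrow> 'e) \<Rightarrow> 'm \<Rightarrow> real \<Rightarrow> 'e" where
  "along_rep M \<gamma> V p s = tangent_change M (\<gamma> s) p (\<gamma> s) (V s)"

definition smooth_along ::
    "('m, 'e::euclidean_space) manifold \<Rightarrow> (real \<Rightarrow> 'm) \<Rightarrow> (real \<Rightarrow> 'e) \<Rightarrow> bool" where
  "smooth_along M \<gamma> V \<longleftrightarrow>
     (\<forall>p\<in>points M. smooth_on {s. \<gamma> s \<in> chart_dom M p} (along_rep M \<gamma> V p))"

text \<open>The covariant derivative along \<open>\<gamma>\<close>, computed at time \<open>t\<close> in the preferred chart at \<open>\<gamma> t\<close>.\<close>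
definition covariant_derivative ::
    "('m, 'e::euclidean_space) manifold \<Rightarrow> ('m, 'e) metric \<Rightarrow> (real \<Rightarrow> 'm) \<Rightarrow> (real \<Rightarrow> 'e) \<Rightarrow>
       real \<Rightarrow> 'e" where
  "covariant_derivative M g \<gamma> V t =
     vector_derivative (along_rep M \<gamma> V (\<gamma> t)) (at t) +
     christoffel M g (\<gamma> t) (chart M (\<gamma> t) (\<gamma> t)) (velocity M \<gamma> t) (V t)"

definition geodesic ::
    "('m, 'e::euclidean_space) manifold \<Rightarrow> ('m, 'e) metric \<Rightarrow> (real \<Rightarrow> 'm) \<Rightarrow> bool" where
  "geodesic M g \<gamma> \<longleftrightarrow> smooth_map real_line M \<gamma> \<and>
     (\<forall>t. covariant_derivative M g \<gamma> (velocity M \<gamma>) t = 0)"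

text \<open>Only used for geodesically complete manifolds.\<close>
definition riem_exp ::
    "('m, 'e::euclidean_space) manifold \<Rightarrow> ('m, 'e) metric \<Rightarrow> 'm \<Rightarrow> 'e \<Rightarrow> 'm" where
  "riem_exp M g p X = (THE \<gamma>. geodesic M g \<gamma> \<and> \<gamma> 0 = p \<and> velocity M \<gamma> 0 = X) 1"

definition jacobi_field ::
    "('m, 'e::euclidean_space) manifold \<Rightarrow> ('m, 'e) metric \<Rightarrow> (real \<Rightarrow> 'm) \<Rightarrow> (real \<Rightarrow> 'e) \<Rightarrow> bool" where
  "jacobi_field M g \<gamma> V \<longleftrightarrow> smooth_along M \<gamma> V \<and>
     (\<forall>t. covariant_derivative M g \<gamma> (covariant_derivative M g \<gamma> V) t +
          curvature M g (\<gamma> t) (V t) (velocity M \<gamma> t) (velocity M \<gamma> t) = 0)"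

definition conjugate_point ::
    "('m, 'e::euclidean_space) manifold \<Rightarrow> ('m, 'e) metric \<Rightarrow> 'm \<Rightarrow> 'e \<Rightarrow> bool" where
  "conjugate_point M g p X \<longleftrightarrow>
     (\<exists>V. jacobi_field M g (\<lambda>t. riem_exp M g p (t *\<^sub>R X)) V \<and> (\<exists>t. V t \<noteq> 0) \<and> V 0 = 0 \<and> V 1 = 0)"

definition first_conjugate_locus ::
    "('m, 'e::euclidean_space) manifold \<Rightarrow> ('m, 'e) metric \<Rightarrow> 'm \<Rightarrow> 'e set" where
  "first_conjugate_locus M g p =
     {X. conjugate_point M g p X \<and> (\<forall>t\<in>{0<..<1}. \<not> conjugate_point M g p (t *\<^sub>R X))}"

definition isometry ::
    "('m, 'e::euclidean_space) manifold \<Rightarrow> ('m, 'e) metric \<Rightarrow> ('m \<Rightarrow> 'm) \<Rightarrow> bool" where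
  "isometry M g F \<longleftrightarrow>
     bij_betw F (points M) (points M) \<and> smooth_map M M F \<and>
     smooth_map M M (inv_into (points M) F) \<and>
     (\<forall>p\<in>points M. \<forall>v w. g (F p) (differential M M F p v) (differential M M F p w) = g p v w)"

definition riemannian_symmetric :: "('m, 'e::euclidean_space) manifold \<Rightarrow> ('m, 'e) metric \<Rightarrow> bool" where
  "riemannian_symmetric M g \<longleftrightarrow> smooth_manifold M \<and> riemannian_metric M g \<and>
     (\<forall>p\<in>points M. \<exists>s. isometry M g s \<and> s p = p \<and> (\<forall>v. differential M M s p v = - v))"


section \<open>Lie groups and homogeneous spaces\<close>

definition lie_group :: "'u monoid \<Rightarrow> ('u, 'a::euclidean_space) manifold \<Rightarrow> bool" where
  "lie_group G A \<longleftrightarrow> group G \<and> smooth_manifold A \<and> carrier G = points A \<and>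
     smooth_map (prod_manifold A A) A (\<lambda>(x, y). x \<otimes>\<^bsub>G\<^esub> y) \<and>
     smooth_map A A (m_inv G)"

text \<open>The Lie algebra of the group is its tangent space at the unit element, that is, the whole
  type \<open>'a\<close>, with the bracket of left-invariant vector fields.\<close>
definition left_invariant_field ::
    "'u monoid \<Rightarrow> ('u, 'a::euclidean_space) manifold \<Rightarrow> 'a \<Rightarrow> 'u \<Rightarrow> 'a" where
  "left_invariant_field G A X u = differential A A (\<lambda>v. u \<otimes>\<^bsub>G\<^esub> v) \<one>\<^bsub>G\<^esub> X"

definition lie_bracket ::
    "'u monoid \<Rightarrow> ('u, 'a::euclidean_space) manifold \<Rightarrow> 'a \<Rightarrow> 'a \<Rightarrow> 'a" where
  "lie_bracket G A X Y =
     vector_field_bracket A (left_invariant_field G A X) (left_invariant_field G A Y) \<one>\<^bsub>G\<^esub>"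

definition Ad :: "'u monoid \<Rightarrow> ('u, 'a::euclidean_space) manifold \<Rightarrow> 'u \<Rightarrow> 'a \<Rightarrow> 'a" where
  "Ad G A u = differential A A (\<lambda>v. u \<otimes>\<^bsub>G\<^esub> v \<otimes>\<^bsub>G\<^esub> inv\<^bsub>G\<^esub> u) \<one>\<^bsub>G\<^esub>"

definition one_parameter_subgroup ::
    "'u monoid \<Rightarrow> ('u, 'a::euclidean_space) manifold \<Rightarrow> (real \<Rightarrow> 'u) \<Rightarrow> bool" where
  "one_parameter_subgroup G A c \<longleftrightarrow> smooth_map real_line A c \<and> (\<forall>s t. c (s + t) = c s \<otimes>\<^bsub>G\<^esub> c t)"

text \<open>The Lie algebra of a closed subgroup \<open>K\<close>: those \<open>X\<close> with \<open>exp (t X) \<in> K\<close> for all \<open>t\<close>.\<close>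
definition subgroup_lie_algebra ::
    "'u monoid \<Rightarrow> ('u, 'a::euclidean_space) manifold \<Rightarrow> 'u set \<Rightarrow> 'a set" where
  "subgroup_lie_algebra G A K =
     {X. \<exists>c. one_parameter_subgroup G A c \<and> velocity A c 0 = X \<and> (\<forall>t. c t \<in> K)}"

text \<open>The quotient smooth structure on \<open>G/K\<close> is the unique one for which the projection
  \<open>u \<mapsto> uK\<close> is a smooth submersion.\<close>
definition quotient_manifold ::
    "'u monoid \<Rightarrow> ('u, 'a::euclidean_space) manifold \<Rightarrow> 'u set \<Rightarrow>
       ('u set, 'b::euclidean_space) manifold \<Rightarrow> bool" where
  "quotient_manifold G A K M \<longleftrightarrow> smooth_manifold M \<and>
     points M = (\<lambda>u. u <#\<^bsub>G\<^esub> K) ` carrier G \<and>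
     smooth_map A M (\<lambda>u. u <#\<^bsub>G\<^esub> K) \<and>
     (\<forall>u\<in>carrier G. surj (differential A M (\<lambda>u. u <#\<^bsub>G\<^esub> K) u))"

definition invariant_metric ::
    "'u monoid \<Rightarrow> ('u set, 'b::euclidean_space) manifold \<Rightarrow> ('u set, 'b) metric \<Rightarrow> bool" where
  "invariant_metric G M g \<longleftrightarrow> (\<forall>u\<in>carrier G. isometry M g (\<lambda>q. u <#\<^bsub>G\<^esub> q))"


section \<open>Lie algebras and complexification\<close>

definition linear_trace :: "('a::euclidean_space \<Rightarrow> 'a) \<Rightarrow> real" where
  "linear_trace f = (\<Sum>b\<in>Basis. f b \<bullet> b)"

definition killing_form :: "('a::euclidean_space \<Rightarrow> 'a \<Rightarrow> 'a) \<Rightarrow> 'a \<Rightarrow> 'a \<Rightarrow> real" where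
  "killing_form br X Y = linear_trace (\<lambda>Z. br X (br Y Z))"

text \<open>Semisimplicity is taken, as in Helgason's book, to mean that the Killing form is
  nondegenerate.\<close>
definition semisimple :: "('a::euclidean_space \<Rightarrow> 'a \<Rightarrow> 'a) \<Rightarrow> bool" where
  "semisimple br \<longleftrightarrow> (\<forall>X. (\<forall>Y. killing_form br X Y = 0) \<longrightarrow> X = 0)"

definition involutive_automorphism ::
    "('a::euclidean_space \<Rightarrow> 'a \<Rightarrow> 'a) \<Rightarrow> ('a \<Rightarrow> 'a) \<Rightarrow> bool" where
  "involutive_automorphism br \<theta> \<longleftrightarrow>
     linear \<theta> \<and> (\<forall>X Y. \<theta> (br X Y) = br (\<theta> X) (\<theta> Y)) \<and> (\<forall>X. \<theta> (\<theta> X) = X)"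

definition abelian_subspace :: "('a::real_vector \<Rightarrow> 'a \<Rightarrow> 'a) \<Rightarrow> 'a set \<Rightarrow> bool" where
  "abelian_subspace br \<aa> \<longleftrightarrow> subspace \<aa> \<and> (\<forall>X\<in>\<aa>. \<forall>Y\<in>\<aa>. br X Y = 0)"

definition maximal_abelian_in :: "('a::real_vector \<Rightarrow> 'a \<Rightarrow> 'a) \<Rightarrow> 'a set \<Rightarrow> 'a set \<Rightarrow> bool" where
  "maximal_abelian_in br S \<aa> \<longleftrightarrow> abelian_subspace br \<aa> \<and> \<aa> \<subseteq> S \<and>
     (\<forall>\<bb>. abelian_subspace br \<bb> \<and> \<bb> \<subseteq> S \<and> \<aa> \<subseteq> \<bb> \<longrightarrow> \<bb> = \<aa>)"

text \<open>The pair \<open>(X, Y)\<close> stands for the element \<open>X + \<i> Y\<close> of the complexification.\<close>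
type_synonym 'a cplx = "'a \<times> 'a"

definition cembed :: "'a::real_vector \<Rightarrow> 'a cplx" where
  "cembed X = (X, 0)"

definition cscale :: "complex \<Rightarrow> 'a::real_vector cplx \<Rightarrow> 'a cplx" where
  "cscale c = (\<lambda>(X, Y). (Re c *\<^sub>R X - Im c *\<^sub>R Y, Re c *\<^sub>R Y + Im c *\<^sub>R X))"

definition cextend :: "('a::real_vector \<Rightarrow> 'a) \<Rightarrow> 'a cplx \<Rightarrow> 'a cplx" where
  "cextend f = (\<lambda>(X, Y). (f X, f Y))"

definition cbracket :: "('a::real_vector \<Rightarrow> 'a \<Rightarrow> 'a) \<Rightarrow> 'a cplx \<Rightarrow> 'a cplx \<Rightarrow> 'a cplx" where
  "cbracket br = (\<lambda>(X, Y) (X', Y'). (br X X' - br Y Y', br X Y' + br Y X'))"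

text \<open>The trace of a complex linear map, computed in the complex basis \<open>cembed ` Basis\<close>.\<close>
definition ctrace :: "('a::euclidean_space cplx \<Rightarrow> 'a cplx) \<Rightarrow> complex" where
  "ctrace f = (\<Sum>b\<in>Basis. Complex (fst (f (cembed b)) \<bullet> b) (snd (f (cembed b)) \<bullet> b))"

definition ckilling_form :: "('a::euclidean_space \<Rightarrow> 'a \<Rightarrow> 'a) \<Rightarrow> 'a cplx \<Rightarrow> 'a cplx \<Rightarrow> complex" where
  "ckilling_form br Z W = ctrace (\<lambda>T. cbracket br Z (cbracket br W T))"

definition complex_span :: "'a::real_vector cplx set \<Rightarrow> 'a cplx set" where
  "complex_span S = span (S \<union> cscale \<i> ` S)"

definition sum_subspace :: "'a::real_vector set \<Rightarrow> 'a set \<Rightarrow> 'a set" where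
  "sum_subspace S T = {X + Y | X Y. X \<in> S \<and> Y \<in> T}"


section \<open>Restricted roots and the Cartan polyhedron\<close>

text \<open>In this section \<open>hk\<close> and \<open>hp\<close> are the subspaces \<open>\<hh>\<^sub>k\<^sub>0\<close> and \<open>\<hh>\<^sub>p\<^sub>*\<close> of the compact real form.\<close>

definition imag_part :: "'a::real_vector set \<Rightarrow> 'a cplx set" where
  "imag_part S = (\<lambda>X. cscale \<i> (cembed X)) ` S"

definition cartan_subalgebra :: "'a::real_vector set \<Rightarrow> 'a set \<Rightarrow> 'a cplx set" where
  "cartan_subalgebra hk hp = complex_span (cembed ` sum_subspace hk hp)"

definition cartan_real :: "'a::real_vector set \<Rightarrow> 'a set \<Rightarrow> 'a cplx set" where
  "cartan_real hk hp = sum_subspace (imag_part hk) (imag_part hp)"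

text \<open>A root is represented by the vector \<open>\<alpha>\<close> for which \<open>H \<mapsto> (H, \<alpha>)\<close> is the root functional.\<close>
definition roots ::
    "('a::euclidean_space \<Rightarrow> 'a \<Rightarrow> 'a) \<Rightarrow> 'a set \<Rightarrow> 'a set \<Rightarrow> 'a cplx set" where
  "roots br hk hp = {\<alpha> \<in> cartan_real hk hp. \<alpha> \<noteq> 0 \<and>
     (\<exists>E. E \<noteq> 0 \<and> (\<forall>H\<in>cartan_subalgebra hk hp. cbracket br H E = cscale (ckilling_form br H \<alpha>) E))}"

definition restrict_root :: "('a::real_vector \<Rightarrow> 'a) \<Rightarrow> 'a cplx \<Rightarrow> 'a cplx" where
  "restrict_root \<theta> \<alpha> = (1/2) *\<^sub>R (\<alpha> - cextend \<theta> \<alpha>)"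

definition restricted_roots ::
    "('a::euclidean_space \<Rightarrow> 'a \<Rightarrow> 'a) \<Rightarrow> ('a \<Rightarrow> 'a) \<Rightarrow> 'a set \<Rightarrow> 'a set \<Rightarrow> 'a cplx set" where
  "restricted_roots br \<theta> hk hp =
     {restrict_root \<theta> \<alpha> | \<alpha>. \<alpha> \<in> roots br hk hp \<and> restrict_root \<theta> \<alpha> \<noteq> 0}"

text \<open>A vector space ordering of \<open>V\<close>, given by its set \<open>P\<close> of positive vectors.\<close>
definition vector_ordering :: "'a::real_vector set \<Rightarrow> 'a set \<Rightarrow> bool" where
  "vector_ordering V P \<longleftrightarrow> P \<subseteq> V \<and> 0 \<notin> P \<and>
     (\<forall>x\<in>V. x \<noteq> 0 \<longrightarrow> x \<in> P \<or> - x \<in> P) \<and>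
     (\<forall>x\<in>P. \<forall>y\<in>P. x + y \<in> P) \<and> (\<forall>x\<in>P. \<forall>c>0. c *\<^sub>R x \<in> P)"

definition simple_roots :: "'a::real_vector set \<Rightarrow> 'a set \<Rightarrow> 'a set" where
  "simple_roots \<Sigma> P = {\<gamma> \<in> \<Sigma> \<inter> P. \<not> (\<exists>\<alpha>\<in>\<Sigma> \<inter> P. \<exists>\<beta>\<in>\<Sigma> \<inter> P. \<gamma> = \<alpha> + \<beta>)}"

definition orthogonal_sets ::
    "('a::euclidean_space \<Rightarrow> 'a \<Rightarrow> 'a) \<Rightarrow> 'a cplx set \<Rightarrow> 'a cplx set \<Rightarrow> bool" where
  "orthogonal_sets br S T \<longleftrightarrow> (\<forall>x\<in>S. \<forall>y\<in>T. ckilling_form br x y = 0)"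

definition irreducible_component ::
    "('a::euclidean_space \<Rightarrow> 'a \<Rightarrow> 'a) \<Rightarrow> 'a cplx set \<Rightarrow> 'a cplx set \<Rightarrow> bool" where
  "irreducible_component br \<Sigma> C \<longleftrightarrow> C \<subseteq> \<Sigma> \<and> C \<noteq> {} \<and> orthogonal_sets br C (\<Sigma> - C) \<and>
     \<not> (\<exists>D. D \<subset> C \<and> D \<noteq> {} \<and> orthogonal_sets br D (C - D))"

definition highest_root :: "'a::real_vector set \<Rightarrow> 'a set \<Rightarrow> 'a \<Rightarrow> bool" where
  "highest_root simples C \<beta> \<longleftrightarrow> \<beta> \<in> C \<and>
     (\<forall>\<gamma>\<in>C. \<exists>n::'a \<Rightarrow> nat. \<beta> - \<gamma> = (\<Sum>\<delta>\<in>simples. real (n \<delta>) *\<^sub>R \<delta>))"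

definition maximal_roots ::
    "('a::euclidean_space \<Rightarrow> 'a \<Rightarrow> 'a) \<Rightarrow> 'a cplx set \<Rightarrow> 'a cplx set \<Rightarrow> 'a cplx set" where
  "maximal_roots br \<Sigma> P =
     {\<beta>. \<exists>C. irreducible_component br \<Sigma> C \<and> highest_root (simple_roots \<Sigma> P) C \<beta>}"

text \<open>The Killing form is real-valued on \<open>cartan_real hk hp\<close>, so taking real parts loses nothing.\<close>
definition cartan_polyhedron ::
    "('a::euclidean_space \<Rightarrow> 'a \<Rightarrow> 'a) \<Rightarrow> ('a \<Rightarrow> 'a) \<Rightarrow> 'a set \<Rightarrow> 'a set \<Rightarrow> 'a cplx set \<Rightarrow> 'a cplx set" where
  "cartan_polyhedron br \<theta> hk hp P =
     (let \<Sigma> = restricted_roots br \<theta> hk hp in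
       {x \<in> imag_part hp. (\<forall>\<gamma>\<in>simple_roots \<Sigma> P. Re (ckilling_form br x \<gamma>) \<ge> 0) \<and>
          (\<forall>\<beta>\<in>maximal_roots br \<Sigma> P. Re (ckilling_form br x \<beta>) \<le> 1)})"

definition cartan_polyhedron_face ::
    "('a::euclidean_space \<Rightarrow> 'a \<Rightarrow> 'a) \<Rightarrow> ('a \<Rightarrow> 'a) \<Rightarrow> 'a set \<Rightarrow> 'a set \<Rightarrow> 'a cplx set \<Rightarrow> 'a cplx set" where
  "cartan_polyhedron_face br \<theta> hk hp P =
     {x \<in> cartan_polyhedron br \<theta> hk hp P.
        \<exists>\<beta>\<in>maximal_roots br (restricted_roots br \<theta> hk hp) P. Re (ckilling_form br x \<beta>) = 1}"

end

theory Submission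
  imports Defs
begin

text \<open>The geodesics from \<open>o\<close> are the orbits of the one-parameter subgroups generated by \<open>X \<in> \<pp>\<close>, where
  \<open>\<pp>\<close> is the \<open>-1\<close>-eigenspace of \<open>\<theta>\<close>. Such a subgroup also transports tangent vectors parallelly along
  its orbit, and in the resulting frame the Jacobi equation reads \<open>W'' = ad(X)\<^sup>2 W\<close> on \<open>\<pp>\<close>. Compactness and
  semisimplicity make the Killing form negative definite, so \<open>ad(X)\<^sup>2\<close> is symmetric with nonpositive
  eigenvalues on \<open>\<pp>\<close>, and \<open>X\<close> is a conjugate point iff \<open>-(k \<pi>)\<^sup>2\<close> is an eigenvalue for some \<open>k \<ge> 1\<close>. Hence \<open>X\<close> lies
  in the first conjugate locus iff \<open>-\<pi>\<^sup>2\<close> is the lowest eigenvalue. On the maximal flat the nonzero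
  eigenvalues are \<open>-\<langle>X, \<alpha>\<rangle>\<^sup>2\<close> for the restricted roots \<open>\<alpha>\<close>, and on a closed Weyl chamber every
  \<open>\<bar>\<langle>X, \<alpha>\<rangle>\<bar>\<close> is at most \<open>\<bar>\<langle>X, \<beta>\<rangle>\<bar>\<close> for the highest root \<open>\<beta>\<close> of the component of \<open>\<alpha>\<close>. Finally every \<open>X \<in> \<pp>\<close>
  is carried by \<open>Ad(K)\<close> into a given chamber: maximize \<open>\<langle>Ad(k) X, H\<rangle>\<close> over \<open>k \<in> K\<close> for a regular \<open>H\<close>.\<close>

subsection \<open>Symmetric operators\<close>

text \<open>Three obstacles shape the proof. Tangent vectors are given in the preferred chart at
  their base point, so curves are studied in one fixed chart and only then moved back; the
  transformation law of the Christoffel symbols makes this possible. The metric at the origin is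
  only known to be invariant under \<open>K\<close> and is not tied to the Killing form, so the
  connection is found from the isometric action alone: conservation laws of Killing fields give the
  second derivatives of exponential curves, polarization together with the fact that brackets of
  \<open>\<pp>\<close> lie in \<open>\<kk>\<close> gives the Christoffel symbols, and the curvature
  is read off from one explicit Jacobi field. Weights are found over the reals: for the real inner
  product \<open>ip2\<close> on the complexification the operators ad (i h) are symmetric and
  commute. The constant \<pi> is the least frequency l > 0 for which sin(l t) V vanishes at t = 1.
  Since a point of the polyhedron is i times a real vector x, the vector \<pi> i (i x) is - \<pi> x,
  which is why the chamber search runs with a reversed regular vector.\<close>

locale inner_form =
  fixes Q :: "'v::euclidean_space \<Rightarrow> 'v \<Rightarrow> real"
  assumes Q_bilinear: "bilinear Q" and Q_sym: "Q x y = Q y x" and Q_pos: "x \<noteq> 0 \<Longrightarrow> Q x x > 0"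
begin

lemma Q_linear: "linear (Q x)" "linear (\<lambda>x. Q x y)"
  using Q_bilinear by (auto simp: bilinear_def)

lemmas Q_simps = linear_add[OF Q_linear(1)] linear_add[OF Q_linear(2)] linear_scale[OF Q_linear(1)] linear_scale[OF Q_linear(2)]
  linear_diff[OF Q_linear(1)] linear_diff[OF Q_linear(2)] linear_0[OF Q_linear(1)] linear_0[OF Q_linear(2)]
  linear_neg[OF Q_linear(1)] linear_neg[OF Q_linear(2)]

lemma Q_nonneg: "Q x x \<ge> 0"
  using Q_pos[of x] by (cases "x = 0") (auto simp: Q_simps)

lemma Q_eq_0: "Q x x = 0 \<longleftrightarrow> x = 0"
using Q_pos by (fastforce simp: Q_simps)

definition orthonormal :: "'v set \<Rightarrow> bool" where
  "orthonormal B \<longleftrightarrow> finite B \<and> (\<forall>b\<in>B. Q b b = 1) \<and> (\<forall>b\<in>B. \<forall>c\<in>B. b \<noteq> c \<longrightarrow> Q b c = 0)"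

lemma Q_sum_right: "Q x (\<Sum>i\<in>I. f i *\<^sub>R h i) = (\<Sum>i\<in>I. f i * Q x (h i))"
  by (simp add: linear_sum[OF Q_linear(1)] linear_scale[OF Q_linear(1)])

text \<open>Pairing a linear dependence with one of the vectors isolates its coefficient, so
  orthogonal nonzero vectors are independent. The bound serves three times: it makes maximal
  orthonormal sets exist, it makes the set of weights finite, and it bounds the number of terms in
  the averaging estimate.\<close>

lemma orthogonal_card_le:
  assumes fin: "finite B" and nz: "\<And>b. b \<in> B \<Longrightarrow> b \<noteq> 0" and orth: "\<And>b c. b \<in> B \<Longrightarrow> c \<in> B \<Longrightarrow> b \<noteq> c \<Longrightarrow> Q b c = 0"
  shows "card B \<le> DIM('v)"
proof -
  have "independent B"
  proof
    assume "dependent B"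
    then obtain u v where uv: "v \<in> B" "u v \<noteq> 0" "(\<Sum>b\<in>B. u b *\<^sub>R b) = 0"
      using dependent_finite[OF fin] by blast
    have "0 = Q v (\<Sum>b\<in>B. u b *\<^sub>R b)" using uv(3) by (simp add: Q_simps)
    also have "\<dots> = (\<Sum>b\<in>B. u b * Q v b)" by (rule Q_sum_right)
    also have "\<dots> = (\<Sum>b\<in>B. if b = v then u v * Q v v else 0)" using orth uv(1) by (intro sum.cong) auto
    also have "\<dots> = u v * Q v v" using uv(1) fin by simp
    finally show False using uv(2) nz[OF uv(1)] by (simp add: Q_eq_0)
  qed
  then show ?thesis using independent_bound by blast
qed

lemma orthonormal_expand:
  assumes B: "orthonormal B" and c: "c \<in> B"
  shows "Q (\<Sum>b\<in>B. f b *\<^sub>R b) c = f c"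
proof -
  have "Q (\<Sum>b\<in>B. f b *\<^sub>R b) c = (\<Sum>b\<in>B. f b * Q c b)" by (subst Q_sym) (rule Q_sum_right)
  also have "\<dots> = (\<Sum>b\<in>B. if b = c then f c else 0)" using B c by (intro sum.cong) (auto simp: orthonormal_def)
  finally show ?thesis using B c by (simp add: orthonormal_def)
qed

text \<open>An orthonormal subset of maximal cardinality already spans: if the expansion of some
  \<open>x\<close> left a nonzero remainder, the normalized remainder would enlarge the set.\<close>

lemma orthonormal_basis:
  assumes S: "subspace S"
  obtains B where "orthonormal B" "B \<subseteq> S" "\<And>x. x \<in> S \<Longrightarrow> x = (\<Sum>b\<in>B. Q x b *\<^sub>R b)"
proof -
  define P where "P n \<longleftrightarrow> (\<exists>B. orthonormal B \<and> B \<subseteq> S \<and> card B = n)" for n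
  have P0: "P 0" unfolding P_def by (intro exI[of _ "{}"]) (simp add: orthonormal_def)
  have bound: "n \<le> DIM('v)" if Pn: "P n" for n
  proof -
    obtain B where B: "orthonormal B" "card B = n" using Pn unfolding P_def by blast
    have "card B \<le> DIM('v)"
    using orthogonal_card_le B(1) by (fastforce simp: orthonormal_def Q_simps)
    then show ?thesis using B(2) by simp
  qed
  define m where "m = (GREATEST n. P n)"
  have "P m" unfolding m_def by (rule GreatestI_nat[of P 0 "DIM('v)"]) (use P0 bound in auto)
  then obtain B where B: "orthonormal B" "B \<subseteq> S" "card B = m" unfolding P_def by blast
  have fin: "finite B" using B(1) by (simp add: orthonormal_def)
  have "x = (\<Sum>b\<in>B. Q x b *\<^sub>R b)" if x: "x \<in> S" for x
  proof (rule ccontr)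
    assume ne: "x \<noteq> (\<Sum>b\<in>B. Q x b *\<^sub>R b)"
    define r where "r = x - (\<Sum>b\<in>B. Q x b *\<^sub>R b)"
    define e where "e = (1 / sqrt (Q r r)) *\<^sub>R r"
    have r0: "r \<noteq> 0" using ne by (simp add: r_def)
    have rS: "r \<in> S" unfolding r_def using x B(2) by (intro subspace_diff[OF S] subspace_sum[OF S] subspace_scale[OF S]) auto
    have rb: "Q r b = 0" if "b \<in> B" for b
      unfolding r_def using orthonormal_expand[OF B(1) that, of "Q x"] by (simp add: Q_simps)
    have e1: "Q e e = 1" using Q_pos[OF r0] by (simp add: e_def Q_simps)
    have eb: "Q e b = 0" if "b \<in> B" for b using rb[OF that] by (simp add: e_def Q_simps)
    have eb': "Q b e = 0" if "b \<in> B" for b using eb[OF that] Q_sym[of b e] by simp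
    have eB: "e \<notin> B"
    proof
      assume "e \<in> B"
      then show False using eb[of e] e1 by simp
    qed
    have "orthonormal (insert e B)"
      using B(1) e1 eb eb' unfolding orthonormal_def by simp
    moreover have "insert e B \<subseteq> S" using rS B(2) subspace_scale[OF S] by (auto simp: e_def)
    moreover have "card (insert e B) = Suc m" using eB fin B(3) by simp
    ultimately have "P (Suc m)" unfolding P_def by blast
    then have "Suc m \<le> (GREATEST n. P n)" by (rule Greatest_le_nat) (rule bound)
    then show False by (simp add: m_def)
  qed
  then show thesis by (rule that[OF B(1,2)])
qed

text \<open>\<open>linear_trace\<close> refers to the coordinate basis, which has no relation to
  \<open>Q\<close>. Expanding \<open>F x\<close> in the \<open>Q\<close>-orthonormal basis and
  exchanging the two sums turns one diagonal sum into the other.\<close>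

lemma trace_orthonormal:
  assumes B: "orthonormal B" "\<And>x. x = (\<Sum>b\<in>B. Q x b *\<^sub>R b)" and F: "linear F"
  shows "linear_trace F = (\<Sum>b\<in>B. Q (F b) b)"
proof -
  have 1: "F x = (\<Sum>b\<in>B. Q x b *\<^sub>R F b)" for x
    using arg_cong[OF B(2)[of x], of F] by (simp add: linear_sum[OF F] linear_scale[OF F])
  have "linear_trace F = (\<Sum>i\<in>Basis. \<Sum>b\<in>B. Q i b * (F b \<bullet> i))"
    unfolding linear_trace_def
    by (rule sum.cong[OF refl], subst 1) (simp add: inner_sum_left)
  also have "\<dots> = (\<Sum>b\<in>B. \<Sum>i\<in>Basis. Q i b * (F b \<bullet> i))" by (rule sum.swap)
  also have "\<dots> = (\<Sum>b\<in>B. Q (F b) b)"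
  proof (rule sum.cong[OF refl])
    fix b
    have "Q (F b) b = Q (\<Sum>i\<in>Basis. (F b \<bullet> i) *\<^sub>R i) b" by (simp add: euclidean_representation)
    also have "\<dots> = (\<Sum>i\<in>Basis. (F b \<bullet> i) * Q b i)" by (subst Q_sym) (rule Q_sum_right)
    finally show "(\<Sum>i\<in>Basis. Q i b * (F b \<bullet> i)) = Q (F b) b" by (simp add: mult.commute Q_sym[of b])
  qed
  finally show ?thesis .
qed

lemma represent_functional:
  assumes S: "subspace S" and c: "linear (c :: 'v \<Rightarrow> real)"
  shows "\<exists>a\<in>S. \<forall>x\<in>S. Q x a = c x"
proof -
  obtain B where B: "orthonormal B" "B \<subseteq> S" "\<And>x. x \<in> S \<Longrightarrow> x = (\<Sum>b\<in>B. Q x b *\<^sub>R b)"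
    by (rule orthonormal_basis[OF S]) (rule that; assumption)
  define a where "a = (\<Sum>b\<in>B. c b *\<^sub>R b)"
  have "a \<in> S" unfolding a_def using B(2) by (intro subspace_sum[OF S] subspace_scale[OF S]) auto
  moreover have "Q x a = c x" if "x \<in> S" for x
  proof -
    have "Q x a = (\<Sum>b\<in>B. c b * Q x b)" unfolding a_def by (rule Q_sum_right)
    also have "\<dots> = c (\<Sum>b\<in>B. Q x b *\<^sub>R b)" by (simp add: linear_sum[OF c] linear_scale[OF c] mult.commute)
    finally show ?thesis using B(3)[OF that] by simp
  qed
  ultimately show ?thesis by blast
qed

lemma orthogonal_decomposition:
  assumes S: "subspace S"
  shows "\<exists>y\<in>S. \<forall>z\<in>S. Q (x - y) z = 0"
proof -
  obtain a where "a \<in> S" "\<forall>z\<in>S. Q z a = Q z x"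
    using represent_functional[OF S Q_linear(2)[of x]] by blast
  then show ?thesis by (intro bexI[of _ a]) (auto simp: Q_simps Q_sym[of _ a] Q_sym[of x])
qed

text \<open>Closedness is continuity of \<open>Q\<close>. Boundedness in the ambient norm comes from
  Parseval: on the sphere every coefficient is at most 1 in absolute value, so the norm is at most
  the sum of the norms of a finite orthonormal basis.\<close>

lemma compact_unit_sphere:
  assumes S: "subspace S"
  shows "compact {x \<in> S. Q x x = 1}"
proof -
  obtain B where B: "orthonormal B" "\<And>x. x \<in> UNIV \<Longrightarrow> x = (\<Sum>b\<in>B. Q x b *\<^sub>R b)"
    by (rule orthonormal_basis[OF subspace_UNIV]) (rule that; assumption)
  have "bounded {x \<in> S. Q x x = 1}"
  proof (rule boundedI)
    fix x assume "x \<in> {x \<in> S. Q x x = 1}"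
    then have x: "Q x x = 1" by simp
    have "Q x x = Q x (\<Sum>b\<in>B. Q x b *\<^sub>R b)" by (rule arg_cong[OF B(2)[OF UNIV_I]])
    then have "1 = (\<Sum>b\<in>B. Q x b * Q x b)" unfolding Q_sum_right x .
    then have s: "(\<Sum>b\<in>B. (Q x b)^2) = 1" unfolding power2_eq_square by (rule sym)
    have le: "\<bar>Q x b\<bar> \<le> 1" if "b \<in> B" for b
    proof -
      have "(Q x b)^2 \<le> (\<Sum>b\<in>B. (Q x b)^2)" using B(1) that by (intro member_le_sum) (auto simp: orthonormal_def)
      then show ?thesis using s by (simp add: abs_square_le_1)
    qed
    have "norm x = norm (\<Sum>b\<in>B. Q x b *\<^sub>R b)" by (rule arg_cong[OF B(2)[OF UNIV_I]])
    also have "\<dots> \<le> (\<Sum>b\<in>B. 1 * norm b)"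
      by (rule order_trans[OF norm_sum sum_mono], unfold norm_scaleR) (rule mult_right_mono[OF le norm_ge_zero])
    finally show "norm x \<le> (\<Sum>b\<in>B. norm b)" by simp
  qed
  moreover have "closed {x \<in> S. Q x x = 1}"
  proof -
    have "bounded_bilinear Q" using Q_bilinear by (simp add: bilinear_conv_bounded_bilinear)
    then have "continuous_on UNIV (\<lambda>x. Q x x)" by (rule bounded_bilinear.continuous_on[OF _ continuous_on_id continuous_on_id])
    then have "closed ((\<lambda>x. Q x x) -` {1})" by (rule closed_vimage[OF closed_singleton])
    then have "closed (S \<inter> (\<lambda>x. Q x x) -` {1})" by (intro closed_Int closed_subspace[OF S])
    moreover have "S \<inter> (\<lambda>x. Q x x) -` {1} = {x \<in> S. Q x x = 1}" by auto
    ultimately show ?thesis by simp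
  qed
  ultimately show ?thesis by (simp add: compact_eq_bounded_closed)
qed

text \<open>Maximize the Rayleigh quotient on the unit sphere of \<open>S\<close>. The defect
  \<open>R\<close> is nonpositive on \<open>S\<close> and zero at the maximum \<open>x\<close>;
  testing it on \<open>x + t *\<^sub>R z\<close> with the residual z = F x - l x forces z =
  0.\<close>

lemma symmetric_eigenvector:
  assumes S: "subspace S" "S \<noteq> {0}" and F: "linear F" "\<And>x. x \<in> S \<Longrightarrow> F x \<in> S"
    and sym: "\<And>x y. x \<in> S \<Longrightarrow> y \<in> S \<Longrightarrow> Q (F x) y = Q x (F y)"
  shows "\<exists>x\<in>S. x \<noteq> 0 \<and> (\<exists>l. F x = l *\<^sub>R x)"
proof -
  let ?C = "{x \<in> S. Q x x = 1}"
  have norml: "(1 / sqrt (Q y y)) *\<^sub>R y \<in> ?C" if "y \<in> S" "y \<noteq> 0" for y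
    using that Q_pos[OF that(2)] subspace_scale[OF S(1)] by (simp add: Q_simps)
  obtain y0 where "y0 \<in> S" "y0 \<noteq> 0" using S subspace_0 by blast
  then have ne: "?C \<noteq> {}" using norml by blast
  have "bounded_bilinear Q" using Q_bilinear by (simp add: bilinear_conv_bounded_bilinear)
  then have "continuous_on ?C (\<lambda>x. Q (F x) x)"
    by (rule bounded_bilinear.continuous_on[OF _ linear_continuous_on[OF F(1)[unfolded linear_conv_bounded_linear]] continuous_on_id])
  then obtain x where x: "x \<in> ?C" "\<And>y. y \<in> ?C \<Longrightarrow> Q (F y) y \<le> Q (F x) x"
    using continuous_attains_sup[OF compact_unit_sphere[OF S(1)] ne] by blast
  define l where "l = Q (F x) x"
  define R where "R y = Q (F y) y - l * Q y y" for y
  have R: "R y \<le> 0" if y: "y \<in> S" for y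
  using x(2) norml y Q_pos F(1) by (fastforce simp: Q_simps l_def pos_divide_le_eq linear_scale R_def)
  define z where "z = F x - l *\<^sub>R x"
  have xS: "x \<in> S" "Q x x = 1" using x(1) by auto
  have zS: "z \<in> S" unfolding z_def by (intro subspace_diff[OF S(1)] F(2) subspace_scale[OF S(1)] xS)
  have Rt: "R (x + t *\<^sub>R z) = 2 * t * Q z z + t^2 * R z" for t
  proof -
    have e1: "Q (F z) x = Q (F x) z" using sym[OF zS xS(1)] Q_sym by simp
    have e2: "Q z z = Q (F x) z - l * Q x z" by (subst (1) z_def) (simp add: Q_simps)
    have "R (x + t *\<^sub>R z) = (Q (F x) x - l * Q x x) + 2 * t * (Q (F x) z - l * Q x z) + t^2 * R z"
      unfolding R_def linear_add[OF F(1)] linear_scale[OF F(1)]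
      by (simp add: Q_simps e1 Q_sym[of z x] power2_eq_square algebra_simps)
    then show ?thesis using e2 xS(2) by (simp add: l_def)
  qed
  have "Q z z = 0"
  proof (rule ccontr)
    assume "Q z z \<noteq> 0"
    then have zz: "Q z z > 0" using Q_nonneg[of z] by simp
    \<comment> \<open>With this \<open>t\<close> the quadratic term t^2 R z is at least - t Q z z,
      so the linear term 2 t Q z z wins and the defect would be positive. The 1 keeps the
      denominator positive when \<open>R z\<close> is 0.\<close>
    define t where "t = Q z z / (1 - R z)"
    have d: "1 - R z > 0" using R[OF zS] by simp
    have t: "t > 0" "t * (1 - R z) = Q z z" using zz d by (simp_all add: t_def)
    have "0 < 2 * t * Q z z + t^2 * R z"
    proof -
      have "t * (- R z) \<le> Q z z" using t by (simp add: algebra_simps)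
      then have "t * (t * (- R z)) \<le> t * Q z z" using t(1) by (intro mult_left_mono) auto
      moreover have "t * Q z z > 0" using t(1) zz by simp
      ultimately show ?thesis by (simp add: power2_eq_square)
    qed
    moreover have "R (x + t *\<^sub>R z) \<le> 0" by (intro R subspace_add[OF S(1)] subspace_scale[OF S(1)] xS(1) zS)
    ultimately show False by (simp add: Rt)
  qed
  then have "F x = l *\<^sub>R x" by (simp add: Q_eq_0 z_def)
  moreover have "x \<noteq> 0" using xS(2) by (auto simp: Q_simps)
  ultimately show ?thesis using xS(1) by blast
qed

text \<open>On a nonzero common invariant subspace of least dimension every operator is a scalar,
  because an eigenspace of one operator is invariant under the others by commutation. The argument
  by minimality covers infinite index sets, such as a whole abelian subspace.\<close>

lemma common_eigenvector:
  assumes S: "subspace S" "S \<noteq> {0}" and lin: "\<And>i. i \<in> I \<Longrightarrow> linear (F i)" and inv: "\<And>i x. i \<in> I \<Longrightarrow> x \<in> S \<Longrightarrow> F i x \<in> S"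
    and sym: "\<And>i x y. i \<in> I \<Longrightarrow> Q (F i x) y = Q x (F i y)"
    and com: "\<And>i j x. i \<in> I \<Longrightarrow> j \<in> I \<Longrightarrow> F i (F j x) = F j (F i x)"
  shows "\<exists>x\<in>S. x \<noteq> 0 \<and> (\<forall>i\<in>I. \<exists>l. F i x = l *\<^sub>R x)"
proof -
  define good where "good T \<longleftrightarrow> subspace T \<and> T \<subseteq> S \<and> T \<noteq> {0} \<and> (\<forall>i\<in>I. \<forall>x\<in>T. F i x \<in> T)" for T
  have "good S" using S inv by (simp add: good_def)
  then obtain T where T: "good T" "\<And>T'. good T' \<Longrightarrow> dim T \<le> dim T'"
    using ex_has_least_nat[of good S dim] by blast
  have Ts: "subspace T" "T \<noteq> {0}" "T \<subseteq> S" and Ti: "\<And>i x. i \<in> I \<Longrightarrow> x \<in> T \<Longrightarrow> F i x \<in> T"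
    using T(1) by (auto simp: good_def)
  have scalar: "\<exists>l. \<forall>y\<in>T. F i y = l *\<^sub>R y" if i: "i \<in> I" for i
  proof -
    obtain x l where x: "x \<in> T" "x \<noteq> 0" "F i x = l *\<^sub>R x"
      using symmetric_eigenvector[OF Ts(1,2) lin[OF i] Ti[OF i] sym[OF i]] by blast
    let ?T = "{y \<in> T. F i y = l *\<^sub>R y}"
    have "subspace ?T"
      using Ts(1) by (auto simp: subspace_def linear_0[OF lin[OF i]] linear_add[OF lin[OF i]] linear_scale[OF lin[OF i]] scaleR_right_distrib)
    moreover have "F j y \<in> ?T" if "j \<in> I" "y \<in> ?T" for j y
      using that Ti com[OF i that(1), of y] by (simp add: linear_scale[OF lin])
    moreover have "?T \<noteq> {0}" using x by auto
    ultimately have "good ?T" using Ts(3) by (auto simp: good_def)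
    then have "dim T \<le> dim ?T" by (rule T(2))
    then have "?T = T" by (intro subspace_dim_equal[OF \<open>subspace ?T\<close> Ts(1)]) auto
    then show ?thesis by blast
  qed
  obtain x where "x \<in> T" "x \<noteq> 0" using Ts(1,2) subspace_0 by blast
  then show ?thesis using scalar Ts(3) by blast
qed

end

subsection \<open>Highest roots\<close>

text \<open>The form of the difference in \<open>highest_root\<close>, isolated so that such
  differences can be added.\<close>

definition nat_combination :: "'v::real_vector set \<Rightarrow> 'v \<Rightarrow> bool" where
  "nat_combination S x \<longleftrightarrow> (\<exists>n::'v \<Rightarrow> nat. x = (\<Sum>d\<in>S. real (n d) *\<^sub>R d))"

lemma nat_combination_zero: "nat_combination S 0"
  unfolding nat_combination_def by (rule exI[of _ "\<lambda>_. 0"]) simp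

lemma nat_combination_add:
  assumes "nat_combination S x" "nat_combination S y"
  shows "nat_combination S (x + y)"
proof -
  obtain n m :: "'a \<Rightarrow> nat" where "x = (\<Sum>d\<in>S. real (n d) *\<^sub>R d)" "y = (\<Sum>d\<in>S. real (m d) *\<^sub>R d)"
    using assms unfolding nat_combination_def by blast
  then have "x + y = (\<Sum>d\<in>S. real (n d + m d) *\<^sub>R d)" by (simp add: scaleR_left_distrib sum.distrib)
  then show ?thesis unfolding nat_combination_def by (rule exI[of _ "\<lambda>d. n d + m d"])
qed

lemma nat_combination_base:
  assumes "finite S" "x \<in> S"
  shows "nat_combination S x"
proof -
  have "(\<Sum>d\<in>S. real (if d = x then 1 else 0) *\<^sub>R d) = (\<Sum>d\<in>S. if d = x then x else 0)"
    by (rule sum.cong) auto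
  also have "\<dots> = x" using assms by simp
  finally show ?thesis unfolding nat_combination_def by (intro exI[of _ "\<lambda>d. if d = x then 1 else 0"]) simp
qed

lemma nat_combination_span: "nat_combination S x \<Longrightarrow> x \<in> span S"
  unfolding nat_combination_def by (elim exE, hypsubst) (intro span_sum span_scale span_base)

text \<open>\<open>root_add\<close> and \<open>root_string\<close> are the two consequences of sl2
  theory from which highest roots are built here; both also hold for nonreduced systems and are
  derived later from one norm identity. The ordering is an arbitrary vector space ordering, so
  positivity need not come from a linear functional.\<close>

locale restricted_root_system = inner_form Q for Q :: "'v::euclidean_space \<Rightarrow> 'v \<Rightarrow> real" +
  fixes V \<Sigma> P :: "'v set"
  assumes V: "subspace V" and finite_roots: "finite \<Sigma>" and roots_V: "\<Sigma> \<subseteq> V" and zero_root: "0 \<notin> \<Sigma>"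
    and root_minus: "a \<in> \<Sigma> \<Longrightarrow> - a \<in> \<Sigma>"
    and root_add: "a \<in> \<Sigma> \<Longrightarrow> c \<in> \<Sigma> \<Longrightarrow> Q a c < 0 \<Longrightarrow> a + c \<noteq> 0 \<Longrightarrow> a + c \<in> \<Sigma>"
    and root_string: "a \<in> \<Sigma> \<Longrightarrow> c \<in> \<Sigma> \<Longrightarrow> Q a c = 0 \<Longrightarrow> a - c \<notin> \<Sigma> \<Longrightarrow> a + c \<notin> \<Sigma>"
    and ordering: "vector_ordering V P"
begin

abbreviation "simples \<equiv> simple_roots \<Sigma> P"

definition component :: "'v set \<Rightarrow> bool" where
  "component C \<longleftrightarrow> C \<subseteq> \<Sigma> \<and> C \<noteq> {} \<and> (\<forall>x\<in>C. \<forall>y\<in>\<Sigma> - C. Q x y = 0) \<and>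
     \<not> (\<exists>D. D \<subset> C \<and> D \<noteq> {} \<and> (\<forall>x\<in>D. \<forall>y\<in>C - D. Q x y = 0))"

lemma positive_add: "x \<in> P \<Longrightarrow> y \<in> P \<Longrightarrow> x + y \<in> P"
  using ordering by (simp add: vector_ordering_def)

lemma positive_scale: "x \<in> P \<Longrightarrow> c > 0 \<Longrightarrow> c *\<^sub>R x \<in> P"
  using ordering by (simp add: vector_ordering_def)

lemma positive_nonzero: "0 \<notin> P"
  using ordering by (simp add: vector_ordering_def)

lemma positive_or_minus:
  assumes a: "a \<in> \<Sigma>"
  shows "a \<in> P \<or> - a \<in> P"
using a roots_V zero_root ordering by (auto simp: vector_ordering_def)

lemma finite_simples: "finite simples"
  by (rule finite_subset[OF _ finite_roots]) (auto simp: simple_roots_def)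

lemma convex_positive: "convex P"
proof (rule convexI)
  fix x y and u v :: real
  assume a: "x \<in> P" "y \<in> P" "0 \<le> u" "0 \<le> v" "u + v = 1"
  consider "u = 0" | "v = 0" | "u > 0" "v > 0" using a by linarith
  then show "u *\<^sub>R x + v *\<^sub>R y \<in> P"
  proof cases
    case 1 then show ?thesis using a by simp
  next
    case 2 then show ?thesis using a by simp
  next
    case 3 then show ?thesis using a by (intro positive_add positive_scale)
  qed
qed

text \<open>The ordering may be lexicographic, so a functional positive on the positive roots has to
  be produced. These are finitely many; their convex hull is compact, lies in the convex set
  \<open>P\<close> and misses 0. A hyperplane separating it from 0, represented through
  \<open>Q\<close> on \<open>V\<close>, gives \<open>H\<close>.\<close>

lemma chamber_nonempty: "\<exists>H\<in>V. \<forall>a\<in>\<Sigma> \<inter> P. Q a H > 0"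
proof -
  let ?S = "convex hull (\<Sigma> \<inter> P)"
  have "?S \<subseteq> P" by (rule hull_minimal) (use convex_positive in auto)
  then have 0: "0 \<notin> ?S" using positive_nonzero by auto
  have "closed ?S" using finite_roots by (intro compact_imp_closed finite_imp_compact_convex_hull) auto
  from separating_hyperplane_closed_0[OF convex_convex_hull this 0]
  obtain v b where v: "0 < b" "\<And>x. x \<in> ?S \<Longrightarrow> b < inner v x" by blast
  obtain H where H: "H \<in> V" "\<forall>x\<in>V. Q x H = inner v x"
    using represent_functional[OF V, of "inner v"] bounded_linear.linear[OF bounded_linear_inner_right] by blast
  have "Q a H > 0" if a: "a \<in> \<Sigma> \<inter> P" for a
  proof -
    have "b < inner v a" by (rule v(2)) (rule hull_inc[OF a])
    then show ?thesis using H(2) roots_V a v(1) by force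
  qed
  then show ?thesis using H(1) by blast
qed

definition chamber_vector :: 'v where
  "chamber_vector = (SOME H. H \<in> V \<and> (\<forall>a\<in>\<Sigma> \<inter> P. Q a H > 0))"

lemma chamber_vector: "chamber_vector \<in> V" "a \<in> \<Sigma> \<Longrightarrow> a \<in> P \<Longrightarrow> Q a chamber_vector > 0"
proof -
  have "\<exists>H. H \<in> V \<and> (\<forall>a\<in>\<Sigma> \<inter> P. Q a H > 0)" using chamber_nonempty by blast
  from someI_ex[OF this]
  show "chamber_vector \<in> V" "a \<in> \<Sigma> \<Longrightarrow> a \<in> P \<Longrightarrow> Q a chamber_vector > 0"
    unfolding chamber_vector_def[symmetric] by auto
qed

abbreviation "ht x \<equiv> Q x chamber_vector"

lemma simple_root: "d \<in> simples \<Longrightarrow> d \<in> \<Sigma>" "d \<in> simples \<Longrightarrow> d \<in> P"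
  by (simp_all add: simple_roots_def)

text \<open>A positive product would make d - e a root by \<open>root_add\<close>. According to its
  sign, either d = (d - e) + e or e = (e - d) + d decomposes a simple root.\<close>

lemma simple_nonpos:
  assumes d: "d \<in> simples" and e: "e \<in> simples" and ne: "d \<noteq> e"
  shows "Q d e \<le> 0"
proof (rule ccontr)
  assume "\<not> Q d e \<le> 0"
  then have n: "Q d (- e) < 0" by (simp add: Q_simps)
  have "d + - e \<in> \<Sigma>"
    by (rule root_add[OF simple_root(1)[OF d] root_minus[OF simple_root(1)[OF e]] n]) (use ne in simp)
  then have r: "d - e \<in> \<Sigma>" "e - d \<in> \<Sigma>" using root_minus[of "d - e"] by simp_all
  have "d - e \<in> P \<or> e - d \<in> P" using positive_or_minus[OF r(1)] by simp
  then show False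
  proof
    assume "d - e \<in> P"
    then have "\<exists>\<alpha>\<in>\<Sigma> \<inter> P. \<exists>\<beta>\<in>\<Sigma> \<inter> P. d = \<alpha> + \<beta>"
      using r(1) simple_root[OF e] by (intro bexI[of _ "d - e"] bexI[of _ e]) auto
    then show False using d by (simp add: simple_roots_def)
  next
    assume "e - d \<in> P"
    then have "\<exists>\<alpha>\<in>\<Sigma> \<inter> P. \<exists>\<beta>\<in>\<Sigma> \<inter> P. e = \<alpha> + \<beta>"
      using r(2) simple_root[OF d] by (intro bexI[of _ "e - d"] bexI[of _ d]) auto
    then show False using e by (simp add: simple_roots_def)
  qed
qed

text \<open>A positive root that is not simple is a sum of two positive roots, both of strictly
  smaller height because positive roots have positive height. Heights are real numbers, so the
  induction counts the roots of smaller height.\<close>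

lemma positive_root_induct:
  assumes a: "a \<in> \<Sigma>" "a \<in> P" and simple: "\<And>d. d \<in> simples \<Longrightarrow> X d"
    and add: "\<And>b c. b \<in> \<Sigma> \<Longrightarrow> b \<in> P \<Longrightarrow> c \<in> \<Sigma> \<Longrightarrow> c \<in> P \<Longrightarrow> b + c \<in> \<Sigma> \<Longrightarrow> X b \<Longrightarrow> X c \<Longrightarrow> X (b + c)"
  shows "X a"
  using a
proof (induction "card {b \<in> \<Sigma>. ht b < ht a}" arbitrary: a rule: less_induct)
  case less
  show ?case
  proof (cases "a \<in> simples")
    case True then show ?thesis by (rule simple)
  next
    case False
    then obtain b c where bc: "b \<in> \<Sigma>" "b \<in> P" "c \<in> \<Sigma>" "c \<in> P" "a = b + c"
      using less.prems unfolding simple_roots_def by blast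
    have h: "ht a = ht b + ht c" "ht b > 0" "ht c > 0"
      using chamber_vector(2) bc by (simp_all add: Q_simps)
    have fin: "finite {x \<in> \<Sigma>. ht x < ht a}" using finite_roots by simp
    have "card {x \<in> \<Sigma>. ht x < ht b} < card {x \<in> \<Sigma>. ht x < ht a}"
    proof (rule psubset_card_mono[OF fin], rule psubsetI)
      show "{x \<in> \<Sigma>. ht x < ht b} \<subseteq> {x \<in> \<Sigma>. ht x < ht a}" using h by auto
      have "b \<in> {x \<in> \<Sigma>. ht x < ht a}" "b \<notin> {x \<in> \<Sigma>. ht x < ht b}" using h bc(1) by auto
      then show "{x \<in> \<Sigma>. ht x < ht b} \<noteq> {x \<in> \<Sigma>. ht x < ht a}" by blast
    qed
    then have Xb: "X b" by (rule less.hyps[OF _ bc(1,2)])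
    have "card {x \<in> \<Sigma>. ht x < ht c} < card {x \<in> \<Sigma>. ht x < ht a}"
    proof (rule psubset_card_mono[OF fin], rule psubsetI)
      show "{x \<in> \<Sigma>. ht x < ht c} \<subseteq> {x \<in> \<Sigma>. ht x < ht a}" using h by auto
      have "c \<in> {x \<in> \<Sigma>. ht x < ht a}" "c \<notin> {x \<in> \<Sigma>. ht x < ht c}" using h bc(3) by auto
      then show "{x \<in> \<Sigma>. ht x < ht c} \<noteq> {x \<in> \<Sigma>. ht x < ht a}" by blast
    qed
    then have Xc: "X c" by (rule less.hyps[OF _ bc(3,4)])
    show ?thesis using add[OF bc(1-4)] less.prems(1) Xb Xc by (simp add: bc(5))
  qed
qed

lemma positive_root_nat_combination:
  assumes "a \<in> \<Sigma>" "a \<in> P"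
  shows "nat_combination simples a"
  using assms
  by (rule positive_root_induct) (rule nat_combination_base[OF finite_simples], assumption, rule nat_combination_add)

lemma ht_nat_combination_nonneg:
  assumes "S \<subseteq> simples" "nat_combination S x"
  shows "ht x \<ge> 0"
proof -
  obtain n :: "'v \<Rightarrow> nat" where n: "x = (\<Sum>d\<in>S. real (n d) *\<^sub>R d)"
    using assms(2) unfolding nat_combination_def by blast
  have "ht x = (\<Sum>d\<in>S. real (n d) * ht d)"
    unfolding n Q_sym[of _ chamber_vector] by (rule Q_sum_right)
  also have "\<dots> \<ge> 0"
  proof (rule sum_nonneg)
    fix d assume "d \<in> S"
    then have "ht d > 0" using assms(1) simple_root chamber_vector(2) by blast
    then show "0 \<le> real (n d) * ht d" by simp
  qed
  finally show ?thesis .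
qed

lemma span_orthogonal:
  assumes o: "\<forall>x\<in>S. \<forall>y\<in>T. Q x y = 0" and x: "x \<in> span S" and y: "y \<in> span T"
  shows "Q x y = 0"
proof -
  have 1: "Q x y = 0" if "x \<in> S" for x
    using y
  proof (rule span_induct)
    show "subspace {y. Q x y = 0}" by (auto simp: subspace_def Q_simps)
    show "\<And>y. y \<in> T \<Longrightarrow> Q x y = 0" using o that by simp
  qed
  show ?thesis using x
  proof (rule span_induct)
    show "subspace {x. Q x y = 0}" by (auto simp: subspace_def Q_simps)
    show "\<And>x. x \<in> S \<Longrightarrow> Q x y = 0" by (rule 1)
  qed
qed

text \<open>If the simple roots split into two orthogonal parts, then so do all roots: by
  \<open>root_string\<close> the sum of two roots from different parts is not a root.\<close>

lemma positive_root_split: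
  assumes D: "D0 \<union> D1 = simples" and o: "\<forall>x\<in>D0. \<forall>y\<in>D1. Q x y = 0"
    and a: "a \<in> \<Sigma>" "a \<in> P"
  shows "nat_combination D0 a \<or> nat_combination D1 a"
proof -
  have sub: "D0 \<subseteq> simples" "D1 \<subseteq> simples" using D by auto
  have fin: "finite D0" "finite D1" by (rule finite_subset[OF sub(1) finite_simples], rule finite_subset[OF sub(2) finite_simples])
  have split: "\<exists>x y. nat_combination D0 x \<and> nat_combination D1 y \<and> b = x + y" if b: "b \<in> \<Sigma>" "b \<in> P" for b
    using b
  proof (rule positive_root_induct)
    fix d assume "d \<in> simples"
    then consider "d \<in> D0" | "d \<in> D1" using D by blast
    then show "\<exists>x y. nat_combination D0 x \<and> nat_combination D1 y \<and> d = x + y"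
    proof cases
      case 1
      then show ?thesis by (intro exI[of _ d] exI[of _ 0]) (simp add: nat_combination_base[OF fin(1)] nat_combination_zero)
    next
      case 2
      then show ?thesis by (intro exI[of _ 0] exI[of _ d]) (simp add: nat_combination_base[OF fin(2)] nat_combination_zero)
    qed
  next
    fix b c
    assume "\<exists>x y. nat_combination D0 x \<and> nat_combination D1 y \<and> b = x + y"
      and "\<exists>x y. nat_combination D0 x \<and> nat_combination D1 y \<and> c = x + y"
    then obtain x y z w where xy: "nat_combination D0 x" "nat_combination D1 y" "b = x + y"
      and zw: "nat_combination D0 z" "nat_combination D1 w" "c = z + w" by (elim exE conjE)
    show "\<exists>x y. nat_combination D0 x \<and> nat_combination D1 y \<and> b + c = x + y"
      by (rule exI[of _ "x + z"], rule exI[of _ "y + w"])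
        (simp add: nat_combination_add[OF xy(1) zw(1)] nat_combination_add[OF xy(2) zw(2)] xy(3) zw(3))
  qed
  \<comment> \<open>\<open>b\<close> and \<open>c\<close> belong to different parts, in either
    order, hence \<open>E0\<close> and \<open>E1\<close>. Splitting the positive root b - c as x' +
    y' gives b - x' = y' + c, a vector in two orthogonal spans and therefore zero; but
    \<open>y'\<close> has nonnegative and \<open>c\<close> positive height.\<close>
  have no_mixed: "\<not> (nat_combination E0 b \<and> nat_combination E1 c \<and> b - c \<in> P)"
    if bc: "b \<in> \<Sigma>" "b \<in> P" "c \<in> \<Sigma>" "c \<in> P" "b - c \<in> \<Sigma>" and E: "E0 = D0 \<and> E1 = D1 \<or> E0 = D1 \<and> E1 = D0" for E0 E1 b c
  proof
    assume h: "nat_combination E0 b \<and> nat_combination E1 c \<and> b - c \<in> P"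
    obtain x y where xy: "nat_combination D0 x" "nat_combination D1 y" "b - c = x + y"
      using split[OF bc(5)] h by blast
    obtain x' y' where xy': "nat_combination E0 x'" "nat_combination E1 y'" "b - c = x' + y'"
    proof -
      from E show thesis
      proof
        assume "E0 = D0 \<and> E1 = D1" then show thesis using that[of x y] xy by simp
      next
        assume "E0 = D1 \<and> E1 = D0" then show thesis using that[of y x] xy by simp
      qed
    qed
    have "\<forall>x\<in>D1. \<forall>y\<in>D0. Q x y = 0"
    proof (intro ballI)
      fix x y assume "x \<in> D1" "y \<in> D0"
      then show "Q x y = 0" using o Q_sym[of x y] by simp
    qed
    then have oE: "\<forall>x\<in>E0. \<forall>y\<in>E1. Q x y = 0" using E o by (elim disjE conjE) simp_all
    have eq: "b - x' = y' + c" using xy'(3) by (simp add: algebra_simps)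
    have "b - x' \<in> span E0" using h xy'(1) by (intro span_diff nat_combination_span) auto
    moreover have "y' + c \<in> span E1" using h xy'(2) by (intro span_add nat_combination_span) auto
    ultimately have "Q (b - x') (y' + c) = 0" by (rule span_orthogonal[OF oE])
    then have "y' + c = 0" unfolding eq by (simp add: Q_eq_0)
    then have "ht (y' + c) = 0" by (simp add: Q_simps)
    then have "ht y' + ht c = 0" by (simp only: linear_add[OF Q_linear(2)])
    moreover have "E1 \<subseteq> simples" using E sub by auto
    then have "ht y' \<ge> 0" using xy'(2) by (rule ht_nat_combination_nonneg)
    moreover have "ht c > 0" by (rule chamber_vector(2)[OF bc(3,4)])
    ultimately show False by simp
  qed
  have mixed: False
    if bc: "b \<in> \<Sigma>" "b \<in> P" "c \<in> \<Sigma>" "c \<in> P" "b + c \<in> \<Sigma>" and n: "nat_combination D0 b" "nat_combination D1 c" for b c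
  proof -
    have "Q b c = 0" by (rule span_orthogonal[OF o nat_combination_span[OF n(1)] nat_combination_span[OF n(2)]])
    then have m: "b - c \<in> \<Sigma>" using root_string[OF bc(1,3)] bc(5) by blast
    then have m': "c - b \<in> \<Sigma>" using root_minus[OF m] by simp
    have "b - c \<in> P \<or> c - b \<in> P" using positive_or_minus[OF m] by simp
    then show False
    proof
      assume "b - c \<in> P" then show False using no_mixed[OF bc(1-4) m, of D0 D1] n by simp
    next
      assume "c - b \<in> P" then show False using no_mixed[OF bc(3,4,1,2) m', of D1 D0] n by simp
    qed
  qed
  show ?thesis using a
  proof (rule positive_root_induct)
    fix d assume "d \<in> simples"
    then consider "d \<in> D0" | "d \<in> D1" using D by blast
    then show "nat_combination D0 d \<or> nat_combination D1 d"
      by cases (simp_all add: nat_combination_base[OF fin(1)] nat_combination_base[OF fin(2)])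
  next
    fix b c
    assume bc: "b \<in> \<Sigma>" "b \<in> P" "c \<in> \<Sigma>" "c \<in> P" "b + c \<in> \<Sigma>"
      and n: "nat_combination D0 b \<or> nat_combination D1 b" "nat_combination D0 c \<or> nat_combination D1 c"
    have cb: "c + b \<in> \<Sigma>" using bc(5) by (simp add: add.commute)
    consider "nat_combination D0 b" "nat_combination D0 c" | "nat_combination D1 b" "nat_combination D1 c"
      | "nat_combination D0 b" "nat_combination D1 c" | "nat_combination D0 c" "nat_combination D1 b" using n by blast
    then show "nat_combination D0 (b + c) \<or> nat_combination D1 (b + c)"
    using mixed bc bc(3,4,1,2) cb by (metis nat_combination_add)
  qed
qed

text \<open>A smallest set of roots that contains \<open>a\<close> and is orthogonal to all other
  roots is irreducible: in an orthogonal splitting the part containing \<open>a\<close> would be a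
  smaller such set.\<close>

lemma component_exists:
  assumes a: "a \<in> \<Sigma>"
  shows "\<exists>C. component C \<and> a \<in> C"
proof -
  define closed_part where "closed_part C \<longleftrightarrow> C \<subseteq> \<Sigma> \<and> a \<in> C \<and> (\<forall>x\<in>C. \<forall>y\<in>\<Sigma> - C. Q x y = 0)" for C
  have "closed_part \<Sigma>" using a by (simp add: closed_part_def)
  then have "\<exists>C. closed_part C \<and> (\<forall>C'. closed_part C' \<longrightarrow> card C \<le> card C')"
    by (rule ex_has_least_nat)
  then obtain C where C: "closed_part C" and least: "\<forall>C'. closed_part C' \<longrightarrow> card C \<le> card C'"
    by (elim exE conjE)
  have sub: "C \<subseteq> \<Sigma>" and aC: "a \<in> C" and o: "\<And>x y. x \<in> C \<Longrightarrow> y \<in> \<Sigma> \<Longrightarrow> y \<notin> C \<Longrightarrow> Q x y = 0"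
    using C(1) by (auto simp: closed_part_def)
  have fin: "finite C" using finite_subset[OF sub finite_roots] .
  have irr: False if D: "D \<subset> C" "D \<noteq> {}" "\<forall>x\<in>D. \<forall>y\<in>C - D. Q x y = 0" for D
  proof (cases "a \<in> D")
    case True
    have "closed_part D" unfolding closed_part_def
    proof (intro conjI ballI)
      show "D \<subseteq> \<Sigma>" "a \<in> D" using D(1) sub True by auto
      fix x y assume "x \<in> D" "y \<in> \<Sigma> - D"
      then show "Q x y = 0" using D(3) o[of x y] D(1) by (cases "y \<in> C") auto
    qed
    then have "card C \<le> card D" using least by simp
    then show False using psubset_card_mono[OF fin D(1)] by simp
  next
    case False
    have "closed_part (C - D)" unfolding closed_part_def
    proof (intro conjI ballI)
      show "C - D \<subseteq> \<Sigma>" "a \<in> C - D" using sub aC False by auto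
      fix x y assume xy: "x \<in> C - D" "y \<in> \<Sigma> - (C - D)"
      show "Q x y = 0"
      proof (cases "y \<in> D")
        case True
        then have "Q y x = 0" using D(3) xy(1) by blast
        then show ?thesis using Q_sym[of x y] by simp
      next
        case False
        then show ?thesis using o[of x y] xy by simp
      qed
    qed
    then have "card C \<le> card (C - D)" using least by simp
    moreover have "C - D \<subset> C" using D(1,2) by auto
    then have "card (C - D) < card C" by (rule psubset_card_mono[OF fin])
    ultimately show False by simp
  qed
  have "component C" unfolding component_def
  proof (intro conjI)
    show "C \<subseteq> \<Sigma>" "C \<noteq> {}" using sub aC by auto
    show "\<forall>x\<in>C. \<forall>y\<in>\<Sigma> - C. Q x y = 0" using C(1) by (simp add: closed_part_def)
    show "\<not> (\<exists>D. D \<subset> C \<and> D \<noteq> {} \<and> (\<forall>x\<in>D. \<forall>y\<in>C - D. Q x y = 0))"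
      by (intro notI, elim exE conjE) (rule irr)
  qed
  then show ?thesis using aC by (intro exI conjI)
qed

section \<open>Maximal roots of an irreducible component\<close>

lemma component_memI:
  assumes C: "component C" and x: "x \<in> C" and y: "y \<in> \<Sigma>" and nz: "Q x y \<noteq> 0"
  shows "y \<in> C"
  using assms unfolding component_def by blast

lemma component_minus:
  assumes C: "component C" and x: "x \<in> C"
  shows "- x \<in> C"
proof (rule component_memI[OF C x])
  have xS: "x \<in> \<Sigma>" using C x by (auto simp: component_def)
  then show "- x \<in> \<Sigma>" by (rule root_minus)
  have "x \<noteq> 0" using xS zero_root by auto
  then show "Q x (- x) \<noteq> 0" by (simp add: Q_simps Q_eq_0)
qed

text \<open>If \<open>x + e\<close> lay outside \<open>C\<close> it would be orthogonal to
  \<open>x\<close>, so Q x e = - Q x x is nonzero and \<open>e\<close> lies in \<open>C\<close> too.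
  Then \<open>x + e\<close> is orthogonal to both summands, hence to itself.\<close>

lemma component_add:
  assumes C: "component C" and x: "x \<in> C" and e: "e \<in> \<Sigma>" "x + e \<in> \<Sigma>"
  shows "x + e \<in> C"
proof (rule ccontr)
  assume n: "x + e \<notin> C"
  have xS: "x \<in> \<Sigma>" using C x by (auto simp: component_def)
  have nz: "x \<noteq> 0" "x + e \<noteq> 0" using xS e zero_root by auto
  have 1: "Q x (x + e) = 0" using component_memI[OF C x e(2)] n by blast
  then have "Q x e = - Q x x" by (simp add: Q_simps)
  then have "Q x e \<noteq> 0" using nz(1) by (simp add: Q_eq_0)
  then have "e \<in> C" by (rule component_memI[OF C x e(1)])
  then have "Q e (x + e) = 0" using component_memI[OF C _ e(2)] n by blast
  then have "Q (x + e) (x + e) = 0" using 1 by (simp only: linear_add[OF Q_linear(2)])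
  then show False using nz(2) by (simp add: Q_eq_0)
qed

text \<open>Local maximality: only the addition of a single positive root is tested. Inside an
  irreducible component this turns out to single out one positive root, the highest one.\<close>

definition maximal_root :: "'v \<Rightarrow> bool" where
  "maximal_root b \<longleftrightarrow> (\<forall>e\<in>\<Sigma> \<inter> P. b + e \<notin> \<Sigma>)"

lemma maximal_root_dominant:
  assumes b: "b \<in> \<Sigma>" "b \<in> P" "maximal_root b" and e: "e \<in> \<Sigma>" "e \<in> P"
  shows "Q b e \<ge> 0"
proof (rule ccontr)
  assume "\<not> Q b e \<ge> 0"
  moreover have "b + e \<noteq> 0" using positive_add[OF b(2) e(2)] positive_nonzero by auto
  ultimately have "b + e \<in> \<Sigma>" by (intro root_add[OF b(1) e(1)]) auto
  then show False using b(3) e by (simp add: maximal_root_def)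
qed

text \<open>\<open>D0\<close> is the support of \<open>b\<close> among the simple roots and
  \<open>D1\<close> the rest. Dominance of \<open>b\<close> and the nonpositive products of simple
  roots make them orthogonal, so by irreducibility the whole component lies in the span of
  \<open>D0\<close>. Then \<open>Q c b\<close> is a sum of nonnegative terms over \<open>D0\<close>;
  if all vanished, \<open>c\<close> would be orthogonal to a span that contains it.\<close>

lemma maximal_roots_nonorthogonal:
  assumes C: "component C" and b: "b \<in> C" "b \<in> P" "maximal_root b" and c: "c \<in> C" "c \<in> P" "maximal_root c"
  shows "Q c b > 0"
proof -
  have CS: "C \<subseteq> \<Sigma>" using C by (simp add: component_def)
  have bS: "b \<in> \<Sigma>" and cS: "c \<in> \<Sigma>" using CS b c by auto
  obtain m :: "'v \<Rightarrow> nat" where m: "b = (\<Sum>d\<in>simples. real (m d) *\<^sub>R d)"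
    using positive_root_nat_combination[OF bS b(2)] unfolding nat_combination_def by blast
  define D0 D1 where "D0 = {d \<in> simples. m d > 0}" and "D1 = {d \<in> simples. m d = 0}"
  have D: "D0 \<union> D1 = simples" by (auto simp: D0_def D1_def)
  have fin0: "finite D0" using finite_simples by (simp add: D0_def)
  have m0: "b = (\<Sum>d\<in>D0. real (m d) *\<^sub>R d)"
  proof -
    have "(\<Sum>d\<in>simples. real (m d) *\<^sub>R d) = (\<Sum>d\<in>D0. real (m d) *\<^sub>R d)"
      by (rule sum.mono_neutral_right[OF finite_simples]) (auto simp: D0_def)
    then show ?thesis using m by simp
  qed
  have Qb: "Q x b = (\<Sum>d\<in>D0. real (m d) * Q x d)" for x
    by (subst m0) (rule Q_sum_right)
  have o: "\<forall>x\<in>D0. \<forall>y\<in>D1. Q x y = 0"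
  proof (intro ballI)
    fix x y assume x: "x \<in> D0" and y: "y \<in> D1"
    have yS: "y \<in> simples" using y by (simp add: D1_def)
    have "0 \<le> Q b y" by (rule maximal_root_dominant[OF bS b(2,3) simple_root(1)[OF yS] simple_root(2)[OF yS]])
    then have ge: "0 \<le> (\<Sum>d\<in>D0. real (m d) * Q y d)" using Qb[of y] Q_sym[of b y] by simp
    have le: "real (m d) * Q y d \<le> 0" if d: "d \<in> D0" for d
    using d y simple_nonpos yS by (fastforce simp: D1_def D0_def mult_nonneg_nonpos)
    \<comment> \<open>\<open>Q b y\<close> is nonnegative but a sum of nonpositive terms, so every
      term vanishes; the coefficients on \<open>D0\<close> are positive.\<close>
    have "(\<Sum>d\<in>D0. - (real (m d) * Q y d)) = 0"
      using ge sum_nonpos[of D0 "\<lambda>d. real (m d) * Q y d", OF le] by (simp add: sum_negf)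
    then have "- (real (m x) * Q y x) = 0"
      using sum_nonneg_eq_0_iff[OF fin0, of "\<lambda>d. - (real (m d) * Q y d)"] le x by simp
    then show "Q x y = 0" using x Q_sym[of x y] by (simp add: D0_def)
  qed
  have split: "x \<in> span D0 \<or> x \<in> span D1" if x: "x \<in> C" for x
  proof -
    have xS: "x \<in> \<Sigma>" using x CS by auto
    from positive_or_minus[OF this] show ?thesis
    proof
      assume "x \<in> P"
      then show ?thesis using positive_root_split[OF D o xS] nat_combination_span by blast
    next
      assume "- x \<in> P"
      then have "- x \<in> span D0 \<or> - x \<in> span D1"
        using positive_root_split[OF D o root_minus[OF xS]] nat_combination_span by blast
      then show ?thesis using span_neg[of "- x" D0] span_neg[of "- x" D1] by auto
    qed
  qed
  have "b \<in> span D0" by (subst m0) (intro span_sum span_scale span_base)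
  have "C \<inter> span D0 = C"
  proof (rule ccontr)
    assume "C \<inter> span D0 \<noteq> C"
    then have 1: "C \<inter> span D0 \<subset> C" by blast
    have 2: "C \<inter> span D0 \<noteq> {}" using b(1) \<open>b \<in> span D0\<close> by blast
    have "\<forall>x\<in>C \<inter> span D0. \<forall>y\<in>C - C \<inter> span D0. Q x y = 0"
    proof (intro ballI, rule span_orthogonal[OF o])
      fix x y assume that: "x \<in> C \<inter> span D0" "y \<in> C - C \<inter> span D0"
      show "x \<in> span D0" using that by simp
      show "y \<in> span D1" using that split by blast
    qed
    then have "\<exists>D. D \<subset> C \<and> D \<noteq> {} \<and> (\<forall>x\<in>D. \<forall>y\<in>C - D. Q x y = 0)" using 1 2 by (intro exI conjI)
    moreover have "\<not> (\<exists>D. D \<subset> C \<and> D \<noteq> {} \<and> (\<forall>x\<in>D. \<forall>y\<in>C - D. Q x y = 0))"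
      using C unfolding component_def by (elim conjE)
    ultimately show False by contradiction
  qed
  then have c0: "c \<in> span D0" using c(1) by blast
  have nn: "0 \<le> real (m d) * Q c d" if d: "d \<in> D0" for d
  using d maximal_root_dominant cS c(2,3) simple_root by (force simp: D0_def)
  have "Q c b \<ge> 0" unfolding Qb by (rule sum_nonneg[OF nn])
  moreover have "Q c b \<noteq> 0"
  proof
    assume "Q c b = 0"
    then have z: "\<forall>d\<in>D0. real (m d) * Q c d = 0"
      using sum_nonneg_eq_0_iff[OF fin0, of "\<lambda>d. real (m d) * Q c d"] nn Qb[of c] by simp
    have "Q c c = 0"
    proof (rule span_orthogonal[of "{c}" D0])
      show "\<forall>x\<in>{c}. \<forall>y\<in>D0. Q x y = 0" using z by (simp add: D0_def)
      show "c \<in> span {c}" by (simp add: span_base)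
    qed (rule c0)
    then show False using cS zero_root by (auto simp: Q_eq_0)
  qed
  ultimately show ?thesis by simp
qed

text \<open>By \<open>root_add\<close> for \<open>c\<close> and \<open>- b\<close>, a positive
  product makes the difference of two distinct maximal roots a root. Whichever of b - c and c - b is
  positive could be added to one of them, against maximality.\<close>

lemma maximal_root_unique:
  assumes C: "component C" and b: "b \<in> C" "b \<in> P" "maximal_root b" and c: "c \<in> C" "c \<in> P" "maximal_root c"
  shows "b = c"
proof (rule ccontr)
  assume ne: "b \<noteq> c"
  have bS: "b \<in> \<Sigma>" and cS: "c \<in> \<Sigma>" using C b c by (auto simp: component_def)
  have "Q c b > 0" by (rule maximal_roots_nonorthogonal[OF C b c])
  then have "c + - b \<in> \<Sigma>" using ne by (intro root_add[OF cS root_minus[OF bS]]) (auto simp: Q_simps)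
  then have r: "c - b \<in> \<Sigma>" "b - c \<in> \<Sigma>" using root_minus[of "c - b"] by auto
  have "c - b \<in> P \<or> b - c \<in> P" using positive_or_minus[OF r(1)] by simp
  then show False
  proof
    assume "c - b \<in> P"
    then have "b + (c - b) \<notin> \<Sigma>" using b(3) r(1) unfolding maximal_root_def by blast
    then show False using cS by simp
  next
    assume "b - c \<in> P"
    then have "c + (b - c) \<notin> \<Sigma>" using c(3) r(2) unfolding maximal_root_def by blast
    then show False using bS by simp
  qed
qed

text \<open>Adding positive roots as long as possible stays in the component and raises the height,
  so it stops. Every added root is a natural combination of simple roots. The induction counts the
  roots of greater height.\<close>

lemma climb_to_maximal:
  assumes C: "component C" and a: "a \<in> C" "a \<in> P"
  shows "\<exists>b\<in>C. b \<in> P \<and> maximal_root b \<and> nat_combination simples (b - a)"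
  using a
proof (induction "card {b \<in> \<Sigma>. ht b > ht a}" arbitrary: a rule: less_induct)
  case less
  show ?case
  proof (cases "maximal_root a")
    case True
    then show ?thesis using less.prems by (intro bexI[of _ a]) (simp_all add: nat_combination_zero)
  next
    case False
    then obtain e where e: "e \<in> \<Sigma>" "e \<in> P" "a + e \<in> \<Sigma>" by (auto simp: maximal_root_def)
    have hl: "ht a < ht (a + e)" using chamber_vector(2)[OF e(1,2)] by (simp add: Q_simps)
    have mem: "a + e \<in> C" "a + e \<in> P"
      using component_add[OF C less.prems(1) e(1,3)] positive_add[OF less.prems(2) e(2)] by auto
    have "card {b \<in> \<Sigma>. ht b > ht (a + e)} < card {b \<in> \<Sigma>. ht b > ht a}"
    proof (rule psubset_card_mono, use finite_roots in simp, rule psubsetI)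
      show "{b \<in> \<Sigma>. ht b > ht (a + e)} \<subseteq> {b \<in> \<Sigma>. ht b > ht a}" using hl by auto
      have "a + e \<in> {b \<in> \<Sigma>. ht b > ht a}" "a + e \<notin> {b \<in> \<Sigma>. ht b > ht (a + e)}" using hl e(3) by auto
      then show "{b \<in> \<Sigma>. ht b > ht (a + e)} \<noteq> {b \<in> \<Sigma>. ht b > ht a}" by blast
    qed
    from less.hyps[OF this mem] obtain b where b: "b \<in> C" "b \<in> P" "maximal_root b" "nat_combination simples (b - (a + e))"
      by blast
    have "nat_combination simples (b - (a + e) + e)"
      by (rule nat_combination_add[OF b(4) positive_root_nat_combination[OF e(1,2)]])
    moreover have "b - (a + e) + e = b - a" by simp
    ultimately show ?thesis using b(1-3) by (intro bexI[of _ b]) simp_all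
  qed
qed

text \<open>By uniqueness every climb inside \<open>C\<close> ends at the same root
  \<open>b\<close>, which handles the positive roots of \<open>C\<close>. For negative
  \<open>c\<close> the difference b - c is the sum of the positive roots \<open>b\<close> and
  \<open>- c\<close>.\<close>

lemma highest_root_exists:
  assumes C: "component C"
  shows "\<exists>b. highest_root simples C b"
proof -
  have CS: "C \<subseteq> \<Sigma>" using C by (simp add: component_def)
  obtain a where aC: "a \<in> C" using C by (auto simp: component_def)
  have "\<exists>a\<in>C. a \<in> P" using positive_or_minus[of a] component_minus[OF C aC] aC CS by blast
  then obtain a' where a': "a' \<in> C" "a' \<in> P" by blast
  obtain b where b: "b \<in> C" "b \<in> P" "maximal_root b" using climb_to_maximal[OF C a'] by blast
  have "nat_combination simples (b - c)" if c: "c \<in> C" for c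
  proof (cases "c \<in> P")
    case True
    from climb_to_maximal[OF C c True] obtain b' where b': "b' \<in> C" "b' \<in> P" "maximal_root b'"
      "nat_combination simples (b' - c)" by blast
    have "b = b'" by (rule maximal_root_unique[OF C b b'(1-3)])
    then show ?thesis using b'(4) by simp
  next
    case False
    then have p: "- c \<in> P" using positive_or_minus[of c] c CS by auto
    have "nat_combination simples (b + - c)"
      using b c CS root_minus p by (intro nat_combination_add positive_root_nat_combination) auto
    then show ?thesis by simp
  qed
  then have "highest_root simples C b"
    using b(1) unfolding highest_root_def nat_combination_def by blast
  then show ?thesis by blast
qed

end

subsection \<open>The Killing form\<close>

lemma linear_trace_commute:
  fixes F G :: "'a::euclidean_space \<Rightarrow> 'a"
  assumes F: "linear F" and G: "linear G"
  shows "linear_trace (\<lambda>x. F (G x)) = linear_trace (\<lambda>x. G (F x))"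
proof -
  have 1: "linear_trace (\<lambda>x. F (G x)) = (\<Sum>b\<in>Basis. \<Sum>c\<in>Basis. (G b \<bullet> c) * (F c \<bullet> b))"
    if F: "linear F" for F G :: "'a \<Rightarrow> 'a"
  proof -
    have "F (G b) \<bullet> b = (\<Sum>c\<in>Basis. (G b \<bullet> c) * (F c \<bullet> b))" for b
    proof -
      have "F (G b) = F (\<Sum>c\<in>Basis. (G b \<bullet> c) *\<^sub>R c)" by (simp add: euclidean_representation)
      also have "\<dots> = (\<Sum>c\<in>Basis. (G b \<bullet> c) *\<^sub>R F c)" by (simp add: linear_sum[OF F] linear_scale[OF F])
      finally show ?thesis by (simp add: inner_sum_left)
    qed
    then show ?thesis by (simp add: linear_trace_def)
  qed
  have "linear_trace (\<lambda>x. F (G x)) = (\<Sum>c\<in>Basis. \<Sum>b\<in>Basis. (G b \<bullet> c) * (F c \<bullet> b))"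
    unfolding 1[OF F] by (rule sum.swap)
  also have "\<dots> = linear_trace (\<lambda>x. G (F x))"
    unfolding 1[OF G] by (simp add: mult.commute)
  finally show ?thesis .
qed

lemma linear_trace_linear:
  "linear_trace (\<lambda>x. F x + G x) = linear_trace F + linear_trace G"
  "linear_trace (\<lambda>x. F x - G x) = linear_trace F - linear_trace G"
  "linear_trace (\<lambda>x. c *\<^sub>R F x) = c * linear_trace F"
  "linear_trace (\<lambda>x. - F x) = - linear_trace F"
  by (simp_all add: linear_trace_def inner_add_left inner_diff_left sum.distrib sum_subtractf sum_distrib_left sum_negf)

locale lie_algebra =
  fixes br :: "'a::euclidean_space \<Rightarrow> 'a \<Rightarrow> 'a"
  assumes br_bil: "bilinear br" and br_anti: "br X Y = - br Y X"
    and br_jac: "br X (br Y Z) = br (br X Y) Z + br Y (br X Z)"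
begin

lemma br_lin: "linear (br X)" "linear (\<lambda>X. br X Y)"
  using br_bil by (auto simp: bilinear_def)

lemmas br_simps = linear_add[OF br_lin(1)] linear_add[OF br_lin(2)] linear_scale[OF br_lin(1)] linear_scale[OF br_lin(2)]
  linear_diff[OF br_lin(1)] linear_diff[OF br_lin(2)] linear_0[OF br_lin(1)] linear_0[OF br_lin(2)]
  linear_neg[OF br_lin(1)] linear_neg[OF br_lin(2)]

lemma br_self: "br X X = 0"
proof -
  have "br X X + br X X = 0" using br_anti[of X X] by (metis add.right_inverse)
  then have "2 *\<^sub>R br X X = 0" by (simp add: scaleR_2)
  then show ?thesis by simp
qed

lemma killing_bilinear: "bilinear (killing_form br)"
  unfolding bilinear_def killing_form_def
  by (intro conjI allI linearI) (simp_all add: br_simps linear_trace_linear)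

lemma killing_sym: "killing_form br X Y = killing_form br Y X"
  unfolding killing_form_def by (rule linear_trace_commute[OF br_lin(1) br_lin(1)])

text \<open>The Jacobi identity writes ad [Z, X] and ad [Z, Y] as commutators; after expanding, only
  the cyclic invariance of the trace is left to apply.\<close>

lemma killing_invariant: "killing_form br (br Z X) Y = - killing_form br X (br Z Y)"
proof -
  have 1: "br (br Z X) (br Y W) = br Z (br X (br Y W)) - br X (br Z (br Y W))" for W
    using br_jac[of Z X "br Y W"] by (simp add: algebra_simps)
  have 2: "br X (br (br Z Y) W) = br X (br Z (br Y W)) - br X (br Y (br Z W))" for W
    using arg_cong[OF br_jac[of Z Y W], of "br X"] by (simp add: br_simps algebra_simps)
  have "linear (\<lambda>W. br X (br Y W))" using linear_compose[OF br_lin(1) br_lin(1), of X Y] by (simp add: comp_def)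
  then have "linear_trace (\<lambda>W. br Z (br X (br Y W))) = linear_trace (\<lambda>W. br X (br Y (br Z W)))"
    using linear_trace_commute[OF br_lin(1)[of Z]] by simp
  then show ?thesis
    unfolding killing_form_def 1 2 by (simp add: linear_trace_linear)
qed

text \<open>An automorphism conjugates ad X into ad (f X), and the trace is invariant under
  conjugation. With the inverse \<open>h\<close> as a separate argument the lemma serves both the
  involution \<theta> and the adjoint action of group elements.\<close>

lemma killing_automorphism:
  assumes f: "linear f" "\<And>X Y. f (br X Y) = br (f X) (f Y)" and h: "linear h" "\<And>X. f (h X) = X" "\<And>X. h (f X) = X"
  shows "killing_form br (f X) (f Y) = killing_form br X Y"
proof -
  have 1: "br (f X) (br (f Y) W) = f (br X (br Y (h W)))" for W
    by (simp add: f(2) h(2))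
  have "linear (\<lambda>W. br X (br Y W))" using linear_compose[OF br_lin(1) br_lin(1), of X Y] by (simp add: comp_def)
  then have "linear (\<lambda>W. br X (br Y (h W)))" using linear_compose[OF h(1), of "\<lambda>W. br X (br Y W)"] by (simp add: comp_def)
  from linear_trace_commute[OF f(1) this]
  show ?thesis unfolding killing_form_def 1 by (simp add: h(3))
qed

end

subsection \<open>Restricted weights\<close>

text \<open>The vectors of \<open>S\<close> orthogonal to all eigenvectors in \<open>S\<close> form
  an invariant subspace; were it nonzero it would contain an eigenvector, orthogonal to itself. In
  this form the lemma yields an eigencomponent in which a given nonzero vector does not
  vanish.\<close>

lemma eigenvectors_span:
  assumes Q: "inner_form Q" and S: "subspace S" and F: "linear F" "\<And>x. x \<in> S \<Longrightarrow> F x \<in> S"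
    and sym: "\<And>x y. Q (F x) y = Q x (F y)"
    and w: "w \<in> S" "w \<noteq> 0"
  shows "\<exists>v\<in>S. \<exists>l. F v = l *\<^sub>R v \<and> v \<noteq> 0 \<and> Q w v \<noteq> 0"
proof (rule ccontr)
  interpret inner_form Q by (rule Q)
  assume n: "\<not> (\<exists>v\<in>S. \<exists>l. F v = l *\<^sub>R v \<and> v \<noteq> 0 \<and> Q w v \<noteq> 0)"
  let ?E = "{v \<in> S. \<exists>l. F v = l *\<^sub>R v}"
  let ?T = "{x \<in> S. \<forall>v\<in>?E. Q x v = 0}"
  have T: "subspace ?T" using S by (auto simp: subspace_def Q_simps)
  have "w \<in> ?T"
  using w n by (fastforce simp: Q_simps)
  then have ne: "?T \<noteq> {0}" using w(2) by auto
  have inv: "F x \<in> ?T" if x: "x \<in> ?T" for x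
  proof -
    have "Q (F x) v = 0" if v: "v \<in> S" "F v = l *\<^sub>R v" for v l
    using sym x v v(2) by (force simp: Q_simps)
    then show ?thesis using x F(2) by auto
  qed
  have "\<exists>x\<in>?T. x \<noteq> 0 \<and> (\<exists>l. F x = l *\<^sub>R x)"
    by (rule symmetric_eigenvector[OF T ne F(1)]) (erule inv, rule sym)
  then obtain x l where x: "x \<in> ?T" "x \<noteq> 0" "F x = l *\<^sub>R x" by blast
  then have "Q x x = 0" by blast
  then show False using x(2) by (simp add: Q_eq_0)
qed

locale compact_symmetric_algebra = lie_algebra br for br :: "'a::euclidean_space \<Rightarrow> 'a \<Rightarrow> 'a" +
  fixes \<theta> :: "'a \<Rightarrow> 'a"
  assumes inv: "involutive_automorphism br \<theta>" and killing_negative: "X \<noteq> 0 \<Longrightarrow> killing_form br X X < 0"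
begin

definition ip :: "'a \<Rightarrow> 'a \<Rightarrow> real" where "ip X Y = - killing_form br X Y"

text \<open>The real part of the Hermitian extension of \<open>ip\<close> to the complexification.
  Over the reals the spectral arguments for \<open>inner_form\<close> apply directly, since every ad
  (i h) is symmetric for this form.\<close>

definition ip2 :: "'a cplx \<Rightarrow> 'a cplx \<Rightarrow> real" where
  "ip2 E F = ip (fst E) (fst F) + ip (snd E) (snd F)"

abbreviation "cbr \<equiv> cbracket br"
abbreviation "kk \<equiv> {X. \<theta> X = X}"
abbreviation "pp \<equiv> {X. \<theta> X = - X}"

lemma ip_bilinear: "bilinear ip"
using killing_bilinear linear_compose_neg by (auto simp: bilinear_def ip_def)

sublocale inner_form ip
  by standard (simp_all add: ip_bilinear ip_def killing_sym killing_negative)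

lemma ip2_bilinear: "bilinear ip2"
  unfolding bilinear_def ip2_def by (intro conjI allI linearI) (simp_all add: Q_simps algebra_simps)

sublocale two: inner_form ip2
proof
  show "bilinear ip2" by (rule ip2_bilinear)
  fix x y :: "'a cplx"
  show "ip2 x y = ip2 y x" by (simp add: ip2_def Q_sym)
  assume "x \<noteq> 0"
  then have "fst x \<noteq> 0 \<or> snd x \<noteq> 0" by (auto simp: prod_eq_iff)
  then show "ip2 x x > 0"
    using Q_pos[of "fst x"] Q_pos[of "snd x"] Q_nonneg[of "fst x"] Q_nonneg[of "snd x"]
    unfolding ip2_def by (auto intro: add_pos_nonneg add_nonneg_pos)
qed

lemma ip_skew: "ip (br Z X) Y = - ip X (br Z Y)"
  by (simp add: ip_def killing_invariant)

lemma th_lin: "linear \<theta>" and th_br: "\<theta> (br X Y) = br (\<theta> X) (\<theta> Y)" and th_th: "\<theta> (\<theta> X) = X"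
  using inv by (auto simp: involutive_automorphism_def)

lemma ip_th: "ip (\<theta> X) (\<theta> Y) = ip X Y"
  unfolding ip_def using killing_automorphism[OF th_lin th_br th_lin th_th th_th] by simp

lemma ip_kk_pp: "X \<in> kk \<Longrightarrow> Y \<in> pp \<Longrightarrow> ip X Y = 0"
  using ip_th[of X Y] by (simp add: Q_simps)

lemma bracket_kk_pp:
  "X \<in> kk \<Longrightarrow> Y \<in> kk \<Longrightarrow> br X Y \<in> kk" "X \<in> kk \<Longrightarrow> Y \<in> pp \<Longrightarrow> br X Y \<in> pp"
  "X \<in> pp \<Longrightarrow> Y \<in> kk \<Longrightarrow> br X Y \<in> pp" "X \<in> pp \<Longrightarrow> Y \<in> pp \<Longrightarrow> br X Y \<in> kk"
  by (simp_all add: th_br br_simps)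

lemma subspace_pp: "subspace pp"
  by (auto simp: subspace_def linear_0[OF th_lin] linear_add[OF th_lin] linear_scale[OF th_lin])

lemma kk_pp_zero: "X \<in> kk \<Longrightarrow> X \<in> pp \<Longrightarrow> X = 0"
  using ip_kk_pp[of X X] by (simp add: Q_eq_0)

definition kpt :: "'a \<Rightarrow> 'a" where "kpt X = (1/2) *\<^sub>R (X + \<theta> X)"
definition ppt :: "'a \<Rightarrow> 'a" where "ppt X = (1/2) *\<^sub>R (X - \<theta> X)"

lemma kpt_ppt: "kpt X \<in> kk" "ppt X \<in> pp" "kpt X + ppt X = X"
proof -
  show "kpt X \<in> kk" "ppt X \<in> pp"
    by (simp_all add: kpt_def ppt_def linear_scale[OF th_lin] linear_add[OF th_lin] linear_diff[OF th_lin] th_th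
        add.commute scaleR_diff_right)
  have "kpt X + ppt X = (1/2) *\<^sub>R X + (1/2) *\<^sub>R X" by (simp add: kpt_def ppt_def algebra_simps)
  then show "kpt X + ppt X = X" by (simp flip: scaleR_left_distrib)
qed

lemma part_bracket:
  assumes h: "h \<in> pp"
  shows "kpt (br h X) = br h (ppt X)" "ppt (br h X) = br h (kpt X)"
  using h by (simp_all add: kpt_def ppt_def th_br br_simps)

lemma part_scale: "kpt (c *\<^sub>R X) = c *\<^sub>R kpt X" "ppt (c *\<^sub>R X) = c *\<^sub>R ppt X"
  by (simp_all add: kpt_def ppt_def linear_scale[OF th_lin] scaleR_add_right scaleR_diff_right)

subsubsection \<open>The complexified bracket\<close>

lemma cbr_Pair: "cbr (X, Y) (X', Y') = (br X X' - br Y Y', br X Y' + br Y X')"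
  by (simp add: cbracket_def)

lemma cbr_imag: "cbr (0, h) F = (- br h (snd F), br h (fst F))"
  by (cases F) (simp add: cbr_Pair br_simps)

lemma cbr_linear: "linear (cbr E)" "linear (\<lambda>E. cbr E F)"
proof -
  show "linear (cbr E)"
  proof (rule linearI)
    show "cbr E (x + y) = cbr E x + cbr E y" for x y
      by (cases E; cases x; cases y) (simp add: cbr_Pair br_simps)
    show "cbr E (c *\<^sub>R x) = c *\<^sub>R cbr E x" for c x
      by (cases E; cases x) (simp add: cbr_Pair br_simps algebra_simps)
  qed
  show "linear (\<lambda>E. cbr E F)"
  proof (rule linearI)
    show "cbr (x + y) F = cbr x F + cbr y F" for x y
      by (cases F; cases x; cases y) (simp add: cbr_Pair br_simps)
    show "cbr (c *\<^sub>R x) F = c *\<^sub>R cbr x F" for c x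
      by (cases F; cases x) (simp add: cbr_Pair br_simps algebra_simps)
  qed
qed

lemma cbr_jacobi: "cbr E (cbr F G) = cbr (cbr E F) G + cbr F (cbr E G)"
proof -
  obtain a b c d e f where s: "E = (a, b)" "F = (c, d)" "G = (e, f)" by (cases E; cases F; cases G)
  have 1: "br a (br c e) = br (br a c) e + br c (br a e)" "br a (br d f) = br (br a d) f + br d (br a f)"
    "br b (br c f) = br (br b c) f + br c (br b f)" "br b (br d e) = br (br b d) e + br d (br b e)"
    "br a (br c f) = br (br a c) f + br c (br a f)" "br a (br d e) = br (br a d) e + br d (br a e)"
    "br b (br c e) = br (br b c) e + br c (br b e)" "br b (br d f) = br (br b d) f + br d (br b f)"
    by (rule br_jac)+
  show ?thesis unfolding s cbr_Pair br_simps 1 by simp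
qed

text \<open>Complex conjugation with respect to the compact real form. It yields the adjoint of ad E
  up to sign, and it sends weights to their negatives.\<close>

definition conj_pair :: "'a cplx \<Rightarrow> 'a cplx" where "conj_pair E = (fst E, - snd E)"

lemma ip2_adjoint: "ip2 (cbr E F) G = - ip2 F (cbr (conj_pair E) G)"
  by (cases E; cases F; cases G) (simp add: cbr_Pair conj_pair_def ip2_def Q_simps br_simps ip_skew)

lemma conj_pair_simps: "conj_pair (conj_pair E) = E" "conj_pair (X, Y) = (X, - Y)"
  by (simp_all add: conj_pair_def)

lemma ip2_imag_symmetric: "ip2 (cbr (0, h) F) G = ip2 F (cbr (0, h) G)"
  using ip2_adjoint[of "(0, h)" F G] cbr_linear(2)
  by (simp add: conj_pair_def cbr_imag br_simps ip2_def Q_simps)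

text \<open>With \<open>E = (X, Y)\<close> standing for \<open>X + \<i> Y\<close>, the element \<open>(0, h)\<close> is \<open>\<i> h\<close>; so \<open>a\<close> is the weight
  for which \<open>[\<i> h, E] = \<langle>h, a\<rangle> E\<close>.\<close>
definition weight_vector :: "'a set \<Rightarrow> 'a \<Rightarrow> 'a cplx \<Rightarrow> bool" where
  "weight_vector S a E \<longleftrightarrow> (\<forall>h\<in>S. cbr (0, h) E = ip h a *\<^sub>R E)"

lemma weight_vectorD: "weight_vector S a E \<Longrightarrow> h \<in> S \<Longrightarrow> cbr (0, h) E = ip h a *\<^sub>R E"
  by (simp add: weight_vector_def)

lemma weight_vector_pair:
  "weight_vector S a (X, Y) \<longleftrightarrow> (\<forall>h\<in>S. br h X = ip h a *\<^sub>R Y \<and> br h Y = - (ip h a *\<^sub>R X))"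
proof -
  have "cbr (0, h) (X, Y) = ip h a *\<^sub>R (X, Y) \<longleftrightarrow> br h X = ip h a *\<^sub>R Y \<and> br h Y = - (ip h a *\<^sub>R X)" for h
    by (auto simp: cbr_imag minus_equation_iff[of "br h Y"])
  then show ?thesis by (simp add: weight_vector_def)
qed

lemma weight_vector_conj: "weight_vector S a E \<Longrightarrow> weight_vector S (- a) (conj_pair E)"
  by (cases E) (simp add: weight_vector_pair conj_pair_simps br_simps Q_simps)

lemma weight_vector_bracket:
  assumes E: "weight_vector S a E" and F: "weight_vector S c F"
  shows "weight_vector S (a + c) (cbr E F)"
  unfolding weight_vector_def
proof
  fix h assume h: "h \<in> S"
  have "cbr (0, h) (cbr E F) = cbr (ip h a *\<^sub>R E) F + cbr E (ip h c *\<^sub>R F)"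
    unfolding cbr_jacobi[of "(0, h)" E F] weight_vectorD[OF E h] weight_vectorD[OF F h] ..
  also have "\<dots> = ip h (a + c) *\<^sub>R cbr E F"
    by (simp add: linear_scale[OF cbr_linear(1)] linear_scale[OF cbr_linear(2)] Q_simps scaleR_left_distrib)
  finally show "cbr (0, h) (cbr E F) = ip h (a + c) *\<^sub>R cbr E F" .
qed

lemma imag_commute:
  assumes "br h k = 0"
  shows "cbr (0, h) (cbr (0, k) E) = cbr (0, k) (cbr (0, h) E)"
proof -
  have "cbr (0, h) (0, k) = 0" using assms by (simp add: cbr_imag zero_prod_def br_simps)
  then show ?thesis using cbr_jacobi[of "(0, h)" "(0, k)" E] by (simp add: linear_0[OF cbr_linear(2)])
qed

text \<open>The operators ad (i h) with \<open>h\<close> in \<open>S\<close> are symmetric for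
  \<open>ip2\<close> and commute, so \<open>W\<close> contains a common eigenvector. Its eigenvalue
  equals the Rayleigh quotient, which is visibly linear in \<open>h\<close> and hence represented by
  a vector \<open>a\<close> of \<open>S\<close>.\<close>

lemma weight_exists:
  assumes W: "subspace W" "W \<noteq> {0}" and S: "abelian_subspace br S"
    and inv: "\<And>h E. h \<in> S \<Longrightarrow> E \<in> W \<Longrightarrow> cbr (0, h) E \<in> W"
  shows "\<exists>E\<in>W. E \<noteq> 0 \<and> (\<exists>a\<in>S. weight_vector S a E)"
proof -
  have Ss: "subspace S" and ab: "\<And>h k. h \<in> S \<Longrightarrow> k \<in> S \<Longrightarrow> br h k = 0"
    using S by (auto simp: abelian_subspace_def)
  have "\<exists>E\<in>W. E \<noteq> 0 \<and> (\<forall>h\<in>S. \<exists>l. cbr (0, h) E = l *\<^sub>R E)"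
  proof (rule two.common_eigenvector[OF W, where I = S and F = "\<lambda>h. cbr (0, h)"])
    show "\<And>i. linear (cbr (0, i))" by (rule cbr_linear(1))
    show "\<And>i x. i \<in> S \<Longrightarrow> x \<in> W \<Longrightarrow> cbr (0, i) x \<in> W" by (rule inv)
    show "\<And>i x y. ip2 (cbr (0, i) x) y = ip2 x (cbr (0, i) y)" by (rule ip2_imag_symmetric)
    show "\<And>i j x. i \<in> S \<Longrightarrow> j \<in> S \<Longrightarrow> cbr (0, i) (cbr (0, j) x) = cbr (0, j) (cbr (0, i) x)"
      by (rule imag_commute[OF ab])
  qed
  then obtain E where E: "E \<in> W" "E \<noteq> 0" "\<And>h. h \<in> S \<Longrightarrow> \<exists>l. cbr (0, h) E = l *\<^sub>R E" by blast
  have EE: "ip2 E E > 0" by (rule two.Q_pos[OF E(2)])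
  have 0: "linear (\<lambda>h. ip2 (cbr (0, h) E) E)"
    by (rule linearI) (simp_all add: cbr_imag ip2_def Q_simps br_simps algebra_simps)
  have "linear (\<lambda>h. ip2 (cbr (0, h) E) E / ip2 E E)"
    by (rule linearI) (simp_all add: linear_add[OF 0] linear_scale[OF 0] add_divide_distrib)
  from represent_functional[OF Ss this]
  obtain a where a: "a \<in> S" "\<forall>h\<in>S. ip h a = ip2 (cbr (0, h) E) E / ip2 E E" by blast
  have "weight_vector S a E" unfolding weight_vector_def
  using E(3) a(2) EE by (force simp: two.Q_simps)
  then show ?thesis using E(1,2) a(1) by blast
qed

end

subsection \<open>Restricted roots of a compact symmetric algebra\<close>

locale maximal_flat = compact_symmetric_algebra br \<theta> for br :: "'a::euclidean_space \<Rightarrow> 'a \<Rightarrow> 'a" and \<theta> +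
  fixes hp :: "'a set"
  assumes hp_maximal: "maximal_abelian_in br {X. \<theta> X = - X} hp"
begin

lemma hp: "abelian_subspace br hp" "subspace hp" "hp \<subseteq> pp" "X \<in> hp \<Longrightarrow> Y \<in> hp \<Longrightarrow> br X Y = 0"
  using hp_maximal by (auto simp: maximal_abelian_in_def abelian_subspace_def)

text \<open>Adjoining \<open>X\<close> to \<open>hp\<close> gives an abelian subspace of
  \<open>pp\<close> again, which maximality identifies with \<open>hp\<close>.\<close>

lemma hp_centralizer:
  assumes X: "X \<in> pp" and c: "\<And>h. h \<in> hp \<Longrightarrow> br h X = 0"
  shows "X \<in> hp"
proof -
  let ?b = "span (insert X hp)"
  have e: "\<exists>k. y - k *\<^sub>R X \<in> hp" if "y \<in> ?b" for y
    using that hp(2) by (simp add: span_breakdown_eq span_eq_iff[THEN iffD2])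
  have com: "br y z = 0" if y: "y \<in> ?b" and z: "z \<in> ?b" for y z
  proof -
    obtain k l where kl: "y - k *\<^sub>R X \<in> hp" "z - l *\<^sub>R X \<in> hp" using e[OF y] e[OF z] by blast
    have 1: "br (y - k *\<^sub>R X) (z - l *\<^sub>R X) = 0" by (rule hp(4)[OF kl])
    have 2: "br (y - k *\<^sub>R X) X = 0" "br (z - l *\<^sub>R X) X = 0" by (rule c[OF kl(1)], rule c[OF kl(2)])
    have 3: "br X (z - l *\<^sub>R X) = 0" using br_anti[of X "z - l *\<^sub>R X"] 2(2) by simp
    have "br ((y - k *\<^sub>R X) + k *\<^sub>R X) ((z - l *\<^sub>R X) + l *\<^sub>R X) = 0"
      unfolding linear_add[OF br_lin(1)] linear_add[OF br_lin(2)] linear_scale[OF br_lin(1)] linear_scale[OF br_lin(2)]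
      using 1 2 3 by (simp add: br_self)
    then show ?thesis by simp
  qed
  have "?b \<subseteq> pp" using X hp(3) by (intro span_minimal subspace_pp) auto
  moreover have "abelian_subspace br ?b" unfolding abelian_subspace_def using com by (simp add: subspace_span)
  moreover have "hp \<subseteq> ?b" by (auto intro: span_base)
  ultimately have "?b = hp" using hp_maximal unfolding maximal_abelian_in_def by blast
  then show ?thesis using span_base[of X "insert X hp"] by simp
qed

text \<open>Restricted roots as the nonzero weights of \<open>hp\<close> alone, held as vectors of
  the compact form. \<open>restricted_roots_eq\<close> matches them with the projections of the
  roots of the full Cartan subalgebra.\<close>

definition rroots :: "'a set" where
  "rroots = {a \<in> hp. a \<noteq> 0 \<and> (\<exists>E. E \<noteq> 0 \<and> weight_vector hp a E)}"

lemma rrootI: "a \<in> hp \<Longrightarrow> a \<noteq> 0 \<Longrightarrow> E \<noteq> 0 \<Longrightarrow> weight_vector hp a E \<Longrightarrow> a \<in> rroots"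
  unfolding rroots_def by blast

lemma rrootD: "a \<in> rroots \<Longrightarrow> a \<in> hp" "a \<in> rroots \<Longrightarrow> a \<noteq> 0"
  by (simp_all add: rroots_def)

lemma rroot_minus:
  assumes a: "a \<in> rroots"
  shows "- a \<in> rroots"
proof -
  obtain E where E: "E \<noteq> 0" "weight_vector hp a E" using a by (auto simp: rroots_def)
  have "conj_pair E \<noteq> 0" using E(1) by (cases E) (auto simp: conj_pair_def zero_prod_def)
  then show ?thesis using rrootD[OF a] by (intro rrootI[OF _ _ _ weight_vector_conj[OF E(2)]] subspace_neg[OF hp(2)]) simp_all
qed

text \<open>Weight vectors for distinct weights \<open>a\<close> and \<open>b\<close> are
  orthogonal, as eigenvectors of the symmetric operator ad (i (a - b)) whose eigenvalues differ by
  \<open>ip (a - b) (a - b)\<close>. So their number is bounded by the dimension.\<close>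

lemma finite_rroots: "finite rroots"
proof (rule ccontr)
  assume "infinite rroots"
  then obtain R where R: "R \<subseteq> rroots" "finite R" "card R = Suc DIM('a cplx)"
    using infinite_arbitrarily_large by blast
  have "\<exists>E. E \<noteq> 0 \<and> weight_vector hp a E" if "a \<in> R" for a
    using that R(1) by (auto simp: rroots_def)
  then obtain e where e: "\<And>a. a \<in> R \<Longrightarrow> e a \<noteq> 0" "\<And>a. a \<in> R \<Longrightarrow> weight_vector hp a (e a)" by metis
  have o: "ip2 (e a) (e b) = 0" if ab: "a \<in> R" "b \<in> R" "a \<noteq> b" for a b
  proof -
    have h: "a - b \<in> hp" using ab R(1) rrootD(1) by (intro subspace_diff[OF hp(2)]) auto
    have "ip2 (cbr (0, a - b) (e a)) (e b) = ip2 (e a) (cbr (0, a - b) (e b))" by (rule ip2_imag_symmetric)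
    then have "ip (a - b) a * ip2 (e a) (e b) = ip (a - b) b * ip2 (e a) (e b)"
      unfolding weight_vectorD[OF e(2)[OF ab(1)] h] weight_vectorD[OF e(2)[OF ab(2)] h]
      by (simp only: two.Q_simps real_scaleR_def)
    then have "ip (a - b) (a - b) * ip2 (e a) (e b) = 0"
      by (simp add: Q_simps algebra_simps)
    then show ?thesis using ab(3) by (simp add: Q_eq_0)
  qed
  have inj: "inj_on e R"
  proof (rule inj_onI, rule ccontr)
    fix a b assume "a \<in> R" "b \<in> R" "e a = e b" "a \<noteq> b"
    then show False using o[of a b] e(1)[of b] by (simp add: two.Q_eq_0)
  qed
  have "card (e ` R) \<le> DIM('a cplx)"
  proof (rule two.orthogonal_card_le)
    show "finite (e ` R)" using R(2) by simp
    show "\<And>b. b \<in> e ` R \<Longrightarrow> b \<noteq> 0" using e(1) by auto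
    fix b c assume "b \<in> e ` R" "c \<in> e ` R" "b \<noteq> c"
    then show "ip2 b c = 0" using o by auto
  qed
  then show False using R(3) card_image[OF inj] by simp
qed

text \<open>ad h exchanges \<open>kk\<close> and \<open>pp\<close>, so the \<open>kk\<close>-part of
  \<open>X\<close> with the \<open>pp\<close>-part of \<open>Y\<close> is again a weight vector; the
  other two parts give a second one after multiplication by - i. One of them is nonzero, and then
  both of its components are, since ad a maps each component to a nonzero multiple of the
  other.\<close>

lemma special_vectors:
  assumes a: "a \<in> rroots"
  shows "\<exists>T\<in>kk. \<exists>S\<in>pp. T \<noteq> 0 \<and> S \<noteq> 0 \<and> weight_vector hp a (T, S)"
proof -
  obtain X Y where E: "(X, Y) \<noteq> 0" "weight_vector hp a (X, Y)" using a by (auto simp: rroots_def)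
  have w: "br h X = ip h a *\<^sub>R Y" "br h Y = - (ip h a *\<^sub>R X)" if "h \<in> hp" for h
    using E(2) that by (simp_all add: weight_vector_pair)
  have hpp: "h \<in> pp" if "h \<in> hp" for h using hp(3) that by auto
  have neg: "kpt (- Z) = - kpt Z" "ppt (- Z) = - ppt Z" for Z using part_scale[of "-1" Z] by simp_all
  have s1: "weight_vector hp a (kpt X, ppt Y)"
    unfolding weight_vector_pair
  proof
    fix h assume h: "h \<in> hp"
    show "br h (kpt X) = ip h a *\<^sub>R ppt Y \<and> br h (ppt Y) = - (ip h a *\<^sub>R kpt X)"
      using part_bracket(2)[OF hpp[OF h], of X] part_bracket(1)[OF hpp[OF h], of Y] w[OF h] by (simp add: part_scale neg)
  qed
  have s2: "weight_vector hp a (kpt Y, - ppt X)"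
    unfolding weight_vector_pair
  proof
    fix h assume h: "h \<in> hp"
    show "br h (kpt Y) = ip h a *\<^sub>R - ppt X \<and> br h (- ppt X) = - (ip h a *\<^sub>R kpt Y)"
      using part_bracket(2)[OF hpp[OF h], of Y] part_bracket(1)[OF hpp[OF h], of X] w[OF h] by (simp add: part_scale neg br_simps)
  qed
  have both: "T \<noteq> 0 \<and> S \<noteq> 0" if ws: "weight_vector hp a (T, S)" and nz: "T \<noteq> 0 \<or> S \<noteq> 0" for T S
  using ws rrootD(1) a rrootD(2) nz by (fastforce simp: weight_vector_pair br_simps Q_eq_0)
  have "X \<noteq> 0 \<or> Y \<noteq> 0" using E(1) by (auto simp: zero_prod_def)
  then have "kpt X \<noteq> 0 \<or> ppt Y \<noteq> 0 \<or> kpt Y \<noteq> 0 \<or> - ppt X \<noteq> 0"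
    using kpt_ppt(3)[of X] kpt_ppt(3)[of Y] by auto
  then consider "kpt X \<noteq> 0 \<or> ppt Y \<noteq> 0" | "kpt Y \<noteq> 0 \<or> - ppt X \<noteq> 0" by blast
  then show ?thesis
  proof cases
    case 1
    show ?thesis
      by (rule bexI[of _ "kpt X"], rule bexI[of _ "ppt Y"]) (use both[OF s1 1] s1 kpt_ppt in auto)
  next
    case 2
    have "- ppt X \<in> pp" using kpt_ppt(2) subspace_neg[OF subspace_pp] by blast
    then show ?thesis
      by (intro bexI[of _ "kpt Y"] bexI[of _ "- ppt X"]) (use both[OF s2 2] s2 kpt_ppt in auto)
  qed
qed

text \<open>[T, S] lies in \<open>pp\<close> and commutes with \<open>hp\<close>, hence lies in
  \<open>hp\<close>, where it is determined by its products with all of \<open>hp\<close>. The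
  equality of lengths is skewness of ad a.\<close>

lemma special_bracket:
  assumes a: "a \<in> rroots" and T: "T \<in> kk" and S: "S \<in> pp" and w: "weight_vector hp a (T, S)"
  shows "br T S = ip T T *\<^sub>R a" "ip S S = ip T T"
proof -
  have w': "br h T = ip h a *\<^sub>R S" "br h S = - (ip h a *\<^sub>R T)" if "h \<in> hp" for h
    using w that by (simp_all add: weight_vector_pair)
  have ahp: "a \<in> hp" by (rule rrootD(1)[OF a])
  have aa: "ip a a \<noteq> 0" using rrootD(2)[OF a] by (simp add: Q_eq_0)
  have "ip (br a T) S = - ip T (br a S)" by (rule ip_skew)
  then show SS: "ip S S = ip T T" using aa by (simp add: w'[OF ahp] Q_simps)
  have "br T S \<in> hp"
  using hp_centralizer bracket_kk_pp(2) T S by (force simp: br_simps w' br_jac br_self)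
  moreover have "ip T T *\<^sub>R a \<in> hp" using ahp by (rule subspace_scale[OF hp(2)])
  ultimately have d: "br T S - ip T T *\<^sub>R a \<in> hp" by (rule subspace_diff[OF hp(2)])
  have "ip h (br T S) = ip T T * ip h a" if h: "h \<in> hp" for h
  proof -
    have "ip h (br T S) = - ip (br T h) S" by (simp add: ip_skew)
    also have "br T h = - br h T" by (rule br_anti)
    finally show ?thesis by (simp add: w'[OF h] Q_simps SS mult.commute)
  qed
  then have "ip h (br T S - ip T T *\<^sub>R a) = 0" if "h \<in> hp" for h using that by (simp add: Q_simps)
  from this[OF d] show "br T S = ip T T *\<^sub>R a" by (simp add: Q_eq_0)
qed

text \<open>The sl2 relation in disguise: for E = T + i S with conjugate E', the bracket [E, E'] is
  - 2 |T|^2 times i a. Since the adjoint of ad E is - ad E', the squared lengths of [E, F] and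
  [E', F] differ by 2 |T|^2 |F|^2 times the eigenvalue of ad (i a) on \<open>F\<close>.\<close>

lemma bracket_norm_identity:
  assumes a: "a \<in> rroots" and T: "T \<in> kk" and S: "S \<in> pp" and w: "weight_vector hp a (T, S)"
    and F: "weight_vector hp c F"
  shows "ip2 (cbr (T, S) F) (cbr (T, S) F) = ip2 (cbr (T, - S) F) (cbr (T, - S) F) - 2 * ip T T * ip a c * ip2 F F"
proof -
  let ?E = "(T, S)" and ?E' = "(T, - S)"
  have "br S T = - br T S" by (rule br_anti)
  then have "cbr ?E ?E' = (0, (- 2 * ip T T) *\<^sub>R a)"
    using scaleR_2[of "ip T T *\<^sub>R a"] by (simp add: cbr_Pair br_simps br_self special_bracket(1)[OF a T S w])
  also have "\<dots> = (- 2 * ip T T) *\<^sub>R (0, a)" by simp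
  finally have "cbr (cbr ?E ?E') F = (- 2 * ip T T) *\<^sub>R cbr (0, a) F" by (simp only: linear_scale[OF cbr_linear(2)])
  also have "cbr (0, a) F = ip a c *\<^sub>R F" by (rule weight_vectorD[OF F rrootD(1)[OF a]])
  finally have 1: "cbr ?E (cbr ?E' F) = (- 2 * ip T T) *\<^sub>R ip a c *\<^sub>R F + cbr ?E' (cbr ?E F)"
    using cbr_jacobi[of ?E ?E' F] by simp
  have 2: "ip2 (cbr ?E F) (cbr ?E F) = - ip2 F (cbr ?E' (cbr ?E F))" by (simp add: ip2_adjoint conj_pair_simps)
  have 3: "ip2 (cbr ?E' F) (cbr ?E' F) = - ip2 F (cbr ?E (cbr ?E' F))" by (simp add: ip2_adjoint conj_pair_simps)
  show ?thesis unfolding 2 3 1 by (simp add: two.Q_simps)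
qed

text \<open>The norm identity makes [E, F] nonzero when \<open>ip a c\<close> is negative, and this
  vector has weight \<open>a + c\<close>.\<close>

lemma rroot_add:
  assumes a: "a \<in> rroots" and c: "c \<in> rroots" and n: "ip a c < 0" and nz: "a + c \<noteq> 0"
  shows "a + c \<in> rroots"
proof -
  obtain T S where TS: "T \<in> kk" "S \<in> pp" "T \<noteq> 0" "weight_vector hp a (T, S)" using special_vectors[OF a] by blast
  obtain F where F: "F \<noteq> 0" "weight_vector hp c F" using c by (auto simp: rroots_def)
  have "ip T T * ip a c * ip2 F F < 0"
    using Q_pos[OF TS(3)] two.Q_pos[OF F(1)] n by (intro mult_neg_pos mult_pos_neg) auto
  then have "ip2 (cbr (T, S) F) (cbr (T, S) F) > 0"
    using bracket_norm_identity[OF a TS(1,2,4) F(2)] two.Q_nonneg[of "cbr (T, - S) F"] by linarith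
  then have "cbr (T, S) F \<noteq> 0" by (auto simp: two.Q_simps)
  moreover have "weight_vector hp (a + c) (cbr (T, S) F)" by (rule weight_vector_bracket[OF TS(4) F(2)])
  moreover have "a + c \<in> hp" using rrootD(1) a c by (intro subspace_add[OF hp(2)]) auto
  ultimately show ?thesis using nz by (intro rrootI)
qed

text \<open>Suppose \<open>G\<close> has weight \<open>a + c\<close>. Lowering it by E' gives F of
  weight \<open>c\<close>, nonzero by the norm identity because \<open>ip a (a + c)\<close> is
  positive. If a - c is not a root then [E', F] = 0, and the identity with ip a c = 0 gives [E, F] =
  0 as well; but |F|^2 is minus the product of \<open>G\<close> with [E, F].\<close>

lemma rroot_string:
  assumes a: "a \<in> rroots" and c: "c \<in> rroots" and o: "ip a c = 0" and d: "a - c \<notin> rroots"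
  shows "a + c \<notin> rroots"
proof
  assume s: "a + c \<in> rroots"
  obtain T S where TS: "T \<in> kk" "S \<in> pp" "T \<noteq> 0" "weight_vector hp a (T, S)" using special_vectors[OF a] by blast
  obtain G where G: "G \<noteq> 0" "weight_vector hp (a + c) G" using s by (auto simp: rroots_def)
  have aa: "ip a a > 0" by (rule Q_pos[OF rrootD(2)[OF a]])
  have w': "weight_vector hp (- a) (T, - S)" using weight_vector_conj[OF TS(4)] by (simp add: conj_pair_simps)
  let ?F = "cbr (T, - S) G"
  have F: "weight_vector hp c ?F" using weight_vector_bracket[OF w' G(2)] by simp
  have "ip T T * ip a (a + c) * ip2 G G > 0"
    using Q_pos[OF TS(3)] two.Q_pos[OF G(1)] aa o by (simp add: Q_simps)
  then have F0: "ip2 ?F ?F > 0"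
    using bracket_norm_identity[OF a TS(1,2,4) G(2)] two.Q_nonneg[of "cbr (T, S) G"] by linarith
  have "cbr (T, - S) ?F = 0"
  proof (rule ccontr)
    assume nz: "cbr (T, - S) ?F \<noteq> 0"
    have "weight_vector hp (c - a) (cbr (T, - S) ?F)" using weight_vector_bracket[OF w' F] by simp
    moreover have "c - a \<in> hp" using rrootD(1) a c by (intro subspace_diff[OF hp(2)]) auto
    moreover have "c - a \<noteq> 0" using o aa by auto
    ultimately have "c - a \<in> rroots" using nz by (intro rrootI)
    then show False using rroot_minus[of "c - a"] d by simp
  qed
  then have "ip2 (cbr (T, S) ?F) (cbr (T, S) ?F) = 0"
    using bracket_norm_identity[OF a TS(1,2,4) F] o by (simp add: two.Q_simps)
  then have "cbr (T, S) ?F = 0" by (simp add: two.Q_eq_0)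
  then have "ip2 ?F ?F = 0" using ip2_adjoint[of "(T, - S)" G ?F] by (simp add: conj_pair_simps two.Q_simps)
  then show False using F0 by simp
qed

subsubsection \<open>Eigenvalues of the Jacobi operator\<close>

text \<open>Here - l^2 is the eigenvalue, and \<open>l\<close> is the frequency of the corresponding
  solutions of W'' = ad(X)^2 W; scaling \<open>X\<close> scales frequencies linearly.\<close>

definition spec :: "'a \<Rightarrow> real \<Rightarrow> bool" where
  "spec X l \<longleftrightarrow> (\<exists>V\<in>pp. V \<noteq> 0 \<and> br X (br X V) = - (l\<^sup>2 *\<^sub>R V))"

lemma spec_scale:
  assumes "t > 0"
  shows "spec (t *\<^sub>R X) l \<longleftrightarrow> spec X (l / t)"
proof -
  have "br (t *\<^sub>R X) (br (t *\<^sub>R X) V) = - (l\<^sup>2 *\<^sub>R V) \<longleftrightarrow> br X (br X V) = - ((l / t)\<^sup>2 *\<^sub>R V)" for V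
  proof -
    have "br (t *\<^sub>R X) (br (t *\<^sub>R X) V) = t\<^sup>2 *\<^sub>R br X (br X V)"
      by (simp add: br_simps power2_eq_square)
    moreover have "- (l\<^sup>2 *\<^sub>R V) = t\<^sup>2 *\<^sub>R (- ((l / t)\<^sup>2 *\<^sub>R V))" using assms by (simp add: power_divide)
    moreover have "t\<^sup>2 *\<^sub>R x = t\<^sup>2 *\<^sub>R y \<longleftrightarrow> x = y" for x y :: 'a using assms by simp
    ultimately show ?thesis by presburger
  qed
  then show ?thesis by (simp add: spec_def)
qed

lemma spec_automorphism:
  assumes f: "linear f" "\<And>X Y. f (br X Y) = br (f X) (f Y)" "\<And>X. X \<in> pp \<Longrightarrow> f X \<in> pp" "\<And>X. f X = 0 \<Longrightarrow> X = 0"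
    and s: "spec X l"
  shows "spec (f X) l"
proof -
  obtain V where V: "V \<in> pp" "V \<noteq> 0" "br X (br X V) = - (l\<^sup>2 *\<^sub>R V)" using s unfolding spec_def by blast
  have "br (f X) (br (f X) (f V)) = - (l\<^sup>2 *\<^sub>R f V)"
    using arg_cong[OF V(3), of f] by (simp add: f(2) linear_neg[OF f(1)] linear_scale[OF f(1)])
  then show ?thesis unfolding spec_def using f(3)[OF V(1)] f(4)[of V] V(2) by blast
qed

text \<open>From left to right, V + (i / l) [X, V] is an eigenvector of ad (i X) for the eigenvalue
  \<open>l\<close>; the eigenspace is invariant under i \<open>hp\<close> and so contains a weight
  vector. From right to left, the \<open>pp\<close>-component of a special weight vector is the
  eigenvector. The absolute value enters because only the square of \<open>l\<close> occurs in
  \<open>spec\<close>.\<close>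

lemma spec_hp_iff:
  assumes X: "X \<in> hp" and l: "l > 0"
  shows "spec X l \<longleftrightarrow> (\<exists>a\<in>rroots. \<bar>ip X a\<bar> = l)"
proof
  assume "spec X l"
  then obtain V where V: "V \<in> pp" "V \<noteq> 0" "br X (br X V) = - (l\<^sup>2 *\<^sub>R V)" unfolding spec_def by blast
  let ?W = "{E. cbr (0, X) E = l *\<^sub>R E}"
  have W: "subspace ?W" by (auto simp: subspace_def linear_0[OF cbr_linear(1)] linear_add[OF cbr_linear(1)] linear_scale[OF cbr_linear(1)] scaleR_add_right)
  have "(V, (1/l) *\<^sub>R br X V) \<in> ?W" using V(3) l by (simp add: cbr_imag br_simps power2_eq_square)
  moreover have "(V, (1/l) *\<^sub>R br X V) \<noteq> 0" using V(2) by (simp add: zero_prod_def)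
  ultimately have ne: "?W \<noteq> {0}" by blast
  have inv: "cbr (0, h) E \<in> ?W" if h: "h \<in> hp" and E: "E \<in> ?W" for h E
    using imag_commute[OF hp(4)[OF X h], of E] E by (simp add: linear_scale[OF cbr_linear(1)])
  obtain E a where E: "E \<in> ?W" "E \<noteq> 0" "a \<in> hp" "weight_vector hp a E"
    using weight_exists[OF W ne hp(1) inv] by blast
  have "l *\<^sub>R E = ip X a *\<^sub>R E" using E(1) by (simp flip: weight_vectorD[OF E(4) X])
  then have "ip X a = l" using E(2) by (metis scaleR_cancel_right)
  then have "a \<noteq> 0" using l by (auto simp: Q_simps)
  then have "a \<in> rroots" by (rule rrootI[OF E(3) _ E(2,4)])
  then show "\<exists>a\<in>rroots. \<bar>ip X a\<bar> = l" using \<open>ip X a = l\<close> l by (intro bexI[of _ a]) simp_all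
next
  assume "\<exists>a\<in>rroots. \<bar>ip X a\<bar> = l"
  then obtain a where a: "a \<in> rroots" "\<bar>ip X a\<bar> = l" by blast
  obtain T S where TS: "T \<in> kk" "S \<in> pp" "S \<noteq> 0" "weight_vector hp a (T, S)" using special_vectors[OF a(1)] by blast
  have "br X T = ip X a *\<^sub>R S" "br X S = - (ip X a *\<^sub>R T)" using TS(4) X by (simp_all add: weight_vector_pair)
  then have "br X (br X S) = - ((ip X a)\<^sup>2 *\<^sub>R S)" by (simp add: br_simps power2_eq_square)
  moreover have "(ip X a)\<^sup>2 = l\<^sup>2" using a(2) by (metis power2_abs)
  ultimately show "spec X l" unfolding spec_def using TS(2,3) by (intro bexI[of _ S]) simp_all
qed

end

subsection \<open>The Cartan polyhedron in terms of the compact real form\<close>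

text \<open>The real Cartan space consists of the pairs (0, a), which stand for i a. The locale
  carries the notions built from these pairs over to the vectors \<open>a\<close> of the compact
  form.\<close>

locale ordered_flat = maximal_flat br \<theta> hp for br :: "'a::euclidean_space \<Rightarrow> 'a \<Rightarrow> 'a" and \<theta> hp +
  fixes hk :: "'a set" and P :: "'a cplx set"
  assumes hk: "hk \<subseteq> {X. \<theta> X = X}"
    and cartan_maximal: "maximal_abelian_in br UNIV (sum_subspace hk hp)"
    and P: "vector_ordering (imag_part hp) P"
begin

abbreviation "hs \<equiv> sum_subspace hk hp"
abbreviation "\<Sigma> \<equiv> restricted_roots br \<theta> hk hp"

lemma hs: "abelian_subspace br hs" "subspace hs"
  using cartan_maximal by (simp_all add: maximal_abelian_in_def abelian_subspace_def)

lemma ppt_hs: "a \<in> hs \<Longrightarrow> ppt a \<in> hp"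
proof -
  assume "a \<in> hs"
  then obtain x y where xy: "x \<in> hk" "y \<in> hp" "a = x + y" by (auto simp: sum_subspace_def)
  have "\<theta> x = x" "\<theta> y = - y" using xy(1,2) hk hp(3) by auto
  then have "ppt a = (1/2) *\<^sub>R y + (1/2) *\<^sub>R y" by (simp add: ppt_def xy(3) linear_add[OF th_lin] algebra_simps)
  then show ?thesis using xy(2) by (simp flip: scaleR_left_distrib)
qed

lemma imag_part_iff: "E \<in> imag_part S \<longleftrightarrow> (\<exists>x\<in>S. E = (0, x))"
  by (auto simp: imag_part_def cscale_def cembed_def)

lemma cartan_real_iff: "E \<in> cartan_real hk hp \<longleftrightarrow> (\<exists>x\<in>hs. E = (0, x))"
by (auto simp: cartan_real_def sum_subspace_def imag_part_iff)

lemma cartan_subalgebra_iff: "H \<in> cartan_subalgebra hk hp \<longleftrightarrow> fst H \<in> hs \<and> snd H \<in> hs"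
proof
  assume "H \<in> cartan_subalgebra hk hp"
  then have "H \<in> span (cembed ` hs \<union> cscale \<i> ` cembed ` hs)" by (simp add: cartan_subalgebra_def complex_span_def)
  then show "fst H \<in> hs \<and> snd H \<in> hs"
  proof (rule span_induct)
    show "subspace {H. fst H \<in> hs \<and> snd H \<in> hs}"
      using hs(2) by (auto simp: subspace_def)
    fix x assume "x \<in> cembed ` hs \<union> cscale \<i> ` cembed ` hs"
    then show "fst x \<in> hs \<and> snd x \<in> hs" using subspace_0[OF hs(2)] by (auto simp: cembed_def cscale_def)
  qed
next
  assume h: "fst H \<in> hs \<and> snd H \<in> hs"
  have "cembed (fst H) \<in> span (cembed ` hs \<union> cscale \<i> ` cembed ` hs)"
    "cscale \<i> (cembed (snd H)) \<in> span (cembed ` hs \<union> cscale \<i> ` cembed ` hs)"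
    using h by (auto intro!: span_base)
  then have "cembed (fst H) + cscale \<i> (cembed (snd H)) \<in> cartan_subalgebra hk hp"
    unfolding cartan_subalgebra_def complex_span_def by (rule span_add)
  moreover have "cembed (fst H) + cscale \<i> (cembed (snd H)) = H"
    by (simp add: cembed_def cscale_def prod_eq_iff)
  ultimately show "H \<in> cartan_subalgebra hk hp" by simp
qed

lemma ckilling_imag: "ckilling_form br (p, q) (0, a) = Complex (ip q a) (- ip p a)"
by (auto simp: linear_trace_def complex_eq_iff cbr_Pair Re_sum br_simps ip_def sum_negf killing_form_def ctrace_def Im_sum cembed_def ckilling_form_def)

text \<open>By complex linearity the condition on all p + i q reduces to the elements i q with
  \<open>q\<close> in \<open>hs\<close>; the part \<open>p\<close> contributes - i times
  \<open>ip p a\<close>, the imaginary part in \<open>ckilling_imag\<close>.\<close>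

lemma root_condition:
  "(\<forall>H\<in>cartan_subalgebra hk hp. cbr H E = cscale (ckilling_form br H (0, a)) E) \<longleftrightarrow> weight_vector hs a E"
proof
  assume h: "\<forall>H\<in>cartan_subalgebra hk hp. cbr H E = cscale (ckilling_form br H (0, a)) E"
  show "weight_vector hs a E" unfolding weight_vector_def
  proof
    fix q assume q: "q \<in> hs"
    then have "(0, q) \<in> cartan_subalgebra hk hp" using subspace_0[OF hs(2)] by (simp add: cartan_subalgebra_iff)
    then have "cbr (0, q) E = cscale (Complex (ip q a) (- ip 0 a)) E" using h by (simp add: ckilling_imag)
    then show "cbr (0, q) E = ip q a *\<^sub>R E" by (cases E) (simp add: cscale_def Q_simps)
  qed
next
  assume w: "weight_vector hs a E"
  obtain X Y where E: "E = (X, Y)" by (cases E)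
  have w': "br h X = ip h a *\<^sub>R Y" "br h Y = - (ip h a *\<^sub>R X)" if "h \<in> hs" for h
    using w that unfolding E by (simp_all add: weight_vector_pair)
  show "\<forall>H\<in>cartan_subalgebra hk hp. cbr H E = cscale (ckilling_form br H (0, a)) E"
  by (fastforce simp: w' E cbr_Pair ckilling_imag cscale_def cartan_subalgebra_iff)
qed

lemma roots_iff: "\<alpha> \<in> roots br hk hp \<longleftrightarrow> (\<exists>a\<in>hs. a \<noteq> 0 \<and> \<alpha> = (0, a) \<and> (\<exists>E. E \<noteq> 0 \<and> weight_vector hs a E))"
by (fastforce simp: cartan_real_iff roots_def root_condition zero_prod_def)

lemma restrict_root_imag: "restrict_root \<theta> (0, a) = (0, ppt a)"
  by (simp add: restrict_root_def cextend_def ppt_def linear_0[OF th_lin])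

lemma ip_ppt:
  assumes "h \<in> hp"
  shows "ip h (ppt a) = ip h a"
proof -
  have "ip (kpt a) h = 0" by (rule ip_kk_pp[OF kpt_ppt(1)]) (use assms hp(3) in auto)
  then have "ip h (kpt a + ppt a) = ip h (ppt a)" using Q_sym[of "kpt a" h] by (simp add: linear_add[OF Q_linear(1)])
  then show ?thesis by (simp add: kpt_ppt(3))
qed

lemma hp_hs: "hp \<subseteq> hs"
proof
  fix h assume "h \<in> hp"
  \<comment> \<open>Read off from a decomposition of 0 in \<open>hs\<close>: in x + y = 0 the vector
    x = - y lies in both eigenspaces of \<theta>, so it is 0.\<close>
  moreover have "0 \<in> hk"
  proof -
    have "0 \<in> hs" by (rule subspace_0[OF hs(2)])
    then obtain x y where xy: "x \<in> hk" "y \<in> hp" "x + y = 0" by (auto simp: sum_subspace_def)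
    then have "x = - y" by (simp add: add_eq_0_iff2)
    then have "x \<in> pp" using xy(2) subspace_neg[OF hp(2)] hp(3) by blast
    then have "x = 0" using kk_pp_zero xy(1) hk by blast
    then show ?thesis using xy(1) by simp
  qed
  ultimately have "0 + h \<in> hs" unfolding sum_subspace_def by blast
  then show "h \<in> hs" by simp
qed

text \<open>A weight vector for \<open>hs\<close> is one for \<open>hp\<close>, with the projected
  weight. Conversely the weight space of \<open>a\<close> for \<open>hp\<close> is invariant under
  the abelian \<open>hs\<close>, so it contains a weight vector for \<open>hs\<close>; its weight
  \<open>b\<close> agrees with \<open>a\<close> on \<open>hp\<close> and hence projects to
  \<open>a\<close>.\<close>

lemma restricted_roots_eq: "\<Sigma> = Pair (0::'a) ` rroots"
proof (intro equalityI subsetI)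
  fix x assume "x \<in> \<Sigma>"
  then obtain a E where a: "a \<in> hs" "x = (0, ppt a)" "ppt a \<noteq> 0" and E: "E \<noteq> 0" "weight_vector hs a E"
    unfolding restricted_roots_def roots_iff by (auto simp: restrict_root_imag zero_prod_def)
  have "weight_vector hp (ppt a) E"
    using E(2) hp_hs unfolding weight_vector_def by (auto simp: ip_ppt)
  then have "ppt a \<in> rroots" by (rule rrootI[OF ppt_hs[OF a(1)] a(3) E(1)])
  then show "x \<in> Pair (0::'a) ` rroots" using a(2) by simp
next
  fix x assume "x \<in> Pair (0::'a) ` rroots"
  then obtain a where a: "a \<in> rroots" "x = (0, a)" by blast
  let ?W = "{E. weight_vector hp a E}"
  have W: "subspace ?W"
    by (auto simp: subspace_def weight_vector_def linear_0[OF cbr_linear(1)] linear_add[OF cbr_linear(1)] linear_scale[OF cbr_linear(1)] scaleR_add_right)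
  have ne: "?W \<noteq> {0}" using a(1) by (auto simp: rroots_def)
  have hps: "h \<in> hs" if "h \<in> hp" for h using that hp_hs by auto
  have inv: "cbr (0, h) E \<in> ?W" if h: "h \<in> hs" and E: "E \<in> ?W" for h E
  proof -
    have "cbr (0, k) (cbr (0, h) E) = ip k a *\<^sub>R cbr (0, h) E" if k: "k \<in> hp" for k
    using hs(1) hps k h imag_commute weight_vectorD hp a E cbr_linear(1) by (simp add: linear_scale abelian_subspace_def)
    then show ?thesis by (simp add: weight_vector_def)
  qed
  obtain E b where E: "E \<in> ?W" "E \<noteq> 0" "b \<in> hs" "weight_vector hs b E"
    using weight_exists[OF W ne hs(1) inv] by blast
  have "ip h a = ip h (ppt b)" if h: "h \<in> hp" for h
  proof -
    have "ip h a *\<^sub>R E = ip h b *\<^sub>R E"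
      using weight_vectorD[of hp a E h] weight_vectorD[OF E(4) hps[OF h]] E(1) h by (simp only: mem_Collect_eq)
    then show ?thesis using E(2) by (auto simp: ip_ppt[OF h])
  qed
  moreover have "a - ppt b \<in> hp" by (intro subspace_diff[OF hp(2)] ppt_hs E(3) rrootD(1)[OF a(1)])
  ultimately have "ip (a - ppt b) (a - ppt b) = 0" by (simp add: linear_diff[OF Q_linear(1)])
  then have ab: "ppt b = a" by (simp add: Q_eq_0)
  have "b \<noteq> 0" using ab rrootD(2)[OF a(1)] by (auto simp: ppt_def linear_0[OF th_lin])
  then have "(0, b) \<in> roots br hk hp" unfolding roots_iff using E by (intro bexI[of _ b] conjI exI[of _ E]) simp_all
  moreover have "restrict_root \<theta> (0, b) = x" by (simp add: restrict_root_imag ab a(2))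
  moreover have "x \<noteq> 0" using a(2) rrootD(2)[OF a(1)] by (simp add: zero_prod_def)
  ultimately show "x \<in> \<Sigma>" unfolding restricted_roots_def by blast
qed

lemma imag_restricted_root: "(0, a) \<in> \<Sigma> \<longleftrightarrow> a \<in> rroots"
  by (auto simp: restricted_roots_eq)

lemma ip2_imag: "ip2 (0, x) (0, y) = ip x y"
  by (simp add: ip2_def Q_simps)

sublocale rs: restricted_root_system ip2 "imag_part hp" \<Sigma> P
proof (unfold_locales)
  have "imag_part hp = {0} \<times> hp" by (auto simp: imag_part_iff)
  then show "subspace (imag_part hp)" using subspace_Times[OF subspace_single_0 hp(2)] by simp
  show "finite \<Sigma>" "\<Sigma> \<subseteq> imag_part hp" "0 \<notin> \<Sigma>"
    using finite_rroots rrootD by (auto simp: restricted_roots_eq imag_part_iff zero_prod_def)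
  show "vector_ordering (imag_part hp) P" by (rule P)
  fix a c
  show "- a \<in> \<Sigma>" if "a \<in> \<Sigma>"
    using that rroot_minus by (auto simp: restricted_roots_eq)
  show "a + c \<in> \<Sigma>" if "a \<in> \<Sigma>" "c \<in> \<Sigma>" "ip2 a c < 0" "a + c \<noteq> 0"
    using that rroot_add by (auto simp: restricted_roots_eq ip2_imag zero_prod_def)
  show "a + c \<notin> \<Sigma>" if h: "a \<in> \<Sigma>" "c \<in> \<Sigma>" "ip2 a c = 0" "a - c \<notin> \<Sigma>"
  using h(1,2) h(3,4) rroot_string by (fastforce simp: imag_restricted_root restricted_roots_eq ip2_imag)
qed

lemma ckilling_roots: "x \<in> imag_part hp \<Longrightarrow> y \<in> imag_part hp \<Longrightarrow> ckilling_form br x y = complex_of_real (ip2 x y)"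
  by (auto simp: imag_part_iff ckilling_imag ip2_imag Q_simps complex_eq_iff)

lemma orthogonal_sets_iff:
  assumes "S \<subseteq> \<Sigma>" "T \<subseteq> \<Sigma>"
  shows "orthogonal_sets br S T \<longleftrightarrow> (\<forall>x\<in>S. \<forall>y\<in>T. ip2 x y = 0)"
proof -
  have "ckilling_form br x y = 0 \<longleftrightarrow> ip2 x y = 0" if "x \<in> S" "y \<in> T" for x y
  proof -
    have "x \<in> imag_part hp" "y \<in> imag_part hp" using that assms rs.roots_V by blast+
    then show ?thesis using ckilling_roots[of x y] by simp
  qed
  then show ?thesis unfolding orthogonal_sets_def by simp
qed

lemma irreducible_component_iff: "irreducible_component br \<Sigma> C \<longleftrightarrow> rs.component C"
proof (cases "C \<subseteq> \<Sigma>")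
  case True
  have 1: "orthogonal_sets br C (\<Sigma> - C) \<longleftrightarrow> (\<forall>x\<in>C. \<forall>y\<in>\<Sigma> - C. ip2 x y = 0)"
    by (rule orthogonal_sets_iff) (use True in auto)
  have 2: "D \<subset> C \<and> D \<noteq> {} \<and> orthogonal_sets br D (C - D) \<longleftrightarrow> D \<subset> C \<and> D \<noteq> {} \<and> (\<forall>x\<in>D. \<forall>y\<in>C - D. ip2 x y = 0)" for D
  proof (cases "D \<subset> C")
    case sub: True
    have "orthogonal_sets br D (C - D) \<longleftrightarrow> (\<forall>x\<in>D. \<forall>y\<in>C - D. ip2 x y = 0)"
      by (rule orthogonal_sets_iff) (use True sub in auto)
    then show ?thesis by simp
  qed simp
  show ?thesis unfolding irreducible_component_def rs.component_def 1 2 ..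
next
  case False
  then show ?thesis by (simp add: irreducible_component_def rs.component_def)
qed

lemma maximal_roots_iff: "\<beta> \<in> maximal_roots br \<Sigma> P \<longleftrightarrow> (\<exists>C. rs.component C \<and> highest_root (simple_roots \<Sigma> P) C \<beta>)"
  by (simp add: maximal_roots_def irreducible_component_iff)

lemma maximal_root_rroot:
  assumes "\<beta> \<in> maximal_roots br \<Sigma> P"
  shows "\<exists>b\<in>rroots. \<beta> = (0, b)"
proof -
  have "\<beta> \<in> \<Sigma>" using assms by (auto simp: maximal_roots_iff highest_root_def rs.component_def)
  then show ?thesis by (auto simp: restricted_roots_eq)
qed

lemma face_iff:
  "E \<in> cartan_polyhedron_face br \<theta> hk hp P \<longleftrightarrow> (\<exists>x\<in>hp. E = (0, x) \<and>
     (\<forall>\<gamma>\<in>simple_roots \<Sigma> P. ip2 (0, x) \<gamma> \<ge> 0) \<and> (\<forall>\<beta>\<in>maximal_roots br \<Sigma> P. ip2 (0, x) \<beta> \<le> 1) \<and>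
     (\<exists>\<beta>\<in>maximal_roots br \<Sigma> P. ip2 (0, x) \<beta> = 1))"
proof -
  have k: "Re (ckilling_form br (0, x) \<gamma>) = ip2 (0, x) \<gamma>" if "x \<in> hp" "\<gamma> \<in> \<Sigma>" for x \<gamma>
    using ckilling_roots[of "(0, x)" \<gamma>] that rs.roots_V by (auto simp: imag_part_iff)
  have s: "\<gamma> \<in> \<Sigma>" if "\<gamma> \<in> simple_roots \<Sigma> P" for \<gamma> using that by (simp add: simple_roots_def)
  have m: "\<beta> \<in> \<Sigma>" if "\<beta> \<in> maximal_roots br \<Sigma> P" for \<beta>
    using maximal_root_rroot[OF that] by (auto simp: restricted_roots_eq)
  show ?thesis
    unfolding cartan_polyhedron_face_def cartan_polyhedron_def Let_def mem_Collect_eq imag_part_iff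
    by (intro iffI; elim conjE bexE; hypsubst?; (intro bexI conjI ballI)?) (auto simp: k s m)
qed

text \<open>\<open>x\<close> is nonnegative on the simple roots, and the highest root of the
  component of \<open>a\<close> exceeds \<open>a\<close> by a natural combination of simple
  roots.\<close>

lemma root_le_maximal:
  assumes dom: "\<forall>\<gamma>\<in>simple_roots \<Sigma> P. ip2 (0, x) \<gamma> \<ge> 0" and a: "a \<in> rroots"
  shows "\<exists>\<beta>\<in>maximal_roots br \<Sigma> P. ip x a \<le> ip2 (0, x) \<beta>"
proof -
  have "(0, a) \<in> \<Sigma>" using a by (simp add: restricted_roots_eq)
  from rs.component_exists[OF this] obtain C where C: "rs.component C" "(0, a) \<in> C" by blast
  obtain \<beta> where b: "highest_root (simple_roots \<Sigma> P) C \<beta>" using rs.highest_root_exists[OF C(1)] by blast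
  then obtain n :: "'a cplx \<Rightarrow> nat" where n: "\<beta> - (0, a) = (\<Sum>\<delta>\<in>simple_roots \<Sigma> P. real (n \<delta>) *\<^sub>R \<delta>)"
    using C(2) unfolding highest_root_def by blast
  have "ip2 (0, x) (\<beta> - (0, a)) = (\<Sum>\<delta>\<in>simple_roots \<Sigma> P. real (n \<delta>) * ip2 (0, x) \<delta>)"
    unfolding n by (rule two.Q_sum_right)
  also have "\<dots> \<ge> 0" using dom by (intro sum_nonneg mult_nonneg_nonneg) simp_all
  finally have "ip x a \<le> ip2 (0, x) \<beta>" by (simp only: linear_diff[OF two.Q_linear(1)] ip2_imag)
  moreover have "\<beta> \<in> maximal_roots br \<Sigma> P" unfolding maximal_roots_iff using C(1) b by (intro exI conjI)
  ultimately show ?thesis by (rule bexI)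
qed

lemma face_bound:
  assumes "(0, x) \<in> cartan_polyhedron_face br \<theta> hk hp P"
  shows "x \<in> hp" "\<forall>a\<in>rroots. \<bar>ip x a\<bar> \<le> 1" "\<exists>a\<in>rroots. \<bar>ip x a\<bar> = 1"
proof -
  have x: "x \<in> hp" "\<forall>\<gamma>\<in>simple_roots \<Sigma> P. ip2 (0, x) \<gamma> \<ge> 0" "\<forall>\<beta>\<in>maximal_roots br \<Sigma> P. ip2 (0, x) \<beta> \<le> 1"
    "\<exists>\<beta>\<in>maximal_roots br \<Sigma> P. ip2 (0, x) \<beta> = 1"
    using assms unfolding face_iff by auto
  show "x \<in> hp" by (rule x(1))
  have le: "ip x a \<le> 1" if "a \<in> rroots" for a
    using root_le_maximal[OF x(2) that] x(3) by force
  show "\<forall>a\<in>rroots. \<bar>ip x a\<bar> \<le> 1"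
  proof
    fix a assume "a \<in> rroots"
    then show "\<bar>ip x a\<bar> \<le> 1" using le[of a] le[OF rroot_minus[of a]] by (simp add: Q_simps)
  qed
  obtain \<beta> where "\<beta> \<in> maximal_roots br \<Sigma> P" "ip2 (0, x) \<beta> = 1" using x(4) by blast
  moreover from maximal_root_rroot[OF this(1)] obtain b where "b \<in> rroots" "\<beta> = (0, b)" by blast
  ultimately show "\<exists>a\<in>rroots. \<bar>ip x a\<bar> = 1" by (intro bexI[of _ b]) (simp_all add: ip2_imag)
qed

text \<open>A root of value -1 at \<open>x\<close> is replaced by its negative. The maximal root
  above a root of value 1 has value at least 1, and also at most 1 because it is itself a restricted
  root.\<close>

lemma faceI:
  assumes x: "x \<in> hp" and dom: "\<And>a. a \<in> rroots \<Longrightarrow> (0, a) \<in> P \<Longrightarrow> ip x a \<ge> 0"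
    and le: "\<forall>a\<in>rroots. \<bar>ip x a\<bar> \<le> 1" and eq: "\<exists>a\<in>rroots. \<bar>ip x a\<bar> = 1"
  shows "(0, x) \<in> cartan_polyhedron_face br \<theta> hk hp P"
proof -
  have d: "\<forall>\<gamma>\<in>simple_roots \<Sigma> P. ip2 (0, x) \<gamma> \<ge> 0"
    using dom by (auto simp: simple_roots_def restricted_roots_eq ip2_imag)
  have m: "\<forall>\<beta>\<in>maximal_roots br \<Sigma> P. ip2 (0, x) \<beta> \<le> 1"
  proof
    fix \<beta> assume "\<beta> \<in> maximal_roots br \<Sigma> P"
    then obtain b where b: "b \<in> rroots" "\<beta> = (0, b)" using maximal_root_rroot by blast
    then show "ip2 (0, x) \<beta> \<le> 1" using le[rule_format, OF b(1)] by (simp add: ip2_imag)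
  qed
  obtain a where a: "a \<in> rroots" "\<bar>ip x a\<bar> = 1" using eq by blast
  have "\<exists>a\<in>rroots. ip x a = 1"
  proof (cases "ip x a \<ge> 0")
    case True then show ?thesis using a by (intro bexI[of _ a]) simp_all
  next
    case False then show ?thesis using a(2) rroot_minus[OF a(1)] by (intro bexI[of _ "- a"]) (simp_all add: Q_simps)
  qed
  then obtain a' where a': "a' \<in> rroots" "ip x a' = 1" by blast
  from root_le_maximal[OF d a'(1)] obtain \<beta> where \<beta>: "\<beta> \<in> maximal_roots br \<Sigma> P" "1 \<le> ip2 (0, x) \<beta>"
    unfolding a'(2) by blast
  then have "ip2 (0, x) \<beta> = 1" using m by force
  then show ?thesis using x d m \<beta>(1) by (auto simp: face_iff)
qed

lemma regular_vector: "\<exists>H\<in>hp. \<forall>a\<in>rroots. if (0, a) \<in> P then ip a H > 0 else ip a H < 0"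
proof -
  obtain H where H: "H \<in> hp" "rs.chamber_vector = (0, H)" using rs.chamber_vector(1) by (auto simp: imag_part_iff)
  have pos: "ip a H > 0" if "a \<in> rroots" "(0, a) \<in> P" for a
    using rs.chamber_vector(2)[of "(0, a)"] that unfolding H(2) by (simp add: ip2_imag imag_restricted_root)
  have neg: "ip a H < 0" if a: "a \<in> rroots" "(0, a) \<notin> P" for a
  using rs.positive_or_minus a pos rroot_minus a(1) by (force simp: Q_simps imag_restricted_root)
  show ?thesis using H(1) pos neg by (intro bexI[of _ H]) auto
qed

end

subsection \<open>Negativity of the Killing form\<close>

lemma nonpos_of_le_divide:
  fixes a E :: real
  assumes "\<And>T. T > 0 \<Longrightarrow> a \<le> E / T"
  shows "a \<le> 0"
proof (rule ccontr)
  assume "\<not> a \<le> 0"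
  then have a: "a > 0" by simp
  \<comment> \<open>Chosen so that a T = |E| + 1, which exceeds \<open>E\<close>.\<close>
  define T where "T = (\<bar>E\<bar> + 1) / a"
  have "T > 0" using a by (simp add: T_def)
  then have "a * T \<le> E" using assms[of T] by (simp add: pos_le_divide_eq)
  moreover have "a * T = \<bar>E\<bar> + 1" using a by (simp add: T_def)
  ultimately show False by linarith
qed

text \<open>A generator \<open>L\<close> of a bounded one-parameter group \<open>\<Phi>\<close> is skew up to \<open>O(1/T)\<close> for the average
  of the inner products \<open>\<Phi> t v \<bullet> \<Phi> t w\<close> over \<open>{0..T}\<close>; this replaces an invariant inner product.\<close>

locale bounded_flow =
  fixes \<Phi> :: "real \<Rightarrow> 'a::euclidean_space \<Rightarrow> 'a" and L :: "'a \<Rightarrow> 'a" and C :: real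
  assumes flow_linear: "linear (\<Phi> t)" and generator_linear: "linear L"
    and flow_derivative: "((\<lambda>t. \<Phi> t v) has_vector_derivative \<Phi> t (L v)) (at t)"
    and C: "C > 0" and flow_le: "norm (\<Phi> t v) \<le> C * norm v" and flow_ge: "norm v \<le> C * norm (\<Phi> t v)"
begin

definition avg :: "real \<Rightarrow> 'a \<Rightarrow> 'a \<Rightarrow> real" where
  "avg T v w = integral {0..T} (\<lambda>t. \<Phi> t v \<bullet> \<Phi> t w) / T"

lemma flow_inner_derivative:
  "((\<lambda>t. \<Phi> t v \<bullet> \<Phi> t w) has_vector_derivative (\<Phi> t (L v) \<bullet> \<Phi> t w + \<Phi> t v \<bullet> \<Phi> t (L w))) (at t within S)"
proof -
  have "((\<lambda>t. \<Phi> t v \<bullet> \<Phi> t w) has_vector_derivative (\<Phi> t v \<bullet> \<Phi> t (L w) + \<Phi> t (L v) \<bullet> \<Phi> t w)) (at t)"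
    by (rule bounded_bilinear.has_vector_derivative[OF bounded_bilinear_inner flow_derivative flow_derivative])
  then show ?thesis by (simp add: add.commute has_vector_derivative_at_within)
qed

lemma flow_integrable: "(\<lambda>t. \<Phi> t v \<bullet> \<Phi> t w) integrable_on {0..T}"
  by (rule integrable_continuous_real, rule continuous_on_vector_derivative) (rule flow_inner_derivative)

lemma avg_add: "avg T (v + v') w = avg T v w + avg T v' w"
  using integral_add[OF flow_integrable flow_integrable, of T v w v' w]
  by (simp add: avg_def linear_add[OF flow_linear] inner_add_left add_divide_distrib)

lemma avg_scale: "avg T (c *\<^sub>R v) w = c * avg T v w"
  by (simp add: avg_def linear_scale[OF flow_linear])

lemma avg_sym: "avg T v w = avg T w v"
  by (simp add: avg_def inner_commute)

text \<open>The bounds are uniform in \<open>T\<close>, which is what leaves all error terms of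
  order 1/T.\<close>

lemma avg_bounds:
  assumes "T > 0"
  shows "(norm v)\<^sup>2 / C\<^sup>2 \<le> avg T v v" "avg T v v \<le> C\<^sup>2 * (norm v)\<^sup>2"
proof -
  have sq: "\<Phi> t v \<bullet> \<Phi> t v = (norm (\<Phi> t v))\<^sup>2" for t by (simp add: power2_norm_eq_inner)
  have lo: "(norm v)\<^sup>2 / C\<^sup>2 \<le> \<Phi> t v \<bullet> \<Phi> t v" for t
    unfolding sq using power_mono[OF flow_ge[of v t] norm_ge_zero, of 2] C
    by (simp add: pos_divide_le_eq power_mult_distrib mult.commute)
  have hi: "\<Phi> t v \<bullet> \<Phi> t v \<le> C\<^sup>2 * (norm v)\<^sup>2" for t
    unfolding sq using power_mono[OF flow_le[of t v] norm_ge_zero, of 2] by (simp add: power_mult_distrib)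
  have "integral {0..T} (\<lambda>t. (norm v)\<^sup>2 / C\<^sup>2) \<le> integral {0..T} (\<lambda>t. \<Phi> t v \<bullet> \<Phi> t v)"
    by (rule integral_le[OF integrable_const_ivl flow_integrable]) (rule lo)
  then have "T * ((norm v)\<^sup>2 / C\<^sup>2) \<le> integral {0..T} (\<lambda>t. \<Phi> t v \<bullet> \<Phi> t v)" using assms by simp
  then show "(norm v)\<^sup>2 / C\<^sup>2 \<le> avg T v v" unfolding avg_def pos_le_divide_eq[OF assms] by (simp add: mult.commute)
  have "integral {0..T} (\<lambda>t. \<Phi> t v \<bullet> \<Phi> t v) \<le> integral {0..T} (\<lambda>t. C\<^sup>2 * (norm v)\<^sup>2)"
    by (rule integral_le[OF flow_integrable integrable_const_ivl]) (rule hi)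
  then have "integral {0..T} (\<lambda>t. \<Phi> t v \<bullet> \<Phi> t v) \<le> T * (C\<^sup>2 * (norm v)\<^sup>2)" using assms by (simp add: mult_ac)
  then show "avg T v v \<le> C\<^sup>2 * (norm v)\<^sup>2" unfolding avg_def pos_divide_le_eq[OF assms] by (simp add: mult.commute)
qed

lemma avg_inner_form:
  assumes "T > 0"
  shows "inner_form (avg T)"
proof
  have lin: "linear (\<lambda>v. avg T v w)" for w
    by (rule linearI) (simp_all add: avg_add avg_scale)
  have "linear (\<lambda>v. avg T w v)" for w
    unfolding avg_sym[of T w] by (rule lin)
  then show "bilinear (avg T)" unfolding bilinear_def using lin by simp
  show "avg T x y = avg T y x" for x y by (rule avg_sym)
  fix x :: 'a assume "x \<noteq> 0"
  then have "(norm x)\<^sup>2 / C\<^sup>2 > 0" using C by simp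
  then show "avg T x x > 0" using avg_bounds(1)[OF assms, of x] by linarith
qed

text \<open>The left side averages the derivative of the inner product of \<open>\<Phi> t v\<close>
  and \<open>\<Phi> t w\<close>, so only the two boundary values remain, each bounded by C^2 |v|
  |w|.\<close>

lemma avg_almost_skew:
  assumes "T > 0"
  shows "\<bar>avg T (L v) w + avg T v (L w)\<bar> \<le> (2 * C\<^sup>2 / T) * (norm v * norm w)"
proof -
  have "((\<lambda>t. \<Phi> t (L v) \<bullet> \<Phi> t w + \<Phi> t v \<bullet> \<Phi> t (L w)) has_integral (\<Phi> T v \<bullet> \<Phi> T w - \<Phi> 0 v \<bullet> \<Phi> 0 w)) {0..T}"
    by (rule fundamental_theorem_of_calculus) (use assms flow_inner_derivative in auto)
  then have 1: "avg T (L v) w + avg T v (L w) = (\<Phi> T v \<bullet> \<Phi> T w - \<Phi> 0 v \<bullet> \<Phi> 0 w) / T"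
    unfolding avg_def using integral_add[OF flow_integrable flow_integrable, of T "L v" w v "L w"]
    by (simp add: integral_unique flip: add_divide_distrib)
  have b: "\<bar>\<Phi> t v \<bullet> \<Phi> t w\<bar> \<le> C\<^sup>2 * (norm v * norm w)" for t
  proof -
    have "\<bar>\<Phi> t v \<bullet> \<Phi> t w\<bar> \<le> norm (\<Phi> t v) * norm (\<Phi> t w)" by (rule Cauchy_Schwarz_ineq2)
    also have "\<dots> \<le> (C * norm v) * (C * norm w)" using C by (intro mult_mono flow_le) auto
    finally show ?thesis by (simp add: power2_eq_square mult_ac)
  qed
  have "\<bar>\<Phi> T v \<bullet> \<Phi> T w - \<Phi> 0 v \<bullet> \<Phi> 0 w\<bar> \<le> 2 * C\<^sup>2 * (norm v * norm w)" using b[of T] b[of 0] by linarith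
  then show ?thesis unfolding 1 using assms by (simp add: abs_divide divide_right_mono)
qed

text \<open>In a basis orthonormal for the averaged form, the trace of L^2 is at most minus the sum
  of the squared lengths of the \<open>L b\<close>, plus the skewness error. If the trace is 0, the
  same inequality bounds those squared lengths by D / T, and expanding \<open>x\<close> in the basis
  bounds \<open>L x\<close>.\<close>

lemma generator_trace_estimate:
  "\<exists>D. \<forall>T>0. linear_trace (\<lambda>v. L (L v)) \<le> D / T \<and>
     (linear_trace (\<lambda>v. L (L v)) = 0 \<longrightarrow> (\<forall>x. (norm (L x))\<^sup>2 \<le> (real DIM('a))\<^sup>2 * (C\<^sup>2 * (norm x)\<^sup>2 * C\<^sup>2 * D) / T))"
proof -
  obtain K where K: "K > 0" "\<And>v. norm (L v) \<le> K * norm v"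
    using linear_bounded_pos[OF generator_linear] by blast
  \<comment> \<open>At most DIM many basis vectors, each with error (2 C^2 / T) |L b| |b|, where |L
    b| is at most K |b| and |b|^2 is at most C^2.\<close>
  define D where "D = real DIM('a) * (2 * C\<^sup>2 * K * C\<^sup>2)"
  have LL: "linear (\<lambda>v. L (L v))" using linear_compose[OF generator_linear generator_linear] by (simp add: comp_def)
  show ?thesis
  proof (intro exI allI impI)
    fix T :: real assume T: "T > 0"
    interpret inner_form "avg T" by (rule avg_inner_form[OF T])
    obtain B where B: "orthonormal B" "\<And>x. x \<in> UNIV \<Longrightarrow> x = (\<Sum>b\<in>B. avg T x b *\<^sub>R b)"
      by (rule orthonormal_basis[OF subspace_UNIV]) (rule that; assumption)
    have fin: "finite B" and unit: "\<And>b. b \<in> B \<Longrightarrow> avg T b b = 1" using B(1) by (simp_all add: orthonormal_def)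
    have card: "card B \<le> DIM('a)"
    proof (rule orthogonal_card_le[OF fin])
      show "b \<noteq> 0" if "b \<in> B" for b using unit[OF that] by (auto simp: Q_simps)
      show "avg T b c = 0" if "b \<in> B" "c \<in> B" "b \<noteq> c" for b c using B(1) that by (simp add: orthonormal_def)
    qed
    have bn: "(norm b)\<^sup>2 \<le> C\<^sup>2" if "b \<in> B" for b
      using avg_bounds(1)[OF T, of b] unit[OF that] C by (simp add: pos_divide_le_eq)
    have skew: "avg T (L (L b)) b \<le> - avg T (L b) (L b) + 2 * C\<^sup>2 * K * C\<^sup>2 / T" if b: "b \<in> B" for b
    proof -
      have "avg T (L (L b)) b + avg T (L b) (L b) \<le> (2 * C\<^sup>2 / T) * (norm (L b) * norm b)"
        using avg_almost_skew[OF T, of "L b" b] by linarith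
      also have "\<dots> \<le> (2 * C\<^sup>2 / T) * ((K * norm b) * norm b)"
        using T by (intro mult_left_mono mult_right_mono K(2)) auto
      also have "\<dots> = (2 * C\<^sup>2 / T * K) * (norm b)\<^sup>2" by (simp add: power2_eq_square)
      also have "\<dots> \<le> (2 * C\<^sup>2 / T * K) * C\<^sup>2" using T K(1) by (intro mult_left_mono bn b) auto
      finally show ?thesis by (simp add: mult_ac)
    qed
    have "linear_trace (\<lambda>v. L (L v)) = (\<Sum>b\<in>B. avg T (L (L b)) b)"
      by (rule trace_orthonormal[OF B(1) B(2)[OF UNIV_I] LL])
    also have "\<dots> \<le> (\<Sum>b\<in>B. - avg T (L b) (L b) + 2 * C\<^sup>2 * K * C\<^sup>2 / T)" by (rule sum_mono[OF skew])
    also have "\<dots> = real (card B) * (2 * C\<^sup>2 * K * C\<^sup>2 / T) - (\<Sum>b\<in>B. avg T (L b) (L b))"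
      by (simp add: sum.distrib sum_negf sum_subtractf)
    also have "\<dots> \<le> D / T - (\<Sum>b\<in>B. avg T (L b) (L b))"
    proof -
      have "real (card B) * (2 * C\<^sup>2 * K * C\<^sup>2 / T) \<le> real DIM('a) * (2 * C\<^sup>2 * K * C\<^sup>2 / T)"
        using card T K(1) by (intro mult_right_mono) auto
      then show ?thesis by (simp add: D_def)
    qed
    finally have tr: "linear_trace (\<lambda>v. L (L v)) + (\<Sum>b\<in>B. avg T (L b) (L b)) \<le> D / T" by simp
    have "0 \<le> (\<Sum>b\<in>B. avg T (L b) (L b))" by (rule sum_nonneg) (rule Q_nonneg)
    then have 1: "linear_trace (\<lambda>v. L (L v)) \<le> D / T" using tr by linarith
    have 2: "(norm (L x))\<^sup>2 \<le> (real DIM('a))\<^sup>2 * (C\<^sup>2 * (norm x)\<^sup>2 * C\<^sup>2 * D) / T"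
      if z: "linear_trace (\<lambda>v. L (L v)) = 0" for x
    proof -
      \<comment> \<open>Bound for one summand: the coefficient of \<open>x\<close> has square at
        most C^2 |x|^2, and \<open>L b\<close> has squared norm at most C^2 D / T.\<close>
      define R where "R = sqrt ((C\<^sup>2 * (norm x)\<^sup>2) * (C\<^sup>2 * (D / T)))"
      have summand: "norm (avg T x b *\<^sub>R L b) \<le> R" if b: "b \<in> B" for b
      proof -
        have "avg T (L b) (L b) \<le> (\<Sum>b\<in>B. avg T (L b) (L b))" by (rule member_le_sum[OF b Q_nonneg fin])
        then have "avg T (L b) (L b) \<le> D / T" using tr z by linarith
        then have "(norm (L b))\<^sup>2 / C\<^sup>2 \<le> D / T" using avg_bounds(1)[OF T, of "L b"] by linarith
        then have l: "(norm (L b))\<^sup>2 \<le> C\<^sup>2 * (D / T)" using C by (simp add: pos_divide_le_eq mult.commute)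
        have "avg T x x = avg T x (\<Sum>b\<in>B. avg T x b *\<^sub>R b)" by (rule arg_cong[OF B(2)[OF UNIV_I]])
        then have e: "avg T x x = (\<Sum>b\<in>B. avg T x b * avg T x b)" unfolding Q_sum_right .
        have "avg T x b * avg T x b \<le> (\<Sum>b\<in>B. avg T x b * avg T x b)" by (rule member_le_sum[OF b _ fin]) simp
        then have q: "(avg T x b)\<^sup>2 \<le> C\<^sup>2 * (norm x)\<^sup>2" using avg_bounds(2)[OF T, of x] e by (simp add: power2_eq_square)
        have "(norm (avg T x b *\<^sub>R L b))\<^sup>2 = (avg T x b)\<^sup>2 * (norm (L b))\<^sup>2" by (simp add: power_mult_distrib)
        also have "\<dots> \<le> (C\<^sup>2 * (norm x)\<^sup>2) * (C\<^sup>2 * (D / T))" by (rule mult_mono[OF q l]) auto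
        finally show ?thesis unfolding R_def by (rule real_le_rsqrt)
      qed
      have "L x = L (\<Sum>b\<in>B. avg T x b *\<^sub>R b)" by (rule arg_cong[OF B(2)[OF UNIV_I]])
      also have "\<dots> = (\<Sum>b\<in>B. avg T x b *\<^sub>R L b)"
        by (simp add: linear_sum[OF generator_linear] linear_scale[OF generator_linear])
      finally have "norm (L x) = norm (\<Sum>b\<in>B. avg T x b *\<^sub>R L b)" by (rule arg_cong)
      also have "\<dots> \<le> (\<Sum>b\<in>B. R)" by (rule order_trans[OF norm_sum sum_mono]) (rule summand)
      also have "\<dots> \<le> real DIM('a) * R"
      using K(1) T card by (fastforce simp: D_def mult_right_mono R_def)
      finally have "(norm (L x))\<^sup>2 \<le> (real DIM('a) * R)\<^sup>2" by (rule power_mono) simp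
      also have "\<dots> = (real DIM('a))\<^sup>2 * R\<^sup>2" by (simp add: power_mult_distrib)
      also have "R\<^sup>2 = (C\<^sup>2 * (norm x)\<^sup>2) * (C\<^sup>2 * (D / T))"
      using K(1) T real_sqrt_pow2 by (simp add: D_def R_def)
      finally show ?thesis by (simp add: mult_ac)
    qed
    show "linear_trace (\<lambda>v. L (L v)) \<le> D / T \<and>
     (linear_trace (\<lambda>v. L (L v)) = 0 \<longrightarrow> (\<forall>x. (norm (L x))\<^sup>2 \<le> (real DIM('a))\<^sup>2 * (C\<^sup>2 * (norm x)\<^sup>2 * C\<^sup>2 * D) / T))"
      using 1 2 by (intro conjI impI allI)
  qed
qed

text \<open>Both claims let \<open>T\<close> tend to infinity in the estimate, whose constant
  \<open>D\<close> does not depend on \<open>T\<close>.\<close>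

lemma generator_trace: "linear_trace (\<lambda>v. L (L v)) \<le> 0" "linear_trace (\<lambda>v. L (L v)) = 0 \<Longrightarrow> L x = 0"
proof -
  obtain D where D: "\<forall>T>0. linear_trace (\<lambda>v. L (L v)) \<le> D / T \<and>
     (linear_trace (\<lambda>v. L (L v)) = 0 \<longrightarrow> (\<forall>x. (norm (L x))\<^sup>2 \<le> (real DIM('a))\<^sup>2 * (C\<^sup>2 * (norm x)\<^sup>2 * C\<^sup>2 * D) / T))"
    using generator_trace_estimate by (elim exE)
  show "linear_trace (\<lambda>v. L (L v)) \<le> 0"
    by (rule nonpos_of_le_divide[of _ D]) (use D in simp)
  assume z: "linear_trace (\<lambda>v. L (L v)) = 0"
  have "(norm (L x))\<^sup>2 \<le> 0"
    by (rule nonpos_of_le_divide[of _ "(real DIM('a))\<^sup>2 * (C\<^sup>2 * (norm x)\<^sup>2 * C\<^sup>2 * D)"]) (use D z in simp)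
  then show "L x = 0" by simp
qed

end

subsection \<open>Conjugate points and the Jacobi operator\<close>

text \<open>\<open>A\<close> and \<open>B\<close> arise from w' and l w by a rotation through the
  angle l t, so they are constant, with values 0 and \<open>w1 0\<close>. Rotating back recovers l
  w; keeping the factor \<open>l\<close> makes the formula valid for l = 0 too.\<close>

lemma harmonic_solution:
  fixes w w1 :: "real \<Rightarrow> real" and l :: real
  assumes w: "\<And>t. (w has_real_derivative w1 t) (at t)" and w1: "\<And>t. (w1 has_real_derivative - (l\<^sup>2 * w t)) (at t)" and w0: "w 0 = 0"
  shows "l * w t = w1 0 * sin (l * t)"
proof -
  define A where "A t = w1 t * sin (l * t) - l * (w t * cos (l * t))" for t
  define B where "B t = w1 t * cos (l * t) + l * (w t * sin (l * t))" for t
  have "(A has_real_derivative 0) (at t)" for t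
    unfolding A_def by (rule w w1 derivative_eq_intros refl)+ (simp add: algebra_simps power2_eq_square)
  then have A: "A t = A 0" by (intro DERIV_isconst_all) simp
  have "(B has_real_derivative 0) (at t)" for t
    unfolding B_def by (rule w w1 derivative_eq_intros refl)+ (simp add: algebra_simps power2_eq_square)
  then have B: "B t = B 0" by (intro DERIV_isconst_all) simp
  have "(p * c + l * (q * s)) * s - (p * s - l * (q * c)) * c = l * q * (s * s + c * c)" for p q s c :: real
    by (simp add: algebra_simps)
  then have "B t * sin (l * t) - A t * cos (l * t) = l * w t * (sin (l * t) * sin (l * t) + cos (l * t) * cos (l * t))"
    unfolding A_def B_def .
  moreover have "sin (l * t) * sin (l * t) + cos (l * t) * cos (l * t) = 1"
    using sin_cos_squared_add[of "l * t"] by (simp only: power2_eq_square)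
  ultimately have "B t * sin (l * t) - A t * cos (l * t) = l * w t" by simp
  then show ?thesis using A B w0 by (simp add: A_def B_def)
qed

lemma affine_solution:
  fixes w w1 :: "real \<Rightarrow> real"
  assumes w: "\<And>t. (w has_real_derivative w1 t) (at t)" and w1: "\<And>t. (w1 has_real_derivative 0) (at t)"
  shows "w t = w 0 + w1 0 * t"
proof -
  have c: "w1 s = w1 0" for s by (rule DERIV_isconst_all[of w1]) (use w1 in simp)
  define f where "f = (\<lambda>s. w s - w1 0 * s)"
  have "(f has_real_derivative w1 s - w1 0 * 1) (at s)" for s
    unfolding f_def by (rule DERIV_diff[OF w DERIV_cmult[OF DERIV_ident]])
  moreover have "w1 s - w1 0 * 1 = 0" for s using c[of s] by simp
  ultimately have "(f has_real_derivative 0) (at s)" for s by metis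
  then have "f t = f 0" by (intro DERIV_isconst_all[of f]) simp
  then show ?thesis by (simp add: f_def)
qed

context maximal_flat
begin

definition conj_spec :: "'a \<Rightarrow> bool" where
  "conj_spec X \<longleftrightarrow> (\<exists>k\<ge>1. spec X (real k * pi))"

text \<open>Passing to t X multiplies frequencies by t. A frequency l > \<pi> therefore gives a
  conjugate multiple at t = \<pi> / l < 1, and a conjugate multiple at some t < 1 comes from a
  frequency k \<pi> / t > \<pi> of \<open>X\<close>.\<close>

lemma first_conj_spec:
  "conj_spec X \<and> (\<forall>t\<in>{0<..<1}. \<not> conj_spec (t *\<^sub>R X)) \<longleftrightarrow> spec X pi \<and> (\<forall>l>pi. \<not> spec X l)"
proof
  assume h: "conj_spec X \<and> (\<forall>t\<in>{0<..<1}. \<not> conj_spec (t *\<^sub>R X))"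
  have no: "\<not> spec X l" if l: "l > pi" for l
  proof
    assume "spec X l"
    define t where "t = pi / l"
    have "l > 0" using l pi_gt_zero by linarith
    then have t: "t \<in> {0<..<1}" using l by (simp add: t_def)
    have "spec X (pi / t)" using \<open>spec X l\<close> l pi_gt_zero by (simp add: t_def)
    then have "spec (t *\<^sub>R X) (real 1 * pi)" using t by (simp add: spec_scale)
    then have "conj_spec (t *\<^sub>R X)" unfolding conj_spec_def by (intro exI[of _ 1]) simp
    then show False using h t by blast
  qed
  obtain k :: nat where k: "k \<ge> 1" "spec X (real k * pi)" using h unfolding conj_spec_def by blast
  have "k = 1"
  using k(1) no k(2) by force
  then have "spec X pi" using k(2) by simp
  then show "spec X pi \<and> (\<forall>l>pi. \<not> spec X l)" using no by blast
next
  assume h: "spec X pi \<and> (\<forall>l>pi. \<not> spec X l)"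
  have "conj_spec X" unfolding conj_spec_def using h by (intro exI[of _ 1]) simp
  moreover have "\<not> conj_spec (t *\<^sub>R X)" if t: "t \<in> {0<..<1}" for t
  using t mult_strict_left_mono h by (auto simp: spec_scale pos_less_divide_eq conj_spec_def)
  ultimately show "conj_spec X \<and> (\<forall>t\<in>{0<..<1}. \<not> conj_spec (t *\<^sub>R X))" by blast
qed

text \<open>Project \<open>W\<close> to an eigenvector \<open>v\<close> on which \<open>W t0\<close>
  has a nonzero component. The coefficient solves w'' = - l^2 w and vanishes at 0 and 1 without
  vanishing identically. For l = 0 it would be affine, so l is a positive zero of the sine.\<close>

lemma jacobi_conj_spec:
  assumes X: "X \<in> pp" and W: "\<And>t. (W has_vector_derivative W1 t) (at t)"
    and W1: "\<And>t. (W1 has_vector_derivative br X (br X (W t))) (at t)"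
    and p: "\<And>t. W t \<in> pp" and z: "W 0 = 0" "W 1 = 0" and nz: "W t0 \<noteq> 0"
  shows "conj_spec X"
proof -
  let ?F = "\<lambda>V. br X (br X V)"
  have lin: "linear ?F" using linear_compose[OF br_lin(1) br_lin(1), of X X] by (simp add: comp_def)
  have sym: "ip (?F u) v = ip u (?F v)" for u v by (simp add: ip_skew)
  have pres: "?F V \<in> pp" if "V \<in> pp" for V by (rule bracket_kk_pp(3)[OF X bracket_kk_pp(4)[OF X that]])
  have "\<exists>v\<in>pp. \<exists>m. ?F v = m *\<^sub>R v \<and> v \<noteq> 0 \<and> ip (W t0) v \<noteq> 0"
  proof (rule eigenvectors_span[where F = ?F and S = pp and w = "W t0" and Q = ip])
    show "inner_form ip" by (rule inner_form_axioms)
    show "subspace pp" by (rule subspace_pp)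
    show "linear ?F" by (rule lin)
    show "?F x \<in> pp" if "x \<in> pp" for x using that by (rule pres)
    show "ip (?F x) y = ip x (?F y)" for x y by (rule sym)
    show "W t0 \<in> pp" by (rule p)
    show "W t0 \<noteq> 0" by (rule nz)
  qed
  then obtain v m where v: "v \<in> pp" "?F v = m *\<^sub>R v" "v \<noteq> 0" "ip (W t0) v \<noteq> 0" by blast
  have "m * ip v v = - ip (br X v) (br X v)" using arg_cong[OF v(2), of "\<lambda>u. ip u v"] by (simp add: ip_skew Q_simps)
  then have "m * ip v v \<le> 0" using Q_nonneg[of "br X v"] by simp
  then have m: "m \<le> 0" using Q_pos[OF v(3)] by (simp add: mult_le_0_iff)
  define l where "l = sqrt (- m)"
  have l: "l \<ge> 0" "m = - l\<^sup>2" using m by (simp_all add: l_def)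
  define w w1 where "w = (\<lambda>t. ip (W t) v)" and "w1 = (\<lambda>t. ip (W1 t) v)"
  have bl: "bounded_linear (\<lambda>u. ip u v)" using Q_linear(2) by (simp add: linear_conv_bounded_linear)
  have d: "(w has_real_derivative w1 t) (at t)" for t
    unfolding w_def w1_def has_real_derivative_iff_has_vector_derivative
    by (rule bounded_linear.has_vector_derivative[OF bl W])
  have d1: "(w1 has_real_derivative - (l\<^sup>2 * w t)) (at t)" for t
  using bounded_linear.has_vector_derivative bl W1 by (fastforce simp: w_def has_real_derivative_iff_has_vector_derivative Q_simps v(2) w1_def l(2) sym)
  have w0: "w 0 = 0" "w 1 = 0" using z by (simp_all add: w_def Q_simps)
  note sol = harmonic_solution[OF d d1 w0(1)]
  have l0: "l \<noteq> 0"
  proof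
    assume "l = 0"
    then have d1': "(w1 has_real_derivative 0) (at t)" for t using d1[of t] by simp
    have e: "w t = w1 0 * t" for t using affine_solution[OF d d1', of t] w0(1) by simp
    have "w1 0 = 0" using e[of 1] w0(2) by simp
    then show False using e[of t0] v(4) by (simp add: w_def)
  qed
  have "w1 0 \<noteq> 0"
  proof
    assume "w1 0 = 0"
    then have "w t0 = 0" using sol[of t0] l0 by simp
    then show False using v(4) by (simp add: w_def)
  qed
  then have "sin l = 0" using sol[of 1] w0(2) by simp
  then have "\<exists>i::int. l = of_int i * pi" by (rule sin_zero_iff_int2[THEN iffD1])
  then obtain i :: int where i: "l = of_int i * pi" by (elim exE)
  have "i > 0"
  proof -
    have "0 < of_int i * pi" using l(1) l0 i by linarith
    then show ?thesis by (simp add: zero_less_mult_iff)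
  qed
  then have k: "real (nat i) = of_int i" "nat i \<ge> 1" by simp_all
  have "spec X l" unfolding spec_def using v l(2) by (intro bexI[of _ v]) simp_all
  then show ?thesis unfolding conj_spec_def using k i by (intro exI[of _ "nat i"]) simp
qed

subsection \<open>Conjugation into the maximal flat\<close>

definition regular :: "'a \<Rightarrow> bool" where
  "regular H \<longleftrightarrow> H \<in> hp \<and> (\<forall>a\<in>rroots. ip a H \<noteq> 0)"

text \<open>Inside the kernel of ad (i H) take the part orthogonal to the zero weight space of
  \<open>hp\<close>. A weight occurring in it is orthogonal to \<open>H\<close>, hence 0 by
  regularity, which is impossible there; so the part is zero. Thus \<open>Y\<close> has weight 0 and
  commutes with all of \<open>hp\<close>.\<close>

lemma regular_centralizer:
  assumes H: "regular H" and Y: "Y \<in> pp" "br H Y = 0"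
  shows "Y \<in> hp"
proof -
  have Hhp: "H \<in> hp" using H by (simp add: regular_def)
  let ?S = "{F. weight_vector hp 0 F}"
  let ?W = "{E. cbr (0, H) E = 0 \<and> (\<forall>F\<in>?S. ip2 E F = 0)}"
  have S: "subspace ?S"
    by (auto simp: subspace_def weight_vector_def Q_simps linear_0[OF cbr_linear(1)] linear_add[OF cbr_linear(1)] linear_scale[OF cbr_linear(1)])
  have W: "subspace ?W"
    by (auto simp: subspace_def two.Q_simps linear_0[OF cbr_linear(1)] linear_add[OF cbr_linear(1)] linear_scale[OF cbr_linear(1)])
  have S0: "cbr (0, h) F = 0" if "h \<in> hp" "F \<in> ?S" for h F
    using weight_vectorD[of hp 0 F h] that by (simp add: Q_simps)
  have W0: "?W = {0}"
  proof (rule ccontr)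
    assume ne: "?W \<noteq> {0}"
    have inv: "cbr (0, h) E \<in> ?W" if h: "h \<in> hp" and E: "E \<in> ?W" for h E
    proof -
      have "cbr (0, H) (cbr (0, h) E) = cbr (0, h) (cbr (0, H) E)" by (rule imag_commute[OF hp(4)[OF Hhp h]])
      then have 1: "cbr (0, H) (cbr (0, h) E) = 0" using E by (simp add: linear_0[OF cbr_linear(1)])
      have "ip2 (cbr (0, h) E) F = 0" if F: "F \<in> ?S" for F
        unfolding ip2_imag_symmetric S0[OF h F] by (simp add: two.Q_simps)
      then show ?thesis using 1 by blast
    qed
    have "\<exists>E\<in>?W. E \<noteq> 0 \<and> (\<exists>a\<in>hp. weight_vector hp a E)" by (rule weight_exists[OF W ne hp(1) inv])
    then obtain E a where E: "E \<in> ?W" "E \<noteq> 0" "a \<in> hp" "weight_vector hp a E" by blast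
    have "ip H a *\<^sub>R E = 0" using E(1) by (simp flip: weight_vectorD[OF E(4) Hhp])
    then have "ip a H = 0" using E(2) Q_sym[of a H] by simp
    have "a = 0"
    proof (rule ccontr)
      assume "a \<noteq> 0"
      then have "a \<in> rroots" by (rule rrootI[OF E(3) _ E(2,4)])
      then show False using H \<open>ip a H = 0\<close> by (simp add: regular_def)
    qed
    then have "E \<in> ?S" using E(4) by simp
    then have "ip2 E E = 0" using E(1) by blast
    then show False using E(2) by (simp add: two.Q_eq_0)
  qed
  obtain F where F: "F \<in> ?S" "\<forall>G\<in>?S. ip2 ((Y, 0) - F) G = 0" using two.orthogonal_decomposition[OF S] by blast
  have "cbr (0, H) (Y, 0) = 0" using Y(2) by (simp add: cbr_imag br_simps zero_prod_def)
  then have "cbr (0, H) ((Y, 0) - F) = 0" using S0[OF Hhp F(1)] by (simp only: linear_diff[OF cbr_linear(1)] diff_self)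
  then have "(Y, 0) - F \<in> ?W" using F(2) by blast
  then have "(Y, 0) - F = 0" unfolding W0 by (rule singletonD)
  then have "(Y, 0) = F" by (simp only: right_minus_eq)
  then have w: "weight_vector hp 0 (Y, 0)" using F(1) by simp
  show ?thesis by (rule hp_centralizer[OF Y(1)]) (use w in \<open>simp add: weight_vector_pair Q_simps\<close>)
qed

text \<open>The first variation in the direction T = [H, Y] gives |[H, Y]|^2 = 0, so
  \<open>Y\<close> lies in the flat by regularity. For a root \<open>a\<close> with special weight
  vector (T, S), [T, [T, Y]] is - (ip Y a) |T|^2 a, and the second variation says that its product
  with \<open>H\<close> is nonpositive.\<close>

lemma critical_dominant:
  assumes H: "regular H" and Y: "Y \<in> pp" and first: "\<And>T. T \<in> kk \<Longrightarrow> ip (br T Y) H = 0"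
    and second: "\<And>T. T \<in> kk \<Longrightarrow> ip (br T (br T Y)) H \<le> 0"
  shows "Y \<in> hp" "a \<in> rroots \<Longrightarrow> ip Y a * ip a H \<ge> 0"
proof -
  have Hhp: "H \<in> hp" "H \<in> pp" using H hp(3) by (auto simp: regular_def)
  have "br H Y \<in> kk" by (rule bracket_kk_pp(4)[OF Hhp(2) Y])
  from first[OF this] have "ip (br H Y) (br Y H) = 0"
    using ip_skew[of Y "br H Y" H] br_anti[of "br H Y" Y] by (simp add: Q_simps)
  then have "ip (br H Y) (br H Y) = 0" using br_anti[of Y H] by (simp add: Q_simps)
  then have "br H Y = 0" by (simp add: Q_eq_0)
  then show Yhp: "Y \<in> hp" by (rule regular_centralizer[OF H Y])
  assume a: "a \<in> rroots"
  obtain T S where TS: "T \<in> kk" "S \<in> pp" "T \<noteq> 0" "weight_vector hp a (T, S)" using special_vectors[OF a] by blast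
  have "br Y T = ip Y a *\<^sub>R S" using TS(4) Yhp by (simp add: weight_vector_pair)
  then have "br T Y = - (ip Y a *\<^sub>R S)" using br_anti[of T Y] by simp
  then have "br T (br T Y) = - ((ip Y a * ip T T) *\<^sub>R a)"
    using special_bracket(1)[OF a TS(1,2,4)] by (simp add: br_simps)
  then have "ip Y a * ip T T * ip a H \<ge> 0" using second[OF TS(1)] by (simp add: Q_simps)
  then have "(ip Y a * ip a H) * ip T T \<ge> 0" by (simp add: mult_ac)
  then show "ip Y a * ip a H \<ge> 0" using Q_pos[OF TS(3)] by (simp add: zero_le_mult_iff)
qed

end

text \<open>If the second derivative at 0 were positive, the first derivative would be positive just
  to the right of 0, and the mean value theorem would give a value larger than the maximum.\<close>

lemma second_derivative_at_maximum:
  fixes g g1 :: "real \<Rightarrow> real"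
  assumes g: "\<And>t. (g has_real_derivative g1 t) (at t)" and g1: "(g1 has_real_derivative m) (at 0)" and max: "\<And>t. g t \<le> g 0"
  shows "g1 0 = 0" "m \<le> 0"
proof -
  show z: "g1 0 = 0" by (rule DERIV_local_max[OF g, of 1]) (use max in auto)
  show "m \<le> 0"
  proof (rule ccontr)
    assume "\<not> m \<le> 0"
    then obtain d where d: "d > 0" "\<forall>h>0. h < d \<longrightarrow> g1 0 < g1 (0 + h)" using DERIV_pos_inc_right[OF g1] by auto
    have "\<exists>z. 0 < z \<and> z < d / 2 \<and> g (d / 2) - g 0 = (d / 2 - 0) * g1 z"
      by (rule MVT2) (use d(1) g in auto)
    then obtain s where s: "0 < s" "s < d / 2" "g (d / 2) - g 0 = (d / 2 - 0) * g1 s" by blast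
    have "g1 s > 0" using d s z by auto
    then have "(d / 2 - 0) * g1 s > 0" using d(1) by simp
    then have "g (d / 2) - g 0 > 0" using s(3) by (simp only:)
    then show False using max[of "d / 2"] by simp
  qed
qed

section \<open>Elementary rules for Frechet derivatives at a point\<close>

abbreviation D :: "('a::real_normed_vector \<Rightarrow> 'b::real_normed_vector) \<Rightarrow> 'a \<Rightarrow> 'a \<Rightarrow> 'b" where
  "D f x \<equiv> frechet_derivative f (at x)"

lemma D_eqI: "(f has_derivative f') (at x) \<Longrightarrow> D f x = f'"
  using frechet_derivative_at by metis

lemma has_derivative_D: "f differentiable (at x) \<Longrightarrow> (f has_derivative D f x) (at x)"
  by (simp add: frechet_derivative_works)

text \<open>\<open>frechet_derivative\<close> chooses among all derivatives. Functions that agree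
  near \<open>x\<close> have the same derivatives there, so the choices coincide even where no
  derivative exists, and functions can be replaced without first showing differentiability.\<close>

lemma D_cong_open:
  assumes "open S" "x \<in> S" "\<And>y. y \<in> S \<Longrightarrow> f y = g y"
  shows "D f x = D g x"
proof -
  have "(f has_derivative f') (at x) \<longleftrightarrow> (g has_derivative f') (at x)" for f'
    using has_derivative_transform_within_open[OF _ assms(1,2), of f f' UNIV g]
      has_derivative_transform_within_open[OF _ assms(1,2), of g f' UNIV f] assms(3) by metis
  then show ?thesis by (simp add: frechet_derivative_def)
qed

lemma differentiable_cong_open:
  assumes "open S" "x \<in> S" "\<And>y. y \<in> S \<Longrightarrow> f y = g y" "f differentiable (at x)"
  shows "g differentiable (at x)"
  using assms has_derivative_transform_within_open[OF _ assms(1,2)] unfolding differentiable_def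
  by metis

subsection \<open>Functions of class \<open>C\<^sup>k\<close>\<close>

lemma Ck_on_SucD: "Ck_on (Suc k) S f \<Longrightarrow> Ck_on k S f"
proof (induction k arbitrary: f)
  case 0
  then show ?case
    by (auto intro!: continuous_at_imp_continuous_on differentiable_imp_continuous_within)
next
  case (Suc k)
  then show ?case by (meson Ck_on.simps(2))
qed

lemma Ck_on_subset: "Ck_on k S f \<Longrightarrow> T \<subseteq> S \<Longrightarrow> Ck_on k T f"
  by (induction k arbitrary: f) (auto intro: continuous_on_subset)

lemma Ck_on_cong:
  assumes "open S" "\<And>x. x \<in> S \<Longrightarrow> f x = g x" "Ck_on k S f"
  shows "Ck_on k S g"
  using assms(2,3)
proof (induction k arbitrary: f g)
  case 0
  then show ?case using continuous_on_cong by (metis Ck_on.simps(1))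
next
  case (Suc k)
  have D: "D f x = D g x" if "x \<in> S" for x
    using D_cong_open[OF assms(1) that] Suc.prems(1) by blast
  have "Ck_on k S (\<lambda>x. D g x v)" for v
    using Suc.IH[of "\<lambda>x. D f x v" "\<lambda>x. D g x v"] Suc.prems D by auto
  moreover have "g differentiable (at x)" if "x \<in> S" for x
    using differentiable_cong_open[OF assms(1) that, of f g] Suc.prems that by simp
  ultimately show ?case by simp
qed

lemma Ck_on_local:
  assumes "\<And>x. x \<in> S \<Longrightarrow> \<exists>T. open T \<and> x \<in> T \<and> Ck_on k T f"
  shows "Ck_on k S f"
  using assms
proof (induction k arbitrary: f)
  case 0
  then show ?case
    by (auto intro!: continuous_at_imp_continuous_on) (metis continuous_on_interior interior_open)
next
  case (Suc k)
  have "f differentiable (at x)" if "x \<in> S" for x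
    using Suc.prems[OF that] by auto
  moreover have "Ck_on k S (\<lambda>x. D f x v)" for v
    by (rule Suc.IH) (use Suc.prems in force)
  ultimately show ?case by simp
qed

lemma Ck_on_const: "Ck_on k S (\<lambda>x. c)"
  by (induction k arbitrary: c) (simp_all add: frechet_derivative_const)

lemma Ck_on_bounded_linear:
  assumes "bounded_linear L" "open S" "Ck_on k S f"
  shows "Ck_on k S (\<lambda>x. L (f x))"
  using assms(3)
proof (induction k arbitrary: f)
  case 0
  then show ?case using assms(1) by (auto intro: bounded_linear.continuous_on)
next
  case (Suc k)
  have d: "((\<lambda>x. L (f x)) has_derivative (\<lambda>v. L (D f x v))) (at x)" if "x \<in> S" for x
    using Suc.prems that by (intro bounded_linear.has_derivative[OF assms(1)] has_derivative_D) simp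
  have "Ck_on k S (\<lambda>x. D (\<lambda>x. L (f x)) x v)" for v
    by (rule Ck_on_cong[OF assms(2) _ Suc.IH[of "\<lambda>x. D f x v"]])
      (use D_eqI[OF d] Suc.prems in auto)
  then show ?case using d by (auto simp: differentiable_def)
qed

lemma Ck_on_id: "open S \<Longrightarrow> Ck_on k S (\<lambda>x. x)"
  by (cases k) (auto simp: Ck_on_const differentiable_ident frechet_derivative_ident)

lemma Ck_on_add:
  assumes "open S" "Ck_on k S f" "Ck_on k S g"
  shows "Ck_on k S (\<lambda>x. f x + g x)"
  using assms(2,3)
proof (induction k arbitrary: f g)
  case 0
  then show ?case by (auto intro: continuous_on_add)
next
  case (Suc k)
  have d: "((\<lambda>x. f x + g x) has_derivative (\<lambda>v. D f x v + D g x v)) (at x)" if "x \<in> S" for x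
    using Suc.prems that by (intro has_derivative_add has_derivative_D) auto
  have "Ck_on k S (\<lambda>x. D (\<lambda>x. f x + g x) x v)" for v
    by (rule Ck_on_cong[OF assms(1) _ Suc.IH[of "\<lambda>x. D f x v" "\<lambda>x. D g x v"]])
      (use D_eqI[OF d] Suc.prems in auto)
  then show ?case using d by (auto simp: differentiable_def)
qed

lemma Ck_on_sum:
  assumes "open S" "\<And>i. i \<in> I \<Longrightarrow> Ck_on k S (f i)"
  shows "Ck_on k S (\<lambda>x. \<Sum>i\<in>I. f i x)"
  using assms(2) by (induction I rule: infinite_finite_induct) (auto simp: Ck_on_const Ck_on_add[OF assms(1)])

lemma Ck_on_bounded_bilinear:
  assumes "bounded_bilinear b" "open S" "Ck_on k S f" "Ck_on k S g"
  shows "Ck_on k S (\<lambda>x. b (f x) (g x))"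
  using assms(3,4)
proof (induction k arbitrary: f g)
  case 0
  then show ?case using assms(1) by (auto intro: bounded_bilinear.continuous_on)
next
  case (Suc k)
  have d: "((\<lambda>x. b (f x) (g x)) has_derivative (\<lambda>v. b (f x) (D g x v) + b (D f x v) (g x))) (at x)"
    if "x \<in> S" for x
    using Suc.prems that by (intro bounded_bilinear.FDERIV[OF assms(1)] has_derivative_D) auto
  have "Ck_on k S (\<lambda>x. b (f x) (D g x v) + b (D f x v) (g x))" for v
    using Suc.prems by (intro Ck_on_add[OF assms(2)] Suc.IH) (auto simp del: Ck_on.simps simp: Ck_on_SucD, auto)
  then have "Ck_on k S (\<lambda>x. D (\<lambda>x. b (f x) (g x)) x v)" for v
    by (rule Ck_on_cong[OF assms(2), rotated]) (simp add: D_eqI[OF d])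
  then show ?case using d by (auto simp: differentiable_def)
qed

text \<open>\<open>Ck_on\<close> speaks about derivatives in fixed directions; this expansion turns
  a direction that varies with the point into a sum over fixed ones.\<close>

lemma D_euclidean:
  fixes f :: "'a::euclidean_space \<Rightarrow> 'b::real_normed_vector"
  assumes "f differentiable (at x)"
  shows "D f x v = (\<Sum>b\<in>Basis. (v \<bullet> b) *\<^sub>R D f x b)"
proof -
  interpret linear "D f x" using assms by (rule linear_frechet_derivative)
  have "D f x v = D f x (\<Sum>b\<in>Basis. (v \<bullet> b) *\<^sub>R b)" by (simp add: euclidean_representation)
  then show ?thesis by (simp add: sum scaleR del: euclidean_representation)
qed

text \<open>The chain rule evaluates the derivative of \<open>f\<close> in the moving direction
  \<open>D g x v\<close>. Expanded over the basis it is a sum of products of C^k functions, one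
  factor by hypothesis and the other by the induction hypothesis.\<close>

lemma Ck_on_compose:
  fixes f :: "'b::euclidean_space \<Rightarrow> 'c::real_normed_vector" and g :: "'a::real_normed_vector \<Rightarrow> 'b"
  assumes "open S" "open T" "Ck_on k T f" "Ck_on k S g" "g ` S \<subseteq> T"
  shows "Ck_on k S (\<lambda>x. f (g x))"
  using assms(3,4)
proof (induction k arbitrary: f)
  case 0
  then show ?case using assms(5) by (auto intro: continuous_on_compose2)
next
  case (Suc k)
  have d: "((\<lambda>x. f (g x)) has_derivative (\<lambda>v. D f (g x) (D g x v))) (at x)" if "x \<in> S" for x
    by (rule has_derivative_compose[OF has_derivative_D has_derivative_D]) (use Suc.prems that assms(5) in auto)
  have "Ck_on k S (\<lambda>x. \<Sum>b\<in>Basis. (D g x v \<bullet> b) *\<^sub>R D f (g x) b)" for v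
  proof (intro Ck_on_sum[OF assms(1)] Ck_on_bounded_bilinear[OF bounded_bilinear_scaleR assms(1)])
    fix b
    show "Ck_on k S (\<lambda>x. D g x v \<bullet> b)"
      by (rule Ck_on_bounded_linear[OF bounded_linear_inner_left assms(1)]) (use Suc.prems in auto)
    show "Ck_on k S (\<lambda>x. D f (g x) b)"
      by (rule Suc.IH) (use Suc.prems Ck_on_SucD in auto)
  qed
  then have "Ck_on k S (\<lambda>x. D (\<lambda>x. f (g x)) x v)" for v
  proof (rule Ck_on_cong[OF assms(1), rotated])
    fix x assume x: "x \<in> S"
    have "f differentiable at (g x)" using x Suc.prems assms(5) by auto
    then show "(\<Sum>b\<in>Basis. (D g x v \<bullet> b) *\<^sub>R D f (g x) b) = D (\<lambda>x. f (g x)) x v"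
      using D_euclidean[of f "g x" "D g x v"] D_eqI[OF d[OF x]] by simp
  qed
  then show ?case using d by (auto simp: differentiable_def)
qed

subsection \<open>Smooth functions\<close>

lemma smooth_on_differentiable: "smooth_on S f \<Longrightarrow> x \<in> S \<Longrightarrow> f differentiable (at x)"
  unfolding smooth_on_def by (metis Ck_on.simps(2))

lemma smooth_on_continuous: "smooth_on S f \<Longrightarrow> continuous_on S f"
  unfolding smooth_on_def by (metis Ck_on.simps(1))

lemma smooth_on_has_derivative: "smooth_on S f \<Longrightarrow> x \<in> S \<Longrightarrow> (f has_derivative D f x) (at x)"
  by (intro has_derivative_D smooth_on_differentiable)

lemma smooth_on_linear_D: "smooth_on S f \<Longrightarrow> x \<in> S \<Longrightarrow> linear (D f x)"
  by (intro linear_frechet_derivative smooth_on_differentiable)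

lemma smooth_on_D: "smooth_on S f \<Longrightarrow> smooth_on S (\<lambda>x. D f x v)"
  unfolding smooth_on_def by (metis Ck_on.simps(2))

lemma smooth_on_subset: "smooth_on S f \<Longrightarrow> T \<subseteq> S \<Longrightarrow> smooth_on T f"
  unfolding smooth_on_def using Ck_on_subset by blast

lemma smooth_on_cong: "open S \<Longrightarrow> (\<And>x. x \<in> S \<Longrightarrow> f x = g x) \<Longrightarrow> smooth_on S f \<Longrightarrow> smooth_on S g"
  unfolding smooth_on_def using Ck_on_cong by blast

lemma smooth_on_local: "(\<And>x. x \<in> S \<Longrightarrow> \<exists>T. open T \<and> x \<in> T \<and> smooth_on T f) \<Longrightarrow> smooth_on S f"
  unfolding smooth_on_def by (intro allI Ck_on_local) blast

lemma smooth_on_const: "smooth_on S (\<lambda>x. c)"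
  by (simp add: smooth_on_def Ck_on_const)

lemma smooth_on_id: "open S \<Longrightarrow> smooth_on S (\<lambda>x. x)"
  by (simp add: smooth_on_def Ck_on_id)

lemma smooth_on_bounded_linear:
  "bounded_linear L \<Longrightarrow> open S \<Longrightarrow> smooth_on S f \<Longrightarrow> smooth_on S (\<lambda>x. L (f x))"
  by (simp add: smooth_on_def Ck_on_bounded_linear)

lemma smooth_on_linear:
  fixes L :: "'a::euclidean_space \<Rightarrow> 'b::real_normed_vector"
  shows "linear L \<Longrightarrow> open S \<Longrightarrow> smooth_on S f \<Longrightarrow> smooth_on S (\<lambda>x. L (f x))"
  by (simp add: smooth_on_bounded_linear linear_conv_bounded_linear)

lemma smooth_on_add: "open S \<Longrightarrow> smooth_on S f \<Longrightarrow> smooth_on S g \<Longrightarrow> smooth_on S (\<lambda>x. f x + g x)"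
  by (simp add: smooth_on_def Ck_on_add)

lemma smooth_on_sum: "open S \<Longrightarrow> (\<And>i. i \<in> I \<Longrightarrow> smooth_on S (f i)) \<Longrightarrow> smooth_on S (\<lambda>x. \<Sum>i\<in>I. f i x)"
  by (simp add: smooth_on_def Ck_on_sum)

lemma smooth_on_bounded_bilinear:
  "bounded_bilinear b \<Longrightarrow> open S \<Longrightarrow> smooth_on S f \<Longrightarrow> smooth_on S g \<Longrightarrow> smooth_on S (\<lambda>x. b (f x) (g x))"
  by (simp add: smooth_on_def Ck_on_bounded_bilinear)

lemmas smooth_on_scaleR = smooth_on_bounded_bilinear[OF bounded_bilinear_scaleR]

lemma smooth_on_uminus: "open S \<Longrightarrow> smooth_on S f \<Longrightarrow> smooth_on S (\<lambda>x. - f x)"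
  by (rule smooth_on_bounded_linear[OF bounded_linear_minus[OF bounded_linear_ident]])

lemma smooth_on_diff: "open S \<Longrightarrow> smooth_on S f \<Longrightarrow> smooth_on S g \<Longrightarrow> smooth_on S (\<lambda>x. f x - g x)"
  using smooth_on_add[of S f "\<lambda>x. - g x"] smooth_on_uminus[of S g] by simp

lemma smooth_on_compose:
  fixes f :: "'b::euclidean_space \<Rightarrow> 'c::real_normed_vector" and g :: "'a::real_normed_vector \<Rightarrow> 'b"
  assumes "open S" "open T" "smooth_on T f" "smooth_on S g" "g ` S \<subseteq> T"
  shows "smooth_on S (\<lambda>x. f (g x))"
  using assms by (simp add: smooth_on_def Ck_on_compose)

lemma smooth_on_Pair:
  assumes "open S" "smooth_on S f" "smooth_on S g"
  shows "smooth_on S (\<lambda>x. (f x, g x))"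
proof -
  have "smooth_on S (\<lambda>x. (f x, 0) + (0, g x))"
    using assms by (intro smooth_on_add smooth_on_bounded_linear[of "\<lambda>x. (x, 0)"]
        smooth_on_bounded_linear[of "\<lambda>x. (0, x)"]) (auto intro!: bounded_linear_Pair bounded_linear_ident)
  then show ?thesis by simp
qed

lemma smooth_on_fst: "open S \<Longrightarrow> smooth_on S f \<Longrightarrow> smooth_on S (\<lambda>x. fst (f x))"
  by (rule smooth_on_bounded_linear[OF bounded_linear_fst])

lemma smooth_on_snd: "open S \<Longrightarrow> smooth_on S f \<Longrightarrow> smooth_on S (\<lambda>x. snd (f x))"
  by (rule smooth_on_bounded_linear[OF bounded_linear_snd])

lemma smooth_on_D_joint:
  fixes f :: "'b::euclidean_space \<Rightarrow> 'c::real_normed_vector"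
  assumes "open S" "open T" "smooth_on T f" "smooth_on S g" "smooth_on S k" "g ` S \<subseteq> T"
  shows "smooth_on S (\<lambda>x. D f (g x) (k x))"
proof -
  have "smooth_on S (\<lambda>x. \<Sum>b\<in>Basis. (k x \<bullet> b) *\<^sub>R D f (g x) b)"
    using assms by (intro smooth_on_sum smooth_on_scaleR smooth_on_bounded_linear[OF bounded_linear_inner_left]
        smooth_on_compose[of S T "\<lambda>y. D f y _" g] smooth_on_D)
  then show ?thesis
    by (rule smooth_on_cong[OF assms(1), rotated])
      (rule D_euclidean[OF smooth_on_differentiable[OF assms(3)], symmetric], use assms in auto)
qed

lemma D_compose:
  assumes "f differentiable (at (g x))" "g differentiable (at x)"
  shows "D (\<lambda>x. f (g x)) x v = D f (g x) (D g x v)"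
  by (subst D_eqI[OF has_derivative_compose[OF has_derivative_D has_derivative_D]]) (use assms in auto)

text \<open>The product rule for a derivative evaluated at a moving point in a moving direction; it
  is the source of the second-derivative terms in coordinate changes.\<close>

lemma has_derivative_D_joint:
  fixes f :: "'b::euclidean_space \<Rightarrow> 'c::real_normed_vector"
  assumes "open T" "smooth_on T f" "g x \<in> T" "(g has_derivative g') (at x)" "(k has_derivative k') (at x)"
  shows "((\<lambda>x. D f (g x) (k x)) has_derivative
    (\<lambda>w. D (\<lambda>y. D f y (k x)) (g x) (g' w) + D f (g x) (k' w))) (at x)"
proof -
  have gc: "continuous (at x) g" using assms(4) has_derivative_continuous by blast
  obtain U where U: "open U" "x \<in> U" "\<forall>y\<in>U. g y \<in> T"
    using continuous_at_open[THEN iffD1, OF gc, rule_format, OF conjI[OF assms(1,3)]] by blast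
  have "((\<lambda>x. (k x \<bullet> b) *\<^sub>R D f (g x) b) has_derivative
    (\<lambda>w. (k x \<bullet> b) *\<^sub>R D (\<lambda>y. D f y b) (g x) (g' w) + (k' w \<bullet> b) *\<^sub>R D f (g x) b)) (at x)" for b
    by (rule has_derivative_scaleR[OF has_derivative_inner_left[OF assms(5)]
        has_derivative_compose[OF assms(4) smooth_on_has_derivative[OF smooth_on_D[OF assms(2)] assms(3)]]])
  then have "((\<lambda>x. \<Sum>b\<in>Basis. (k x \<bullet> b) *\<^sub>R D f (g x) b) has_derivative
    (\<lambda>w. \<Sum>b\<in>Basis. (k x \<bullet> b) *\<^sub>R D (\<lambda>y. D f y b) (g x) (g' w) + (k' w \<bullet> b) *\<^sub>R D f (g x) b)) (at x)"
    by (intro has_derivative_sum)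
  moreover have "(\<Sum>b\<in>Basis. (k' w \<bullet> b) *\<^sub>R D f (g x) b) = D f (g x) (k' w)" for w
    by (rule D_euclidean[OF smooth_on_differentiable[OF assms(2,3)], symmetric])
  moreover have "(\<Sum>b\<in>Basis. (k x \<bullet> b) *\<^sub>R D (\<lambda>y. D f y b) (g x) u) = D (\<lambda>y. D f y (k x)) (g x) u" for u
  proof -
    have "((\<lambda>y. \<Sum>b\<in>Basis. (k x \<bullet> b) *\<^sub>R D f y b) has_derivative
      (\<lambda>u. \<Sum>b\<in>Basis. (k x \<bullet> b) *\<^sub>R D (\<lambda>y. D f y b) (g x) u)) (at (g x))"
      by (intro has_derivative_sum has_derivative_scaleR_right smooth_on_has_derivative[OF smooth_on_D[OF assms(2)] assms(3)])
    then have "((\<lambda>y. D f y (k x)) has_derivative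
      (\<lambda>u. \<Sum>b\<in>Basis. (k x \<bullet> b) *\<^sub>R D (\<lambda>y. D f y b) (g x) u)) (at (g x))"
      by (rule has_derivative_transform_within_open[OF _ assms(1,3)])
        (rule D_euclidean[OF smooth_on_differentiable[OF assms(2)], symmetric])
    then show ?thesis by (simp add: D_eqI)
  qed
  ultimately have "((\<lambda>x. \<Sum>b\<in>Basis. (k x \<bullet> b) *\<^sub>R D f (g x) b) has_derivative
    (\<lambda>w. D (\<lambda>y. D f y (k x)) (g x) (g' w) + D f (g x) (k' w))) (at x)"
    by (simp add: sum.distrib)
  then show ?thesis
    by (rule has_derivative_transform_within_open[OF _ U(1,2)])
      (rule D_euclidean[OF smooth_on_differentiable[OF assms(2)], symmetric], use U in auto)
qed

text \<open>Second-order chain rule. The last term contains the second derivative of the inner map;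
  where this derivative vanishes, second derivatives transform bilinearly.\<close>

lemma D_D_compose:
  fixes f :: "'b::euclidean_space \<Rightarrow> 'c::real_normed_vector" and h :: "'a::real_normed_vector \<Rightarrow> 'b"
  assumes "open S" "open T" "smooth_on T f" "smooth_on S h" "h ` S \<subseteq> T" "x \<in> S"
  shows "D (\<lambda>x. D (\<lambda>x. f (h x)) x v) x w =
    D (\<lambda>y. D f y (D h x v)) (h x) (D h x w) + D f (h x) (D (\<lambda>x. D h x v) x w)"
proof -
  have "D (\<lambda>x. D (\<lambda>x. f (h x)) x v) x = D (\<lambda>x. D f (h x) (D h x v)) x"
    by (rule D_cong_open[OF assms(1,6)])
      (use assms in \<open>auto intro!: D_compose smooth_on_differentiable\<close>)
  also have "\<dots> = (\<lambda>w. D (\<lambda>y. D f y (D h x v)) (h x) (D h x w) + D f (h x) (D (\<lambda>x. D h x v) x w))"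
    using assms by (intro D_eqI has_derivative_D_joint[of T] smooth_on_has_derivative[of S] smooth_on_D) auto
  finally show ?thesis by simp
qed

subsection \<open>Symmetry of second derivatives\<close>

lemma D_has_real_derivative_line:
  assumes "f differentiable (at (c + s *\<^sub>R v))"
  shows "((\<lambda>s. f (c + s *\<^sub>R v) :: real) has_real_derivative D f (c + s *\<^sub>R v) v) (at s)"
proof -
  have "((\<lambda>s. c + s *\<^sub>R v) has_derivative (\<lambda>s. s *\<^sub>R v)) (at s)"
    by (auto intro!: derivative_eq_intros)
  from has_derivative_compose[OF this has_derivative_D[OF assms]]
  have "((\<lambda>s. f (c + s *\<^sub>R v)) has_derivative (\<lambda>t. D f (c + s *\<^sub>R v) (t *\<^sub>R v))) (at s)" .
  moreover have "(\<lambda>t. D f (c + s *\<^sub>R v) (t *\<^sub>R v)) = (*) (D f (c + s *\<^sub>R v) v)"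
    using linear_frechet_derivative[OF assms] by (auto simp: linear_scale)
  ultimately show ?thesis by (simp add: has_field_derivative_def)
qed

text \<open>The mean value theorem in the direction \<open>v\<close> is applied to the increment of
  \<open>f\<close> by h w, and then in the direction \<open>w\<close> to the derivative along
  \<open>v\<close>.\<close>

lemma second_difference_mvt:
  fixes f :: "'a::real_normed_vector \<Rightarrow> real"
  assumes "smooth_on S f" "h > 0"
    and sub: "\<And>s t. 0 \<le> s \<Longrightarrow> s \<le> h \<Longrightarrow> 0 \<le> t \<Longrightarrow> t \<le> h \<Longrightarrow> x + s *\<^sub>R v + t *\<^sub>R w \<in> S"
  shows "\<exists>s t. 0 \<le> s \<and> s \<le> h \<and> 0 \<le> t \<and> t \<le> h \<and>
    f (x + h *\<^sub>R v + h *\<^sub>R w) - f (x + h *\<^sub>R v) - f (x + h *\<^sub>R w) + f x =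
      h * (h * D (\<lambda>y. D f y v) (x + s *\<^sub>R v + t *\<^sub>R w) w)"
proof -
  have d: "f differentiable (at (x + s *\<^sub>R v + t *\<^sub>R w))" if "0 \<le> s" "s \<le> h" "0 \<le> t" "t \<le> h" for s t
    using smooth_on_differentiable[OF assms(1) sub] that by blast
  have "((\<lambda>s. f (x + s *\<^sub>R v + h *\<^sub>R w) - f (x + s *\<^sub>R v)) has_real_derivative
      D f (x + s *\<^sub>R v + h *\<^sub>R w) v - D f (x + s *\<^sub>R v) v) (at s)" if "0 \<le> s" "s \<le> h" for s
    using DERIV_diff[OF D_has_real_derivative_line[of f "x + h *\<^sub>R w" s v] D_has_real_derivative_line[of f x s v]]
      d[of s h] d[of s 0] that assms(2) by (simp add: algebra_simps)
  from MVT2[OF assms(2) this] obtain s where s: "0 < s" "s < h"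
    "f (x + h *\<^sub>R v + h *\<^sub>R w) - f (x + h *\<^sub>R v) - (f (x + h *\<^sub>R w) - f x) =
      h * (D f (x + s *\<^sub>R v + h *\<^sub>R w) v - D f (x + s *\<^sub>R v) v)" by auto
  have "((\<lambda>t. D f (x + s *\<^sub>R v + t *\<^sub>R w) v) has_real_derivative
      D (\<lambda>y. D f y v) (x + s *\<^sub>R v + t *\<^sub>R w) w) (at t)" if "0 \<le> t" "t \<le> h" for t
    by (rule D_has_real_derivative_line)
      (use s that sub in \<open>auto intro!: smooth_on_differentiable[OF smooth_on_D[OF assms(1)]]\<close>)
  from MVT2[OF assms(2) this] obtain t where t: "0 < t" "t < h"
    "D f (x + s *\<^sub>R v + h *\<^sub>R w) v - D f (x + s *\<^sub>R v) v = h * D (\<lambda>y. D f y v) (x + s *\<^sub>R v + t *\<^sub>R w) w"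
    by auto
  show ?thesis using s t by (intro exI[of _ s] exI[of _ t]) (simp add: algebra_simps)
qed

text \<open>One second difference equals h^2 times either mixed derivative, each taken at some
  nearby point. If the two derivatives differed at \<open>x\<close>, continuity would keep them
  apart near \<open>x\<close>.\<close>

lemma D_D_commute_real:
  fixes f :: "'a::real_normed_vector \<Rightarrow> real"
  assumes "open S" "smooth_on S f" "x \<in> S"
  shows "D (\<lambda>y. D f y v) x w = D (\<lambda>y. D f y w) x v"
proof (rule ccontr)
  define A where "A = (\<lambda>y. D (\<lambda>y. D f y v) y w)"
  define B where "B = (\<lambda>y. D (\<lambda>y. D f y w) y v)"
  assume "\<not> ?thesis"
  then have e: "dist (A x) (B x) / 2 > 0" (is "?e > 0") by (simp add: A_def B_def)
  have "continuous_on S A" "continuous_on S B"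
    unfolding A_def B_def using assms by (auto intro!: smooth_on_continuous smooth_on_D)
  then have c: "isCont A x" "isCont B x"
    using assms(1,3) continuous_on_eq_continuous_at by blast+
  obtain d1 where d1: "d1 > 0" "\<And>y. dist y x < d1 \<Longrightarrow> dist (A y) (A x) < ?e"
    using c(1)[unfolded continuous_at_eps_delta, rule_format, OF e] by blast
  obtain d2 where d2: "d2 > 0" "\<And>y. dist y x < d2 \<Longrightarrow> dist (B y) (B x) < ?e"
    using c(2)[unfolded continuous_at_eps_delta, rule_format, OF e] by blast
  obtain d3 where d3: "d3 > 0" "ball x d3 \<subseteq> S" using assms(1,3) open_contains_ball by blast
  define d where "d = min d1 (min d2 d3)"
  \<comment> \<open>Small enough that the parallelogram spanned by h v and h w at \<open>x\<close>
    stays within distance \<open>d\<close>; the 1 avoids division by 0.\<close>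
  define h where "h = d / (norm v + norm w + 1)"
  have d0: "d > 0" using d1(1) d2(1) d3(1) by (simp add: d_def)
  have h: "h > 0" unfolding h_def using d0 by (intro divide_pos_pos) (auto simp: add_nonneg_pos)
  have hd: "h * (norm v + norm w) < d"
  proof -
    have "h * (norm v + norm w + 1) = d" unfolding h_def using norm_ge_zero[of v] norm_ge_zero[of w]
      by (auto simp: add_nonneg_eq_0_iff)
    then show ?thesis using h by (simp add: algebra_simps)
  qed
  have near: "dist (x + s *\<^sub>R v + t *\<^sub>R w) x < d" if "0 \<le> s" "s \<le> h" "0 \<le> t" "t \<le> h" for s t
  proof -
    have "norm (s *\<^sub>R v + t *\<^sub>R w) \<le> h * norm v + h * norm w"
      using that by (intro order_trans[OF norm_triangle_ineq] add_mono) (auto intro!: mult_right_mono)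
    then show ?thesis using hd by (simp add: dist_norm algebra_simps)
  qed
  then have sub: "x + s *\<^sub>R v + t *\<^sub>R w \<in> S" if "0 \<le> s" "s \<le> h" "0 \<le> t" "t \<le> h" for s t
    using d3(2) that by (force simp: d_def dist_commute)
  from second_difference_mvt[OF assms(2) h sub] obtain s t where 1: "0 \<le> s" "s \<le> h" "0 \<le> t" "t \<le> h"
    "f (x + h *\<^sub>R v + h *\<^sub>R w) - f (x + h *\<^sub>R v) - f (x + h *\<^sub>R w) + f x = h * (h * A (x + s *\<^sub>R v + t *\<^sub>R w))"
    unfolding A_def by blast
  have sub': "x + t *\<^sub>R w + s *\<^sub>R v \<in> S" if "0 \<le> t" "t \<le> h" "0 \<le> s" "s \<le> h" for s t
    using sub[OF that(3,4,1,2)] by (simp add: add_ac)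
  from second_difference_mvt[OF assms(2) h sub'] obtain s' t' where 2: "0 \<le> s'" "s' \<le> h" "0 \<le> t'" "t' \<le> h"
    "f (x + h *\<^sub>R w + h *\<^sub>R v) - f (x + h *\<^sub>R w) - f (x + h *\<^sub>R v) + f x = h * (h * B (x + t' *\<^sub>R w + s' *\<^sub>R v))"
    unfolding B_def by blast
  have "A (x + s *\<^sub>R v + t *\<^sub>R w) = B (x + s' *\<^sub>R v + t' *\<^sub>R w)"
  proof -
    have "f (x + h *\<^sub>R w + h *\<^sub>R v) = f (x + h *\<^sub>R v + h *\<^sub>R w)" by (simp add: add_ac)
    then have "h * (h * A (x + s *\<^sub>R v + t *\<^sub>R w)) = h * (h * B (x + s' *\<^sub>R v + t' *\<^sub>R w))"
      using 1(5) 2(5) by (simp only: add.assoc add.commute[of "t' *\<^sub>R w"])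
    then show ?thesis using h by simp
  qed
  moreover have "dist (A (x + s *\<^sub>R v + t *\<^sub>R w)) (A x) < ?e"
    using near[OF 1(1-4)] d1(2) by (simp add: d_def)
  moreover have "dist (B (x + s' *\<^sub>R v + t' *\<^sub>R w)) (B x) < ?e"
    using near[OF 2(1-4)] d2(2) by (simp add: d_def)
  ultimately show False using dist_triangle_half_r[of _ "A x" "dist (A x) (B x)" "B x"] by simp
qed

lemma D_D_commute:
  fixes f :: "'a::real_normed_vector \<Rightarrow> 'b::euclidean_space"
  assumes "open S" "smooth_on S f" "x \<in> S"
  shows "D (\<lambda>y. D f y v) x w = D (\<lambda>y. D f y w) x v"
proof (rule euclidean_eqI)
  fix b :: 'b
  have D1: "D (\<lambda>y. k y \<bullet> b) y u = D k y u \<bullet> b" if "smooth_on S k" "y \<in> S" for y u and k :: "'a \<Rightarrow> 'b"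
    by (rule D_eqI[OF has_derivative_inner_left[OF smooth_on_has_derivative[OF that]], THEN fun_cong])
  have D2: "D (\<lambda>y. D (\<lambda>y. f y \<bullet> b) y u) x u' = D (\<lambda>y. D f y u) x u' \<bullet> b" for u u'
    using D_cong_open[OF assms(1,3), of "\<lambda>y. D (\<lambda>y. f y \<bullet> b) y u" "\<lambda>y. D f y u \<bullet> b"]
      D1[OF assms(2)] D1[OF smooth_on_D[OF assms(2)] assms(3)] by simp
  have "smooth_on S (\<lambda>y. f y \<bullet> b)"
    by (rule smooth_on_bounded_linear[OF bounded_linear_inner_left assms(1,2)])
  from D_D_commute_real[OF assms(1) this assms(3), of v w]
  show "D (\<lambda>y. D f y v) x w \<bullet> b = D (\<lambda>y. D f y w) x v \<bullet> b" by (simp add: D2)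
qed

subsection \<open>Ordinary differential equations\<close>

lemma has_vector_derivative_D:
  "f differentiable (at t) \<Longrightarrow> (f has_vector_derivative D f t 1) (at (t::real))"
proof -
  assume f: "f differentiable (at t)"
  have "D f t = (\<lambda>s. s *\<^sub>R D f t 1)"
  proof
    fix s show "D f t s = s *\<^sub>R D f t 1"
      using linear_scale[OF linear_frechet_derivative[OF f], of s 1] by simp
  qed
  then show ?thesis using has_derivative_D[OF f] by (simp add: has_vector_derivative_def)
qed

lemma D_eq_vector_derivative:
  "(f has_vector_derivative v) (at (t::real)) \<Longrightarrow> D f t s = s *\<^sub>R v"
  unfolding has_vector_derivative_def by (simp add: D_eqI)

lemma smooth_on_has_vector_derivative:
  "smooth_on S f \<Longrightarrow> t \<in> S \<Longrightarrow> (f has_vector_derivative D f t 1) (at (t::real))"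
  by (intro has_vector_derivative_D smooth_on_differentiable)

text \<open>Gronwall's argument: exp(- 2 C t) |e t|^2 is nonincreasing and vanishes at
  \<open>a\<close>.\<close>

lemma linear_ode_zero_forward:
  fixes e :: "real \<Rightarrow> 'a::real_inner"
  assumes "\<And>t. a \<le> t \<Longrightarrow> t \<le> b \<Longrightarrow> (e has_vector_derivative e' t) (at t)"
    and "\<And>t. a \<le> t \<Longrightarrow> t \<le> b \<Longrightarrow> norm (e' t) \<le> C * norm (e t)"
    and "e a = 0" "a \<le> b"
  shows "e b = 0"
proof -
  define g where "g = (\<lambda>t. exp (- 2 * C * t) * (e t \<bullet> e t))"
  have "\<exists>y. DERIV g t :> y \<and> y \<le> 0" if t: "a \<le> t" "t \<le> b" for t
  proof (intro exI conjI)
    have ed: "(e has_derivative (\<lambda>s. s *\<^sub>R e' t)) (at t)"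
      using assms(1)[OF t] by (simp add: has_vector_derivative_def)
    have ee: "((\<lambda>t. e t \<bullet> e t) has_real_derivative 2 * (e t \<bullet> e' t)) (at t)"
      unfolding has_field_derivative_def
      by (rule has_derivative_eq_rhs[OF has_derivative_inner[OF ed ed]]) (auto simp: inner_commute)
    show "DERIV g t :> exp (- 2 * C * t) * (- 2 * C) * (e t \<bullet> e t) + 2 * (e t \<bullet> e' t) * exp (- 2 * C * t)"
      unfolding g_def by (rule DERIV_mult[OF _ ee]) (auto intro!: derivative_eq_intros)
    have "e t \<bullet> e' t \<le> norm (e t) * (C * norm (e t))"
      by (rule order_trans[OF norm_cauchy_schwarz mult_left_mono[OF assms(2)[OF t]]]) simp
    then have "e t \<bullet> e' t - C * (e t \<bullet> e t) \<le> 0"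
      by (simp add: dot_square_norm power2_eq_square mult_ac)
    then have "2 * exp (- 2 * C * t) * (e t \<bullet> e' t - C * (e t \<bullet> e t)) \<le> 0"
      by (intro mult_nonneg_nonpos) auto
    then show "exp (- 2 * C * t) * (- 2 * C) * (e t \<bullet> e t) + 2 * (e t \<bullet> e' t) * exp (- 2 * C * t) \<le> 0"
      by (simp add: algebra_simps)
  qed
  from DERIV_nonpos_imp_nonincreasing[OF assms(4) this] have "g b \<le> g a" by blast
  also have "g a = 0" using assms(3) by (simp add: g_def)
  finally have "e b \<bullet> e b \<le> 0" by (simp add: g_def mult_le_0_iff)
  then show ?thesis using inner_ge_zero[of "e b"] by (metis antisym inner_eq_zero_iff)
qed

lemma linear_ode_zero:
  fixes e :: "real \<Rightarrow> 'a::real_inner"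
  assumes "\<And>t. t \<in> ball t0 r \<Longrightarrow> (e has_vector_derivative e' t) (at t)"
    and "\<And>t. t \<in> ball t0 r \<Longrightarrow> norm (e' t) \<le> C * norm (e t)"
    and "e t0 = 0" "t \<in> ball t0 r"
  shows "e t = 0"
proof (cases "t0 \<le> t")
  case True
  show ?thesis
    by (rule linear_ode_zero_forward[of t0 t e e' C]) (use assms True in \<open>auto simp: dist_real_def\<close>)
next
  case False
  have d: "((\<lambda>s. e (- s)) has_vector_derivative - e' (- s)) (at s)" if "- s \<in> ball t0 r" for s
  proof -
    have "(uminus has_vector_derivative - 1) (at s)"
      unfolding has_vector_derivative_def by (auto intro!: derivative_eq_intros)
    from vector_diff_chain_at[OF this assms(1)[OF that]] show ?thesis by (simp add: o_def)
  qed
  have "e (- (- t)) = 0"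
    by (rule linear_ode_zero_forward[of "- t0" "- t" "\<lambda>s. e (- s)" "\<lambda>s. - e' (- s)" C])
      (use assms False d in \<open>auto simp: dist_real_def\<close>)
  then show ?thesis by simp
qed

lemma smooth_on_lipschitz_cball:
  fixes F :: "'a::euclidean_space \<Rightarrow> 'b::real_normed_vector"
  assumes "smooth_on S F" "cball x R \<subseteq> S"
  obtains L where "L \<ge> 0" "\<And>y z. y \<in> cball x R \<Longrightarrow> z \<in> cball x R \<Longrightarrow> norm (F y - F z) \<le> L * norm (y - z)"
proof -
  have "\<exists>B. \<forall>y\<in>cball x R. norm (D F y b) \<le> B" for b
    using compact_continuous_image[OF continuous_on_subset[OF smooth_on_continuous[OF smooth_on_D[OF assms(1)]] assms(2)] compact_cball, THEN compact_imp_bounded]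
    by (auto simp: bounded_iff)
  then obtain B where B: "\<And>b y. y \<in> cball x R \<Longrightarrow> norm (D F y b) \<le> B b" by metis
  define L where "L = (\<Sum>b\<in>Basis. \<bar>B b\<bar>)"
  have "norm (F y - F z) \<le> L * norm (y - z)" if yz: "y \<in> cball x R" "z \<in> cball x R" for y z
  proof (rule differentiable_bound[OF convex_cball _ _ yz])
    fix u assume u: "u \<in> cball x R"
    show "(F has_derivative D F u) (at u within cball x R)"
      using u assms(2) by (auto intro!: has_derivative_at_withinI smooth_on_has_derivative[OF assms(1)])
    show "onorm (D F u) \<le> L"
    proof (rule onorm_bound)
      show "0 \<le> L" by (simp add: L_def sum_nonneg)
      fix v
      have "norm (D F u v) = norm (\<Sum>b\<in>Basis. (v \<bullet> b) *\<^sub>R D F u b)"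
        by (rule arg_cong[OF D_euclidean]) (use u assms in \<open>auto intro!: smooth_on_differentiable[OF assms(1)]\<close>)
      also have "\<dots> \<le> (\<Sum>b\<in>Basis. norm v * \<bar>B b\<bar>)"
      proof (rule order_trans[OF norm_sum sum_mono])
        fix b :: 'a assume b: "b \<in> Basis"
        show "norm ((v \<bullet> b) *\<^sub>R D F u b) \<le> norm v * \<bar>B b\<bar>"
          unfolding norm_scaleR using B[OF u, of b] Basis_le_norm[OF b, of v] by (intro mult_mono) auto
      qed
      also have "\<dots> = L * norm v" by (simp add: L_def sum_distrib_left mult_ac)
      finally show "norm (D F u v) \<le> L * norm v" .
    qed
  qed
  moreover have "L \<ge> 0" by (simp add: L_def sum_nonneg)
  ultimately show thesis using that by blast
qed

text \<open>The solution is a fixed point of the integral operator on bounded continuous functions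
  on the line, a contraction with constant L r, at most 1/2. Times are clamped to [- r, r] by
  \<open>cl\<close>, so that every iterate is bounded and defined on the whole line.\<close>

lemma picard_global:
  fixes G :: "'a::euclidean_space \<Rightarrow> 'a"
  assumes lip: "\<And>y z. norm (G y - G z) \<le> L * norm (y - z)" and bd: "\<And>y. norm (G y) \<le> M"
    and r: "r > 0" "L * r \<le> 1/2" "L \<ge> 0"
  obtains x :: "real \<Rightarrow> 'a" where "x 0 = x0" "\<And>t. t \<in> ball 0 r \<Longrightarrow> (x has_vector_derivative G (x t)) (at t)"
proof -
  \<comment> \<open>The integral starts at - r so that \<open>J\<close> can be differentiated on
    both sides of 0; subtracting \<open>J \<psi> 0\<close> moves the initial time to 0.\<close>
  define J where "J = (\<lambda>(\<psi>::real \<Rightarrow>\<^sub>C 'a) t. integral {-r..t} (\<lambda>s. G (apply_bcontfun \<psi> s)))"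
  have contG: "continuous_on UNIV G"
  proof (rule continuous_on_iff[THEN iffD2], intro ballI allI impI)
    fix y and e :: real assume "e > 0"
    have "dist (G z) (G y) < e" if "dist z y < e / (L + 1)" for z
    proof -
      have "dist (G z) (G y) \<le> L * dist z y" using lip by (simp add: dist_norm)
      also have "\<dots> \<le> (L + 1) * dist z y" by (simp add: mult_right_mono)
      also have "\<dots> < e" using that r(3) by (simp add: field_simps pos_less_divide_eq)
      finally show ?thesis .
    qed
    then show "\<exists>d>0. \<forall>z\<in>UNIV. dist z y < d \<longrightarrow> dist (G z) (G y) < e"
      using \<open>e > 0\<close> r(3) by (intro exI[of _ "e / (L + 1)"]) auto
  qed
  have Jd: "(J \<psi> has_vector_derivative G (apply_bcontfun \<psi> t)) (at t within {-r..r})" if "t \<in> {-r..r}" for \<psi> t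
  proof -
    have "continuous_on {-r..r} (\<lambda>s. G (apply_bcontfun \<psi> s))"
      using continuous_on_compose2[OF contG continuous_on_apply_bcontfun[of "{-r..r}" \<psi>]] by simp
    from integral_has_vector_derivative[OF this that] show ?thesis unfolding J_def .
  qed
  define cl where "cl = (\<lambda>t. max (-r) (min r t))"
  have cl: "cl t \<in> {-r..r}" "continuous_on UNIV cl" for t
    using r by (auto simp: cl_def intro!: continuous_intros)
  have cl_id: "cl t = t" if "t \<in> {-r..r}" for t using that by (auto simp: cl_def)
  define \<Phi> where "\<Phi> = (\<lambda>\<psi>. Bcontfun (\<lambda>t. x0 + (J \<psi> (cl t) - J \<psi> 0)))"
  have contJ: "continuous_on {-r..r} (J \<psi>)" for \<psi>
    unfolding continuous_on_eq_continuous_within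
    by (rule ballI, rule has_vector_derivative_continuous[OF Jd])
  have Phi: "apply_bcontfun (\<Phi> \<psi>) t = x0 + (J \<psi> (cl t) - J \<psi> 0)" for \<psi> t
  proof -
    have "compact (J \<psi> ` {-r..r})" by (rule compact_continuous_image[OF contJ]) simp
    then obtain b where b: "\<And>u. u \<in> {-r..r} \<Longrightarrow> norm (J \<psi> u) \<le> b"
      using compact_imp_bounded[of "J \<psi> ` {-r..r}"] unfolding bounded_iff by blast
    have "(\<lambda>t. x0 + (J \<psi> (cl t) - J \<psi> 0)) \<in> bcontfun"
    proof (rule bcontfun_normI)
      show "continuous_on UNIV (\<lambda>t. x0 + (J \<psi> (cl t) - J \<psi> 0))"
        using cl by (intro continuous_intros continuous_on_compose2[OF contJ]) auto
      fix t
      have "norm (x0 + (J \<psi> (cl t) - J \<psi> 0)) \<le> norm x0 + (norm (J \<psi> (cl t)) + norm (J \<psi> 0))"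
        by (intro norm_triangle_le norm_triangle_le_diff add_left_mono) simp
      also have "\<dots> \<le> norm x0 + (b + b)" using cl(1) r(1) by (intro add_left_mono add_mono b) auto
      finally show "norm (x0 + (J \<psi> (cl t) - J \<psi> 0)) \<le> norm x0 + (b + b)" .
    qed
    then show ?thesis by (simp add: \<Phi>_def Bcontfun_inverse)
  qed
  have "\<exists>!\<psi>. \<Phi> \<psi> = \<psi>"
  proof (rule banach_fix_type[of "1/2"], simp, simp, intro allI dist_bound)
    fix \<psi> \<psi>' t
    define Df where "Df = (\<lambda>t. J \<psi> t - J \<psi>' t)"
    have "norm (Df (cl t) - Df 0) \<le> (L * dist \<psi> \<psi>') * norm (cl t - 0)"
    proof (rule differentiable_bound[of "{-r..r}"])
      fix s assume s: "s \<in> {-r..r}"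
      show "(Df has_derivative (\<lambda>h. h *\<^sub>R (G (apply_bcontfun \<psi> s) - G (apply_bcontfun \<psi>' s)))) (at s within {-r..r})"
        using has_vector_derivative_diff[OF Jd[OF s, of \<psi>] Jd[OF s, of \<psi>']]
        by (simp add: Df_def has_vector_derivative_def)
      have "norm (G (apply_bcontfun \<psi> s) - G (apply_bcontfun \<psi>' s)) \<le> L * dist \<psi> \<psi>'"
        using dist_bounded[of \<psi> s \<psi>'] by (intro order_trans[OF lip mult_left_mono[OF _ r(3)]]) (simp add: dist_norm)
      then show "onorm (\<lambda>h. h *\<^sub>R (G (apply_bcontfun \<psi> s) - G (apply_bcontfun \<psi>' s))) \<le> L * dist \<psi> \<psi>'"
        by (intro onorm_bound) (auto simp: mult.commute[of "L * dist \<psi> \<psi>'"] intro!: mult_left_mono mult_nonneg_nonneg r)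
    qed (use cl r in auto)
    also have "\<dots> \<le> L * dist \<psi> \<psi>' * r"
      using cl(1)[of t] r by (intro mult_left_mono mult_nonneg_nonneg) auto
    also have "\<dots> = (L * r) * dist \<psi> \<psi>'" by simp
    also have "\<dots> \<le> 1/2 * dist \<psi> \<psi>'" using r(2) by (rule mult_right_mono) simp
    finally show "dist (apply_bcontfun (\<Phi> \<psi>) t) (apply_bcontfun (\<Phi> \<psi>') t) \<le> 1/2 * dist \<psi> \<psi>'"
      by (simp add: Phi Df_def dist_norm algebra_simps)
  qed
  then obtain \<psi> where \<psi>: "\<Phi> \<psi> = \<psi>" by blast
  define x where "x = (\<lambda>t. x0 + (J \<psi> t - J \<psi> 0))"
  have x\<psi>: "x t = apply_bcontfun \<psi> t" if "t \<in> {-r..r}" for t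
    using Phi[of \<psi> t] cl_id[OF that] by (simp add: \<psi> x_def)
  show thesis
  proof
    show "x 0 = x0" by (simp add: x_def)
    fix t :: real assume t: "t \<in> ball 0 r"
    then have t': "t \<in> {-r..r}" and ti: "t \<in> interior {-r..r}" by (auto simp: dist_real_def)
    have "(J \<psi> has_vector_derivative G (apply_bcontfun \<psi> t)) (at t)"
      using Jd[OF t', of \<psi>] by (simp add: at_within_interior[OF ti])
    then show "(x has_vector_derivative G (x t)) (at t)"
      unfolding x\<psi>[OF t'] unfolding x_def by (auto intro!: derivative_eq_intros)
  qed
qed

text \<open>Bootstrapping: if \<open>x\<close> is C^k, so is its derivative F(x), and
  \<open>x\<close> gains one order.\<close>

lemma ode_solution_smooth:
  fixes F :: "'a::euclidean_space \<Rightarrow> 'a"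
  assumes "open S" "smooth_on S F" "open T"
    and d: "\<And>t. t \<in> T \<Longrightarrow> x t \<in> S \<and> (x has_vector_derivative F (x t)) (at t)"
  shows "smooth_on T x"
  unfolding smooth_on_def
proof
  fix k show "Ck_on k T x"
  proof (induction k)
    case 0
    have "isCont x t" if "t \<in> T" for t
      using d[OF that, THEN conjunct2] by (rule has_vector_derivative_continuous)
    then show ?case by (simp add: continuous_at_imp_continuous_on)
  next
    case (Suc k)
    have "Ck_on k T (\<lambda>t. F (x t))"
      by (rule Ck_on_compose[OF assms(3,1) assms(2)[unfolded smooth_on_def, rule_format] Suc.IH]) (use d in blast)
    then have "Ck_on k T (\<lambda>t. s *\<^sub>R F (x t))" for s
      by (rule Ck_on_bounded_linear[OF bounded_linear_scaleR_right assms(3)])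
    then have "Ck_on k T (\<lambda>t. D x t s)" for s
      by (rule Ck_on_cong[OF assms(3), rotated]) (rule D_eq_vector_derivative[symmetric], use d in blast)
    moreover have "x differentiable (at t)" if "t \<in> T" for t
      using d[OF that] unfolding differentiable_def has_vector_derivative_def by blast
    ultimately show ?case by simp
  qed
qed

text \<open>\<open>picard_global\<close> wants a bounded, globally Lipschitz field. \<open>F\<close>
  is therefore composed with the nearest-point projection onto a closed ball, which does not
  increase distances. For times below R / M the solution stays in the ball, where the projection is
  the identity.\<close>

lemma ode_local_solution:
  fixes F :: "'a::euclidean_space \<Rightarrow> 'a"
  assumes "open S" "smooth_on S F" "x0 \<in> S"
  obtains r and x :: "real \<Rightarrow> 'a" where "r > 0" "x 0 = x0" "smooth_on (ball 0 r) x"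
    "\<And>t. t \<in> ball 0 r \<Longrightarrow> x t \<in> S \<and> (x has_vector_derivative F (x t)) (at t)"
proof -
  obtain R where R: "R > 0" "cball x0 R \<subseteq> S" using assms(1,3) open_contains_cball by blast
  obtain L where L: "L \<ge> 0" "\<And>y z. y \<in> cball x0 R \<Longrightarrow> z \<in> cball x0 R \<Longrightarrow> norm (F y - F z) \<le> L * norm (y - z)"
    using smooth_on_lipschitz_cball[OF assms(2) R(2), of thesis] by simp
  have "bounded (F ` cball x0 R)"
    by (intro compact_imp_bounded compact_continuous_image compact_cball
        continuous_on_subset[OF smooth_on_continuous[OF assms(2)] R(2)])
  then obtain M where M: "M > 0" "\<And>y. y \<in> cball x0 R \<Longrightarrow> norm (F y) \<le> M"
    unfolding bounded_pos by (meson imageI)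
  define c where "c = closest_point (cball x0 R)"
  have c: "c y \<in> cball x0 R" for y unfolding c_def by (rule closest_point_in_set) (use R in auto)
  have c_id: "c y = y" if "y \<in> cball x0 R" for y unfolding c_def using that by (rule closest_point_self)
  \<comment> \<open>The first bound gives L r at most 1/2 also for L = 0; the second confines the
    solution to the ball of radius \<open>R\<close>.\<close>
  define r where "r = min (1 / (2 * (L + 1))) (R / M)"
  have r: "r > 0" using L(1) M(1) R(1) by (simp add: r_def)
  have "L * r \<le> L * (1 / (2 * (L + 1)))" unfolding r_def using L(1) by (intro mult_left_mono) auto
  also have "\<dots> \<le> 1/2" using L(1) by (simp add: field_simps)
  finally have Lr: "L * r \<le> 1/2" .
  have "norm (c y - c z) \<le> norm (y - z)" for y z
    using closest_point_lipschitz[of "cball x0 R" y z] R(1) by (simp add: c_def dist_norm)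
  then have lip: "norm (F (c y) - F (c z)) \<le> L * norm (y - z)" for y z
    by (intro order_trans[OF L(2)[OF c c] mult_left_mono[OF _ L(1)]])
  obtain x :: "real \<Rightarrow> 'a" where x: "x 0 = x0" "\<And>t. t \<in> ball 0 r \<Longrightarrow> (x has_vector_derivative F (c (x t))) (at t)"
    using picard_global[of "\<lambda>y. F (c y)", OF lip M(2)[OF c] r Lr L(1), of x0 thesis] by simp
  have xin: "x t \<in> cball x0 R" if t: "t \<in> ball 0 r" for t
  proof -
    have "norm (x t - x 0) \<le> M * norm (t - 0)"
    proof (rule differentiable_bound[of "ball 0 r"])
      fix s :: real assume "s \<in> ball 0 r"
      then show "(x has_derivative (\<lambda>h. h *\<^sub>R F (c (x s)))) (at s within ball 0 r)"
        using x(2) by (auto simp: has_vector_derivative_def intro: has_derivative_at_withinI)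
      show "onorm (\<lambda>h. h *\<^sub>R F (c (x s))) \<le> M"
        using M(1) by (intro onorm_bound) (auto simp: mult.commute[of M] intro!: mult_left_mono M(2)[OF c])
    qed (use t r in auto)
    also have "\<dots> \<le> M * r" using t M(1) by (intro mult_left_mono) auto
    also have "\<dots> \<le> M * (R / M)" unfolding r_def using M(1) by (intro mult_left_mono) auto
    also have "\<dots> = R" using M(1) by simp
    finally show ?thesis using x(1) by (simp add: dist_norm norm_minus_commute)
  qed
  have sol: "x t \<in> S \<and> (x has_vector_derivative F (x t)) (at t)" if "t \<in> ball 0 r" for t
    using x(2)[OF that] R(2) xin[OF that] unfolding c_id[OF xin[OF that]] by blast
  have "smooth_on (ball 0 r) x" by (rule ode_solution_smooth[OF assms(1,2) open_ball sol])
  then show thesis by (rule that[of r x, OF r x(1) _ sol])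
qed

subsection \<open>Smooth maps from Euclidean spaces into manifolds\<close>

text \<open>The part of being a manifold that passes at once to products. It is enough for composing
  plots with group multiplication, a map on a product manifold.\<close>

definition charted :: "('m, 'e::euclidean_space) manifold \<Rightarrow> bool" where
  "charted M \<longleftrightarrow> (\<forall>p\<in>points M. p \<in> chart_dom M p \<and> chart_dom M p \<subseteq> points M \<and>
     inj_on (chart M p) (chart_dom M p) \<and> open (chart M p ` chart_dom M p))"

text \<open>Smooth maps from open Euclidean sets, tested in all preferred charts. Curves, variations
  with two parameters and inverse charts are all plots, so differentiation takes place on Euclidean
  spaces and \<open>pd\<close> refers the result to the preferred chart at the image point.\<close>

definition plot :: "('m, 'e::euclidean_space) manifold \<Rightarrow> 'c::euclidean_space set \<Rightarrow> ('c \<Rightarrow> 'm) \<Rightarrow> bool" where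
  "plot M S f \<longleftrightarrow> open S \<and> f ` S \<subseteq> points M \<and>
     (\<forall>p\<in>points M. open {x\<in>S. f x \<in> chart_dom M p} \<and>
        smooth_on {x\<in>S. f x \<in> chart_dom M p} (\<lambda>x. chart M p (f x)))"

definition pd :: "('m, 'e::euclidean_space) manifold \<Rightarrow> ('c::euclidean_space \<Rightarrow> 'm) \<Rightarrow> 'c \<Rightarrow> 'c \<Rightarrow> 'e" where
  "pd M f x = D (\<lambda>y. chart M (f x) (f y)) x"

lemma smooth_manifold_charted: "smooth_manifold M \<Longrightarrow> charted M"
  by (simp add: smooth_manifold_def charted_def)

lemma chartedD:
  assumes "charted M" "p \<in> points M"
  shows "p \<in> chart_dom M p" "chart_dom M p \<subseteq> points M" "inj_on (chart M p) (chart_dom M p)"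
    "open (chart M p ` chart_dom M p)"
  using assms by (auto simp: charted_def)

lemma chart_inv_chart: "charted M \<Longrightarrow> p \<in> points M \<Longrightarrow> r \<in> chart_dom M p \<Longrightarrow> chart_inv M p (chart M p r) = r"
  unfolding chart_inv_def by (rule inv_into_f_f[OF chartedD(3)])

lemma chart_chart_inv:
  "x \<in> chart M p ` chart_dom M p \<Longrightarrow> chart M p (chart_inv M p x) = x"
  "x \<in> chart M p ` chart_dom M p \<Longrightarrow> chart_inv M p x \<in> chart_dom M p"
  unfolding chart_inv_def by (simp_all add: f_inv_into_f inv_into_into)

lemma plotD:
  assumes "plot M S f"
  shows "open S" "x \<in> S \<Longrightarrow> f x \<in> points M"
    "p \<in> points M \<Longrightarrow> open {x\<in>S. f x \<in> chart_dom M p}"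
    "p \<in> points M \<Longrightarrow> smooth_on {x\<in>S. f x \<in> chart_dom M p} (\<lambda>x. chart M p (f x))"
  using assms unfolding plot_def by auto

lemma plot_chart_differentiable:
  assumes "plot M S f" "x \<in> S" "p \<in> points M" "f x \<in> chart_dom M p"
  shows "(\<lambda>x. chart M p (f x)) differentiable (at x)"
  using smooth_on_differentiable[OF plotD(4)[OF assms(1,3)]] assms by simp

lemma smooth_transition:
  assumes "smooth_manifold M" "p \<in> points M" "q \<in> points M"
  shows "open (chart M p ` (chart_dom M p \<inter> chart_dom M q))"
    "smooth_on (chart M p ` (chart_dom M p \<inter> chart_dom M q)) (\<lambda>x. chart M q (chart_inv M p x))"
  using assms by (auto simp: smooth_manifold_def comp_def)

lemma tangent_change_eq: "tangent_change M p q r = D (\<lambda>x. chart M q (chart_inv M p x)) (chart M p r)"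
  by (simp add: tangent_change_def comp_def)

lemma transition_differentiable:
  assumes "smooth_manifold M" "p \<in> points M" "q \<in> points M" "r \<in> chart_dom M p" "r \<in> chart_dom M q"
  shows "(\<lambda>x. chart M q (chart_inv M p x)) differentiable (at (chart M p r))"
  by (rule smooth_on_differentiable[OF smooth_transition(2)[OF assms(1-3)]]) (use assms in blast)

lemma linear_tangent_change:
  assumes "smooth_manifold M" "p \<in> points M" "q \<in> points M" "r \<in> chart_dom M p" "r \<in> chart_dom M q"
  shows "linear (tangent_change M p q r)"
  unfolding tangent_change_eq by (rule linear_frechet_derivative[OF transition_differentiable[OF assms]])

lemma D_chart_plot_change:
  assumes M: "smooth_manifold M" and f: "plot M S f" "x \<in> S"
    and p: "p \<in> points M" "f x \<in> chart_dom M p" and q: "q \<in> points M" "f x \<in> chart_dom M q"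
  shows "D (\<lambda>y. chart M p (f y)) x v = tangent_change M q p (f x) (D (\<lambda>y. chart M q (f y)) x v)"
proof -
  let ?T = "{y\<in>S. f y \<in> chart_dom M p} \<inter> {y\<in>S. f y \<in> chart_dom M q}"
  note c = smooth_manifold_charted[OF M]
  have T: "open ?T" "x \<in> ?T" using plotD(3)[OF f(1)] p q f(2) by auto
  have "D (\<lambda>y. chart M p (f y)) x = D (\<lambda>y. chart M p (chart_inv M q (chart M q (f y)))) x"
    by (rule D_cong_open[OF T]) (simp add: chart_inv_chart[OF c q(1)])
  then show ?thesis
    using D_compose[OF transition_differentiable[OF M q(1) p(1) q(2) p(2)] plot_chart_differentiable[OF f q]]
    by (simp add: tangent_change_eq)
qed

lemma D_chart_plot:
  assumes "smooth_manifold M" "plot M S f" "x \<in> S" "p \<in> points M" "f x \<in> chart_dom M p"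
  shows "D (\<lambda>y. chart M p (f y)) x v = tangent_change M (f x) p (f x) (pd M f x v)"
  unfolding pd_def using plotD(2)[OF assms(2,3)] chartedD(1)[OF smooth_manifold_charted[OF assms(1)]]
  by (intro D_chart_plot_change[OF assms]) auto

lemma pd_eq_tangent_change:
  assumes "smooth_manifold M" "plot M S f" "x \<in> S" "p \<in> points M" "f x \<in> chart_dom M p"
  shows "pd M f x v = tangent_change M p (f x) (f x) (D (\<lambda>y. chart M p (f y)) x v)"
  unfolding pd_def using plotD(2)[OF assms(2,3)] chartedD(1)[OF smooth_manifold_charted[OF assms(1)]]
  by (intro D_chart_plot_change[OF assms(1-3) _ _ assms(4,5)]) auto

lemma plot_cong: "plot M S f \<Longrightarrow> (\<And>x. x \<in> S \<Longrightarrow> f x = g x) \<Longrightarrow> plot M S g"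
proof -
  assume f: "plot M S f" and fg: "\<And>x. x \<in> S \<Longrightarrow> f x = g x"
  have e: "{x\<in>S. g x \<in> chart_dom M p} = {x\<in>S. f x \<in> chart_dom M p}" for p using fg by auto
  show ?thesis unfolding plot_def e
  proof (intro conjI ballI plotD(1)[OF f] plotD(3)[OF f])
    show "g ` S \<subseteq> points M" using plotD(2)[OF f] fg by auto
    fix p assume p: "p \<in> points M"
    show "smooth_on {x\<in>S. f x \<in> chart_dom M p} (\<lambda>x. chart M p (g x))"
      by (rule smooth_on_cong[OF plotD(3)[OF f p] _ plotD(4)[OF f p]]) (simp add: fg)
  qed
qed

lemma plot_compose:
  assumes f: "plot M S f" and h: "smooth_on T h" "open T" "h ` T \<subseteq> S"
  shows "plot M T (\<lambda>x. f (h x))"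
  unfolding plot_def
proof (intro conjI ballI h(2))
  show "(\<lambda>x. f (h x)) ` T \<subseteq> points M" using plotD(2)[OF f] h(3) by auto
  fix p assume p: "p \<in> points M"
  have e: "{x\<in>T. f (h x) \<in> chart_dom M p} = T \<inter> h -` {x\<in>S. f x \<in> chart_dom M p}" using h(3) by auto
  show o: "open {x\<in>T. f (h x) \<in> chart_dom M p}"
    unfolding e by (rule continuous_open_preimage[OF smooth_on_continuous[OF h(1)] h(2) plotD(3)[OF f p]])
  show "smooth_on {x\<in>T. f (h x) \<in> chart_dom M p} (\<lambda>x. chart M p (f (h x)))"
    by (rule smooth_on_compose[OF o plotD(3)[OF f p] plotD(4)[OF f p] smooth_on_subset[OF h(1)]]) (use h(3) in auto)
qed

lemma plot_subset: "plot M S f \<Longrightarrow> open T \<Longrightarrow> T \<subseteq> S \<Longrightarrow> plot M T f"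
  using plot_compose[of M S f T "\<lambda>x. x"] smooth_on_id by auto

lemma pd_compose:
  assumes "smooth_manifold M" "plot M S f" "h x \<in> S" "h differentiable (at x)"
  shows "pd M (\<lambda>x. f (h x)) x v = pd M f (h x) (D h x v)"
  unfolding pd_def
  by (rule D_compose[OF plot_chart_differentiable[OF assms(2,3)] assms(4)])
    (use plotD(2)[OF assms(2,3)] chartedD(1)[OF smooth_manifold_charted[OF assms(1)]] in auto)

lemma linear_pd:
  assumes "smooth_manifold M" "plot M S f" "x \<in> S"
  shows "linear (pd M f x)"
  unfolding pd_def
  by (rule linear_frechet_derivative[OF plot_chart_differentiable[OF assms(2,3)]])
    (use plotD(2)[OF assms(2,3)] chartedD(1)[OF smooth_manifold_charted[OF assms(1)]] in auto)

lemma plot_local: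
  assumes "\<And>x. x \<in> S \<Longrightarrow> \<exists>T. x \<in> T \<and> T \<subseteq> S \<and> plot M T f"
  shows "plot M S f"
  unfolding plot_def
proof (intro conjI ballI)
  show "open S"
  using open_subopen assms plotD(1) by meson
  show "f ` S \<subseteq> points M"
  using assms plotD(2) by blast
  fix p assume p: "p \<in> points M"
  show "open {x\<in>S. f x \<in> chart_dom M p}"
  using open_subopen assms plotD(3) p by fast
  show "smooth_on {x\<in>S. f x \<in> chart_dom M p} (\<lambda>x. chart M p (f x))"
  proof (rule smooth_on_local)
    fix x assume x: "x \<in> {x\<in>S. f x \<in> chart_dom M p}"
    then obtain T where T: "x \<in> T" "T \<subseteq> S" "plot M T f" using assms by blast
    show "\<exists>U. open U \<and> x \<in> U \<and> smooth_on U (\<lambda>x. chart M p (f x))"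
      by (rule exI[of _ "{x\<in>T. f x \<in> chart_dom M p}"]) (use T x plotD(3,4)[OF T(3) p] in auto)
  qed
qed

lemma plot_chart_inv:
  assumes M: "smooth_manifold M" and p: "p \<in> points M"
  shows "plot M (chart M p ` chart_dom M p) (chart_inv M p)"
  unfolding plot_def
proof (intro conjI ballI)
  note c = smooth_manifold_charted[OF M]
  show "open (chart M p ` chart_dom M p)" by (rule chartedD(4)[OF c p])
  show "chart_inv M p ` chart M p ` chart_dom M p \<subseteq> points M"
  proof
    fix y assume "y \<in> chart_inv M p ` chart M p ` chart_dom M p"
    then obtain r where "r \<in> chart_dom M p" "y = chart_inv M p (chart M p r)" by blast
    then show "y \<in> points M" using chart_inv_chart[OF c p, of r] chartedD(2)[OF c p] by auto
  qed
  fix q assume q: "q \<in> points M"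
  have e: "{x \<in> chart M p ` chart_dom M p. chart_inv M p x \<in> chart_dom M q} =
    chart M p ` (chart_dom M p \<inter> chart_dom M q)" (is "?L = ?R")
  proof (rule equalityI; rule subsetI)
    fix x assume "x \<in> ?L"
    then show "x \<in> ?R" using chart_chart_inv[of x M p] by (intro image_eqI[of x _ "chart_inv M p x"]) auto
  next
    fix x assume "x \<in> ?R"
    then obtain r where "r \<in> chart_dom M p" "r \<in> chart_dom M q" "x = chart M p r" by blast
    then show "x \<in> ?L" using chart_inv_chart[OF c p, of r] by simp
  qed
  show "open {x \<in> chart M p ` chart_dom M p. chart_inv M p x \<in> chart_dom M q}"
    "smooth_on {x \<in> chart M p ` chart_dom M p. chart_inv M p x \<in> chart_dom M q} (\<lambda>x. chart M q (chart_inv M p x))"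
    by (simp_all add: e smooth_transition[OF M p q])
qed

lemma pd_chart_inv:
  assumes M: "smooth_manifold M" and p: "p \<in> points M"
  shows "pd M (chart_inv M p) (chart M p p) v = v"
proof -
  note c = smooth_manifold_charted[OF M]
  have e: "chart_inv M p (chart M p p) = p" using chart_inv_chart[OF c p chartedD(1)[OF c p]] .
  have "D (\<lambda>y. chart M p (chart_inv M p y)) (chart M p p) = D (\<lambda>y. y) (chart M p p)"
    by (rule D_cong_open[OF chartedD(4)[OF c p] imageI[OF chartedD(1)[OF c p]]]) (rule chart_chart_inv(1))
  then show ?thesis unfolding pd_def e by (simp add: frechet_derivative_ident)
qed

lemma differential_eq_pd:
  assumes "charted M" "p \<in> points M"
  shows "differential M N F p = pd N (\<lambda>x. F (chart_inv M p x)) (chart M p p)"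
  using chart_inv_chart[OF assms chartedD(1)[OF assms]] by (simp add: differential_def pd_def comp_def)

text \<open>Near \<open>x\<close> the composition factors through the preferred chart at
  \<open>f x\<close>. Injectivity of that chart ensures that the local parameter set really consists
  of points that \<open>F\<close> sends into the target chart domain.\<close>

lemma plot_map:
  assumes M: "charted M" and F: "smooth_map M N F" and f: "plot M S f"
  shows "plot N S (\<lambda>x. F (f x))"
  unfolding plot_def
proof (intro conjI ballI plotD(1)[OF f])
  have F1: "F ` points M \<subseteq> points N" and F2: "\<forall>p\<in>points M. \<forall>q\<in>points N.
      open (chart M p ` {r \<in> chart_dom M p. F r \<in> chart_dom N q}) \<and>
      smooth_on (chart M p ` {r \<in> chart_dom M p. F r \<in> chart_dom N q}) (\<lambda>y. chart N q (F (chart_inv M p y)))"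
    using F unfolding smooth_map_def comp_def by simp_all
  show "(\<lambda>x. F (f x)) ` S \<subseteq> points N" using F1 plotD(2)[OF f] by blast
  fix q assume q: "q \<in> points N"
  have loc: "\<exists>T. open T \<and> x \<in> T \<and> T \<subseteq> {x\<in>S. F (f x) \<in> chart_dom N q} \<and> smooth_on T (\<lambda>x. chart N q (F (f x)))"
    if x: "x \<in> S" "F (f x) \<in> chart_dom N q" for x
  proof -
    let ?p = "f x"
    have p: "?p \<in> points M" using plotD(2)[OF f x(1)] .
    let ?C = "chart M ?p ` {r \<in> chart_dom M ?p. F r \<in> chart_dom N q}"
    have C: "open ?C" "smooth_on ?C (\<lambda>y. chart N q (F (chart_inv M ?p y)))"
      using F2[rule_format, OF p q] by simp_all
    let ?A = "{y\<in>S. f y \<in> chart_dom M ?p}"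
    let ?T = "?A \<inter> (\<lambda>y. chart M ?p (f y)) -` ?C"
    have inv: "chart_inv M ?p (chart M ?p (f y)) = f y" if "y \<in> ?A" for y
      using that chart_inv_chart[OF M p] by simp
    have T: "open ?T"
      by (rule continuous_open_preimage[OF smooth_on_continuous[OF plotD(4)[OF f p]] plotD(3)[OF f p] C(1)])
    have "x \<in> ?A" "chart M ?p (f x) \<in> ?C" using x chartedD(1)[OF M p] by simp_all
    then have xT: "x \<in> ?T" by simp
    have sub: "?T \<subseteq> {x\<in>S. F (f x) \<in> chart_dom N q}"
    proof
      fix y assume y: "y \<in> ?T"
      then obtain r where r: "r \<in> chart_dom M ?p" "F r \<in> chart_dom N q" "chart M ?p (f y) = chart M ?p r" by auto
      then have "f y = r" using inj_onD[OF chartedD(3)[OF M p] r(3)] y by simp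
      then show "y \<in> {x\<in>S. F (f x) \<in> chart_dom N q}" using y r by simp
    qed
    have "smooth_on ?T (\<lambda>y. chart N q (F (chart_inv M ?p (chart M ?p (f y)))))"
      by (rule smooth_on_compose[OF T C smooth_on_subset[OF plotD(4)[OF f p]]]) auto
    then have "smooth_on ?T (\<lambda>x. chart N q (F (f x)))"
      by (rule smooth_on_cong[OF T, rotated]) (simp add: inv)
    then show ?thesis using T xT sub by blast
  qed
  show "open {x\<in>S. F (f x) \<in> chart_dom N q}"
    by (subst open_subopen) (use loc in blast)
  show "smooth_on {x\<in>S. F (f x) \<in> chart_dom N q} (\<lambda>x. chart N q (F (f x)))"
  proof (rule smooth_on_local)
    fix x assume "x \<in> {x\<in>S. F (f x) \<in> chart_dom N q}"
    then show "\<exists>T. open T \<and> x \<in> T \<and> smooth_on T (\<lambda>x. chart N q (F (f x)))" using loc[of x] by blast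
  qed
qed

lemma plot_map_chart_inv:
  assumes "smooth_manifold M" "smooth_map M N F" "p \<in> points M"
  shows "plot N (chart M p ` chart_dom M p) (\<lambda>x. F (chart_inv M p x))"
  by (rule plot_map[OF smooth_manifold_charted[OF assms(1)] assms(2) plot_chart_inv[OF assms(1,3)]])

lemma chart_self_mem: "charted M \<Longrightarrow> p \<in> points M \<Longrightarrow> chart M p p \<in> chart M p ` chart_dom M p"
  by (rule imageI[OF chartedD(1)])

lemma pd_map:
  assumes M: "smooth_manifold M" and N: "smooth_manifold N" and F: "smooth_map M N F" and f: "plot M S f" "x \<in> S"
  shows "pd N (\<lambda>x. F (f x)) x v = differential M N F (f x) (pd M f x v)"
proof -
  note c = smooth_manifold_charted[OF M]
  have p: "f x \<in> points M" using plotD(2)[OF f] .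
  have fd: "f x \<in> chart_dom M (f x)" using chartedD(1)[OF c p] .
  let ?T = "{y\<in>S. f y \<in> chart_dom M (f x)}"
  have T: "open ?T" "x \<in> ?T" using plotD(3)[OF f(1) p] fd f(2) by auto
  have inv: "chart_inv M (f x) (chart M (f x) (f y)) = f y" if "y \<in> ?T" for y
    using that chart_inv_chart[OF c p] by simp
  have "pd N (\<lambda>y. F (chart_inv M (f x) (chart M (f x) (f y)))) x v =
    pd N (\<lambda>y. F (chart_inv M (f x) y)) (chart M (f x) (f x)) (pd M f x v)"
    unfolding pd_def[of M] using plot_map_chart_inv[OF M F p] chart_self_mem[OF c p] plot_chart_differentiable[OF f p fd]
    by (intro pd_compose[OF N]) auto
  also have "\<dots> = differential M N F (f x) (pd M f x v)"
    by (simp add: differential_eq_pd[OF c p])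
  also have "pd N (\<lambda>y. F (chart_inv M (f x) (chart M (f x) (f y)))) x = pd N (\<lambda>y. F (f y)) x"
    unfolding pd_def inv[OF T(2)] by (rule D_cong_open[OF T]) (simp add: inv)
  finally show ?thesis .
qed

lemma linear_differential:
  assumes "smooth_manifold M" "smooth_manifold N" "smooth_map M N F" "p \<in> points M"
  shows "linear (differential M N F p)"
  unfolding differential_eq_pd[OF smooth_manifold_charted[OF assms(1)] assms(4)]
  using linear_pd[OF assms(2) plot_map_chart_inv[OF assms(1,3,4)]]
    chart_self_mem[OF smooth_manifold_charted[OF assms(1)] assms(4)] by blast

lemma plot_const: "charted M \<Longrightarrow> open S \<Longrightarrow> p \<in> points M \<Longrightarrow> plot M S (\<lambda>x. p)"
proof -
  assume "open S" "p \<in> points M"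
  moreover have "{x \<in> S. p \<in> chart_dom M q} = (if p \<in> chart_dom M q then S else {})" for q by simp
  ultimately show ?thesis unfolding plot_def by (auto simp: smooth_on_const)
qed

lemma pd_const: "pd M (\<lambda>x. p) x v = 0"
  by (simp add: pd_def frechet_derivative_const)

lemma pd_cong_open:
  assumes "open S" "x \<in> S" "\<And>y. y \<in> S \<Longrightarrow> f y = g y"
  shows "pd M f x = pd M g x"
  unfolding pd_def using assms(3)[OF assms(2)] by (intro D_cong_open[OF assms(1,2)]) (simp add: assms)

lemma charted_prod:
  assumes "charted M" "charted N"
  shows "charted (prod_manifold M N)"
  unfolding charted_def
proof
  fix pq assume "pq \<in> points (prod_manifold M N)"
  then obtain p q where pq: "pq = (p, q)" "p \<in> points M" "q \<in> points N" by (auto simp: prod_manifold_def)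
  have "(\<lambda>(x, y). (chart M p x, chart N q y)) ` (chart_dom M p \<times> chart_dom N q) =
    (chart M p ` chart_dom M p) \<times> (chart N q ` chart_dom N q)" by auto
  then show "pq \<in> chart_dom (prod_manifold M N) pq \<and> chart_dom (prod_manifold M N) pq \<subseteq> points (prod_manifold M N) \<and>
    inj_on (chart (prod_manifold M N) pq) (chart_dom (prod_manifold M N) pq) \<and>
    open (chart (prod_manifold M N) pq ` chart_dom (prod_manifold M N) pq)"
    using chartedD[OF assms(1) pq(2)] chartedD[OF assms(2) pq(3)]
    by (auto simp: prod_manifold_def pq inj_on_def intro!: open_Times)
qed

lemma plot_Pair:
  assumes f: "plot M S f" and h: "plot N S h"
  shows "plot (prod_manifold M N) S (\<lambda>x. (f x, h x))"
  unfolding plot_def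
proof (intro conjI ballI plotD(1)[OF f])
  show "(\<lambda>x. (f x, h x)) ` S \<subseteq> points (prod_manifold M N)"
    using plotD(2)[OF f] plotD(2)[OF h] by (auto simp: prod_manifold_def)
  fix pq assume "pq \<in> points (prod_manifold M N)"
  then obtain p q where pq: "pq = (p, q)" and p: "p \<in> points M" and q: "q \<in> points N" by (auto simp: prod_manifold_def)
  have e: "{x\<in>S. (f x, h x) \<in> chart_dom (prod_manifold M N) pq} =
     {x\<in>S. f x \<in> chart_dom M p} \<inter> {x\<in>S. h x \<in> chart_dom N q}" by (auto simp: pq prod_manifold_def)
  show o: "open {x\<in>S. (f x, h x) \<in> chart_dom (prod_manifold M N) pq}"
    unfolding e by (intro open_Int plotD(3)[OF f p] plotD(3)[OF h q])
  have "smooth_on {x\<in>S. (f x, h x) \<in> chart_dom (prod_manifold M N) pq} (\<lambda>x. (chart M p (f x), chart N q (h x)))"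
    by (intro smooth_on_Pair[OF o] smooth_on_subset[OF plotD(4)[OF f p]] smooth_on_subset[OF plotD(4)[OF h q]])
      (auto simp: e)
  then show "smooth_on {x\<in>S. (f x, h x) \<in> chart_dom (prod_manifold M N) pq}
      (\<lambda>x. chart (prod_manifold M N) pq (f x, h x))"
    by (simp add: pq prod_manifold_def)
qed

lemma chart_inv_real_line: "chart_inv real_line p = (\<lambda>x. x)"
  by (auto simp: chart_inv_def real_line_def inv_into_def)

lemma smooth_map_real_line: "smooth_map real_line M \<gamma> \<longleftrightarrow> plot M UNIV \<gamma>"
  unfolding smooth_map_def plot_def chart_inv_real_line by (auto simp: real_line_def comp_def)

lemma velocity_eq_pd: "velocity M \<gamma> t = pd M \<gamma> t 1"
  unfolding velocity_def differential_def chart_inv_real_line by (simp add: real_line_def comp_def pd_def)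

subsection \<open>Continuity\<close>

lemma openin_manifold: "smooth_manifold M \<Longrightarrow> openin (manifold_topology M) W \<longleftrightarrow> chart_open M W"
  by (rule openin_manifold_topology) (simp add: smooth_manifold_def)

lemma topspace_manifold:
  assumes "smooth_manifold M" shows "topspace (manifold_topology M) = points M"
proof -
  note c = smooth_manifold_charted[OF assms]
  have "points M \<inter> chart_dom M p = chart_dom M p" if "p \<in> points M" for p using chartedD(2)[OF c that] by auto
  then have "chart_open M (points M)" unfolding chart_open_def using chartedD(4)[OF c] by simp
  then have "openin (manifold_topology M) (points M)" by (simp add: openin_manifold[OF assms])
  moreover have "W \<subseteq> points M" if "openin (manifold_topology M) W" for W
    using that by (simp add: openin_manifold[OF assms] chart_open_def)
  ultimately show ?thesis unfolding topspace_def by blast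
qed

lemma plot_continuous_map:
  assumes M: "smooth_manifold M" and f: "plot M S f"
  shows "continuous_map (top_of_set S) (manifold_topology M) f"
  unfolding continuous_map
proof (intro conjI allI impI)
  note c = smooth_manifold_charted[OF M]
  show "f ` topspace (top_of_set S) \<subseteq> topspace (manifold_topology M)"
    using plotD(2)[OF f] by (auto simp: topspace_manifold[OF M])
  fix W assume "openin (manifold_topology M) W"
  then have W: "chart_open M W" by (simp add: openin_manifold[OF M])
  have "open {x\<in>S. f x \<in> W}"
  proof (subst open_subopen, intro ballI)
    fix x assume x: "x \<in> {x\<in>S. f x \<in> W}"
    then have p: "f x \<in> points M" using plotD(2)[OF f] by blast
    let ?T = "{y\<in>S. f y \<in> chart_dom M (f x)} \<inter> (\<lambda>y. chart M (f x) (f y)) -` (chart M (f x) ` (W \<inter> chart_dom M (f x)))"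
    have T: "open ?T"
      by (rule continuous_open_preimage[OF smooth_on_continuous[OF plotD(4)[OF f p]] plotD(3)[OF f p]])
        (use W p in \<open>auto simp: chart_open_def\<close>)
    have "?T \<subseteq> {x\<in>S. f x \<in> W}"
      using inj_onD[OF chartedD(3)[OF c p]] by fastforce
    moreover have "x \<in> ?T" using x chartedD(1)[OF c p] by auto
    ultimately show "\<exists>T. open T \<and> x \<in> T \<and> T \<subseteq> {x\<in>S. f x \<in> W}" using T by blast
  qed
  then show "openin (top_of_set S) {x \<in> topspace (top_of_set S). f x \<in> W}"
    using open_subset[of "{x\<in>S. f x \<in> W}" S] by (simp add: Collect_mono_iff)
qed

lemma continuous_map_manifold_real:
  fixes F :: "'m \<Rightarrow> 'b::topological_space"
  assumes M: "smooth_manifold M"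
    and F: "\<And>p. p \<in> points M \<Longrightarrow> continuous_on (chart M p ` chart_dom M p) (\<lambda>x. F (chart_inv M p x))"
  shows "continuous_map (manifold_topology M) euclidean F"
  unfolding continuous_map
proof (intro conjI allI impI)
  note c = smooth_manifold_charted[OF M]
  fix V :: "'b set" assume V: "openin euclidean V"
  have "chart_open M {x \<in> points M. F x \<in> V}"
    unfolding chart_open_def
  proof (intro conjI ballI)
    fix p assume p: "p \<in> points M"
    have "chart M p ` ({x \<in> points M. F x \<in> V} \<inter> chart_dom M p) =
      chart M p ` chart_dom M p \<inter> (\<lambda>x. F (chart_inv M p x)) -` V"
      using chart_inv_chart[OF c p] chartedD(2)[OF c p] by auto
    then show "open (chart M p ` ({x \<in> points M. F x \<in> V} \<inter> chart_dom M p))"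
      using continuous_open_preimage[OF F[OF p] chartedD(4)[OF c p]] V by simp
  qed auto
  then show "openin (manifold_topology M) {x \<in> topspace (manifold_topology M). F x \<in> V}"
    by (simp add: openin_manifold[OF M] topspace_manifold[OF M])
qed simp

subsection \<open>Bilinear forms depending on a point\<close>

text \<open>For short times both solutions stay in a ball on which \<open>F\<close> is Lipschitz, so
  their difference satisfies a linear differential inequality with zero initial value.\<close>

lemma ode_unique_local:
  fixes F :: "'a::euclidean_space \<Rightarrow> 'a"
  assumes S: "open S" "smooth_on S F" and r: "r > 0"
    and x: "\<And>t. t \<in> ball t0 r \<Longrightarrow> x t \<in> S \<and> (x has_vector_derivative F (x t)) (at t)"
    and y: "\<And>t. t \<in> ball t0 r \<Longrightarrow> y t \<in> S \<and> (y has_vector_derivative F (y t)) (at t)"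
    and eq: "x t0 = y t0"
  obtains e :: real where "e > 0" "e \<le> r" "\<And>t. t \<in> ball t0 e \<Longrightarrow> x t = y t"
proof -
  have t0: "t0 \<in> ball t0 r" using r by simp
  have "x t0 \<in> S" using x[OF t0] by simp
  then obtain R where R: "R > 0" "cball (x t0) R \<subseteq> S" using S(1) open_contains_cball by blast
  obtain L where L: "L \<ge> 0" "\<And>u v. u \<in> cball (x t0) R \<Longrightarrow> v \<in> cball (x t0) R \<Longrightarrow> norm (F u - F v) \<le> L * norm (u - v)"
    using smooth_on_lipschitz_cball[OF S(2) R(2), of thesis] by simp
  have cx: "isCont x t0" by (rule has_vector_derivative_continuous[OF x[OF t0, THEN conjunct2]])
  have cy: "isCont y t0" by (rule has_vector_derivative_continuous[OF y[OF t0, THEN conjunct2]])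
  obtain d1 where d1: "d1 > 0" "\<And>t. dist t t0 < d1 \<Longrightarrow> dist (x t) (x t0) < R"
    using cx[unfolded continuous_at_eps_delta, rule_format, OF R(1)] by blast
  obtain d2 where d2: "d2 > 0" "\<And>t. dist t t0 < d2 \<Longrightarrow> dist (y t) (y t0) < R"
    using cy[unfolded continuous_at_eps_delta, rule_format, OF R(1)] by blast
  define e where "e = min r (min d1 d2)"
  have in_cball: "x t \<in> cball (x t0) R" "y t \<in> cball (x t0) R" if "t \<in> ball t0 e" for t
    using d1(2)[of t] d2(2)[of t] that eq by (auto simp: e_def dist_commute less_imp_le)
  have "x t - y t = 0" if t: "t \<in> ball t0 e" for t
  proof (rule linear_ode_zero[of t0 e "\<lambda>t. x t - y t" "\<lambda>t. F (x t) - F (y t)" L t, OF _ _ _ t])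
    fix s assume s: "s \<in> ball t0 e"
    then have sr: "s \<in> ball t0 r" by (simp add: e_def)
    show "((\<lambda>t. x t - y t) has_vector_derivative F (x s) - F (y s)) (at s)"
      by (rule has_vector_derivative_diff[OF x[OF sr, THEN conjunct2] y[OF sr, THEN conjunct2]])
    show "norm (F (x s) - F (y s)) \<le> L * norm (x s - y s)" by (rule L(2)[OF in_cball[OF s]])
  qed (simp add: eq)
  then show thesis using that[of e] r d1(1) d2(1) by (simp add: e_def)
qed

lemma bilinear_euclidean:
  fixes F :: "'b::euclidean_space \<Rightarrow> 'c::euclidean_space \<Rightarrow> 'd::real_vector"
  assumes "bilinear F"
  shows "F v w = (\<Sum>b\<in>Basis. \<Sum>c\<in>Basis. ((v \<bullet> b) * (w \<bullet> c)) *\<^sub>R F b c)"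
proof -
  have l: "linear (\<lambda>v. F v w)" "linear (F v)" for v w using assms by (auto simp: bilinear_def)
  have "F v w = F (\<Sum>b\<in>Basis. (v \<bullet> b) *\<^sub>R b) w" by (simp add: euclidean_representation)
  also have "\<dots> = (\<Sum>b\<in>Basis. (v \<bullet> b) *\<^sub>R F b w)"
    by (simp add: linear_sum[OF l(1)] linear_scale[OF l(1)] del: euclidean_representation)
  also have "\<dots> = (\<Sum>b\<in>Basis. (v \<bullet> b) *\<^sub>R (\<Sum>c\<in>Basis. (w \<bullet> c) *\<^sub>R F b c))"
  proof (rule sum.cong[OF refl])
    fix b :: 'b
    have "F b w = F b (\<Sum>c\<in>Basis. (w \<bullet> c) *\<^sub>R c)" by (simp add: euclidean_representation)
    also have "\<dots> = (\<Sum>c\<in>Basis. (w \<bullet> c) *\<^sub>R F b c)"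
      by (simp add: linear_sum[OF l(2)] linear_scale[OF l(2)] del: euclidean_representation)
    finally show "(v \<bullet> b) *\<^sub>R F b w = (v \<bullet> b) *\<^sub>R (\<Sum>c\<in>Basis. (w \<bullet> c) *\<^sub>R F b c)" by (rule arg_cong)
  qed
  also have "\<dots> = (\<Sum>b\<in>Basis. \<Sum>c\<in>Basis. ((v \<bullet> b) * (w \<bullet> c)) *\<^sub>R F b c)" by (simp add: scaleR_sum_right)
  finally show ?thesis .
qed

text \<open>Bilinearity on an open set reduces the family to finitely many coefficients
  \<open>F y b c\<close>, so differentiability in \<open>y\<close> for fixed arguments yields the
  full product rule.\<close>

lemma has_derivative_bilinear_family:
  fixes F :: "'a::euclidean_space \<Rightarrow> 'b::euclidean_space \<Rightarrow> 'c::euclidean_space \<Rightarrow> 'd::real_normed_vector"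
  assumes T: "open T" "h x \<in> T" and bil: "\<And>y. y \<in> T \<Longrightarrow> bilinear (F y)"
    and F: "\<And>v w. (\<lambda>y. F y v w) differentiable (at (h x))"
    and h: "(h has_derivative h') (at x)" and k: "(k has_derivative k') (at x)" and l: "(l has_derivative l') (at x)"
  shows "((\<lambda>x. F (h x) (k x) (l x)) has_derivative
    (\<lambda>u. D (\<lambda>y. F y (k x) (l x)) (h x) (h' u) + F (h x) (k' u) (l x) + F (h x) (k x) (l' u))) (at x)"
proof -
  have "isCont h x" using h has_derivative_continuous by blast
  then obtain U where U: "open U" "x \<in> U" "\<forall>y\<in>U. h y \<in> T"
    using continuous_at_open[of x h] T by blast
  let ?t = "\<lambda>b c u. (((k' u \<bullet> b) * (l x \<bullet> c)) *\<^sub>R F (h x) b c + ((k x \<bullet> b) * (l' u \<bullet> c)) *\<^sub>R F (h x) b c)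
    + ((k x \<bullet> b) * (l x \<bullet> c)) *\<^sub>R D (\<lambda>y. F y b c) (h x) (h' u)"
  have "((\<lambda>x. ((k x \<bullet> b) * (l x \<bullet> c)) *\<^sub>R F (h x) b c) has_derivative ?t b c) (at x)" for b c
  proof -
    have 1: "((\<lambda>x. (k x \<bullet> b) * (l x \<bullet> c)) has_derivative (\<lambda>u. (k x \<bullet> b) * (l' u \<bullet> c) + (k' u \<bullet> b) * (l x \<bullet> c))) (at x)"
      by (rule has_derivative_mult[OF has_derivative_inner_left[OF k] has_derivative_inner_left[OF l]])
    have 2: "((\<lambda>x. F (h x) b c) has_derivative (\<lambda>u. D (\<lambda>y. F y b c) (h x) (h' u))) (at x)"
      by (rule has_derivative_compose[OF h has_derivative_D[OF F]])
    show ?thesis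
      by (rule has_derivative_eq_rhs[OF has_derivative_scaleR[OF 1 2]]) (auto simp: algebra_simps)
  qed
  then have 1: "((\<lambda>x. \<Sum>b\<in>Basis. \<Sum>c\<in>Basis. ((k x \<bullet> b) * (l x \<bullet> c)) *\<^sub>R F (h x) b c) has_derivative
      (\<lambda>u. \<Sum>b\<in>Basis. \<Sum>c\<in>Basis. ?t b c u)) (at x)"
    by (intro has_derivative_sum)
  have 2: "D (\<lambda>y. F y v w) (h x) u = (\<Sum>b\<in>Basis. \<Sum>c\<in>Basis. ((v \<bullet> b) * (w \<bullet> c)) *\<^sub>R D (\<lambda>y. F y b c) (h x) u)" for v w u
  proof -
    have "((\<lambda>y. \<Sum>b\<in>Basis. \<Sum>c\<in>Basis. ((v \<bullet> b) * (w \<bullet> c)) *\<^sub>R F y b c) has_derivative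
       (\<lambda>u. \<Sum>b\<in>Basis. \<Sum>c\<in>Basis. ((v \<bullet> b) * (w \<bullet> c)) *\<^sub>R D (\<lambda>y. F y b c) (h x) u)) (at (h x))"
      by (intro has_derivative_sum has_derivative_scaleR_right has_derivative_D F)
    then have "((\<lambda>y. F y v w) has_derivative
       (\<lambda>u. \<Sum>b\<in>Basis. \<Sum>c\<in>Basis. ((v \<bullet> b) * (w \<bullet> c)) *\<^sub>R D (\<lambda>y. F y b c) (h x) u)) (at (h x))"
      by (rule has_derivative_transform_within_open[OF _ T]) (rule bilinear_euclidean[OF bil, symmetric])
    then show ?thesis by (simp add: D_eqI)
  qed
  have "(\<Sum>b\<in>Basis. \<Sum>c\<in>Basis. ?t b c u) =
    D (\<lambda>y. F y (k x) (l x)) (h x) (h' u) + F (h x) (k' u) (l x) + F (h x) (k x) (l' u)" for u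
    unfolding 2[of "k x"] bilinear_euclidean[OF bil[OF T(2)], of "k' u"] bilinear_euclidean[OF bil[OF T(2)], of "k x"]
    by (simp only: sum.distrib add_ac)
  then have "((\<lambda>x. \<Sum>b\<in>Basis. \<Sum>c\<in>Basis. ((k x \<bullet> b) * (l x \<bullet> c)) *\<^sub>R F (h x) b c) has_derivative
    (\<lambda>u. D (\<lambda>y. F y (k x) (l x)) (h x) (h' u) + F (h x) (k' u) (l x) + F (h x) (k x) (l' u))) (at x)"
    using 1 by simp
  then show ?thesis
    by (rule has_derivative_transform_within_open[OF _ U(1,2)]) (rule bilinear_euclidean[OF bil, symmetric], use U(3) in blast)
qed

text \<open>Collecting the values on the basis turns the form into a linear endomorphism
  \<open>T\<close>; positivity makes it injective, and finite dimension then makes it onto.\<close>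

lemma bilinear_form_represent:
  fixes B :: "'e::euclidean_space \<Rightarrow> 'e \<Rightarrow> real"
  assumes bil: "bilinear B" and pos: "\<And>v. v \<noteq> 0 \<Longrightarrow> B v v > 0" and L: "linear L"
  shows "\<exists>!z. \<forall>u. B z u = L u"
proof -
  have l: "linear (\<lambda>v. B v w)" "linear (B v)" for v w using bil by (auto simp: bilinear_def)
  define T where "T z = (\<Sum>b\<in>Basis. B z b *\<^sub>R b)" for z
  have Tb: "T z \<bullet> b = B z b" if "b \<in> Basis" for z b
    using that by (simp add: T_def inner_sum_left inner_Basis if_distrib cong: if_cong)
  have linT: "linear T"
    by (rule linearI) (simp_all add: T_def linear_add[OF l(1)] linear_scale[OF l(1)] scaleR_left_distrib
        sum.distrib scaleR_sum_right)
  have ext: "\<forall>u. B z u = K u" if "linear K" "\<And>b. b \<in> Basis \<Longrightarrow> B z b = K b" for z K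
    using linear_eq_stdbasis[OF l(2)[of z] that(1)] that(2) by metis
  have "inj T"
  proof (rule linear_injective_0[OF linT, THEN iffD2], intro allI impI)
    fix z assume z: "T z = 0"
    have "B z z = 0" using ext[of "\<lambda>_. 0" z] Tb[of _ z] z by (simp add: linear_zero)
    then show "z = 0" using pos[of z] by force
  qed
  then have "surj T" by (rule linear_inj_imp_surj[OF linT])
  then obtain z where z: "T z = (\<Sum>b\<in>Basis. L b *\<^sub>R b)" by (metis surjD)
  have "B z b = L b" if "b \<in> Basis" for b
    using Tb[OF that, of z] that by (simp add: z inner_sum_left inner_Basis if_distrib cong: if_cong)
  then have "\<forall>u. B z u = L u" by (rule ext[OF L])
  moreover have "y = z" if "\<forall>u. B y u = L u" for y
  proof -
    have "B (y - z) (y - z) = 0" using calculation that by (simp add: linear_diff[OF l(1)])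
    then show ?thesis using pos[of "y - z"] by force
  qed
  ultimately show ?thesis by blast
qed

text \<open>At a zero of \<open>A\<close> continuity of the other factor is enough. This permits
  differentiating a product in which one factor is a solution whose differentiability is still
  open.\<close>

lemma has_derivative_scaleR_vanishing:
  fixes A :: "'a::real_normed_vector \<Rightarrow> 'b::real_normed_vector"
  assumes c: "isCont f x" and A: "(A has_derivative A') (at x)" "A x = 0"
  shows "((\<lambda>y. f y *\<^sub>R A y) has_derivative (\<lambda>u. f x *\<^sub>R A' u)) (at x)"
proof -
  have 1: "((\<lambda>y. norm (A y - A x - A' (y - x)) / norm (y - x)) \<longlongrightarrow> 0) (at x)"
    using A(1) unfolding has_derivative_iff_norm by simp
  obtain K where K: "\<And>u. norm (A' u) \<le> norm u * K"
    using bounded_linear.bounded[OF has_derivative_bounded_linear[OF A(1)]] by blast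
  let ?r = "\<lambda>y. norm (A y - A x - A' (y - x)) / norm (y - x)"
  have 2: "((\<lambda>y. \<bar>f y\<bar> * ?r y + \<bar>f y - f x\<bar> * \<bar>K\<bar>) \<longlongrightarrow> \<bar>f x\<bar> * 0 + \<bar>f x - f x\<bar> * \<bar>K\<bar>) (at x)"
    using c unfolding isCont_def by (intro tendsto_intros 1)
  have 3: "\<bar>f x\<bar> * 0 + \<bar>f x - f x\<bar> * \<bar>K\<bar> = 0" by simp
  have "((\<lambda>y. norm (f y *\<^sub>R A y - f x *\<^sub>R A x - f x *\<^sub>R A' (y - x)) / norm (y - x)) \<longlongrightarrow> 0) (at x)"
  proof (rule tendsto_sandwich[OF _ _ tendsto_const 2[unfolded 3]])
    show "\<forall>\<^sub>F y in at x. 0 \<le> norm (f y *\<^sub>R A y - f x *\<^sub>R A x - f x *\<^sub>R A' (y - x)) / norm (y - x)" by simp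
    show "\<forall>\<^sub>F y in at x. norm (f y *\<^sub>R A y - f x *\<^sub>R A x - f x *\<^sub>R A' (y - x)) / norm (y - x) \<le>
      \<bar>f y\<bar> * ?r y + \<bar>f y - f x\<bar> * \<bar>K\<bar>"
      unfolding eventually_at_filter
    proof (intro always_eventually allI impI)
      fix y assume y: "y \<noteq> x"
      have e: "f y *\<^sub>R A y - f x *\<^sub>R A x - f x *\<^sub>R A' (y - x) =
        f y *\<^sub>R (A y - A x - A' (y - x)) + (f y - f x) *\<^sub>R A' (y - x)" by (simp add: A(2) algebra_simps)
      have "norm (f y *\<^sub>R A y - f x *\<^sub>R A x - f x *\<^sub>R A' (y - x)) \<le>
        \<bar>f y\<bar> * norm (A y - A x - A' (y - x)) + \<bar>f y - f x\<bar> * (norm (y - x) * \<bar>K\<bar>)"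
        unfolding e
      proof (rule order_trans[OF norm_triangle_ineq add_mono])
        have "norm (A' (y - x)) \<le> norm (y - x) * \<bar>K\<bar>"
          by (rule order_trans[OF K]) (simp add: mult_left_mono)
        then show "norm ((f y - f x) *\<^sub>R A' (y - x)) \<le> \<bar>f y - f x\<bar> * (norm (y - x) * \<bar>K\<bar>)"
          by (simp add: mult_left_mono)
      qed simp
      then show "norm (f y *\<^sub>R A y - f x *\<^sub>R A x - f x *\<^sub>R A' (y - x)) / norm (y - x) \<le>
        \<bar>f y\<bar> * ?r y + \<bar>f y - f x\<bar> * \<bar>K\<bar>"
        using y by (simp add: divide_simps) (simp add: algebra_simps)
    qed
  qed
  then show ?thesis unfolding has_derivative_iff_norm
    using bounded_linear_compose[OF bounded_linear_scaleR_right has_derivative_bounded_linear[OF A(1)]] by simp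
qed

text \<open>T x0 (z x - z x0) equals (r x - r x0) - (T x - T x0) (z x). The last term is at most
  \<open>e x\<close> times the norm of \<open>z x\<close>, and as soon as \<open>C * e x\<close> is
  below 1/2 it can be absorbed on the left.\<close>

lemma linear_solve_continuous:
  fixes T :: "'a::euclidean_space \<Rightarrow> 'e::euclidean_space \<Rightarrow> 'e"
  assumes S: "open S" "x0 \<in> S" and lin: "\<And>x. x \<in> S \<Longrightarrow> linear (T x)" and inj: "\<And>v. T x0 v = 0 \<Longrightarrow> v = 0"
    and T: "\<And>b. isCont (\<lambda>x. T x b) x0" and r: "isCont r x0"
    and z: "\<And>x. x \<in> S \<Longrightarrow> T x (z x) = r x"
  shows "isCont z x0"
proof -
  have lin0: "linear (T x0)" using lin S(2) by blast
  have "inj (T x0)" using inj linear_injective_0[OF lin0] by blast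
  then obtain g where g: "linear g" "\<And>v. g (T x0 v) = v"
    using linear_injective_left_inverse[OF lin0] by (auto simp: fun_eq_iff)
  obtain C where C: "C > 0" "\<And>v. norm (g v) \<le> C * norm v" using linear_bounded_pos[OF g(1)] by blast
  define e where "e = (\<lambda>x. \<Sum>b\<in>Basis. norm (T x b - T x0 b))"
  have ed: "norm (T x v - T x0 v) \<le> e x * norm v" if "x \<in> S" for x v
  proof -
    have l: "linear (\<lambda>v. T x v - T x0 v)" using lin[OF that] lin0 by (rule linear_compose_sub)
    have "T x v - T x0 v = (\<Sum>b\<in>Basis. (v \<bullet> b) *\<^sub>R (T x b - T x0 b))"
      using linear_sum[OF l, of "\<lambda>b. (v \<bullet> b) *\<^sub>R b" Basis] linear_scale[OF l] by (simp add: euclidean_representation)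
    also have "norm \<dots> \<le> (\<Sum>b\<in>Basis. norm (T x b - T x0 b) * norm v)"
    proof (rule order_trans[OF norm_sum sum_mono])
      fix b :: 'e assume "b \<in> Basis"
      then show "norm ((v \<bullet> b) *\<^sub>R (T x b - T x0 b)) \<le> norm (T x b - T x0 b) * norm v"
        using Basis_le_norm[of b v] by (simp add: mult.commute mult_right_mono)
    qed
    finally show ?thesis by (simp add: e_def sum_distrib_right)
  qed
  have bd: "norm (z x - z x0) \<le> C * (norm (r x - r x0) + e x * norm (z x))" if "x \<in> S" for x
  proof -
    have "z x - z x0 = g (T x0 (z x - z x0))" by (simp add: g(2))
    also have "T x0 (z x - z x0) = (r x - r x0) - (T x (z x) - T x0 (z x))"
      using z[OF that] z[OF S(2)] by (simp add: linear_diff[OF lin0])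
    also have "norm (g \<dots>) \<le> C * norm ((r x - r x0) - (T x (z x) - T x0 (z x)))" by (rule C(2))
    also have "\<dots> \<le> C * (norm (r x - r x0) + e x * norm (z x))"
      by (rule mult_left_mono[OF order_trans[OF norm_triangle_ineq4 add_left_mono[OF ed[OF that]]]]) (use C(1) in simp)
    finally show ?thesis .
  qed
  have elim: "(e \<longlongrightarrow> 0) (at x0)"
  proof -
    have "(e \<longlongrightarrow> (\<Sum>b\<in>(Basis::'e set). norm (T x0 b - T x0 b))) (at x0)"
      unfolding e_def using T unfolding isCont_def by (intro tendsto_intros)
    then show ?thesis by simp
  qed
  have ev: "\<forall>\<^sub>F x in at x0. x \<in> S" using S by (rule eventually_at_in_open')
  have "\<forall>\<^sub>F x in at x0. C * e x < 1/2"
    using order_tendstoD(2)[OF tendsto_mult[OF tendsto_const[of C] elim], of "1/2"] by simp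
  then have ev2: "\<forall>\<^sub>F x in at x0. norm (z x - z x0) \<le> 2 * (C * (norm (r x - r x0) + e x * norm (z x0)))"
    using ev
  proof eventually_elim
    case (elim x)
    have "norm (z x) \<le> norm (z x0) + norm (z x - z x0)" using norm_triangle_sub by blast
    moreover have "e x \<ge> 0" by (simp add: e_def sum_nonneg)
    ultimately have "C * (e x * norm (z x)) \<le> C * (e x * (norm (z x0) + norm (z x - z x0)))"
      using C(1) by (intro mult_left_mono) auto
    moreover have "C * e x * norm (z x - z x0) \<le> 1/2 * norm (z x - z x0)"
      using elim(1) by (intro mult_right_mono) auto
    ultimately show ?case using bd[OF elim(2)] by (simp add: algebra_simps)
  qed
  have "((\<lambda>x. 2 * (C * (norm (r x - r x0) + e x * norm (z x0)))) \<longlongrightarrow> 2 * (C * (norm (r x0 - r x0) + 0 * norm (z x0)))) (at x0)"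
    using r unfolding isCont_def by (intro tendsto_intros elim)
  then have "((\<lambda>x. norm (z x - z x0)) \<longlongrightarrow> 0) (at x0)"
    by (intro tendsto_sandwich[OF _ ev2 tendsto_const]) auto
  then show ?thesis unfolding isCont_def using tendsto_norm_zero_iff Lim_null by blast
qed

text \<open>With \<open>g\<close> inverse to \<open>T x0\<close>, the equation reads z = g (r - (T -
  T x0) z). The operator T - T x0 vanishes at \<open>x0\<close>, so continuity of \<open>z\<close>
  suffices to differentiate the right side.\<close>

lemma linear_solve_has_derivative:
  fixes T :: "'a::euclidean_space \<Rightarrow> 'e::euclidean_space \<Rightarrow> 'e"
  assumes S: "open S" "x0 \<in> S" and lin: "\<And>x. x \<in> S \<Longrightarrow> linear (T x)" and inj: "\<And>v. T x0 v = 0 \<Longrightarrow> v = 0"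
    and T: "\<And>b. (\<lambda>x. T x b) differentiable (at x0)" and r: "r differentiable (at x0)"
    and z: "\<And>x. x \<in> S \<Longrightarrow> T x (z x) = r x"
  shows "z differentiable (at x0)"
    "T x0 (D z x0 v) = D r x0 v - (\<Sum>b\<in>Basis. (z x0 \<bullet> b) *\<^sub>R D (\<lambda>x. T x b) x0 v)"
proof -
  have lin0: "linear (T x0)" using lin S(2) by blast
  have "inj (T x0)" using inj linear_injective_0[OF lin0] by blast
  then obtain g where g: "linear g" "\<And>v. g (T x0 v) = v"
    using linear_injective_left_inverse[OF lin0] by (auto simp: fun_eq_iff)
  have zc: "isCont z x0"
    by (rule linear_solve_continuous[OF S lin inj _ _ z]) (use T r differentiable_imp_continuous_within in auto)
  have A: "((\<lambda>x. T x b - T x0 b) has_derivative D (\<lambda>x. T x b) x0) (at x0)" for b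
    using has_derivative_diff[OF has_derivative_D[OF T] has_derivative_const] by simp
  have sm: "((\<lambda>x. \<Sum>b\<in>Basis. (z x \<bullet> b) *\<^sub>R (T x b - T x0 b)) has_derivative
      (\<lambda>v. \<Sum>b\<in>Basis. (z x0 \<bullet> b) *\<^sub>R D (\<lambda>x. T x b) x0 v)) (at x0)"
    by (intro has_derivative_sum has_derivative_scaleR_vanishing A isCont_inner zc continuous_const) simp
  have "((\<lambda>x. g (r x - (\<Sum>b\<in>Basis. (z x \<bullet> b) *\<^sub>R (T x b - T x0 b)))) has_derivative
      (\<lambda>v. g (D r x0 v - (\<Sum>b\<in>Basis. (z x0 \<bullet> b) *\<^sub>R D (\<lambda>x. T x b) x0 v)))) (at x0)"
    by (intro bounded_linear.has_derivative[OF g(1)[unfolded linear_conv_bounded_linear]]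
        has_derivative_diff has_derivative_D r sm)
  moreover have "g (r x - (\<Sum>b\<in>Basis. (z x \<bullet> b) *\<^sub>R (T x b - T x0 b))) = z x" if "x \<in> S" for x
  proof -
    have l: "linear (\<lambda>v. T x v - T x0 v)" using lin[OF that] lin0 by (rule linear_compose_sub)
    have "(\<Sum>b\<in>Basis. (z x \<bullet> b) *\<^sub>R (T x b - T x0 b)) = T x (z x) - T x0 (z x)"
      using linear_sum[OF l, of "\<lambda>b. (z x \<bullet> b) *\<^sub>R b" Basis] linear_scale[OF l] by (simp add: euclidean_representation)
    then show ?thesis using z[OF that] g(2) by simp
  qed
  ultimately have zd: "(z has_derivative
      (\<lambda>v. g (D r x0 v - (\<Sum>b\<in>Basis. (z x0 \<bullet> b) *\<^sub>R D (\<lambda>x. T x b) x0 v)))) (at x0)"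
    by (rule has_derivative_transform_within_open[OF _ S])
  then show "z differentiable (at x0)" by (auto simp: differentiable_def)
  have "surj (T x0)" by (rule linear_inj_imp_surj[OF lin0 \<open>inj (T x0)\<close>])
  then have "T x0 (g u) = u" for u using g(2) by (metis surjD)
  then show "T x0 (D z x0 v) = D r x0 v - (\<Sum>b\<in>Basis. (z x0 \<bullet> b) *\<^sub>R D (\<lambda>x. T x b) x0 v)"
    by (simp add: D_eqI[OF zd])
qed

text \<open>A directional derivative of \<open>z\<close> solves a system with the same operators,
  whose right side is built from derivatives of \<open>r\<close> and \<open>T\<close> and from
  \<open>z\<close> itself. So regularity climbs one order at a time; the argument takes the place of
  Cramer's rule.\<close>

lemma linear_solve_smooth:
  fixes T :: "'a::euclidean_space \<Rightarrow> 'e::euclidean_space \<Rightarrow> 'e"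
  assumes S: "open S" and lin: "\<And>x. x \<in> S \<Longrightarrow> linear (T x)" and inj: "\<And>x v. x \<in> S \<Longrightarrow> T x v = 0 \<Longrightarrow> v = 0"
    and T: "\<And>b. smooth_on S (\<lambda>x. T x b)" and r: "smooth_on S r"
    and z: "\<And>x. x \<in> S \<Longrightarrow> T x (z x) = r x"
  shows "smooth_on S z"
proof -
  have "Ck_on k S z" if "Ck_on k S r" "\<And>x. x \<in> S \<Longrightarrow> T x (z x) = r x" for k r z
    using that
  proof (induction k arbitrary: r z)
    case 0
    have "isCont z x" if x: "x \<in> S" for x
    proof (rule linear_solve_continuous[OF S x lin inj[OF x] _ _ 0(2)])
      show "isCont (\<lambda>x. T x b) x" for b
        using smooth_on_continuous[OF T] S x continuous_on_eq_continuous_at by blast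
      show "isCont r x" using 0(1) x continuous_on_eq_continuous_at[OF S, of r] by simp
    qed
    then show ?case by (simp add: continuous_at_imp_continuous_on)
  next
    case (Suc k)
    have rd: "r differentiable (at x)" if "x \<in> S" for x using Suc.prems(1) that by simp
    have *: "z differentiable (at x)"
      "T x (D z x v) = D r x v - (\<Sum>b\<in>Basis. (z x \<bullet> b) *\<^sub>R D (\<lambda>x. T x b) x v)" if x: "x \<in> S" for x v
      by (rule linear_solve_has_derivative[OF S x lin inj[OF x] smooth_on_differentiable[OF T x] rd[OF x] Suc.prems(2)]; assumption)+
    have zk: "Ck_on k S z" by (rule Suc.IH[OF Ck_on_SucD[OF Suc.prems(1)] Suc.prems(2)])
    have "Ck_on k S (\<lambda>x. D z x v)" for v
    proof (rule Suc.IH)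
      show "Ck_on k S (\<lambda>x. D r x v + - (\<Sum>b\<in>Basis. (z x \<bullet> b) *\<^sub>R D (\<lambda>x. T x b) x v))"
      proof (intro Ck_on_add[OF S] Ck_on_bounded_linear[OF bounded_linear_minus[OF bounded_linear_ident] S]
          Ck_on_sum[OF S] Ck_on_bounded_bilinear[OF bounded_bilinear_scaleR S])
        show "Ck_on k S (\<lambda>x. D r x v)" using Suc.prems(1) by simp
        fix b :: 'e
        show "Ck_on k S (\<lambda>x. z x \<bullet> b)" by (rule Ck_on_bounded_linear[OF bounded_linear_inner_left S zk])
        show "Ck_on k S (\<lambda>x. D (\<lambda>x. T x b) x v)" using smooth_on_D[OF T] unfolding smooth_on_def by blast
      qed
      show "T x (D z x v) = D r x v + - (\<Sum>b\<in>Basis. (z x \<bullet> b) *\<^sub>R D (\<lambda>x. T x b) x v)" if "x \<in> S" for x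
        using *(2)[OF that] by simp
    qed
    moreover have "z differentiable (at x)" if "x \<in> S" for x
      using *(1)[OF that] by simp
    ultimately show ?case by simp
  qed
  then show ?thesis using r z unfolding smooth_on_def by blast
qed

subsection \<open>The Levi-Civita connection in charts\<close>

locale riemannian_manifold =
  fixes M :: "('m, 'e::euclidean_space) manifold" and g :: "('m, 'e) metric"
  assumes M: "smooth_manifold M" and metric: "riemannian_metric M g"
begin

lemmas charted_M = smooth_manifold_charted[OF M]

abbreviation "E p \<equiv> chart M p ` chart_dom M p"
abbreviation "G \<equiv> metric_rep M g"
abbreviation "\<Gamma> \<equiv> christoffel M g"

lemma metricD:
  assumes "p \<in> points M"
  shows "bilinear (g p)" "g p v w = g p w v" "v \<noteq> 0 \<Longrightarrow> g p v v > 0" "smooth_on (E p) (\<lambda>x. G p x v w)"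
  using metric assms by (auto simp: riemannian_metric_def)

lemma open_E: "p \<in> points M \<Longrightarrow> open (E p)"
  by (rule chartedD(4)[OF charted_M])

lemma tangent_change_inverse:
  assumes p: "p \<in> points M" "r \<in> chart_dom M p" and q: "q \<in> points M" "r \<in> chart_dom M q"
  shows "tangent_change M q p r (tangent_change M p q r v) = v"
proof -
  have r: "r = chart_inv M p (chart M p r)" using chart_inv_chart[OF charted_M p] by simp
  have x: "chart M p r \<in> E p" using p by blast
  have "D (\<lambda>y. chart M p (chart_inv M p y)) (chart M p r) = D (\<lambda>y. y) (chart M p r)"
    by (rule D_cong_open[OF open_E[OF p(1)] x]) (rule chart_chart_inv(1))
  then have "v = D (\<lambda>y. chart M p (chart_inv M p y)) (chart M p r) v" by (simp add: frechet_derivative_ident)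
  also have "\<dots> = tangent_change M q p r (D (\<lambda>y. chart M q (chart_inv M p y)) (chart M p r) v)"
    using D_chart_plot_change[OF M plot_chart_inv[OF M p(1)] x p(1) _ q(1), of v] p q r by simp
  finally show ?thesis by (simp add: tangent_change_eq)
qed

lemma tangent_change_self: "p \<in> points M \<Longrightarrow> r \<in> chart_dom M p \<Longrightarrow> tangent_change M p p r v = v"
proof -
  assume p: "p \<in> points M" "r \<in> chart_dom M p"
  have x: "chart M p r \<in> E p" using p by blast
  have "D (\<lambda>y. chart M p (chart_inv M p y)) (chart M p r) = D (\<lambda>y. y) (chart M p r)"
    by (rule D_cong_open[OF open_E[OF p(1)] x]) (rule chart_chart_inv(1))
  then show ?thesis by (simp add: tangent_change_eq frechet_derivative_ident)
qed

lemma tangent_change_trans: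
  assumes p: "p \<in> points M" "r \<in> chart_dom M p" and q: "q \<in> points M" "r \<in> chart_dom M q"
    and s: "s \<in> points M" "r \<in> chart_dom M s"
  shows "tangent_change M q s r (tangent_change M p q r v) = tangent_change M p s r v"
proof -
  have r: "chart_inv M p (chart M p r) = r" using chart_inv_chart[OF charted_M p] by simp
  have x: "chart M p r \<in> E p" using p by blast
  show ?thesis
    using D_chart_plot_change[OF M plot_chart_inv[OF M p(1)] x s(1) _ q(1), of v] p q s r
    by (simp add: tangent_change_eq)
qed

lemma G_plot:
  assumes f: "plot M S f" "x \<in> S" and p: "p \<in> points M" "f x \<in> chart_dom M p"
  shows "G p (chart M p (f x)) (D (\<lambda>y. chart M p (f y)) x v) (D (\<lambda>y. chart M p (f y)) x w) =
    g (f x) (pd M f x v) (pd M f x w)"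
  unfolding metric_rep_def Let_def chart_inv_chart[OF charted_M p] pd_eq_tangent_change[OF M f p] ..

lemma G_bilinear:
  assumes p: "p \<in> points M" and x: "x \<in> E p"
  shows "bilinear (G p x)"
proof -
  let ?q = "chart_inv M p x"
  have q: "?q \<in> chart_dom M p" using chart_chart_inv(2)[OF x] .
  then have qp: "?q \<in> points M" using chartedD(2)[OF charted_M p] by blast
  have l: "linear (tangent_change M p ?q ?q)"
    by (rule linear_tangent_change[OF M p qp q chartedD(1)[OF charted_M qp]])
  have b: "linear (\<lambda>v. g ?q v w)" "linear (g ?q v)" for v w using metricD(1)[OF qp] by (auto simp: bilinear_def)
  show ?thesis unfolding bilinear_def metric_rep_def Let_def
    by (intro conjI allI linear_compose[OF l b(1), unfolded comp_def] linear_compose[OF l b(2), unfolded comp_def])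
qed

lemma G_sym: "p \<in> points M \<Longrightarrow> x \<in> E p \<Longrightarrow> G p x v w = G p x w v"
  unfolding metric_rep_def Let_def
  by (rule metricD(2)) (use chart_chart_inv(2)[of x M p] chartedD(2)[OF charted_M, of p] in auto)

lemma G_pos:
  assumes p: "p \<in> points M" and x: "x \<in> E p" and v: "v \<noteq> 0"
  shows "G p x v v > 0"
proof -
  let ?q = "chart_inv M p x"
  have q: "?q \<in> chart_dom M p" using chart_chart_inv(2)[OF x] .
  then have qp: "?q \<in> points M" using chartedD(2)[OF charted_M p] by blast
  have "linear (tangent_change M ?q p ?q)"
    by (rule linear_tangent_change[OF M qp p chartedD(1)[OF charted_M qp] q])
  then have "tangent_change M p ?q ?q v \<noteq> 0"
    using tangent_change_inverse[OF p q qp chartedD(1)[OF charted_M qp], of v] v linear_0 by metis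
  then show ?thesis unfolding metric_rep_def Let_def by (rule metricD(3)[OF qp])
qed

lemma G_differentiable: "p \<in> points M \<Longrightarrow> x \<in> E p \<Longrightarrow> (\<lambda>y. G p y v w) differentiable (at x)"
  by (rule smooth_on_differentiable[OF metricD(4)])

lemma G_linear:
  assumes "p \<in> points M" "x \<in> E p"
  shows "linear (\<lambda>v. G p x v w)" "linear (G p x v)"
  using G_bilinear[OF assms] by (auto simp: bilinear_def)

lemma has_derivative_G:
  assumes "p \<in> points M" "h x \<in> E p"
    and "(h has_derivative h') (at x)" "(k has_derivative k') (at x)" "(l has_derivative l') (at x)"
  shows "((\<lambda>x. G p (h x) (k x) (l x)) has_derivative
    (\<lambda>u. D (\<lambda>y. G p y (k x) (l x)) (h x) (h' u) + G p (h x) (k' u) (l x) + G p (h x) (k x) (l' u))) (at x)"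
  by (rule has_derivative_bilinear_family[OF open_E[OF assms(1)] assms(2) G_bilinear[OF assms(1)]
        G_differentiable[OF assms(1,2)] assms(3-5)])

lemma D_G_linear:
  assumes p: "p \<in> points M" and x: "x \<in> E p"
  shows "linear (\<lambda>v. D (\<lambda>y. G p y v w) x u)" "linear (\<lambda>w. D (\<lambda>y. G p y v w) x u)" "linear (D (\<lambda>y. G p y v w) x)"
proof -
  show "linear (D (\<lambda>y. G p y v w) x)" by (rule linear_frechet_derivative[OF G_differentiable[OF p x]])
  have e: "D f x u = D k x u" if "\<And>y. y \<in> E p \<Longrightarrow> f y = k y" for f k :: "'e \<Rightarrow> real"
    by (rule fun_cong[OF D_cong_open[OF open_E[OF p] x that]])
  have a: "D (\<lambda>y. f y + k y) x u = D f x u + D k x u" if "f differentiable (at x)" "k differentiable (at x)" for f k :: "'e \<Rightarrow> real"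
    by (rule fun_cong[OF D_eqI[OF has_derivative_add[OF has_derivative_D[OF that(1)] has_derivative_D[OF that(2)]]]])
  have s: "D (\<lambda>y. c *\<^sub>R f y) x u = c *\<^sub>R D f x u" if "f differentiable (at x)" for f :: "'e \<Rightarrow> real" and c
    by (rule fun_cong[OF D_eqI[OF has_derivative_scaleR_right[OF has_derivative_D[OF that]]]])
  note d = G_differentiable[OF p x]
  show "linear (\<lambda>v. D (\<lambda>y. G p y v w) x u)"
    by (rule linearI; (subst a[OF d d, symmetric] | subst s[OF d, symmetric]); rule e)
      (simp_all add: linear_add[OF G_linear(1)[OF p]] linear_scale[OF G_linear(1)[OF p]])
  show "linear (\<lambda>w. D (\<lambda>y. G p y v w) x u)"
    by (rule linearI; (subst a[OF d d, symmetric] | subst s[OF d, symmetric]); rule e)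
      (simp_all add: linear_add[OF G_linear(2)[OF p]] linear_scale[OF G_linear(2)[OF p]])
qed

text \<open>The Koszul expression is linear in \<open>u\<close>, so the positive definite metric
  represents it by exactly one vector; this gives meaning to the definite description in
  \<open>christoffel\<close>.\<close>

lemma christoffel_ex1:
  assumes p: "p \<in> points M" and x: "x \<in> E p"
  shows "\<exists>!z. \<forall>u. 2 * G p x z u = D (\<lambda>y. G p y w u) x v + D (\<lambda>y. G p y v u) x w - D (\<lambda>y. G p y v w) x u"
proof -
  have "linear (\<lambda>u. (1/2) * (D (\<lambda>y. G p y w u) x v + D (\<lambda>y. G p y v u) x w - D (\<lambda>y. G p y v w) x u))"
    using linear_compose_scale_right[OF linear_compose_sub[OF linear_compose_add[OF D_G_linear(2)[OF p x] D_G_linear(2)[OF p x]] D_G_linear(3)[OF p x]], of "1/2"]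
    by simp
  from bilinear_form_represent[OF G_bilinear[OF p x] G_pos[OF p x] this]
  have *: "\<exists>!z. \<forall>u. G p x z u = (1/2) * (D (\<lambda>y. G p y w u) x v + D (\<lambda>y. G p y v u) x w - D (\<lambda>y. G p y v w) x u)" .
  have "(s = (1/2) * t) = (2 * s = t)" for s t :: real by linarith
  then show ?thesis using * by (simp only:)
qed

lemma christoffel_eq:
  assumes p: "p \<in> points M" and x: "x \<in> E p"
  shows "2 * G p x (\<Gamma> p x v w) u = D (\<lambda>y. G p y w u) x v + D (\<lambda>y. G p y v u) x w - D (\<lambda>y. G p y v w) x u"
  unfolding christoffel_def using theI'[OF christoffel_ex1[OF p x, of w v]] by blast

lemma christoffel_unique:
  assumes p: "p \<in> points M" and x: "x \<in> E p"
    and z: "\<And>u. 2 * G p x z u = D (\<lambda>y. G p y w u) x v + D (\<lambda>y. G p y v u) x w - D (\<lambda>y. G p y v w) x u"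
  shows "\<Gamma> p x v w = z"
  unfolding christoffel_def by (rule the1_equality[OF christoffel_ex1[OF p x]]) (use z in blast)

lemma G_eq_imp_eq:
  assumes p: "p \<in> points M" and x: "x \<in> E p" and "\<And>u. G p x v u = G p x w u"
  shows "v = w"
proof (rule ccontr)
  assume "v \<noteq> w"
  then have "G p x (v - w) (v - w) > 0" using G_pos[OF p x, of "v - w"] by simp
  then show False using assms(3)[of "v - w"] by (simp add: linear_diff[OF G_linear(1)[OF p x]])
qed

lemma christoffel_sym: "p \<in> points M \<Longrightarrow> x \<in> E p \<Longrightarrow> \<Gamma> p x v w = \<Gamma> p x w v"
proof (rule christoffel_unique)
  fix u assume p: "p \<in> points M" and x: "x \<in> E p"
  have "D (\<lambda>y. G p y v w) x = D (\<lambda>y. G p y w v) x"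
    by (rule D_cong_open[OF open_E[OF p] x]) (rule G_sym[OF p])
  then show "2 * G p x (\<Gamma> p x w v) u = D (\<lambda>y. G p y w u) x v + D (\<lambda>y. G p y v u) x w - D (\<lambda>y. G p y v w) x u"
    by (simp add: christoffel_eq[OF p x])
qed

lemma christoffel_bilinear:
  assumes p: "p \<in> points M" and x: "x \<in> E p"
  shows "bilinear (\<Gamma> p x)"
proof -
  have l: "linear (\<Gamma> p x v)" for v
  proof (rule linearI)
    note l = D_G_linear[OF p x]
    fix a b :: 'e and c :: real
    show "\<Gamma> p x v (a + b) = \<Gamma> p x v a + \<Gamma> p x v b"
      by (rule christoffel_unique[OF p x])
        (simp add: linear_add[OF G_linear(1)[OF p x]] linear_add[OF l(1)] linear_add[OF l(2)] linear_add[OF l(3)] distrib_left christoffel_eq[OF p x])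
    show "\<Gamma> p x v (c *\<^sub>R a) = c *\<^sub>R \<Gamma> p x v a"
    proof (rule christoffel_unique[OF p x])
      fix u
      have "2 * G p x (c *\<^sub>R \<Gamma> p x v a) u = c * (2 * G p x (\<Gamma> p x v a) u)"
        by (simp add: linear_scale[OF G_linear(1)[OF p x]])
      also have "\<dots> = D (\<lambda>y. G p y (c *\<^sub>R a) u) x v + D (\<lambda>y. G p y v u) x (c *\<^sub>R a) - D (\<lambda>y. G p y v (c *\<^sub>R a)) x u"
        unfolding christoffel_eq[OF p x]
        by (simp add: linear_scale[OF l(1)] linear_scale[OF l(2)] linear_scale[OF l(3)] right_diff_distrib distrib_left)
      finally show "2 * G p x (c *\<^sub>R \<Gamma> p x v a) u = D (\<lambda>y. G p y (c *\<^sub>R a) u) x v + D (\<lambda>y. G p y v u) x (c *\<^sub>R a) - D (\<lambda>y. G p y v (c *\<^sub>R a)) x u" .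
    qed
  qed
  moreover have "(\<lambda>v. \<Gamma> p x v w) = \<Gamma> p x w" for w using christoffel_sym[OF p x] by auto
  ultimately show ?thesis by (simp add: bilinear_def)
qed

text \<open>Pairing with the basis vectors turns the Koszul formula into an invertible linear system
  whose coefficients and right side are smooth.\<close>

lemma christoffel_smooth:
  assumes p: "p \<in> points M"
  shows "smooth_on (E p) (\<lambda>x. \<Gamma> p x v w)"
proof (rule linear_solve_smooth[OF open_E[OF p]])
  define T where "T x z = (\<Sum>b\<in>Basis. G p x z b *\<^sub>R b)" for x z
  show "linear (T x)" if "x \<in> E p" for x
    by (rule linearI) (simp_all add: T_def linear_add[OF G_linear(1)[OF p that]] linear_scale[OF G_linear(1)[OF p that]]
        scaleR_left_distrib sum.distrib scaleR_sum_right)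
  have Tb: "T x z \<bullet> b = G p x z b" if "b \<in> Basis" for x z b
    using that by (simp add: T_def inner_sum_left inner_Basis if_distrib cong: if_cong)
  show "z = 0" if "x \<in> E p" "T x z = 0" for x z
  proof (rule G_eq_imp_eq[OF p that(1)])
    fix u
    have "G p x z b = 0" if "b \<in> Basis" for b using Tb[OF that, of x z] \<open>T x z = 0\<close> by simp
    then have "G p x z u = 0"
      using linear_eq_stdbasis[OF G_linear(2)[OF p that(1)] linear_zero] by metis
    then show "G p x z u = G p x 0 u" by (simp add: linear_0[OF G_linear(1)[OF p that(1)]])
  qed
  show "smooth_on (E p) (\<lambda>x. T x b)" for b
    unfolding T_def by (intro smooth_on_sum smooth_on_scaleR metricD(4)[OF p] smooth_on_const open_E[OF p])
  let ?r = "\<lambda>x. \<Sum>b\<in>Basis. ((1/2) *\<^sub>R (D (\<lambda>y. G p y w b) x v + D (\<lambda>y. G p y v b) x w - D (\<lambda>y. G p y v w) x b)) *\<^sub>R b"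
  show "smooth_on (E p) ?r"
    by (intro smooth_on_sum smooth_on_scaleR smooth_on_const smooth_on_add smooth_on_diff smooth_on_D metricD(4)[OF p] open_E[OF p])
  show "T x (\<Gamma> p x v w) = ?r x" if "x \<in> E p" for x
    unfolding T_def
  proof (intro sum.cong refl arg_cong2[where f=scaleR])
    fix b :: 'e
    show "G p x (\<Gamma> p x v w) b = (1/2) *\<^sub>R (D (\<lambda>y. G p y w b) x v + D (\<lambda>y. G p y v b) x w - D (\<lambda>y. G p y v w) x b)"
      using christoffel_eq[OF p that, of v w b] by simp
  qed
qed

lemma christoffel_differentiable: "p \<in> points M \<Longrightarrow> x \<in> E p \<Longrightarrow> (\<lambda>y. \<Gamma> p y v w) differentiable (at x)"
  by (rule smooth_on_differentiable[OF christoffel_smooth])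

lemma has_derivative_christoffel:
  assumes "p \<in> points M" "h x \<in> E p"
    and "(h has_derivative h') (at x)" "(k has_derivative k') (at x)" "(l has_derivative l') (at x)"
  shows "((\<lambda>x. \<Gamma> p (h x) (k x) (l x)) has_derivative
    (\<lambda>u. D (\<lambda>y. \<Gamma> p y (k x) (l x)) (h x) (h' u) + \<Gamma> p (h x) (k' u) (l x) + \<Gamma> p (h x) (k x) (l' u))) (at x)"
  by (rule has_derivative_bilinear_family[OF open_E[OF assms(1)] assms(2) christoffel_bilinear[OF assms(1)]
        christoffel_differentiable[OF assms(1,2)] assms(3-5)])

text \<open>Differentiating the relation between the metrics in the two charts produces second
  derivatives of the transition map. In the Koszul combination their symmetry leaves exactly one
  such term.\<close>

lemma christoffel_change:
  assumes p: "p \<in> points M" and q: "q \<in> points M" and x: "x \<in> chart M p ` (chart_dom M p \<inter> chart_dom M q)"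
  defines "\<phi> \<equiv> \<lambda>y. chart M q (chart_inv M p y)"
  shows "D \<phi> x (\<Gamma> p x v w) = \<Gamma> q (\<phi> x) (D \<phi> x v) (D \<phi> x w) + D (\<lambda>y. D \<phi> y v) x w"
proof -
  let ?O = "chart M p ` (chart_dom M p \<inter> chart_dom M q)"
  note O = smooth_transition[OF M p q, folded \<phi>_def]
  have OE: "y \<in> E p" if "y \<in> ?O" for y using that by blast
  have inv: "chart_inv M p y \<in> chart_dom M p" "chart_inv M p y \<in> chart_dom M q" if "y \<in> ?O" for y
    using that chart_inv_chart[OF charted_M p] by auto
  have \<phi>E: "\<phi> y \<in> E q" if "y \<in> ?O" for y using inv[OF that] by (simp add: \<phi>_def)
  have idD: "D (\<lambda>y. chart M p (chart_inv M p y)) y v = v" if "y \<in> E p" for y v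
  proof -
    have "D (\<lambda>y. chart M p (chart_inv M p y)) y = D (\<lambda>y. y) y"
      by (rule D_cong_open[OF open_E[OF p] that]) (rule chart_chart_inv(1))
    then show ?thesis by (simp add: frechet_derivative_ident)
  qed
  have Geq: "G p y v w = G q (\<phi> y) (D \<phi> y v) (D \<phi> y w)" if y: "y \<in> ?O" for y v w
    using G_plot[OF plot_chart_inv[OF M p] OE[OF y] p inv(1)[OF y], of v w]
      G_plot[OF plot_chart_inv[OF M p] OE[OF y] q inv(2)[OF y], of v w]
    by (simp add: idD[OF OE[OF y]] chart_chart_inv(1)[OF OE[OF y]] \<phi>_def)
  let ?J = "D \<phi> x" and ?H = "\<lambda>v w. D (\<lambda>y. D \<phi> y v) x w"
  have H_sym: "?H v w = ?H w v" for v w by (rule D_D_commute[OF O x])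
  have DG: "D (\<lambda>y. G p y v w) x u = D (\<lambda>y. G q y (?J v) (?J w)) (\<phi> x) (?J u) + G q (\<phi> x) (?H v u) (?J w) + G q (\<phi> x) (?J v) (?H w u)" for u v w
  proof -
    have "D (\<lambda>y. G p y v w) x = D (\<lambda>y. G q (\<phi> y) (D \<phi> y v) (D \<phi> y w)) x"
      by (rule D_cong_open[OF O(1) x]) (rule Geq)
    also have "\<dots> = (\<lambda>u. D (\<lambda>y. G q y (?J v) (?J w)) (\<phi> x) (?J u) + G q (\<phi> x) (?H v u) (?J w) + G q (\<phi> x) (?J v) (?H w u))"
      by (intro D_eqI has_derivative_G q \<phi>E x smooth_on_has_derivative[OF O(2)] smooth_on_has_derivative[OF smooth_on_D[OF O(2)]])
    finally show ?thesis by simp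
  qed
  have r: "chart_inv M p x \<in> chart_dom M p" "chart_inv M p x \<in> chart_dom M q" using inv[OF x] by auto
  have xr: "chart M p (chart_inv M p x) = x" using chart_chart_inv(1)[OF OE[OF x]] .
  have J: "?J = tangent_change M p q (chart_inv M p x)" by (simp add: tangent_change_eq \<phi>_def xr)
  have sJ: "\<exists>u. u' = ?J u" for u'
    using tangent_change_inverse[OF q r(2) p r(1), of u'] unfolding J by metis
  have lJ: "linear ?J" using smooth_on_linear_D[OF O(2) x] .
  show ?thesis
  proof (rule G_eq_imp_eq[OF q \<phi>E[OF x]])
    fix u' obtain u where u: "u' = ?J u" using sJ by blast
    have "2 * G q (\<phi> x) (?J (\<Gamma> p x v w)) (?J u) = 2 * G p x (\<Gamma> p x v w) u" by (simp add: Geq[OF x])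
    also have "\<dots> = 2 * G q (\<phi> x) (\<Gamma> q (\<phi> x) (?J v) (?J w)) (?J u) + 2 * G q (\<phi> x) (?H v w) (?J u)"
      unfolding christoffel_eq[OF p OE[OF x]] christoffel_eq[OF q \<phi>E[OF x]] DG
      using H_sym[of w v] H_sym[of u v] H_sym[of u w] G_sym[OF q \<phi>E[OF x]] by simp
    finally show "G q (\<phi> x) (?J (\<Gamma> p x v w)) u' = G q (\<phi> x) (\<Gamma> q (\<phi> x) (?J v) (?J w) + ?H v w) u'"
      by (simp add: u linear_add[OF G_linear(1)[OF q \<phi>E[OF x]]])
  qed
qed

text \<open>\<open>covariant_derivative\<close> uses the preferred chart at
  \<open>\<gamma> t\<close>, which changes with \<open>t\<close>. The transformation law of the
  Christoffel symbols cancels the second derivatives of the transition map, so any fixed chart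
  around \<open>\<gamma> t\<close> computes the same vector.\<close>

lemma covariant_derivative_in_chart:
  assumes \<gamma>: "plot M UNIV \<gamma>" and p: "p \<in> points M" "\<gamma> t \<in> chart_dom M p"
    and w: "(along_rep M \<gamma> V p has_vector_derivative w') (at t)"
  shows "tangent_change M (\<gamma> t) p (\<gamma> t) (covariant_derivative M g \<gamma> V t) =
    w' + \<Gamma> p (chart M p (\<gamma> t)) (D (\<lambda>s. chart M p (\<gamma> s)) t 1) (along_rep M \<gamma> V p t)"
proof -
  define q where "q = \<gamma> t"
  define \<phi> where "\<phi> = (\<lambda>y. chart M q (chart_inv M p y))"
  define u where "u = (\<lambda>s. chart M p (\<gamma> s))"
  let ?w = "along_rep M \<gamma> V p"
  have pts: "\<gamma> s \<in> points M" for s using plotD(2)[OF \<gamma>] by blast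
  then have q: "q \<in> points M" by (simp add: q_def)
  have td: "\<gamma> s \<in> chart_dom M (\<gamma> s)" for s using chartedD(1)[OF charted_M pts] .
  let ?T = "{s\<in>UNIV. \<gamma> s \<in> chart_dom M p} \<inter> {s\<in>UNIV. \<gamma> s \<in> chart_dom M q}"
  have T: "open ?T" "t \<in> ?T" using plotD(3)[OF \<gamma>] p q td[of t] by (auto simp: q_def)
  have x: "u s \<in> chart M p ` (chart_dom M p \<inter> chart_dom M q)" if "s \<in> ?T" for s using that by (auto simp: u_def)
  note O = smooth_transition[OF M p(1) q, folded \<phi>_def]
  have tc: "tangent_change M p q (\<gamma> s) = D \<phi> (u s)" for s by (simp add: tangent_change_eq \<phi>_def u_def)
  have wq: "along_rep M \<gamma> V q s = D \<phi> (u s) (?w s)" if "s \<in> ?T" for s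
    unfolding along_rep_def tc[symmetric]
    by (rule tangent_change_trans[symmetric]) (use that pts td p q in auto)
  have u: "(u has_derivative D u t) (at t)"
    unfolding u_def by (rule has_derivative_D[OF plot_chart_differentiable[OF \<gamma> UNIV_I p]])
  have wd: "(?w has_derivative (\<lambda>s. s *\<^sub>R w')) (at t)" using w by (simp add: has_vector_derivative_def)
  have "((\<lambda>s. D \<phi> (u s) (?w s)) has_derivative
      (\<lambda>s. D (\<lambda>y. D \<phi> y (?w t)) (u t) (D u t s) + D \<phi> (u t) (s *\<^sub>R w'))) (at t)"
    by (rule has_derivative_D_joint[OF O x[OF T(2)] u wd])
  then have "(along_rep M \<gamma> V q has_derivative
      (\<lambda>s. D (\<lambda>y. D \<phi> y (?w t)) (u t) (D u t s) + D \<phi> (u t) (s *\<^sub>R w'))) (at t)"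
    by (rule has_derivative_transform_within_open[OF _ T]) (rule wq[symmetric])
  then have "D (along_rep M \<gamma> V q) t = (\<lambda>s. D (\<lambda>y. D \<phi> y (?w t)) (u t) (D u t s) + D \<phi> (u t) (s *\<^sub>R w'))"
    and diff: "along_rep M \<gamma> V q differentiable (at t)" by (auto simp: D_eqI differentiable_def)
  then have vd: "vector_derivative (along_rep M \<gamma> V q) (at t) = D (\<lambda>y. D \<phi> y (?w t)) (u t) (D u t 1) + D \<phi> (u t) w'"
    using vector_derivative_at[OF has_vector_derivative_D[OF diff]] by simp
  have vel: "velocity M \<gamma> t = D \<phi> (u t) (D u t 1)"
    unfolding velocity_eq_pd pd_eq_tangent_change[OF M \<gamma> UNIV_I p] tc[symmetric] by (simp add: q_def u_def)
  have Vt: "V t = D \<phi> (u t) (?w t)"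
    unfolding tc[symmetric] along_rep_def using tangent_change_inverse[OF pts td p] by (simp add: q_def)
  have ch: "chart M q q = \<phi> (u t)"
    using chart_inv_chart[OF charted_M p] by (simp add: q_def \<phi>_def u_def)
  have lJ: "linear (D \<phi> (u t))" by (rule smooth_on_linear_D[OF O(2) x[OF T(2)]])
  have "covariant_derivative M g \<gamma> V t = D \<phi> (u t) (w' + \<Gamma> p (u t) (D u t 1) (?w t))"
    unfolding covariant_derivative_def q_def[symmetric] vd ch vel linear_add[OF lJ]
      christoffel_change[OF p(1) q x[OF T(2)], folded \<phi>_def]
    unfolding Vt D_D_commute[OF O x[OF T(2)], of "D u t 1"] by (simp add: add_ac \<phi>_def)
  then have *: "covariant_derivative M g \<gamma> V t = tangent_change M p (\<gamma> t) (\<gamma> t) (w' + \<Gamma> p (u t) (D u t 1) (?w t))"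
    unfolding tc[symmetric] q_def .
  show ?thesis unfolding * tangent_change_inverse[OF p pts td] u_def ..
qed

end

subsection \<open>Geodesics and variations through geodesics\<close>

lemma smooth_on_bilinear_family:
  fixes F :: "'a::euclidean_space \<Rightarrow> 'b::euclidean_space \<Rightarrow> 'c::euclidean_space \<Rightarrow> 'd::real_normed_vector"
  assumes S: "open S" and T: "open T" and bil: "\<And>y. y \<in> T \<Longrightarrow> bilinear (F y)"
    and F: "\<And>v w. smooth_on T (\<lambda>y. F y v w)"
    and h: "smooth_on S h" "h ` S \<subseteq> T" and k: "smooth_on S k" and l: "smooth_on S l"
  shows "smooth_on S (\<lambda>x. F (h x) (k x) (l x))"
proof -
  have "smooth_on S (\<lambda>x. ((k x \<bullet> b) * (l x \<bullet> c)) *\<^sub>R F (h x) b c)" for b c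
  proof -
    have 1: "smooth_on S (\<lambda>x. k x \<bullet> b)" by (rule smooth_on_bounded_linear[OF bounded_linear_inner_left S k])
    have 2: "smooth_on S (\<lambda>x. l x \<bullet> c)" by (rule smooth_on_bounded_linear[OF bounded_linear_inner_left S l])
    have 3: "smooth_on S (\<lambda>x. (k x \<bullet> b) * (l x \<bullet> c))"
      by (rule smooth_on_bounded_bilinear[OF bounded_bilinear_mult S 1 2])
    have 4: "smooth_on S (\<lambda>x. F (h x) b c)" by (rule smooth_on_compose[OF S T F[of b c] h(1,2)])
    show ?thesis by (rule smooth_on_scaleR[OF S 3 4])
  qed
  then have "smooth_on S (\<lambda>x. \<Sum>b\<in>Basis. \<Sum>c\<in>Basis. ((k x \<bullet> b) * (l x \<bullet> c)) *\<^sub>R F (h x) b c)"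
    by (intro smooth_on_sum S)
  then show ?thesis
    by (rule smooth_on_cong[OF S, rotated]) (rule bilinear_euclidean[OF bil, symmetric], use h(2) in blast)
qed

context riemannian_manifold
begin

lemma along_rep_velocity:
  assumes \<gamma>: "plot M UNIV \<gamma>" and p: "p \<in> points M" and t: "\<gamma> t \<in> chart_dom M p"
  shows "along_rep M \<gamma> (velocity M \<gamma>) p t = D (\<lambda>s. chart M p (\<gamma> s)) t 1"
  unfolding along_rep_def velocity_eq_pd by (rule D_chart_plot[OF M \<gamma> UNIV_I p t, symmetric])

lemma covariant_derivative_velocity:
  assumes \<gamma>: "plot M UNIV \<gamma>" and p: "p \<in> points M" and t: "\<gamma> t \<in> chart_dom M p"
  defines "u \<equiv> \<lambda>s. chart M p (\<gamma> s)"
  shows "tangent_change M (\<gamma> t) p (\<gamma> t) (covariant_derivative M g \<gamma> (velocity M \<gamma>) t) =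
    D (\<lambda>s. D u s 1) t 1 + \<Gamma> p (u t) (D u t 1) (D u t 1)"
proof -
  let ?T = "{s\<in>UNIV. \<gamma> s \<in> chart_dom M p}"
  have T: "open ?T" "t \<in> ?T" using plotD(3)[OF \<gamma> p] t by auto
  have su: "smooth_on ?T u" using plotD(4)[OF \<gamma> p] by (simp add: u_def)
  have "((\<lambda>s. D u s 1) has_vector_derivative D (\<lambda>s. D u s 1) t 1) (at t)"
    by (rule smooth_on_has_vector_derivative[OF smooth_on_D[OF su] T(2)])
  then have "(along_rep M \<gamma> (velocity M \<gamma>) p has_vector_derivative D (\<lambda>s. D u s 1) t 1) (at t)"
    by (rule has_vector_derivative_transform_within_open[OF _ T])
      (simp add: along_rep_velocity[OF \<gamma> p] u_def)
  from covariant_derivative_in_chart[OF \<gamma> p t this] show ?thesis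
    by (simp add: along_rep_velocity[OF \<gamma> p t] u_def)
qed

lemma geodesic_in_chart:
  assumes \<gamma>: "geodesic M g \<gamma>" and p: "p \<in> points M" and t: "\<gamma> t \<in> chart_dom M p"
  defines "u \<equiv> \<lambda>s. chart M p (\<gamma> s)"
  shows "D (\<lambda>s. D u s 1) t 1 = - \<Gamma> p (u t) (D u t 1) (D u t 1)"
proof -
  have pl: "plot M UNIV \<gamma>" using \<gamma> by (simp add: geodesic_def smooth_map_real_line)
  have pts: "\<gamma> t \<in> points M" using plotD(2)[OF pl] by blast
  have "tangent_change M (\<gamma> t) p (\<gamma> t) (covariant_derivative M g \<gamma> (velocity M \<gamma>) t) = 0"
    using \<gamma> linear_0[OF linear_tangent_change[OF M pts p chartedD(1)[OF charted_M pts] t]] by (simp add: geodesic_def)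
  then show ?thesis using covariant_derivative_velocity[OF pl p t] unfolding u_def by (simp add: eq_neg_iff_add_eq_0)
qed

text \<open>The times at which position and velocity agree form an open and closed set. Openness is
  uniqueness for the first-order system in position and velocity in a fixed chart. For closedness,
  agreement of positions is a closed condition by the Hausdorff property, and at a common position a
  difference of velocities persists nearby.\<close>

lemma geodesic_unique:
  assumes g1: "geodesic M g \<gamma>1" and g2: "geodesic M g \<gamma>2" and eq: "\<gamma>1 0 = \<gamma>2 0" "velocity M \<gamma>1 0 = velocity M \<gamma>2 0"
  shows "\<gamma>1 = \<gamma>2"
proof -
  have pl: "plot M UNIV \<gamma>1" "plot M UNIV \<gamma>2" using g1 g2 by (auto simp: geodesic_def smooth_map_real_line)
  define C where "C = {t. \<gamma>1 t = \<gamma>2 t}"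
  define S where "S = {t. \<gamma>1 t = \<gamma>2 t \<and> velocity M \<gamma>1 t = velocity M \<gamma>2 t}"
  have haus: "Hausdorff_space (manifold_topology M)" using M by (simp add: smooth_manifold_def)
  have "closedin (top_of_set UNIV) {t \<in> topspace (top_of_set (UNIV::real set)). \<gamma>1 t = \<gamma>2 t}"
    by (rule closedin_continuous_maps_eq[OF haus plot_continuous_map[OF M pl(1)] plot_continuous_map[OF M pl(2)]])
  then have closedC: "closed C" by (simp add: C_def)
  have loc: "\<exists>r>0. ball t0 r \<subseteq> {s\<in>UNIV. \<gamma>1 s \<in> chart_dom M p} \<and> ball t0 r \<subseteq> {s\<in>UNIV. \<gamma>2 s \<in> chart_dom M p}"
    if "p \<in> points M" "\<gamma>1 t0 = p" "\<gamma>2 t0 = p" for t0 p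
  proof -
    have "open ({s\<in>UNIV. \<gamma>1 s \<in> chart_dom M p} \<inter> {s\<in>UNIV. \<gamma>2 s \<in> chart_dom M p})"
      by (intro open_Int plotD(3)[OF pl(1) that(1)] plotD(3)[OF pl(2) that(1)])
    moreover have "t0 \<in> {s\<in>UNIV. \<gamma>1 s \<in> chart_dom M p} \<inter> {s\<in>UNIV. \<gamma>2 s \<in> chart_dom M p}"
      using that chartedD(1)[OF charted_M that(1)] by simp
    ultimately obtain r where "r > 0" "ball t0 r \<subseteq> {s\<in>UNIV. \<gamma>1 s \<in> chart_dom M p} \<inter> {s\<in>UNIV. \<gamma>2 s \<in> chart_dom M p}"
      by (rule openE)
    then show ?thesis by auto
  qed
  have vel: "velocity M \<gamma> s = tangent_change M p (\<gamma> s) (\<gamma> s) (D (\<lambda>s. chart M p (\<gamma> s)) s 1)"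
    if "plot M UNIV \<gamma>" "p \<in> points M" "\<gamma> s \<in> chart_dom M p" for \<gamma> p s
    unfolding velocity_eq_pd by (rule pd_eq_tangent_change[OF M that(1) UNIV_I that(2,3)])
  have opS: "open S"
  proof (subst open_subopen, intro ballI)
    fix t0 assume t0: "t0 \<in> S"
    define p where "p = \<gamma>1 t0"
    have p: "p \<in> points M" "\<gamma>1 t0 = p" "\<gamma>2 t0 = p" using plotD(2)[OF pl(1) UNIV_I, of t0] t0 by (simp_all add: p_def S_def)
    obtain r where r: "r > 0" and b: "ball t0 r \<subseteq> {s\<in>UNIV. \<gamma>1 s \<in> chart_dom M p}" "ball t0 r \<subseteq> {s\<in>UNIV. \<gamma>2 s \<in> chart_dom M p}"
      using loc[OF p] by blast
    define x where "x = (\<lambda>\<gamma> s :: real. (chart M p (\<gamma> s), D (\<lambda>s. chart M p (\<gamma> s)) s 1))"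
    define F where "F = (\<lambda>z. (snd z, - \<Gamma> p (fst z) (snd z) (snd z)))"
    have op: "open (E p \<times> (UNIV::'e set))" by (intro open_Times open_E[OF p(1)] open_UNIV)
    have F: "smooth_on (E p \<times> UNIV) F"
      unfolding F_def
      by (intro smooth_on_Pair smooth_on_uminus smooth_on_bilinear_family[OF op open_E[OF p(1)] christoffel_bilinear[OF p(1)] christoffel_smooth[OF p(1)]]
          smooth_on_snd smooth_on_fst smooth_on_id op) auto
    have sol: "x \<gamma> t \<in> E p \<times> UNIV \<and> (x \<gamma> has_vector_derivative F (x \<gamma> t)) (at t)"
      if gg: "geodesic M g \<gamma>" "plot M UNIV \<gamma>" and T: "ball t0 r \<subseteq> {s\<in>UNIV. \<gamma> s \<in> chart_dom M p}" and t: "t \<in> ball t0 r" for \<gamma> t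
    proof
      let ?u = "\<lambda>s. chart M p (\<gamma> s)"
      have d: "\<gamma> t \<in> chart_dom M p" using T t by blast
      then show "x \<gamma> t \<in> E p \<times> UNIV" by (simp add: x_def)
      have t': "t \<in> {s\<in>UNIV. \<gamma> s \<in> chart_dom M p}" using d by simp
      note s = plotD(4)[OF gg(2) p(1)]
      have "(x \<gamma> has_vector_derivative (D ?u t 1, D (\<lambda>s. D ?u s 1) t 1)) (at t)"
        unfolding x_def
        by (intro has_vector_derivative_Pair smooth_on_has_vector_derivative[OF s t'] smooth_on_has_vector_derivative[OF smooth_on_D[OF s] t'])
      then show "(x \<gamma> has_vector_derivative F (x \<gamma> t)) (at t)"
        unfolding geodesic_in_chart[OF gg(1) p(1) d] by (simp add: F_def x_def)
    qed
    have "chart M p (\<gamma>1 t0) = chart M p (\<gamma>2 t0)" using p by simp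
    moreover have "D (\<lambda>s. chart M p (\<gamma>1 s)) t0 1 = D (\<lambda>s. chart M p (\<gamma>2 s)) t0 1"
      using t0 vel[OF pl(1) p(1), of t0] vel[OF pl(2) p(1), of t0] p chartedD(1)[OF charted_M p(1)]
      by (simp add: S_def tangent_change_self)
    ultimately have x0: "x \<gamma>1 t0 = x \<gamma>2 t0" by (simp add: x_def)
    obtain e where e: "e > 0" "e \<le> r" "\<And>t. t \<in> ball t0 e \<Longrightarrow> x \<gamma>1 t = x \<gamma>2 t"
      using ode_unique_local[OF op F r sol[OF g1 pl(1) b(1)] sol[OF g2 pl(2) b(2)] x0, of thesis] by simp
    have "t \<in> S" if t: "t \<in> ball t0 e" for t
    proof -
      have d: "\<gamma>1 t \<in> chart_dom M p" "\<gamma>2 t \<in> chart_dom M p" using t e(2) b by (auto simp: subset_iff)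
      have xx: "chart M p (\<gamma>1 t) = chart M p (\<gamma>2 t)" "D (\<lambda>s. chart M p (\<gamma>1 s)) t 1 = D (\<lambda>s. chart M p (\<gamma>2 s)) t 1"
        using e(3)[OF t] by (simp_all add: x_def)
      have g: "\<gamma>1 t = \<gamma>2 t" using inj_onD[OF chartedD(3)[OF charted_M p(1)] xx(1) d] .
      show ?thesis using vel[OF pl(1) p(1) d(1)] vel[OF pl(2) p(1) d(2)] by (simp add: S_def g xx(2))
    qed
    then show "\<exists>T. open T \<and> t0 \<in> T \<and> T \<subseteq> S" using e(1) by (intro exI[of _ "ball t0 e"]) auto
  qed
  have "open (- S)"
  proof (subst open_subopen, intro ballI)
    fix t0 assume t0: "t0 \<in> - S"
    show "\<exists>T. open T \<and> t0 \<in> T \<and> T \<subseteq> - S"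
    proof (cases "t0 \<in> C")
      case False
      then show ?thesis using closedC by (intro exI[of _ "- C"]) (auto simp: C_def S_def)
    next
      case True
      define p where "p = \<gamma>1 t0"
      have p: "p \<in> points M" "\<gamma>1 t0 = p" "\<gamma>2 t0 = p" using plotD(2)[OF pl(1) UNIV_I, of t0] True by (simp_all add: p_def C_def)
      obtain r where r: "r > 0" and b: "ball t0 r \<subseteq> {s\<in>UNIV. \<gamma>1 s \<in> chart_dom M p}" "ball t0 r \<subseteq> {s\<in>UNIV. \<gamma>2 s \<in> chart_dom M p}"
        using loc[OF p] by blast
      \<comment> \<open>Velocities at different times refer to different preferred charts; measured
        in the single chart at \<open>p\<close>, their difference is continuous in
        \<open>s\<close>.\<close>
      define d where "d = (\<lambda>s. D (\<lambda>s. chart M p (\<gamma>1 s)) s 1 - D (\<lambda>s. chart M p (\<gamma>2 s)) s 1)"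
      have "smooth_on (ball t0 r) d" unfolding d_def
        by (intro smooth_on_diff open_ball smooth_on_D smooth_on_subset[OF plotD(4)[OF pl(1) p(1)] b(1)] smooth_on_subset[OF plotD(4)[OF pl(2) p(1)] b(2)])
      then have op: "open (ball t0 r \<inter> d -` (- {0}))"
        by (intro continuous_open_preimage smooth_on_continuous open_ball) auto
      have d0: "d t0 \<noteq> 0"
        using t0 True vel[OF pl(1) p(1), of t0] vel[OF pl(2) p(1), of t0] p chartedD(1)[OF charted_M p(1)]
        by (auto simp: S_def C_def d_def)
      have notS: "s \<notin> S" if s: "s \<in> ball t0 r" "d s \<noteq> 0" for s
      proof
        assume S: "s \<in> S"
        have dd: "\<gamma>1 s \<in> chart_dom M p" "\<gamma>2 s \<in> chart_dom M p" using s b by auto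
        show False using s(2) S D_chart_plot[OF M pl(1) UNIV_I p(1) dd(1)] D_chart_plot[OF M pl(2) UNIV_I p(1) dd(2)]
          by (simp add: d_def S_def velocity_eq_pd)
      qed
      show ?thesis
      proof (intro exI conjI subsetI)
        show "open (ball t0 r \<inter> d -` (- {0}))" by (rule op)
        show "t0 \<in> ball t0 r \<inter> d -` (- {0})" using d0 r by simp
        fix s assume "s \<in> ball t0 r \<inter> d -` (- {0})"
        then show "s \<in> - S" using notS[of s] by simp
      qed
    qed
  qed
  then have clS: "closed S" by (simp only: closed_def)
  have 0: "0 \<in> S" using eq by (simp add: S_def)
  have "S = {} \<or> S = UNIV" by (rule iffD1[OF clopen conjI[OF clS opS]])
  then have "t \<in> S" for t using 0 by (elim disjE) simp_all
  then show ?thesis by (simp add: S_def fun_eq_iff)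
qed

lemma riem_exp_eq:
  assumes "geodesic M g \<gamma>" "\<gamma> 0 = p" "velocity M \<gamma> 0 = X"
  shows "riem_exp M g p X = \<gamma> 1"
proof -
  have "(THE \<gamma>. geodesic M g \<gamma> \<and> \<gamma> 0 = p \<and> velocity M \<gamma> 0 = X) = \<gamma>"
  proof (rule the_equality)
    show "geodesic M g \<gamma> \<and> \<gamma> 0 = p \<and> velocity M \<gamma> 0 = X" using assms by blast
    fix c assume c: "geodesic M g c \<and> c 0 = p \<and> velocity M c 0 = X"
    have 1: "c 0 = \<gamma> 0" using c assms(2) by (elim conjE) (rule trans, assumption, rule sym)
    have 2: "velocity M c 0 = velocity M \<gamma> 0" using c assms(3) by (elim conjE) (rule trans, assumption, rule sym)
    show "c = \<gamma>" by (rule geodesic_unique[OF conjunct1[OF c] assms(1) 1 2])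
  qed
  then show ?thesis unfolding riem_exp_def by (rule arg_cong)
qed

text \<open>Each t \<mapsto> u (s, t) is a geodesic in the chart at \<open>p\<close>, and
  \<open>A\<close> is the covariant t-derivative of the variation field. Commuting partial
  derivatives moves the s-derivative onto the geodesic equation; the derivatives of \<Gamma> that
  remain form the curvature.\<close>

lemma jacobi_variation:
  fixes u :: "real \<times> real \<Rightarrow> 'e"
  assumes p: "p \<in> points M" and W: "open W" "smooth_on W u" "u ` W \<subseteq> E p"
  defines "us \<equiv> \<lambda>z. D u z (1, 0)" and "ut \<equiv> \<lambda>z. D u z (0, 1)"
  assumes geo: "\<And>z. z \<in> W \<Longrightarrow> D ut z (0, 1) = - \<Gamma> p (u z) (ut z) (ut z)"
  defines "A \<equiv> \<lambda>z. D us z (0, 1) + \<Gamma> p (u z) (ut z) (us z)"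
  assumes z: "z \<in> W" and uz: "u z = chart M p p"
  shows "D A z (0, 1) + \<Gamma> p (u z) (ut z) (A z) = - curvature M g p (us z) (ut z) (ut z)"
proof -
  have sus: "smooth_on W us" and sut: "smooth_on W ut" unfolding us_def ut_def by (rule smooth_on_D[OF W(2)])+
  have uE: "u y \<in> E p" if "y \<in> W" for y using W(3) that by blast
  have com: "D us y (0, 1) = D ut y (1, 0)" if "y \<in> W" for y
    unfolding us_def ut_def by (rule D_D_commute[OF W(1,2) that])
  note d = smooth_on_has_derivative[OF W(2)] smooth_on_has_derivative[OF sus] smooth_on_has_derivative[OF sut]
  have DGam: "((\<lambda>y. \<Gamma> p (u y) (k y) (l y)) has_derivative
      (\<lambda>e. D (\<lambda>y. \<Gamma> p y (k z) (l z)) (u z) (D u z e) + \<Gamma> p (u z) (D k z e) (l z) + \<Gamma> p (u z) (k z) (D l z e))) (at z)"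
    if "smooth_on W k" "smooth_on W l" for k l
    by (rule has_derivative_christoffel[OF p uE[OF z] d(1)[OF z] smooth_on_has_derivative[OF that(1) z] smooth_on_has_derivative[OF that(2) z]])
  have b: "linear (\<Gamma> p (u z) v)" "linear (\<lambda>v. \<Gamma> p (u z) v w)" for v w
    using christoffel_bilinear[OF p uE[OF z]] by (auto simp: bilinear_def)
  note sym = christoffel_sym[OF p uE[OF z]]
  have "D (\<lambda>y. D us y (0, 1)) z (0, 1) = D (\<lambda>y. D ut y (1, 0)) z (0, 1)"
    by (rule fun_cong[OF D_cong_open[OF W(1) z]]) (rule com)
  also have "\<dots> = D (\<lambda>y. D ut y (0, 1)) z (1, 0)" by (rule D_D_commute[OF W(1) sut z])
  also have "\<dots> = D (\<lambda>y. - \<Gamma> p (u y) (ut y) (ut y)) z (1, 0)"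
    by (rule fun_cong[OF D_cong_open[OF W(1) z]]) (rule geo)
  also have "\<dots> = - (D (\<lambda>y. \<Gamma> p y (ut z) (ut z)) (u z) (us z) + \<Gamma> p (u z) (D ut z (1, 0)) (ut z) + \<Gamma> p (u z) (ut z) (D ut z (1, 0)))"
  proof -
    from fun_cong[OF D_eqI[OF has_derivative_minus[OF DGam[OF sut sut]]], of "(1, 0)"]
    show ?thesis by (simp only: meta_eq_to_obj_eq[OF us_def, THEN fun_cong, of z])
  qed
  finally have 1: "D (\<lambda>y. D us y (0, 1)) z (0, 1) =
    - (D (\<lambda>y. \<Gamma> p y (ut z) (ut z)) (u z) (us z) + 2 *\<^sub>R \<Gamma> p (u z) (ut z) (D ut z (1, 0)))"
    by (simp add: sym[of "D ut z (1, 0)"] scaleR_2)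
  have "D A z (0, 1) = D (\<lambda>y. D us y (0, 1)) z (0, 1) +
    (D (\<lambda>y. \<Gamma> p y (ut z) (us z)) (u z) (ut z) + \<Gamma> p (u z) (D ut z (0, 1)) (us z) + \<Gamma> p (u z) (ut z) (D us z (0, 1)))"
  proof -
    have "(A has_derivative (\<lambda>e. D (\<lambda>y. D us y (0, 1)) z e + (D (\<lambda>y. \<Gamma> p y (ut z) (us z)) (u z) (D u z e) +
        \<Gamma> p (u z) (D ut z e) (us z) + \<Gamma> p (u z) (ut z) (D us z e)))) (at z)"
      unfolding A_def by (rule has_derivative_add[OF smooth_on_has_derivative[OF smooth_on_D[OF sus] z] DGam[OF sut sus]])
    from fun_cong[OF D_eqI[OF this], of "(0, 1)"] show ?thesis by (simp only: ut_def[symmetric] meta_eq_to_obj_eq[OF ut_def, THEN fun_cong, of z, symmetric])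
  qed
  moreover have "\<Gamma> p (u z) (D ut z (0, 1)) (us z) = - \<Gamma> p (u z) (us z) (\<Gamma> p (u z) (ut z) (ut z))"
    by (simp only: geo[OF z] linear_neg[OF b(2)] sym[of "\<Gamma> p (u z) (ut z) (ut z)" "us z"])
  moreover have "D us z (0, 1) = D ut z (1, 0)" by (rule com[OF z])
  moreover have "- (a + 2 *\<^sub>R b) + (c + - d + b) = - a - b + c - d" for a b c d :: 'e
    by (simp add: scaleR_2 algebra_simps)
  ultimately have 2: "D A z (0, 1) = - D (\<lambda>y. \<Gamma> p y (ut z) (ut z)) (u z) (us z) - \<Gamma> p (u z) (ut z) (D ut z (1, 0)) +
    D (\<lambda>y. \<Gamma> p y (ut z) (us z)) (u z) (ut z) - \<Gamma> p (u z) (us z) (\<Gamma> p (u z) (ut z) (ut z))"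
    by (simp only: 1)
  have 3: "D (\<lambda>y. \<Gamma> p y (ut z) (us z)) (u z) (ut z) = D (\<lambda>y. \<Gamma> p y (us z) (ut z)) (u z) (ut z)"
    by (rule fun_cong[OF D_cong_open[OF open_E[OF p] uE[OF z]]]) (rule christoffel_sym[OF p])
  have 4: "\<Gamma> p (u z) (ut z) (A z) = \<Gamma> p (u z) (ut z) (D ut z (1, 0)) + \<Gamma> p (u z) (ut z) (\<Gamma> p (u z) (us z) (ut z))"
    by (simp only: A_def linear_add[OF b(1)] com[OF z] sym[of "ut z" "us z"])
  have "curvature M g p (us z) (ut z) (ut z) = D (\<lambda>y. \<Gamma> p y (ut z) (ut z)) (u z) (us z) -
    D (\<lambda>y. \<Gamma> p y (us z) (ut z)) (u z) (ut z) + \<Gamma> p (u z) (us z) (\<Gamma> p (u z) (ut z) (ut z)) -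
    \<Gamma> p (u z) (ut z) (\<Gamma> p (u z) (us z) (ut z))"
    by (simp only: curvature_def Let_def uz)
  then show ?thesis unfolding 2 3 4 by (simp add: algebra_simps)
qed

end

subsection \<open>One-parameter subgroups\<close>

text \<open>Local uniqueness makes the agreement set open in the ball, continuity makes it closed,
  and a ball is connected.\<close>

lemma ode_unique:
  fixes F :: "'a::euclidean_space \<Rightarrow> 'a"
  assumes S: "open S" "smooth_on S F"
    and x: "\<And>t. t \<in> ball t0 r \<Longrightarrow> x t \<in> S \<and> (x has_vector_derivative F (x t)) (at t)"
    and y: "\<And>t. t \<in> ball t0 r \<Longrightarrow> y t \<in> S \<and> (y has_vector_derivative F (y t)) (at t)"
    and eq: "x t0 = y t0" and t: "t \<in> ball t0 (r::real)"
  shows "x t = y t"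
proof -
  let ?C = "{t \<in> ball t0 r. x t = y t}"
  have r: "r > 0" using t by (metis ball_empty empty_iff not_less)
  have cont: "continuous_on (ball t0 r) (\<lambda>t. x t - y t)"
  proof (rule continuous_at_imp_continuous_on, rule ballI)
    fix s assume s: "s \<in> ball t0 r"
    show "isCont (\<lambda>t. x t - y t) s"
      by (intro continuous_diff has_vector_derivative_continuous[OF x[OF s, THEN conjunct2]]
          has_vector_derivative_continuous[OF y[OF s, THEN conjunct2]])
  qed
  have "closedin (top_of_set (ball t0 r)) (ball t0 r \<inter> (\<lambda>t. x t - y t) -` {0})"
    by (rule continuous_closedin_preimage[OF cont]) simp
  moreover have "ball t0 r \<inter> (\<lambda>t. x t - y t) -` {0} = ?C" by auto
  ultimately have cl: "closedin (top_of_set (ball t0 r)) ?C" by simp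
  have "open ?C"
  proof (subst open_subopen, intro ballI)
    fix s assume s: "s \<in> ?C"
    then obtain d where d: "d > 0" "ball s d \<subseteq> ball t0 r"
      using open_contains_ball[of "ball t0 r"] by blast
    obtain e where e: "e > 0" "e \<le> d" "\<And>t. t \<in> ball s e \<Longrightarrow> x t = y t"
      using ode_unique_local[OF S d(1), of s x y thesis] x y d(2) s by blast
    have "ball s e \<subseteq> ?C"
    using t e(3) e(2) d(2) by force
    then show "\<exists>T. open T \<and> s \<in> T \<and> T \<subseteq> ?C" using e(1) by (intro exI[of _ "ball s e"]) simp
  qed
  then have op: "openin (top_of_set (ball t0 r)) ?C" by (intro open_subset) auto
  have "?C = {} \<or> ?C = ball t0 r"
    using connected_ball[of t0 r] cl op unfolding connected_clopen by blast
  moreover have "t0 \<in> ?C" using eq r by simp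
  ultimately have "?C = ball t0 r" by blast
  then show ?thesis using t by blast
qed

text \<open>The inverse charts are plots that cover \<open>M\<close>, so smoothness of a map can be
  tested on them with the closure rules for plots.\<close>

lemma smooth_mapI:
  assumes M: "smooth_manifold M" and F: "\<And>p. p \<in> points M \<Longrightarrow> F p \<in> points N"
    and pl: "\<And>p. p \<in> points M \<Longrightarrow> plot N (chart M p ` chart_dom M p) (\<lambda>x. F (chart_inv M p x))"
  shows "smooth_map M N F"
  unfolding smooth_map_def
proof (intro conjI ballI)
  show "F ` points M \<subseteq> points N" using F by blast
  fix p q assume p: "p \<in> points M" and q: "q \<in> points N"
  have e: "chart M p ` {r \<in> chart_dom M p. F r \<in> chart_dom N q} =
      {x \<in> chart M p ` chart_dom M p. F (chart_inv M p x) \<in> chart_dom N q}" (is "?L = ?R")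
  proof (rule equalityI; rule subsetI)
    fix x assume "x \<in> ?L"
    then obtain r where "r \<in> chart_dom M p" "F r \<in> chart_dom N q" "x = chart M p r" by blast
    then show "x \<in> ?R" using chart_inv_chart[OF smooth_manifold_charted[OF M] p, of r] by simp
  next
    fix x assume "x \<in> ?R"
    then show "x \<in> ?L" using chart_chart_inv[of x M p] by (intro image_eqI[of x _ "chart_inv M p x"]) auto
  qed
  show "open (chart M p ` {r \<in> chart_dom M p. F r \<in> chart_dom N q})"
    unfolding e by (rule plotD(3)[OF pl[OF p] q])
  show "smooth_on (chart M p ` {r \<in> chart_dom M p. F r \<in> chart_dom N q}) (chart N q \<circ> F \<circ> chart_inv M p)"
    unfolding e comp_def by (rule plotD(4)[OF pl[OF p] q])
qed

locale lie_group_loc =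
  fixes U :: "'u monoid" (structure) and A :: "('u, 'a::euclidean_space) manifold"
  assumes lie: "lie_group U A"
begin

lemma grp: "group U" and A: "smooth_manifold A" and carrier: "carrier U = points A"
  and mult_smooth: "smooth_map (prod_manifold A A) A (\<lambda>(x, y). x \<otimes> y)" and inv_smooth: "smooth_map A A (m_inv U)"
  using lie by (auto simp: lie_group_def)

sublocale group U by (rule grp)

lemmas charted_A = smooth_manifold_charted[OF A]

abbreviation "EU \<equiv> chart A \<one> ` chart_dom A \<one>"
abbreviation "\<iota> \<equiv> chart_inv A \<one>"
abbreviation "e0 \<equiv> chart A \<one> \<one>"

lemma one_points: "\<one> \<in> points A" using one_closed carrier by simp

lemma one_dom: "\<one> \<in> chart_dom A \<one>" by (rule chartedD(1)[OF charted_A one_points])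

lemma e0: "e0 \<in> EU" by (rule imageI[OF one_dom])

lemma open_EU: "open EU" by (rule chartedD(4)[OF charted_A one_points])

lemma \<iota>_e0: "\<iota> e0 = \<one>" by (rule chart_inv_chart[OF charted_A one_points one_dom])

lemma plot_\<iota>: "plot A EU \<iota>" by (rule plot_chart_inv[OF A one_points])

lemma plot_carrier: "plot A S f \<Longrightarrow> x \<in> S \<Longrightarrow> f x \<in> carrier U"
  using plotD(2) carrier by blast

lemma plot_mult: "plot A S f \<Longrightarrow> plot A S h \<Longrightarrow> plot A S (\<lambda>x. f x \<otimes> h x)"
  using plot_map[OF charted_prod[OF charted_A charted_A] mult_smooth plot_Pair] by force

lemma plot_inv: "plot A S f \<Longrightarrow> plot A S (\<lambda>x. inv (f x))"
  by (rule plot_map[OF charted_A inv_smooth])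

lemma plot_const_A: "open S \<Longrightarrow> u \<in> carrier U \<Longrightarrow> plot A S (\<lambda>x. u)"
  by (rule plot_const[OF charted_A]) (simp_all add: carrier)

lemma smooth_map_left: "u \<in> carrier U \<Longrightarrow> smooth_map A A (\<lambda>v. u \<otimes> v)"
  by (rule smooth_mapI[OF A])
    (auto simp: carrier[symmetric] intro!: plot_mult plot_const_A plot_chart_inv[OF A] chartedD(4)[OF charted_A])

lemma left_invariant_field_eq: "left_invariant_field U A X u = pd A (\<lambda>y. u \<otimes> \<iota> y) e0 X"
  unfolding left_invariant_field_def differential_eq_pd[OF charted_A one_points] ..

lemma plot_left_\<iota>: "u \<in> carrier U \<Longrightarrow> plot A EU (\<lambda>y. u \<otimes> \<iota> y)"
  by (intro plot_mult plot_const_A open_EU plot_\<iota>)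

lemma left_invariant_field_left:
  assumes u: "u \<in> carrier U" and v: "v \<in> carrier U"
  shows "differential A A (\<lambda>w. u \<otimes> w) v (left_invariant_field U A X v) = left_invariant_field U A X (u \<otimes> v)"
proof -
  have "pd A (\<lambda>y. u \<otimes> (v \<otimes> \<iota> y)) e0 X = differential A A (\<lambda>w. u \<otimes> w) (v \<otimes> \<iota> e0) (pd A (\<lambda>y. v \<otimes> \<iota> y) e0 X)"
    by (rule pd_map[OF A A smooth_map_left[OF u] plot_left_\<iota>[OF v] e0])
  moreover have "pd A (\<lambda>y. u \<otimes> (v \<otimes> \<iota> y)) e0 = pd A (\<lambda>y. u \<otimes> v \<otimes> \<iota> y) e0"
    by (rule pd_cong_open[OF open_EU e0]) (simp add: m_assoc u v plot_carrier[OF plot_\<iota>])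
  ultimately show ?thesis by (simp add: left_invariant_field_eq \<iota>_e0 v)
qed

lemma left_invariant_field_one: "left_invariant_field U A X \<one> = X"
proof -
  have "pd A (\<lambda>y. \<one> \<otimes> \<iota> y) e0 = pd A \<iota> e0"
    by (rule pd_cong_open[OF open_EU e0]) (simp add: plot_carrier[OF plot_\<iota>])
  then show ?thesis using pd_chart_inv[OF A one_points] by (simp add: left_invariant_field_eq)
qed

section \<open>Left-invariant fields in the chart at the unit element\<close>

definition fld :: "'a \<Rightarrow> 'a \<Rightarrow> 'a" where
  "fld X x = vector_field_rep A \<one> (left_invariant_field U A X) x"

definition mul_dom :: "('a \<times> 'a) set" where
  "mul_dom = {z \<in> EU \<times> EU. \<iota> (fst z) \<otimes> \<iota> (snd z) \<in> chart_dom A \<one>}"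

definition mul :: "'a \<times> 'a \<Rightarrow> 'a" where
  "mul z = chart A \<one> (\<iota> (fst z) \<otimes> \<iota> (snd z))"

lemma plot_mul: "plot A (EU \<times> EU) (\<lambda>z. \<iota> (fst z) \<otimes> \<iota> (snd z))"
proof (rule plot_mult)
  have o: "open (EU \<times> EU)" by (intro open_Times open_EU)
  show "plot A (EU \<times> EU) (\<lambda>z. \<iota> (fst z))"
    by (rule plot_compose[OF plot_\<iota> smooth_on_fst[OF o smooth_on_id[OF o]] o]) auto
  show "plot A (EU \<times> EU) (\<lambda>z. \<iota> (snd z))"
    by (rule plot_compose[OF plot_\<iota> smooth_on_snd[OF o smooth_on_id[OF o]] o]) auto
qed

lemma mul_dom: "open mul_dom" "smooth_on mul_dom mul" "x \<in> EU \<Longrightarrow> (x, e0) \<in> mul_dom"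
proof -
  show "open mul_dom" unfolding mul_dom_def by (rule plotD(3)[OF plot_mul one_points])
  have "mul = (\<lambda>z. chart A \<one> (\<iota> (fst z) \<otimes> \<iota> (snd z)))" by (rule ext) (rule mul_def)
  then show "smooth_on mul_dom mul" using plotD(4)[OF plot_mul one_points] by (simp only: mul_dom_def)
  assume x: "x \<in> EU"
  show "(x, e0) \<in> mul_dom"
    using chart_chart_inv(2)[OF x] plot_carrier[OF plot_\<iota> x] x e0 by (simp add: mul_dom_def \<iota>_e0)
qed

text \<open>The field is a partial derivative of the multiplication written in the chart at the
  unit; hence its smoothness is that of one function of two variables.\<close>

lemma fld_eq:
  assumes x: "x \<in> EU"
  shows "fld X x = D mul (x, e0) (0, X)"
proof -
  let ?u = "\<iota> x"
  have u: "?u \<in> carrier U" "?u \<in> chart_dom A \<one>" using plot_carrier[OF plot_\<iota> x] chart_chart_inv(2)[OF x] .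
  have "fld X x = D (\<lambda>y. chart A \<one> (?u \<otimes> \<iota> y)) e0 X"
    using D_chart_plot[OF A plot_left_\<iota>[OF u(1)] e0 one_points, of X] u
    by (simp add: fld_def vector_field_rep_def left_invariant_field_eq \<iota>_e0)
  also have "(\<lambda>y. chart A \<one> (?u \<otimes> \<iota> y)) = (\<lambda>y. mul (x, y))" by (simp add: mul_def)
  also have "D (\<lambda>y. mul (x, y)) e0 X = D mul (x, e0) (0, X)"
  proof -
    have "((\<lambda>y. (x, y)) has_derivative (\<lambda>v. (0, v))) (at e0)" by (auto intro!: derivative_eq_intros)
    from has_derivative_compose[OF this smooth_on_has_derivative[OF mul_dom(2) mul_dom(3)[OF x]]]
    show ?thesis by (simp add: D_eqI)
  qed
  finally show ?thesis .
qed

lemma fld_smooth: "smooth_on EU (fld X)"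
proof (rule smooth_on_cong[OF open_EU fld_eq[symmetric]])
  show "smooth_on EU (\<lambda>x. D mul (x, e0) (0, X))"
    by (rule smooth_on_D_joint[OF open_EU mul_dom(1,2)])
      (auto intro!: smooth_on_Pair smooth_on_const smooth_on_id open_EU mul_dom(3))
qed

lemma integral_curve_in_chart:
  assumes f: "plot A S f" and t: "t \<in> S" and v: "pd A f t 1 = left_invariant_field U A X (f t)" and d: "f t \<in> chart_dom A \<one>"
  shows "((\<lambda>t. chart A \<one> (f t)) has_vector_derivative fld X (chart A \<one> (f t))) (at t)"
using A f t one_points d charted_A has_vector_derivative_D plot_chart_differentiable by (fastforce simp: D_chart_plot v vector_field_rep_def fld_def chart_inv_chart)

text \<open>The differential equation is solved for \<open>fld X\<close> in the chart at the unit;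
  changing to the preferred chart along the curve turns its velocity back into the left-invariant
  field.\<close>

lemma local_integral_curve:
  obtains r and f :: "real \<Rightarrow> 'u" where "r > 0" "plot A (ball 0 r) f" "f 0 = \<one>" "\<And>t. t \<in> ball 0 r \<Longrightarrow> f t \<in> chart_dom A \<one>"
    "\<And>t. t \<in> ball 0 r \<Longrightarrow> pd A f t 1 = left_invariant_field U A X (f t)"
proof -
  obtain r and x :: "real \<Rightarrow> 'a" where r: "r > 0" "x 0 = e0" "smooth_on (ball 0 r) x"
    and x: "\<And>t. t \<in> ball 0 r \<Longrightarrow> x t \<in> EU \<and> (x has_vector_derivative fld X (x t)) (at t)"
    using ode_local_solution[OF open_EU fld_smooth[of X] e0, of thesis] by simp
  define f where "f t = \<iota> (x t)" for t
  have pf: "plot A (ball 0 r) f" unfolding f_def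
    by (rule plot_compose[OF plot_\<iota> r(3) open_ball]) (use x in blast)
  have fd: "f t \<in> chart_dom A \<one>" "chart A \<one> (f t) = x t" if "t \<in> ball 0 r" for t
    using chart_chart_inv[of "x t" A \<one>] x[OF that] by (simp_all add: f_def)
  have vel: "pd A f t 1 = left_invariant_field U A X (f t)" if t: "t \<in> ball 0 r" for t
  proof -
    have pts: "f t \<in> points A" using plotD(2)[OF pf t] .
    have "D (\<lambda>t. chart A \<one> (f t)) t = D x t"
      by (rule D_cong_open[OF open_ball t]) (rule fd(2))
    then have "D (\<lambda>t. chart A \<one> (f t)) t 1 = fld X (x t)"
      using D_eq_vector_derivative[OF x[OF t, THEN conjunct2]] by simp
    moreover have "fld X (x t) = tangent_change A (f t) \<one> (f t) (left_invariant_field U A X (f t))"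
      by (simp add: fld_def vector_field_rep_def f_def)
    moreover have "tangent_change A \<one> (f t) (f t) (tangent_change A (f t) \<one> (f t) v) = v" for v
    proof -
      have x': "chart A (f t) (f t) \<in> chart A (f t) ` chart_dom A (f t)" by (rule chart_self_mem[OF charted_A pts])
      have i: "chart_inv A (f t) (chart A (f t) (f t)) = f t"
        by (rule chart_inv_chart[OF charted_A pts chartedD(1)[OF charted_A pts]])
      have "pd A (chart_inv A (f t)) (chart A (f t) (f t)) v = v" by (rule pd_chart_inv[OF A pts])
      then show ?thesis
        using pd_eq_tangent_change[OF A plot_chart_inv[OF A pts] x' one_points, of v] fd(1)[OF t]
        by (simp add: i tangent_change_eq)
    qed
    ultimately show ?thesis
      using pd_eq_tangent_change[OF A pf t one_points fd(1)[OF t], of 1] by simp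
  qed
  have "f 0 = \<one>" by (simp add: f_def r(2) \<iota>_e0)
  then show thesis using that[of r f, OF r(1) pf _ fd(1) vel] by simp
qed

text \<open>For fixed \<open>s\<close>, both t \<mapsto> f (s + t) and t \<mapsto> f s \<otimes> f t
  are integral curves of the same left-invariant field with the same start, so uniqueness applies as
  long as both stay in the chart domain.\<close>

lemma local_one_parameter_subgroup:
  obtains d and f :: "real \<Rightarrow> 'u" where "d > 0" "plot A (ball 0 (2 * d)) f" "f 0 = \<one>" "pd A f 0 1 = X"
    "\<And>s t. \<bar>s\<bar> < d \<Longrightarrow> \<bar>t\<bar> < d \<Longrightarrow> f (s + t) = f s \<otimes> f t"
proof -
  obtain r and f :: "real \<Rightarrow> 'u" where r: "r > 0" and f: "plot A (ball 0 r) f" "f 0 = \<one>" "\<And>t. t \<in> ball 0 r \<Longrightarrow> f t \<in> chart_dom A \<one>"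
    and vel: "\<And>t. t \<in> ball 0 r \<Longrightarrow> pd A f t 1 = left_invariant_field U A X (f t)"
    by (rule local_integral_curve[of X]) (rule that; assumption)
  let ?B = "ball (0::real) r \<times> ball (0::real) r"
  have oB: "open ?B" by (intro open_Times open_ball)
  have pl: "plot A ?B (\<lambda>z. f (fst z) \<otimes> f (snd z))"
  proof (rule plot_mult)
    show "plot A ?B (\<lambda>z. f (fst z))"
      by (rule plot_compose[OF f(1) smooth_on_fst[OF oB smooth_on_id[OF oB]] oB]) auto
    show "plot A ?B (\<lambda>z. f (snd z))"
      by (rule plot_compose[OF f(1) smooth_on_snd[OF oB smooth_on_id[OF oB]] oB]) auto
  qed
  let ?W = "{z \<in> ?B. f (fst z) \<otimes> f (snd z) \<in> chart_dom A \<one>}"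
  have "open ?W" "(0, 0) \<in> ?W" using plotD(3)[OF pl one_points] r f(2) one_dom by auto
  then obtain T1 T2 where T: "open T1" "open T2" "(0, 0) \<in> T1 \<times> T2" "T1 \<times> T2 \<subseteq> ?W"
    by (rule open_prod_elim)
  have z: "0 \<in> T1" "0 \<in> T2" using T(3) by auto
  obtain d1 where d1: "d1 > 0" "ball 0 d1 \<subseteq> T1" using T(1) z(1) by (rule openE)
  obtain d2 where d2: "d2 > 0" "ball 0 d2 \<subseteq> T2" using T(2) z(2) by (rule openE)
  note d = d1 d2
  \<comment> \<open>\<open>r/2\<close> keeps s + t in the domain of \<open>f\<close>;
    \<open>d1\<close> and \<open>d2\<close> keep the product in the chart at the unit.\<close>
  define d where "d = min (r/2) (min d1 d2)"
  have d0: "d > 0" "2 * d \<le> r" using r d by (auto simp: d_def)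
  have sub: "f s \<otimes> f t \<in> chart_dom A \<one>" if "\<bar>s\<bar> < d" "\<bar>t\<bar> < d" for s t
  proof -
    have "s \<in> ball 0 d1" "t \<in> ball 0 d2" using that by (simp_all add: d_def)
    then have "(s, t) \<in> T1 \<times> T2" using d(2,4) by blast
    then have "(s, t) \<in> ?W" using T(4) by blast
    then show ?thesis by simp
  qed
  have hom: "f (s + t) = f s \<otimes> f t" if s: "\<bar>s\<bar> < d" and t: "\<bar>t\<bar> < d" for s t
  proof -
    have B: "s + t \<in> ball 0 r" "t \<in> ball 0 r" "s \<in> ball 0 r" if "t \<in> ball 0 d" for t
      using that s d0 by auto
    have fs: "f s \<in> carrier U" using plot_carrier[OF f(1)] B(3)[of 0] d0 by simp
    have p2: "plot A (ball 0 d) (\<lambda>t. f s \<otimes> f t)"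
      by (intro plot_mult plot_const_A open_ball fs plot_subset[OF f(1)]) (use B in blast)
    have sm: "smooth_on (ball 0 d) (\<lambda>t. s + t)" by (intro smooth_on_add smooth_on_const smooth_on_id open_ball)
    have p1: "plot A (ball 0 d) (\<lambda>t. f (s + t))"
      by (rule plot_compose[OF f(1) sm open_ball]) (use B in blast)
    have td: "t \<in> ball 0 d" using t by simp
    have "chart A \<one> (f (s + t)) = chart A \<one> (f s \<otimes> f t)"
    proof (rule ode_unique[OF open_EU fld_smooth[of X] _ _ _ td])
      fix t :: real assume t: "t \<in> ball 0 d"
      have dst: "f (s + t) \<in> chart_dom A \<one>" using f(3) B(1)[OF t] by blast
      have "pd A (\<lambda>t. f (s + t)) t 1 = pd A f (s + t) (D (\<lambda>t. s + t) t 1)"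
        by (rule pd_compose[OF A f(1) B(1)[OF t] smooth_on_differentiable[OF sm t]])
      also have "D (\<lambda>t. s + t) t 1 = 1"
        by (rule D_eqI[THEN fun_cong, of _ "\<lambda>v. v"]) (auto intro!: derivative_eq_intros)
      finally have "pd A (\<lambda>t. f (s + t)) t 1 = left_invariant_field U A X (f (s + t))" using vel[OF B(1)[OF t]] by simp
      from integral_curve_in_chart[OF p1 t this dst] dst
      show "chart A \<one> (f (s + t)) \<in> EU \<and> ((\<lambda>t. chart A \<one> (f (s + t))) has_vector_derivative fld X (chart A \<one> (f (s + t)))) (at t)"
        by simp
      have dst': "f s \<otimes> f t \<in> chart_dom A \<one>" using sub[OF s] t by simp
      have ft: "f t \<in> carrier U" using plot_carrier[OF f(1) B(2)[OF t]] .
      have "pd A (\<lambda>t. f s \<otimes> f t) t 1 = differential A A (\<lambda>v. f s \<otimes> v) (f t) (pd A f t 1)"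
        by (rule pd_map[OF A A smooth_map_left[OF fs] f(1) B(2)[OF t]])
      then have "pd A (\<lambda>t. f s \<otimes> f t) t 1 = left_invariant_field U A X (f s \<otimes> f t)"
        by (simp add: vel[OF B(2)[OF t]] left_invariant_field_left[OF fs ft])
      from integral_curve_in_chart[OF p2 t this dst'] dst'
      show "chart A \<one> (f s \<otimes> f t) \<in> EU \<and> ((\<lambda>t. chart A \<one> (f s \<otimes> f t)) has_vector_derivative fld X (chart A \<one> (f s \<otimes> f t))) (at t)"
        by simp
    qed (simp add: f(2) fs)
    then show ?thesis
      using inj_onD[OF chartedD(3)[OF charted_A one_points]] f(3)[OF B(1)[OF td]] sub[OF s t] by blast
  qed
  have "pd A f 0 1 = X" using vel[of 0] r by (simp add: f(2) left_invariant_field_one)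
  moreover have "plot A (ball 0 (2 * d)) f" by (rule plot_subset[OF f(1) open_ball]) (use d0 in auto)
  ultimately show thesis using that[of d f, OF d0(1) _ f(2) _ hom] by simp
qed

definition ops :: "(real \<Rightarrow> 'u) \<Rightarrow> 'a \<Rightarrow> bool" where
  "ops c X \<longleftrightarrow> plot A UNIV c \<and> (\<forall>s t. c (s + t) = c s \<otimes> c t) \<and> pd A c 0 1 = X"

text \<open>A local homomorphism extends to the line as the n-th power of f (t / n), for any n with
  |t / n| < d. Two choices of n are compared through their product, and the extension is a
  homomorphism because f (s / n) and f (t / n) commute.\<close>

lemma ops_exists: "\<exists>c. ops c X"
proof -
  obtain d and f :: "real \<Rightarrow> 'u" where d: "d > 0" and f: "plot A (ball 0 (2 * d)) f" "f 0 = \<one>" "pd A f 0 1 = X"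
    and hom: "\<And>s t. \<bar>s\<bar> < d \<Longrightarrow> \<bar>t\<bar> < d \<Longrightarrow> f (s + t) = f s \<otimes> f t"
    by (rule local_one_parameter_subgroup[of X]) (rule that; assumption)
  have fc: "f s \<in> carrier U" if "\<bar>s\<bar> < d" for s using plot_carrier[OF f(1), of s] that d by simp
  have pow: "f (real m * s) = f s [^] m" if "\<bar>real m * s\<bar> < d" for m s
    using that
  proof (induction m)
    case 0 then show ?case using f(2) by simp
  next
    case (Suc m)
    have a: "\<bar>real m * s\<bar> \<le> \<bar>real (Suc m) * s\<bar>" unfolding abs_mult by (intro mult_right_mono) auto
    have b: "1 * \<bar>s\<bar> \<le> \<bar>real (Suc m)\<bar> * \<bar>s\<bar>" by (intro mult_right_mono) auto
    have "f (real m * s + s) = f (real m * s) \<otimes> f s"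
      using a b Suc.prems by (intro hom) (simp_all add: abs_mult)
    moreover have "real m * s + s = real (Suc m) * s" by (simp add: algebra_simps)
    ultimately show ?case using Suc.IH a Suc.prems by simp
  qed
  define val where "val t n = f (t / real n) [^] n" for t and n :: nat
  have val_mult: "val t n = val t (n * m)" if n: "n \<ge> 1" "\<bar>t / real n\<bar> < d" and m: "m \<ge> 1" for t n m
  proof -
    have e: "real m * (t / real (n * m)) = t / real n" using n(1) m by (simp add: field_simps)
    have "\<bar>t / real (n * m)\<bar> \<le> \<bar>real m * (t / real (n * m))\<bar>"
      unfolding abs_mult[of "real m"] using m mult_right_mono[of 1 "real m" "\<bar>t / real (n * m)\<bar>"] by simp
    then have c: "f (t / real (n * m)) \<in> carrier U" using fc e n(2) by simp
    have "f (t / real n) = f (t / real (n * m)) [^] m" using pow[of m "t / real (n * m)"] e n(2) by simp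
    then have "val t n = (f (t / real (n * m)) [^] m) [^] n" by (simp only: val_def)
    also have "\<dots> = val t (n * m)" by (simp only: val_def nat_pow_pow[OF c] mult.commute[of m n])
    finally show ?thesis .
  qed
  have val_eq: "val t n = val t m" if "n \<ge> 1" "\<bar>t / real n\<bar> < d" "m \<ge> 1" "\<bar>t / real m\<bar> < d" for t n m
    using val_mult[OF that(1,2,3)] val_mult[OF that(3,4,1)] by (simp add: mult.commute)
  \<comment> \<open>The added 1 makes |t| / d < N t strict and \<open>N t\<close> nonzero.\<close>
  define N where "N t = nat \<lceil>\<bar>t\<bar> / d\<rceil> + 1" for t
  have N: "N t \<ge> 1" for t by (simp add: N_def)
  have valid: "\<bar>t / real n\<bar> < d" if "N t \<le> n" for t n
  proof -
    have "\<bar>t\<bar> / d < real (N t)" unfolding N_def by linarith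
    then have "\<bar>t\<bar> / d < real n" using that by simp
    then have "\<bar>t\<bar> < d * real n" using d by (simp add: pos_divide_less_eq mult.commute)
    moreover have "n > 0" using that N[of t] by simp
    ultimately show ?thesis by (simp add: abs_divide pos_divide_less_eq)
  qed
  define c where "c t = val t (N t)" for t
  have c_val: "c t = val t n" if "N t \<le> n" for t n
    unfolding c_def using that N[of t] by (intro val_eq valid) auto
  have c_hom: "c (s + t) = c s \<otimes> c t" for s t
  proof -
    define n where "n = N s + N t + N (s + t)"
    have n: "N s \<le> n" "N t \<le> n" "N (s + t) \<le> n" by (simp_all add: n_def)
    let ?x = "f (s / real n)" and ?y = "f (t / real n)"
    have xy: "?x \<in> carrier U" "?y \<in> carrier U" using fc valid n by blast+
    have 1: "f ((s + t) / real n) = ?x \<otimes> ?y" using hom[OF valid[OF n(1)] valid[OF n(2)]] by (simp add: add_divide_distrib)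
    have 2: "?x \<otimes> ?y = ?y \<otimes> ?x"
      using hom[OF valid[OF n(1)] valid[OF n(2)]] hom[OF valid[OF n(2)] valid[OF n(1)]] by (simp add: add.commute)
    show ?thesis unfolding c_val[OF n(1)] c_val[OF n(2)] c_val[OF n(3)]
      by (simp add: val_def 1 pow_mult_distrib[OF 2 xy])
  qed
  have c_f: "c t = f t" if "\<bar>t\<bar> < d" for t
  proof -
    have "c t = val t 1" unfolding c_def by (rule val_eq) (use N[of t] valid[of t "N t"] that in simp_all)
    then show ?thesis using fc[OF that] by (simp add: val_def)
  qed
  have c_car: "c t \<in> carrier U" for t unfolding c_def val_def by (intro nat_pow_closed fc valid) simp
  \<comment> \<open>Smoothness at 0 is carried to \<open>t0\<close> by left translation: c t = c t0
    \<otimes> f (t - t0) for \<open>t\<close> near \<open>t0\<close>.\<close>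
  have loc: "plot A (ball t0 d) c" for t0
  proof (rule plot_cong)
    have "plot A (ball t0 d) (\<lambda>t. f (t - t0))"
      by (rule plot_compose[OF f(1) _ open_ball])
        (auto intro!: smooth_on_diff smooth_on_id smooth_on_const open_ball simp: dist_real_def)
    then show "plot A (ball t0 d) (\<lambda>t. c t0 \<otimes> f (t - t0))"
      by (intro plot_mult plot_const_A open_ball c_car)
    fix t assume "t \<in> ball t0 d"
    then have "c (t - t0) = f (t - t0)" by (intro c_f) (simp add: dist_real_def)
    then show "c t0 \<otimes> f (t - t0) = c t" using c_hom[of t0 "t - t0"] by simp
  qed
  have plot: "plot A UNIV c"
  proof (rule plot_local)
    fix t :: real
    show "\<exists>T. t \<in> T \<and> T \<subseteq> UNIV \<and> plot A T c" using loc d by (intro exI[of _ "ball t d"]) simp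
  qed
  have "pd A c 0 = pd A f 0"
    by (rule pd_cong_open[of "ball 0 d"]) (use c_f d in auto)
  then have "ops c X" using plot c_hom f(3) by (simp add: ops_def)
  then show ?thesis by blast
qed

lemma opsD:
  assumes "ops c X"
  shows "plot A UNIV c" "c (s + t) = c s \<otimes> c t" "pd A c 0 1 = X" "c t \<in> carrier U" "c 0 = \<one>" "c (- t) = inv (c t)"
proof -
  show p: "plot A UNIV c" and h: "c (s + t) = c s \<otimes> c t" and "pd A c 0 1 = X" for s t
    using assms by (simp_all add: ops_def)
  show c: "c t \<in> carrier U" for t by (rule plot_carrier[OF p UNIV_I])
  have "c 0 = c 0 \<otimes> c 0" using h[of 0 0] by simp
  then show 0: "c 0 = \<one>" using l_cancel_one'[OF c c] by simp
  show "c (- t) = inv (c t)" using h[of "- t" t] 0 by (intro inv_equality[symmetric] c) simp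
qed

text \<open>The left-invariant fields of \<open>Y\<close> and then \<open>X\<close> applied to
  \<open>F\<close> at the unit, as a second derivative of (u, v) \<mapsto> F (u v). For the identity
  map its antisymmetrization is the Lie bracket; for the projection to U/K it computes Christoffel
  symbols.\<close>

definition mixed :: "('n, 'e::euclidean_space) manifold \<Rightarrow> ('u \<Rightarrow> 'n) \<Rightarrow> 'n \<Rightarrow> 'a \<Rightarrow> 'a \<Rightarrow> 'e" where
  "mixed N F q X Y =
    D (\<lambda>z. D (\<lambda>z. chart N q (F (\<iota> (fst z) \<otimes> \<iota> (snd z)))) z (0, Y)) (e0, e0) (X, 0)"

lemma mixed_domain:
  assumes F: "smooth_map A N F" and q: "q \<in> points N" "F \<one> \<in> chart_dom N q"
  defines "Om \<equiv> {z \<in> EU \<times> EU. F (\<iota> (fst z) \<otimes> \<iota> (snd z)) \<in> chart_dom N q}"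
  shows "open Om" "smooth_on Om (\<lambda>z. chart N q (F (\<iota> (fst z) \<otimes> \<iota> (snd z))))" "(e0, e0) \<in> Om"
  using plotD(3,4)[OF plot_map[OF charted_A F plot_mul] q(1)] q(2) e0 by (simp_all add: Om_def \<iota>_e0)

lemma mixed_bilinear:
  assumes F: "smooth_map A N F" and q: "q \<in> points N" "F \<one> \<in> chart_dom N q"
  shows "bilinear (mixed N F q)"
proof -
  note Om = mixed_domain[OF F q]
  let ?h = "\<lambda>z. chart N q (F (\<iota> (fst z) \<otimes> \<iota> (snd z)))"
  have l1: "linear (\<lambda>X. mixed N F q X Y)" for Y
    using linear_compose[OF _ smooth_on_linear_D[OF smooth_on_D[OF Om(2)] Om(3)], of "\<lambda>X. (X, 0)" "(0, Y)"]
    by (simp add: mixed_def[abs_def] comp_def linear_iff)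
  have "mixed N F q X Y = D (\<lambda>z. D ?h z (X, 0)) (e0, e0) (0, Y)" for X Y
    unfolding mixed_def by (rule D_D_commute[OF Om])
  then have "linear (mixed N F q X)" for X
    using linear_compose[OF _ smooth_on_linear_D[OF smooth_on_D[OF Om(2)] Om(3)], of "\<lambda>Y. (0, Y)" "(X, 0)"]
    by (simp add: comp_def linear_iff)
  then show ?thesis using l1 by (simp add: bilinear_def)
qed

text \<open>The two parameters enter through separate factors, so the reparametrization
  \<open>k\<close> has no mixed second derivative, and the second-order chain rule leaves an
  expression in the two velocities alone.\<close>

lemma mixed_curves:
  fixes c d :: "real \<Rightarrow> 'u"
  assumes F: "smooth_map A N F" and q: "q \<in> points N" "F \<one> \<in> chart_dom N q"
    and c: "plot A UNIV c" "c 0 = \<one>" and d: "plot A UNIV d" "d 0 = \<one>"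
  shows "D (\<lambda>z. D (\<lambda>z. chart N q (F (c (fst z) \<otimes> d (snd z)))) z (0, 1)) (0, 0) (1, 0) =
    mixed N F q (pd A c 0 1) (pd A d 0 (1::real))"
proof -
  define Om where "Om = {z \<in> EU \<times> EU. F (\<iota> (fst z) \<otimes> \<iota> (snd z)) \<in> chart_dom N q}"
  note Om = mixed_domain[OF F q, folded Om_def]
  define h where "h = (\<lambda>z. chart N q (F (\<iota> (fst z) \<otimes> \<iota> (snd z))))"
  define Tc where "Tc = {t\<in>UNIV. c t \<in> chart_dom A \<one>}"
  define Td where "Td = {t\<in>UNIV. d t \<in> chart_dom A \<one>}"
  have Tcd: "open Tc" "open Td" "0 \<in> Tc" "0 \<in> Td"
    using plotD(3)[OF c(1) one_points] plotD(3)[OF d(1) one_points] one_dom c(2) d(2) by (simp_all add: Tc_def Td_def)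
  define c' where "c' = (\<lambda>t. chart A \<one> (c t))"
  define d' where "d' = (\<lambda>t. chart A \<one> (d t))"
  have s: "smooth_on Tc c'" "smooth_on Td d'"
    using plotD(4)[OF c(1) one_points] plotD(4)[OF d(1) one_points] by (simp_all add: Tc_def Td_def c'_def d'_def)
  define k where "k = (\<lambda>z. (c' (fst z), d' (snd z)))"
  have oT: "open (Tc \<times> Td)" by (intro open_Times Tcd)
  have sk0: "smooth_on (Tc \<times> Td) k"
    unfolding k_def
    by (intro smooth_on_Pair oT smooth_on_compose[OF oT Tcd(1) s(1) smooth_on_fst[OF oT smooth_on_id[OF oT]]]
        smooth_on_compose[OF oT Tcd(2) s(2) smooth_on_snd[OF oT smooth_on_id[OF oT]]]) auto
  define T where "T = (Tc \<times> Td) \<inter> k -` Om"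
  have T: "open T" "smooth_on T k" "k ` T \<subseteq> Om"
    unfolding T_def using continuous_open_preimage[OF smooth_on_continuous[OF sk0] oT Om(1)] smooth_on_subset[OF sk0] by auto
  have k0: "k (0, 0) = (e0, e0)" by (simp add: k_def c'_def d'_def c(2) d(2))
  have T0: "(0, 0) \<in> T" using Tcd k0 Om(3) by (simp add: T_def)
  have eq: "chart N q (F (c (fst z) \<otimes> d (snd z))) = h (k z)" if "z \<in> T" for z
  using that charted_A one_points by (fastforce simp: k_def T_def h_def d'_def c'_def Td_def Tc_def chart_inv_chart)
  have eqD: "D (\<lambda>z. chart N q (F (c (fst z) \<otimes> d (snd z)))) z v = D (\<lambda>z. h (k z)) z v" if "z \<in> T" for z v
    by (rule fun_cong[OF D_cong_open[OF T(1) that eq]])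
  have Dk: "D k z v = (D c' (fst z) (fst v), D d' (snd z) (snd v))" if "z \<in> T" for z v
  proof -
    have z: "fst z \<in> Tc" "snd z \<in> Td" using that by (auto simp: T_def)
    have 1: "((\<lambda>z. c' (fst z)) has_derivative (\<lambda>v. D c' (fst z) (fst v))) (at z)"
      by (rule has_derivative_compose[OF has_derivative_fst[OF has_derivative_ident] smooth_on_has_derivative[OF s(1) z(1)]])
    have 2: "((\<lambda>z. d' (snd z)) has_derivative (\<lambda>v. D d' (snd z) (snd v))) (at z)"
      by (rule has_derivative_compose[OF has_derivative_snd[OF has_derivative_ident] smooth_on_has_derivative[OF s(2) z(2)]])
    show ?thesis unfolding k_def using D_eqI[OF has_derivative_Pair[OF 1 2]] by simp
  qed
  have "D (\<lambda>z. D (\<lambda>z. chart N q (F (c (fst z) \<otimes> d (snd z)))) z (0, 1)) (0, 0) (1, 0) =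
    D (\<lambda>z. D (\<lambda>z. h (k z)) z (0, 1)) (0, 0) (1, 0)"
    by (rule fun_cong[OF D_cong_open[OF T(1) T0 eqD]])
  also have "\<dots> = D (\<lambda>y. D h y (D k (0, 0) (0, 1))) (k (0, 0)) (D k (0, 0) (1, 0)) +
      D h (k (0, 0)) (D (\<lambda>z. D k z (0, 1)) (0, 0) (1, 0))"
    unfolding h_def by (rule D_D_compose[OF T(1) Om(1,2) T(2,3) T0])
  also have "D (\<lambda>z. D k z (0, 1)) (0, 0) (1, 0) = 0"
  proof -
    have lc: "D c' t 0 = 0" if "t \<in> Tc" for t by (rule linear_0[OF smooth_on_linear_D[OF s(1) that]])
    have 1: "D (\<lambda>z. D k z (0, 1)) (0, 0) = D (\<lambda>z. (0, D d' (snd z) 1)) (0, 0)"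
      by (rule D_cong_open[OF T(1) T0]) (use Dk lc in \<open>auto simp: T_def\<close>)
    have 2: "D (\<lambda>z::real\<times>real. (0::'a, D d' (snd z) 1)) (0, 0) = (\<lambda>v. (0, D (\<lambda>t. D d' t 1) 0 (snd v)))"
    proof -
      have "(snd has_derivative snd) (at (0::real, 0::real))" by (rule bounded_linear_imp_has_derivative[OF bounded_linear_snd])
      from has_derivative_compose[OF this, of "\<lambda>t. D d' t 1" "D (\<lambda>t. D d' t 1) 0"]
      have "((\<lambda>z::real\<times>real. D d' (snd z) 1) has_derivative (\<lambda>v. D (\<lambda>t. D d' t 1) 0 (snd v))) (at (0, 0))"
        using smooth_on_has_derivative[OF smooth_on_D[OF s(2)] Tcd(4), of 1] by simp
      from D_eqI[OF has_derivative_Pair[OF has_derivative_const[of "0::'a"] this]] show ?thesis .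
    qed
    have 3: "D (\<lambda>t. D d' t 1) 0 0 = 0"
      by (rule linear_0[OF smooth_on_linear_D[OF smooth_on_D[OF s(2)] Tcd(4)]])
    show ?thesis using fun_cong[OF trans[OF 1 2], of "(1, 0)"] by (simp only: snd_conv 3 zero_prod_def)
  qed
  also have "D h (k (0, 0)) 0 = 0"
    unfolding k0 h_def by (rule linear_0[OF smooth_on_linear_D[OF Om(2,3)]])
  finally have *: "D (\<lambda>z. D (\<lambda>z. chart N q (F (c (fst z) \<otimes> d (snd z)))) z (0, 1)) (0, 0) (1, 0) =
    D (\<lambda>y. D h y (D k (0, 0) (0, 1))) (e0, e0) (D k (0, 0) (1, 0))" by (simp add: k0)
  have "D c' 0 0 = 0" "D d' 0 0 = 0"
    using linear_0[OF smooth_on_linear_D[OF s(1) Tcd(3)]] linear_0[OF smooth_on_linear_D[OF s(2) Tcd(4)]] .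
  moreover have "D c' 0 1 = pd A c 0 1" "D d' 0 1 = pd A d 0 1" by (simp_all add: pd_def c(2) d(2) c'_def d'_def)
  ultimately have "D k (0, 0) (0, 1) = (0, pd A d 0 1)" "D k (0, 0) (1, 0) = (pd A c 0 1, 0)"
    using Dk[OF T0] by simp_all
  then show ?thesis unfolding * by (simp add: mixed_def h_def)
qed

text \<open>Since c s \<otimes> c t = c (s + t), the mixed derivative in two parameters is a second
  derivative in one.\<close>

lemma mixed_ops:
  assumes F: "smooth_map A N F" and q: "q \<in> points N" "F \<one> \<in> chart_dom N q" and c: "ops c X"
  shows "D (\<lambda>s. D (\<lambda>s. chart N q (F (c s))) s 1) 0 1 = mixed N F q X X"
proof -
  note c' = opsD[OF c]
  define \<phi> where "\<phi> = (\<lambda>s. chart N q (F (c s)))"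
  define S where "S = {s\<in>UNIV. F (c s) \<in> chart_dom N q}"
  have S: "open S" "smooth_on S \<phi>" "0 \<in> S"
    using plotD(3,4)[OF plot_map[OF charted_A F c'(1)] q(1)] q(2) c'(5) by (simp_all add: S_def \<phi>_def)
  let ?l = "\<lambda>z::real\<times>real. fst z + snd z"
  have dl: "(?l has_derivative ?l) (at z)" for z by (auto intro!: derivative_eq_intros)
  define T where "T = ?l -` S"
  have T: "open T" "(0, 0) \<in> T"
    unfolding T_def using S by (auto intro!: open_vimage continuous_intros)
  have 1: "D (\<lambda>z. \<phi> (?l z)) z (0, 1) = D \<phi> (?l z) 1" if "z \<in> T" for z
    using D_eqI[OF has_derivative_compose[OF dl smooth_on_has_derivative[OF S(2)]], of z] that by (simp add: T_def)
  have "mixed N F q X X = D (\<lambda>z. D (\<lambda>z. \<phi> (?l z)) z (0, 1)) (0, 0) (1, 0)"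
    using mixed_curves[OF F q c'(1,5) c'(1,5)] by (simp add: c'(3) c'(2)[symmetric] \<phi>_def)
  also have "\<dots> = D (\<lambda>z. D \<phi> (?l z) 1) (0, 0) (1, 0)"
    by (rule fun_cong[OF D_cong_open[OF T 1]])
  also have "\<dots> = D (\<lambda>s. D \<phi> s 1) 0 1"
  proof -
    have "((\<lambda>s. D \<phi> s 1) has_derivative D (\<lambda>s. D \<phi> s 1) 0) (at (?l (0, 0)))"
      using smooth_on_has_derivative[OF smooth_on_D[OF S(2)] S(3), of 1] by simp
    from fun_cong[OF D_eqI[OF has_derivative_compose[OF dl this]], of "(1, 0)"] show ?thesis by simp
  qed
  finally show ?thesis by (simp add: \<phi>_def)
qed

lemma smooth_map_id: "smooth_map A A (\<lambda>u. u)"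
  by (rule smooth_mapI[OF A]) (auto intro: plot_chart_inv[OF A])

lemma lie_bracket_mixed:
  "lie_bracket U A X Y = mixed A (\<lambda>u. u) \<one> X Y - mixed A (\<lambda>u. u) \<one> Y X"
proof -
  have 1: "D (vector_field_rep A \<one> (left_invariant_field U A Y)) e0 X = mixed A (\<lambda>u. u) \<one> X Y" for X Y
  proof -
    have "D (vector_field_rep A \<one> (left_invariant_field U A Y)) e0 = D (\<lambda>x. D mul (x, e0) (0, Y)) e0"
      by (rule D_cong_open[OF open_EU e0]) (rule fld_eq[unfolded fld_def])
    moreover have p: "((\<lambda>x. (x, e0)) has_derivative (\<lambda>v. (v, 0))) (at e0)" by (auto intro!: derivative_eq_intros)
    moreover have "D (\<lambda>x. D mul (x, e0) (0, Y)) e0 X = D (\<lambda>z. D mul z (0, Y)) (e0, e0) (X, 0)"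
      by (rule fun_cong[OF D_eqI[OF has_derivative_compose[OF p smooth_on_has_derivative[OF smooth_on_D[OF mul_dom(2)] mul_dom(3)[OF e0]]]], of "(0, Y)" X])
    moreover have "mul = (\<lambda>z. chart A \<one> (\<iota> (fst z) \<otimes> \<iota> (snd z)))" by (rule ext) (rule mul_def)
    ultimately show ?thesis by (simp add: mixed_def)
  qed
  show ?thesis unfolding lie_bracket_def vector_field_bracket_def by (simp add: left_invariant_field_one 1)
qed

abbreviation br :: "'a \<Rightarrow> 'a \<Rightarrow> 'a" where "br \<equiv> lie_bracket U A"

lemma br_bilinear: "bilinear br"
proof -
  have "bilinear (mixed A (\<lambda>u. u) \<one>)" by (rule mixed_bilinear[OF smooth_map_id one_points one_dom])
  then have "linear (\<lambda>x. mixed A (\<lambda>u. u) \<one> x y)" "linear (mixed A (\<lambda>u. u) \<one> x)" for x y by (simp_all add: bilinear_def)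
  then show ?thesis unfolding bilinear_def lie_bracket_mixed by (intro conjI allI linear_compose_sub)
qed

lemma br_antisym: "br X Y = - br Y X"
  by (simp add: lie_bracket_mixed)

text \<open>For \<open>f\<close>, the map \<open>F\<close> read in the chart at the unit, the mixed
  derivative is the second derivative of \<open>f\<close> plus the first derivative of
  \<open>f\<close> applied to the mixed derivative of multiplication. The second derivative is
  symmetric and cancels.\<close>

lemma mixed_commutator:
  assumes F: "smooth_map A N F" and q: "q \<in> points N" "F \<one> \<in> chart_dom N q"
  shows "mixed N F q X Y - mixed N F q Y X = D (\<lambda>x. chart N q (F (\<iota> x))) e0 (br X Y)"
proof -
  define f where "f = (\<lambda>x. chart N q (F (\<iota> x)))"
  define S where "S = {x \<in> EU. F (\<iota> x) \<in> chart_dom N q}"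
  have S: "open S" "smooth_on S f" "e0 \<in> S"
    using plotD(3,4)[OF plot_map[OF charted_A F plot_\<iota>] q(1)] q(2) e0 by (simp_all add: S_def f_def \<iota>_e0)
  have m0: "mul (e0, e0) = e0" by (simp add: mul_def \<iota>_e0)
  define T where "T = mul_dom \<inter> mul -` S"
  have T: "open T" "smooth_on T mul" "mul ` T \<subseteq> S" "(e0, e0) \<in> T"
    unfolding T_def using continuous_open_preimage[OF smooth_on_continuous[OF mul_dom(2)] mul_dom(1) S(1)]
      smooth_on_subset[OF mul_dom(2)] S(3) mul_dom(3)[OF e0] m0 by auto
  have eq: "chart N q (F (\<iota> (fst z) \<otimes> \<iota> (snd z))) = f (mul z)" if "z \<in> T" for z
  using that charted_A one_points by (auto simp: mul_def f_def T_def mul_dom_def chart_inv_chart)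
  have D2: "D mul (e0, e0) (0, Y) = Y" for Y
  proof -
    have "D (\<lambda>x. chart A \<one> (\<iota> x)) e0 = D (\<lambda>x. x) e0"
      by (rule D_cong_open[OF open_EU e0]) (rule chart_chart_inv(1))
    then have "fld Y e0 = Y"
      by (simp add: fld_def vector_field_rep_def \<iota>_e0 tangent_change_eq left_invariant_field_one frechet_derivative_ident)
    then show ?thesis using fld_eq[OF e0, of Y] by simp
  qed
  have D1: "D mul (e0, e0) (X, 0) = X" for X
  proof -
    have "((\<lambda>x. (x, e0)) has_derivative (\<lambda>v. (v, 0))) (at e0)" by (auto intro!: derivative_eq_intros)
    from D_eqI[OF has_derivative_compose[OF this smooth_on_has_derivative[OF mul_dom(2) mul_dom(3)[OF e0]]]]
    have "D mul (e0, e0) (X, 0) = D (\<lambda>x. mul (x, e0)) e0 X" by simp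
    also have "\<dots> = D (\<lambda>x. x) e0 X"
    proof (rule fun_cong[OF D_cong_open[OF open_EU e0]])
      fix x assume x: "x \<in> EU"
      show "mul (x, e0) = x" using chart_chart_inv(1)[OF x] plot_carrier[OF plot_\<iota> x] by (simp add: mul_def \<iota>_e0)
    qed
    finally show ?thesis by (simp add: frechet_derivative_ident)
  qed
  have M: "mixed N F q X Y = D (\<lambda>y. D f y Y) e0 X + D f e0 (mixed A (\<lambda>u. u) \<one> X Y)" for X Y
  proof -
    have eqD: "D (\<lambda>z. chart N q (F (\<iota> (fst z) \<otimes> \<iota> (snd z)))) z v = D (\<lambda>z. f (mul z)) z v" if "z \<in> T" for z v
      by (rule fun_cong[OF D_cong_open[OF T(1) that eq]])
    have "mixed N F q X Y = D (\<lambda>z. D (\<lambda>z. f (mul z)) z (0, Y)) (e0, e0) (X, 0)"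
      unfolding mixed_def by (rule fun_cong[OF D_cong_open[OF T(1,4) eqD]])
    also have "\<dots> = D (\<lambda>y. D f y (D mul (e0, e0) (0, Y))) (mul (e0, e0)) (D mul (e0, e0) (X, 0)) +
        D f (mul (e0, e0)) (D (\<lambda>z. D mul z (0, Y)) (e0, e0) (X, 0))"
      by (rule D_D_compose[OF T(1) S(1,2) T(2,3,4)])
    also have "D (\<lambda>z. D mul z (0, Y)) (e0, e0) (X, 0) = mixed A (\<lambda>u. u) \<one> X Y"
    proof -
      have "mul = (\<lambda>z. chart A \<one> (\<iota> (fst z) \<otimes> \<iota> (snd z)))" by (rule ext) (rule mul_def)
      then show ?thesis by (simp add: mixed_def)
    qed
    finally show ?thesis by (simp add: D1 D2 m0)
  qed
  show ?thesis
    unfolding M lie_bracket_mixed linear_diff[OF smooth_on_linear_D[OF S(2,3)]] f_def[symmetric]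
    using D_D_commute[OF S(1,2,3), of X Y] by simp
qed

end

subsection \<open>The adjoint representation\<close>

lemma D_D_linear_compose:
  fixes f :: "'b::euclidean_space \<Rightarrow> 'c::real_normed_vector" and L :: "'a::euclidean_space \<Rightarrow> 'b"
  assumes S: "open S" "smooth_on S f" "L x \<in> S" and L: "linear L"
  shows "D (\<lambda>x. D (\<lambda>x. f (L x)) x v) x w = D (\<lambda>y. D f y (L v)) (L x) (L w)"
proof -
  have bl: "bounded_linear L" using L by (simp add: linear_conv_bounded_linear)
  have DL: "D L y = L" for y by (rule D_eqI[OF bounded_linear_imp_has_derivative[OF bl]])
  have sL: "smooth_on (L -` S) L"
    by (rule smooth_on_subset[OF smooth_on_bounded_linear[OF bl open_UNIV smooth_on_id[OF open_UNIV]]]) simp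
  have op: "open (L -` S)" using S(1) linear_continuous_on[OF bl] by (simp add: open_vimage)
  have "D (\<lambda>x. D (\<lambda>x. f (L x)) x v) x w =
    D (\<lambda>y. D f y (D L x v)) (L x) (D L x w) + D f (L x) (D (\<lambda>x. D L x v) x w)"
    by (rule D_D_compose[OF op S(1,2) sL]) (use S(3) in auto)
  then show ?thesis using linear_0[OF smooth_on_linear_D[OF S(2,3)]]
    by (simp add: DL frechet_derivative_const)
qed

context lie_group_loc
begin

abbreviation "ad \<equiv> Ad U A"

lemma smooth_map_conj: "u \<in> carrier U \<Longrightarrow> smooth_map A A (\<lambda>v. u \<otimes> v \<otimes> inv u)"
  by (rule smooth_mapI[OF A])
    (auto simp: carrier[symmetric] intro!: plot_mult plot_const_A plot_chart_inv[OF A] chartedD(4)[OF charted_A])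

lemma Ad_curve:
  assumes u: "u \<in> carrier U" and d: "plot A UNIV d" "d 0 = \<one>"
  shows "pd A (\<lambda>r. u \<otimes> d r \<otimes> inv u) 0 v = ad u (pd A d 0 v)"
  using pd_map[OF A A smooth_map_conj[OF u] d(1) UNIV_I, of 0 v] by (simp add: Ad_def d(2))

lemma Ad_linear: "u \<in> carrier U \<Longrightarrow> linear (ad u)"
  unfolding Ad_def by (rule linear_differential[OF A A smooth_map_conj one_points])

lemma ops_conj:
  assumes u: "u \<in> carrier U" and c: "ops c X"
  shows "ops (\<lambda>t. u \<otimes> c t \<otimes> inv u) (ad u X)"
  unfolding ops_def
proof (intro conjI allI)
  note c' = opsD[OF c]
  show "plot A UNIV (\<lambda>t. u \<otimes> c t \<otimes> inv u)" by (rule plot_map[OF charted_A smooth_map_conj[OF u] c'(1)])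
  show "pd A (\<lambda>t. u \<otimes> c t \<otimes> inv u) 0 1 = ad u X" using Ad_curve[OF u c'(1,5)] c'(3) by simp
  fix s t
  have "inv u \<otimes> (u \<otimes> (c t \<otimes> inv u)) = c t \<otimes> inv u"
    using u c'(4) by (simp add: m_assoc[symmetric])
  then show "u \<otimes> c (s + t) \<otimes> inv u = u \<otimes> c s \<otimes> inv u \<otimes> (u \<otimes> c t \<otimes> inv u)"
    using u c'(4) by (simp add: c'(2) m_assoc)
qed

lemma Ad_one: "ad \<one> X = X"
proof -
  obtain c where c: "ops c X" using ops_exists by blast
  have "ops (\<lambda>t. \<one> \<otimes> c t \<otimes> inv \<one>) (ad \<one> X)" by (rule ops_conj[OF one_closed c])
  then have "pd A (\<lambda>t. \<one> \<otimes> c t \<otimes> inv \<one>) 0 1 = ad \<one> X" by (rule opsD(3))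
  then show ?thesis using opsD(3,4)[OF c] by simp
qed

lemma Ad_mult:
  assumes u: "u \<in> carrier U" and v: "v \<in> carrier U"
  shows "ad (u \<otimes> v) X = ad u (ad v X)"
proof -
  obtain c where c: "ops c X" using ops_exists by blast
  have "(\<lambda>t. u \<otimes> (v \<otimes> c t \<otimes> inv v) \<otimes> inv u) = (\<lambda>t. u \<otimes> v \<otimes> c t \<otimes> inv (u \<otimes> v))"
    using u v opsD(4)[OF c] by (auto simp: m_assoc inv_mult_group)
  then show ?thesis
    using opsD(3)[OF ops_conj[OF u ops_conj[OF v c]]] opsD(3)[OF ops_conj[OF m_closed[OF u v] c]] by simp
qed

lemma Ad_inv: "u \<in> carrier U \<Longrightarrow> ad (inv u) (ad u X) = X" "u \<in> carrier U \<Longrightarrow> ad u (ad (inv u) X) = X"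
  using Ad_mult[of "inv u" u] Ad_mult[of u "inv u"] by (simp_all add: Ad_one)

text \<open>The product c s d r c(- s) is the restriction of P (s, s', r) = c s d r c s' to a plane.
  The direction (1, - 1, 0) splits the derivative in s into two mixed derivatives of
  \<open>P\<close>, one for products c d and one for d c; their difference is the bracket.\<close>

lemma Ad_ops_mixed_partial:
  assumes c: "ops c X" and d: "ops d Y"
  defines "\<Theta> \<equiv> \<lambda>z. chart A \<one> (c (fst z) \<otimes> d (snd z) \<otimes> c (- fst z))"
  shows "D (\<lambda>z. D \<Theta> z (0, 1)) (0, 0) (1, 0) = br X Y"
proof -
  note c' = opsD[OF c] and d' = opsD[OF d]
  define P where "P = (\<lambda>z::real\<times>real\<times>real. c (fst z) \<otimes> d (snd (snd z)) \<otimes> c (fst (snd z)))"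
  have sm: "smooth_on UNIV (\<lambda>z::real\<times>real\<times>real. fst z)" "smooth_on UNIV (\<lambda>z::real\<times>real\<times>real. snd (snd z))"
    "smooth_on UNIV (\<lambda>z::real\<times>real\<times>real. fst (snd z))"
    by (intro smooth_on_fst smooth_on_snd smooth_on_id open_UNIV)+
  have P: "plot A UNIV P" unfolding P_def
    by (intro plot_mult plot_compose[OF c'(1) sm(1) open_UNIV] plot_compose[OF d'(1) sm(2) open_UNIV]
        plot_compose[OF c'(1) sm(3) open_UNIV] subset_UNIV)
  define f where "f = (\<lambda>z. chart A \<one> (P z))"
  define S where "S = {z\<in>UNIV. P z \<in> chart_dom A \<one>}"
  have S: "open S" "smooth_on S f" "(0, 0, 0) \<in> S"
    using plotD(3,4)[OF P one_points] one_dom by (simp_all add: S_def f_def P_def c'(5) d'(5))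
  define L0 where "L0 = (\<lambda>z::real\<times>real. (fst z, - fst z, snd z))"
  define L1 where "L1 = (\<lambda>z::real\<times>real. (fst z, 0::real, snd z))"
  define L2 where "L2 = (\<lambda>z::real\<times>real. (0::real, snd z, fst z))"
  have L: "linear L0" "linear L1" "linear L2" by (auto simp: L0_def L1_def L2_def linear_iff)
  have S0: "L0 (0, 0) \<in> S" "L1 (0, 0) \<in> S" "L2 (0, 0) \<in> S" using S(3) by (simp_all add: L0_def L1_def L2_def)
  have f: "f (L0 z) = \<Theta> z" "f (L1 z) = chart A \<one> (c (fst z) \<otimes> d (snd z))" "f (L2 z) = chart A \<one> (d (fst z) \<otimes> c (snd z))" for z
    by (simp_all add: f_def P_def L0_def L1_def L2_def \<Theta>_def c'(4,5) d'(4))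
  have 0: "D (\<lambda>z. D \<Theta> z (0, 1)) (0, 0) (1, 0) = D (\<lambda>y. D f y (0, 0, 1)) (0, 0, 0) (1, - 1, 0)"
    using D_D_linear_compose[OF S(1,2) S0(1) L(1), of "(0, 1)" "(1, 0)"] by (simp add: f) (simp add: L0_def)
  have 1: "mixed A (\<lambda>u. u) \<one> X Y = D (\<lambda>y. D f y (0, 0, 1)) (0, 0, 0) (1, 0, 0)"
    using D_D_linear_compose[OF S(1,2) S0(2) L(2), of "(0, 1)" "(1, 0)"]
      mixed_curves[OF smooth_map_id one_points one_dom c'(1,5) d'(1,5)]
    by (simp add: f c'(3) d'(3)) (simp add: L1_def)
  have 2: "mixed A (\<lambda>u. u) \<one> Y X = D (\<lambda>y. D f y (0, 1, 0)) (0, 0, 0) (0, 0, 1)"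
    using D_D_linear_compose[OF S(1,2) S0(3) L(3), of "(0, 1)" "(1, 0)"]
      mixed_curves[OF smooth_map_id one_points one_dom d'(1,5) c'(1,5)]
    by (simp add: f c'(3) d'(3)) (simp add: L2_def)
  have 3: "D (\<lambda>y. D f y (0, 1, 0)) (0, 0, 0) (0, 0, 1) = D (\<lambda>y. D f y (0, 0, 1)) (0, 0, 0) (0, 1, 0)"
    by (rule D_D_commute[OF S])
  have "(1::real, - 1::real, 0::real) = (1, 0, 0) - (0, 1, 0)" by simp
  then show ?thesis
    unfolding 0 lie_bracket_mixed 1 2 3
    using linear_diff[OF smooth_on_linear_D[OF smooth_on_D[OF S(2)] S(3)], of "(0, 0, 1)" "(1, 0, 0)" "(0, 1, 0)"] by simp
qed

text \<open>Ad (c t) Y is the derivative at r = 0 of c t d r c(- t), which is smooth in both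
  variables. The mixed derivative gives the value at t = 0, and Ad (c s) = Ad (c t) Ad (c (s - t))
  carries it to any \<open>t\<close>.\<close>

lemma Ad_ops:
  assumes c: "ops c X"
  shows "smooth_on UNIV (\<lambda>t. ad (c t) Y)"
    "((\<lambda>t. ad (c t) Y) has_vector_derivative ad (c t) (br X Y)) (at t)"
proof -
  note c' = opsD[OF c]
  obtain d where d: "ops d Y" using ops_exists by blast
  note d' = opsD[OF d]
  define P where "P = (\<lambda>z::real\<times>real. c (fst z) \<otimes> d (snd z) \<otimes> c (- fst z))"
  have sm: "smooth_on UNIV (\<lambda>z::real\<times>real. fst z)" "smooth_on UNIV (\<lambda>z::real\<times>real. snd z)"
    "smooth_on UNIV (\<lambda>z::real\<times>real. - fst z)"
    by (intro smooth_on_fst smooth_on_snd smooth_on_uminus smooth_on_id open_UNIV)+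
  have P: "plot A UNIV P" unfolding P_def
    by (intro plot_mult plot_compose[OF c'(1) sm(1) open_UNIV] plot_compose[OF d'(1) sm(2) open_UNIV]
        plot_compose[OF c'(1) sm(3) open_UNIV] subset_UNIV)
  define \<Theta> where "\<Theta> = (\<lambda>z. chart A \<one> (P z))"
  define S where "S = {z\<in>UNIV. P z \<in> chart_dom A \<one>}"
  have P0: "P (t, 0) = \<one>" for t using c'(4) by (simp add: P_def c'(6) d'(5))
  have S: "open S" "smooth_on S \<Theta>" "(t, 0) \<in> S" for t
    using plotD(3,4)[OF P one_points] one_dom by (simp_all add: S_def \<Theta>_def P0)
  have Ad: "ad (c t) Y = D \<Theta> (t, 0) (0, 1)" for t
  proof -
    have "ad (c t) Y = pd A (\<lambda>r. P (t, r)) 0 1"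
      using Ad_curve[OF c'(4) d'(1,5), of t 1] by (simp add: P_def c'(6) d'(3))
    also have "\<dots> = D (\<lambda>r. \<Theta> (t, r)) 0 1" by (simp add: pd_def \<Theta>_def P0)
    also have "\<dots> = D \<Theta> (t, 0) (0, 1)"
    proof -
      have "((\<lambda>r::real. (t, r)) has_derivative (\<lambda>v. (0, v))) (at 0)" by (auto intro!: derivative_eq_intros)
      from fun_cong[OF D_eqI[OF has_derivative_compose[OF this smooth_on_has_derivative[OF S(2,3)]]], of 1] show ?thesis .
    qed
    finally show ?thesis .
  qed
  have sm: "smooth_on UNIV (\<lambda>t. ad (c t) Y)" for t
    unfolding Ad
    by (rule smooth_on_D_joint[OF open_UNIV S(1,2)])
      (auto intro!: smooth_on_Pair smooth_on_id smooth_on_const S(3))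
  then show "smooth_on UNIV (\<lambda>t. ad (c t) Y)" .
  have d0: "((\<lambda>t. ad (c t) Y) has_vector_derivative br X Y) (at 0)"
  proof -
    have "((\<lambda>t::real. (t, 0::real)) has_derivative (\<lambda>v. (v, 0))) (at 0)" by (auto intro!: derivative_eq_intros)
    from fun_cong[OF D_eqI[OF has_derivative_compose[OF this smooth_on_has_derivative[OF smooth_on_D[OF S(2)] S(3)]]], of "(0, 1)" 1]
    have "D (\<lambda>t. D \<Theta> (t, 0) (0, 1)) 0 1 = D (\<lambda>z. D \<Theta> z (0, 1)) (0, 0) (1, 0)" .
    also have "\<dots> = br X Y" using Ad_ops_mixed_partial[OF c d] by (simp add: \<Theta>_def P_def)
    finally show ?thesis
      using smooth_on_has_vector_derivative[OF sm UNIV_I, of 0] by (simp add: Ad)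
  qed
  have bl: "bounded_linear (ad (c t))" using Ad_linear[OF c'(4)] by (simp add: linear_conv_bounded_linear)
  have "((\<lambda>s. ad (c s) Y) has_derivative (\<lambda>s. s *\<^sub>R br X Y)) (at (t - t))"
    using d0 by (simp add: has_vector_derivative_def)
  moreover have "((\<lambda>s. s - t) has_derivative (\<lambda>s. s)) (at t)" by (auto intro!: derivative_eq_intros)
  ultimately have "((\<lambda>s. ad (c (s - t)) Y) has_vector_derivative br X Y) (at t)"
    using has_derivative_compose[of "\<lambda>s. s - t" "\<lambda>s. s" t UNIV "\<lambda>s. ad (c s) Y" "\<lambda>s. s *\<^sub>R br X Y"]
    by (simp add: has_vector_derivative_def)
  from bounded_linear.has_vector_derivative[OF bl this]
  have "((\<lambda>s. ad (c t) (ad (c (s - t)) Y)) has_vector_derivative ad (c t) (br X Y)) (at t)" .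
  moreover have "ad (c t) (ad (c (s - t)) Y) = ad (c s) Y" for s
    using Ad_mult[OF c'(4) c'(4), of t "s - t" Y] c'(2)[of t "s - t"] by simp
  ultimately show "((\<lambda>t. ad (c t) Y) has_vector_derivative ad (c t) (br X Y)) (at t)" by simp
qed

text \<open>Ad u (Ad (c t) Y) equals Ad (u c t u^-1) (Ad u Y); differentiate both sides at t =
  0.\<close>

lemma Ad_br:
  assumes u: "u \<in> carrier U"
  shows "ad u (br X Y) = br (ad u X) (ad u Y)"
proof -
  obtain c where c: "ops c X" using ops_exists by blast
  note c' = opsD[OF c]
  have bl: "bounded_linear (ad u)" using Ad_linear[OF u] by (simp add: linear_conv_bounded_linear)
  have 1: "((\<lambda>t. ad u (ad (c t) Y)) has_vector_derivative ad u (ad (c 0) (br X Y))) (at 0)"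
    by (rule bounded_linear.has_vector_derivative[OF bl Ad_ops(2)[OF c]])
  have "ad (u \<otimes> c t \<otimes> inv u) (ad u Y) = ad u (ad (c t) Y)" for t
    using u c'(4) by (simp add: Ad_mult Ad_inv)
  then have 2: "((\<lambda>t. ad u (ad (c t) Y)) has_vector_derivative ad (u \<otimes> c 0 \<otimes> inv u) (br (ad u X) (ad u Y))) (at 0)"
    using Ad_ops(2)[OF ops_conj[OF u c], of "ad u Y" 0] by simp
  show ?thesis using vector_derivative_unique_at[OF 1 2] u by (simp add: c'(5) Ad_one)
qed

lemma br_bounded_bilinear: "bounded_bilinear br"
  using br_bilinear by (simp add: bilinear_conv_bounded_bilinear)

text \<open>Differentiate at t = 0 the fact that Ad (c t) preserves the bracket of \<open>Y\<close>
  and \<open>Z\<close>; the product rule gives the two terms on the right.\<close>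

lemma br_jacobi: "br X (br Y Z) = br (br X Y) Z + br Y (br X Z)"
proof -
  obtain c where c: "ops c X" using ops_exists by blast
  have 1: "((\<lambda>t. br (ad (c t) Y) (ad (c t) Z)) has_vector_derivative br (ad (c 0) Y) (ad (c 0) (br X Z)) + br (ad (c 0) (br X Y)) (ad (c 0) Z)) (at 0)"
    by (rule bounded_bilinear.has_vector_derivative[OF br_bounded_bilinear Ad_ops(2)[OF c] Ad_ops(2)[OF c]])
  have 2: "((\<lambda>t. br (ad (c t) Y) (ad (c t) Z)) has_vector_derivative ad (c 0) (br X (br Y Z))) (at 0)"
    using Ad_ops(2)[OF c, of "br Y Z" 0] by (simp add: Ad_br opsD(4)[OF c])
  show ?thesis using vector_derivative_unique_at[OF 1 2] by (simp add: opsD(5)[OF c] Ad_one add.commute)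
qed

lemma Ad_continuous: "continuous_map (manifold_topology A) euclidean (\<lambda>u. ad u Y)"
proof (rule continuous_map_manifold_real[OF A])
  fix p assume p: "p \<in> points A"
  let ?E = "chart A p ` chart_dom A p"
  obtain d where d: "ops d Y" using ops_exists by blast
  note d' = opsD[OF d]
  have oE: "open ?E" by (rule chartedD(4)[OF charted_A p])
  have o: "open (?E \<times> (UNIV :: real set))" by (intro open_Times oE open_UNIV)
  define P where "P = (\<lambda>z::'a\<times>real. chart_inv A p (fst z) \<otimes> d (snd z) \<otimes> inv (chart_inv A p (fst z)))"
  have pl1: "plot A (?E \<times> UNIV) (\<lambda>z::'a\<times>real. chart_inv A p (fst z))"
    by (rule plot_compose[OF plot_chart_inv[OF A p] smooth_on_fst[OF o smooth_on_id[OF o]] o]) auto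
  have pl2: "plot A (?E \<times> UNIV) (\<lambda>z::'a\<times>real. d (snd z))"
    by (rule plot_compose[OF d'(1) smooth_on_snd[OF o smooth_on_id[OF o]] o]) simp
  have P: "plot A (?E \<times> UNIV) P" unfolding P_def by (intro plot_mult plot_inv pl1 pl2)
  have u: "chart_inv A p x \<in> carrier U" if "x \<in> ?E" for x by (rule plot_carrier[OF plot_chart_inv[OF A p] that])
  define S where "S = {z\<in>?E \<times> UNIV. P z \<in> chart_dom A \<one>}"
  have P0: "P (x, 0) = \<one>" if "x \<in> ?E" for x using u[OF that] by (simp add: P_def d'(5))
  have S: "open S" "smooth_on S (\<lambda>z. chart A \<one> (P z))" "x \<in> ?E \<Longrightarrow> (x, 0) \<in> S" for x
    using plotD(3,4)[OF P one_points] one_dom P0[of x] by (simp_all add: S_def)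
  have Ad: "ad (chart_inv A p x) Y = D (\<lambda>z. chart A \<one> (P z)) (x, 0) (0, 1)" if x: "x \<in> ?E" for x
  proof -
    have "ad (chart_inv A p x) Y = pd A (\<lambda>r. P (x, r)) 0 1"
      using Ad_curve[OF u[OF x] d'(1,5), of 1] by (simp add: P_def d'(3))
    also have "\<dots> = D (\<lambda>r. chart A \<one> (P (x, r))) 0 1" by (simp add: pd_def P0[OF x])
    also have "\<dots> = D (\<lambda>z. chart A \<one> (P z)) (x, 0) (0, 1)"
    proof -
      have "((\<lambda>r::real. (x, r)) has_derivative (\<lambda>v. (0, v))) (at 0)" by (auto intro!: derivative_eq_intros)
      from fun_cong[OF D_eqI[OF has_derivative_compose[OF this smooth_on_has_derivative[OF S(2) S(3)[OF x]]]], of 1] show ?thesis .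
    qed
    finally show ?thesis .
  qed
  have "smooth_on ?E (\<lambda>x. D (\<lambda>z. chart A \<one> (P z)) (x, 0) (0, 1))"
    by (rule smooth_on_D_joint[OF oE S(1,2)])
      (auto intro!: smooth_on_Pair smooth_on_id smooth_on_const oE S(3))
  then have "continuous_on ?E (\<lambda>x. D (\<lambda>z. chart A \<one> (P z)) (x, 0) (0, 1))" by (rule smooth_on_continuous)
  then show "continuous_on ?E (\<lambda>x. ad (chart_inv A p x) Y)"
    using continuous_on_cong[OF refl Ad, of ?E "\<lambda>x. x"] by (simp add: Ad cong: continuous_on_cong)
qed

end

subsection \<open>Geodesics of a symmetric space\<close>

lemma D_shift: "D (\<lambda>s. f (t + s)) r = D f (t + r :: 'a::real_normed_vector)"
proof -
  have 1: "((\<lambda>s. f (a + s)) has_derivative f') (at r)" if "(f has_derivative f') (at (a + r))" for f f' a r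
  proof -
    have "((\<lambda>s. a + s) has_derivative (\<lambda>v. v)) (at r)" by (auto intro!: derivative_eq_intros)
    from has_derivative_compose[OF this that] show ?thesis .
  qed
  have "((\<lambda>s. f (t + s)) has_derivative f') (at r) \<longleftrightarrow> (f has_derivative f') (at (t + r))" for f'
    using 1[of f f' t r] 1[of "\<lambda>s. f (t + s)" f' "- t" "t + r"] by auto
  then show ?thesis by (simp add: frechet_derivative_def)
qed

locale hom_space = lie_group_loc U A + riemannian_manifold M g
  for U :: "'u monoid" (structure) and A :: "('u, 'a::euclidean_space) manifold"
    and M :: "('u set, 'b::euclidean_space) manifold" and g :: "('u set, 'b) metric" +
  fixes K :: "'u set" and \<theta> :: "'a \<Rightarrow> 'a"
  assumes K: "subgroup K U" and quot: "quotient_manifold U A K M" and inv_metric: "invariant_metric U M g"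
    and \<theta>: "involutive_automorphism (lie_bracket U A) \<theta>"
    and lieK: "subgroup_lie_algebra U A K = {X. \<theta> X = X}"
begin

abbreviation "prj u \<equiv> u <#\<^bsub>U\<^esub> K"
abbreviation "act u q \<equiv> u <#\<^bsub>U\<^esub> q"
abbreviation "ori \<equiv> prj \<one>"

section \<open>Tangent vectors of U/K as images of Lie algebra elements\<close>

lemma prj_smooth: "smooth_map A M (\<lambda>u. prj u)" and points_M: "points M = (\<lambda>u. prj u) ` carrier U"
  and prj_surj: "u \<in> carrier U \<Longrightarrow> surj (differential A M (\<lambda>u. prj u) u)"
  using quot by (auto simp: quotient_manifold_def)

lemma K_sub: "K \<subseteq> carrier U" by (rule subgroup.subset[OF K])

lemma act_prj: "u \<in> carrier U \<Longrightarrow> v \<in> carrier U \<Longrightarrow> act u (prj v) = prj (u \<otimes> v)"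
  by (rule lcos_m_assoc[OF K_sub])

lemma prj_K: "k \<in> K \<Longrightarrow> u \<in> carrier U \<Longrightarrow> prj (u \<otimes> k) = prj u"
  using act_prj[of u k] coset_join3[OF _ K, of k] K_sub by auto

lemma prj_points: "u \<in> carrier U \<Longrightarrow> prj u \<in> points M"
  by (simp add: points_M)

lemma act_isometry: "u \<in> carrier U \<Longrightarrow> isometry M g (\<lambda>q. act u q)"
  using inv_metric by (simp add: invariant_metric_def)

lemma act_smooth: "u \<in> carrier U \<Longrightarrow> smooth_map M M (\<lambda>q. act u q)"
  using act_isometry by (simp add: isometry_def)

lemma prj_mult_smooth: "b \<in> carrier U \<Longrightarrow> smooth_map A M (\<lambda>u. prj (b \<otimes> u))"
  by (rule smooth_mapI[OF A])
    (auto simp: carrier[symmetric] intro!: prj_points plot_map[OF charted_A prj_smooth] plot_mult plot_const_A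
      plot_chart_inv[OF A] chartedD(4)[OF charted_A])

text \<open>The tangent vector at b K obtained from a Lie algebra element by translation with the
  representative \<open>b\<close>. Along an exponential curve it supplies a moving frame; it kills
  \<open>\<kk>\<close> and is injective on \<open>\<pp>\<close>.\<close>

definition lam :: "'u \<Rightarrow> 'a \<Rightarrow> 'b" where
  "lam b = differential A M (\<lambda>u. prj (b \<otimes> u)) \<one>"

definition d\<pi> :: "'a \<Rightarrow> 'b" where
  "d\<pi> = differential A M (\<lambda>u. prj u) \<one>"

lemma lam_pd: "lam b = pd M (\<lambda>y. prj (b \<otimes> \<iota> y)) e0"
  unfolding lam_def by (rule differential_eq_pd[OF charted_A one_points])

lemma lam_one: "lam \<one> = d\<pi>"
proof -
  have "pd M (\<lambda>y. prj (\<one> \<otimes> \<iota> y)) e0 = pd M (\<lambda>y. prj (\<iota> y)) e0"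
    by (rule pd_cong_open[OF open_EU e0]) (simp add: plot_carrier[OF plot_\<iota>])
  then show ?thesis by (simp add: lam_pd d\<pi>_def differential_eq_pd[OF charted_A one_points])
qed

lemma lam_curve:
  assumes "b \<in> carrier U" "plot A UNIV c" "c x = \<one>"
  shows "pd M (\<lambda>r. prj (b \<otimes> c r)) x v = lam b (pd A c x v)"
  using pd_map[OF A M prj_mult_smooth[OF assms(1)] assms(2) UNIV_I, of x v] by (simp add: lam_def assms(3))

lemma lam_linear: "b \<in> carrier U \<Longrightarrow> linear (lam b)"
  unfolding lam_def by (rule linear_differential[OF A M prj_mult_smooth one_points])

lemma ori_points: "ori \<in> points M" by (rule prj_points[OF one_closed])

lemma lam_act: "b \<in> carrier U \<Longrightarrow> lam b X = differential M M (\<lambda>q. act b q) ori (d\<pi> X)"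
proof -
  assume b: "b \<in> carrier U"
  have p: "plot M EU (\<lambda>y. prj (\<iota> y))" by (rule plot_map[OF charted_A prj_smooth plot_\<iota>])
  have "pd M (\<lambda>y. act b (prj (\<iota> y))) e0 X = differential M M (\<lambda>q. act b q) (prj (\<iota> e0)) (pd M (\<lambda>y. prj (\<iota> y)) e0 X)"
    by (rule pd_map[OF M M act_smooth[OF b] p e0])
  moreover have "pd M (\<lambda>y. act b (prj (\<iota> y))) e0 = pd M (\<lambda>y. prj (b \<otimes> \<iota> y)) e0"
    by (rule pd_cong_open[OF open_EU e0]) (rule act_prj[OF b plot_carrier[OF plot_\<iota>]])
  ultimately show ?thesis by (simp add: lam_pd d\<pi>_def differential_eq_pd[OF charted_A one_points] \<iota>_e0)
qed

lemma act_differential_metric: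
  "b \<in> carrier U \<Longrightarrow> g (prj b) (differential M M (\<lambda>q. act b q) ori v) (differential M M (\<lambda>q. act b q) ori w) = g ori v w"
using act_prj one_closed act_isometry ori_points by (fastforce simp: isometry_def)

lemma g_lam: "b \<in> carrier U \<Longrightarrow> g (prj b) (lam b X) (lam b Y) = g ori (d\<pi> X) (d\<pi> Y)"
  by (simp add: lam_act act_differential_metric)

text \<open>The differential of an isometry preserves lengths, so it is injective, and it maps
  between spaces of equal dimension.\<close>

lemma act_differential_surj: "b \<in> carrier U \<Longrightarrow> surj (differential M M (\<lambda>q. act b q) ori)"
proof -
  assume b: "b \<in> carrier U"
  let ?d = "differential M M (\<lambda>q. act b q) ori"
  have l: "linear ?d" by (rule linear_differential[OF M M act_smooth[OF b] ori_points])
  have "v = 0" if v: "?d v = 0" for v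
  proof (rule ccontr)
    assume "v \<noteq> 0"
    then have "g ori v v > 0" by (rule metricD(3)[OF ori_points])
    moreover have "linear (g (prj b) 0)" and "linear (\<lambda>x. g (prj b) x 0)"
      using metricD(1)[OF prj_points[OF b]] by (simp_all add: bilinear_def)
    ultimately show False using act_differential_metric[OF b, of v v] linear_0[of "g (prj b) 0"] by (simp add: v)
  qed
  then have "inj ?d" using linear_injective_0[OF l] by blast
  then show ?thesis by (rule linear_inj_imp_surj[OF l])
qed

lemma lam_surj: "b \<in> carrier U \<Longrightarrow> \<exists>X. lam b X = v"
proof -
  assume b: "b \<in> carrier U"
  obtain w where w: "v = differential M M (\<lambda>q. act b q) ori w" using surjD[OF act_differential_surj[OF b]] by blast
  obtain X where X: "w = d\<pi> X" unfolding d\<pi>_def using surjD[OF prj_surj[OF one_closed]] by blast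
  show ?thesis using lam_act[OF b, of X] w X by auto
qed

subsubsection \<open>The decomposition into eigenspaces of the involution\<close>

abbreviation "\<kk> \<equiv> {X. \<theta> X = X}"
abbreviation "\<pp> \<equiv> {X. \<theta> X = - X}"

lemma \<theta>_linear: "linear \<theta>" and \<theta>_br: "\<theta> (br X Y) = br (\<theta> X) (\<theta> Y)" and \<theta>_\<theta>: "\<theta> (\<theta> X) = X"
  using \<theta> by (auto simp: involutive_automorphism_def)

lemma br_linear: "linear (br X)" "linear (\<lambda>X. br X Y)"
  using br_bilinear by (auto simp: bilinear_def)

lemma br_minus: "br (- X) Y = - br X Y" "br X (- Y) = - br X Y"
  using linear_neg[OF br_linear(1)] linear_neg[OF br_linear(2)] by auto

lemma br_pp: "X \<in> \<pp> \<Longrightarrow> Y \<in> \<pp> \<Longrightarrow> br X Y \<in> \<kk>"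
  and br_pk: "X \<in> \<pp> \<Longrightarrow> Y \<in> \<kk> \<Longrightarrow> br X Y \<in> \<pp>"
  and br_kp: "X \<in> \<kk> \<Longrightarrow> Y \<in> \<pp> \<Longrightarrow> br X Y \<in> \<pp>"
  by (simp_all add: \<theta>_br br_minus)

definition kpart :: "'a \<Rightarrow> 'a" where "kpart X = (1/2) *\<^sub>R (X + \<theta> X)"
definition ppart :: "'a \<Rightarrow> 'a" where "ppart X = (1/2) *\<^sub>R (X - \<theta> X)"

lemma kpart: "kpart X \<in> \<kk>" and ppart: "ppart X \<in> \<pp>" and kpart_ppart: "kpart X + ppart X = X"
  by (simp_all add: kpart_def ppart_def linear_scale[OF \<theta>_linear] linear_add[OF \<theta>_linear] linear_diff[OF \<theta>_linear] \<theta>_\<theta>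
      add.commute scaleR_left_distrib[symmetric] algebra_simps)

lemma ppart_linear: "linear ppart"
  unfolding ppart_def[abs_def]
  by (intro linear_compose_scale_right linear_compose_sub \<theta>_linear linear_id[unfolded id_def])

lemma ppart_pp: "X \<in> \<pp> \<Longrightarrow> ppart X = X"
  by (simp add: ppart_def scaleR_2[symmetric])

lemma kk_ops: "X \<in> \<kk> \<Longrightarrow> \<exists>c. ops c X \<and> (\<forall>t. c t \<in> K)"
using lieK by (auto simp: ops_def smooth_map_real_line velocity_eq_pd subgroup_lie_algebra_def one_parameter_subgroup_def)

lemma Ad_kk: "k \<in> K \<Longrightarrow> X \<in> \<kk> \<Longrightarrow> ad k X \<in> \<kk>"
proof -
  assume k: "k \<in> K" and X: "X \<in> \<kk>"
  obtain c where c: "ops c X" "\<And>t. c t \<in> K" using kk_ops[OF X] by blast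
  have kc: "k \<in> carrier U" using k K_sub by blast
  have o: "ops (\<lambda>t. k \<otimes> c t \<otimes> inv k) (ad k X)" by (rule ops_conj[OF kc c(1)])
  have "k \<otimes> c t \<otimes> inv k \<in> K" for t
    using k c(2) by (intro subgroup.m_closed[OF K] subgroup.m_inv_closed[OF K])
  then have "ad k X \<in> subgroup_lie_algebra U A K"
    using o unfolding subgroup_lie_algebra_def one_parameter_subgroup_def
    by (intro CollectI exI[of _ "\<lambda>t. k \<otimes> c t \<otimes> inv k"]) (simp add: ops_def smooth_map_real_line velocity_eq_pd)
  then show ?thesis by (simp add: lieK)
qed

lemma lam_kk: "b \<in> carrier U \<Longrightarrow> X \<in> \<kk> \<Longrightarrow> lam b X = 0"
proof -
  assume b: "b \<in> carrier U" and X: "X \<in> \<kk>"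
  obtain c where c: "ops c X" "\<And>t. c t \<in> K" using kk_ops[OF X] by blast
  have "lam b X = pd M (\<lambda>r. prj (b \<otimes> c r)) 0 1"
    using lam_curve[OF b opsD(1,5)[OF c(1)], of 1] opsD(3)[OF c(1)] by simp
  also have "(\<lambda>r. prj (b \<otimes> c r)) = (\<lambda>r. prj b)" using prj_K[OF c(2) b] by simp
  finally show ?thesis by (simp add: pd_const)
qed

lemma lam_ppart: "b \<in> carrier U \<Longrightarrow> lam b (ppart X) = lam b X"
  using linear_add[OF lam_linear, of b "kpart X" "ppart X"] lam_kk[OF _ kpart, of b X] by (simp add: kpart_ppart)

text \<open>Right multiplication by the inverse of \<open>k\<close> does not change a coset, so
  \<open>d\<pi> (ad k X)\<close> is the translate \<open>lam k X\<close>, and translations are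
  isometric.\<close>

lemma g_Ad: "k \<in> K \<Longrightarrow> g ori (d\<pi> (ad k X)) (d\<pi> (ad k Y)) = g ori (d\<pi> X) (d\<pi> Y)"
proof -
  assume k: "k \<in> K"
  then have kc: "k \<in> carrier U" using K_sub by blast
  have e: "d\<pi> (ad k X) = lam k X" for X
  proof -
    obtain c where c: "ops c X" using ops_exists by blast
    note o = opsD[OF ops_conj[OF kc c]]
    have "d\<pi> (ad k X) = pd M (\<lambda>r. prj (\<one> \<otimes> (k \<otimes> c r \<otimes> inv k))) 0 1"
      using lam_curve[OF one_closed o(1,5), of 1] o(3) by (simp add: lam_one)
    also have "(\<lambda>r. prj (\<one> \<otimes> (k \<otimes> c r \<otimes> inv k))) = (\<lambda>r. prj (k \<otimes> c r))"
      using prj_K[OF subgroup.m_inv_closed[OF K k]] kc opsD(4)[OF c] by simp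
    also have "pd M (\<lambda>r. prj (k \<otimes> c r)) 0 1 = lam k X"
      using lam_curve[OF kc opsD(1,5)[OF c], of 1] opsD(3)[OF c] by simp
    finally show ?thesis .
  qed
  have "prj k = ori" using prj_K[OF k one_closed] kc by simp
  then show ?thesis using g_lam[OF kc] by (simp add: e)
qed

lemma gori_bilinear: "bounded_bilinear (g ori)"
  using metricD(1)[OF ori_points] by (simp add: bilinear_conv_bounded_bilinear)

lemma d\<pi>_linear: "linear d\<pi>" using lam_linear[OF one_closed] by (simp add: lam_one)

text \<open>For the \<open>\<pp>\<close>-part of \<open>Z\<close> the bracket lies in
  \<open>\<kk>\<close> and projects to 0. For the \<open>\<kk>\<close>-part, differentiate the
  constant length of the projection of Ad (c t) X along a one-parameter subgroup of
  \<open>K\<close>.\<close>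

lemma g_bracket_orthogonal: "X \<in> \<pp> \<Longrightarrow> g ori (d\<pi> X) (d\<pi> (br X Z)) = 0"
proof -
  assume X: "X \<in> \<pp>"
  have "br X (ppart Z) \<in> \<kk>" by (rule br_pp[OF X ppart])
  then have 1: "d\<pi> (br X (ppart Z)) = 0" using lam_kk[OF one_closed] by (simp add: lam_one)
  obtain c where c: "ops c (kpart Z)" "\<And>t. c t \<in> K" using kk_ops[OF kpart] by blast
  have bl: "bounded_linear d\<pi>" using d\<pi>_linear by (simp add: linear_conv_bounded_linear)
  have "((\<lambda>t. d\<pi> (ad (c t) X)) has_vector_derivative d\<pi> (br (kpart Z) X)) (at 0)"
    using bounded_linear.has_vector_derivative[OF bl Ad_ops(2)[OF c(1), of X 0]] by (simp add: opsD(5)[OF c(1)] Ad_one)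
  from bounded_bilinear.has_vector_derivative[OF gori_bilinear this this]
  have 2: "((\<lambda>t. g ori (d\<pi> X) (d\<pi> X)) has_vector_derivative
      g ori (d\<pi> X) (d\<pi> (br (kpart Z) X)) + g ori (d\<pi> (br (kpart Z) X)) (d\<pi> X)) (at 0)"
    by (simp add: g_Ad[OF c(2)] opsD(5)[OF c(1)] Ad_one)
  have "g ori (d\<pi> X) (d\<pi> (br (kpart Z) X)) + g ori (d\<pi> (br (kpart Z) X)) (d\<pi> X) = 0"
    using vector_derivative_unique_at[OF 2 has_vector_derivative_const] .
  then have 3: "g ori (d\<pi> X) (d\<pi> (br (kpart Z) X)) = 0"
    using metricD(2)[OF ori_points, of "d\<pi> X" "d\<pi> (br (kpart Z) X)"] by simp
  have "br X Z = br X (ppart Z) - br (kpart Z) X"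
    using linear_add[OF br_linear(1), of X "kpart Z" "ppart Z"] br_antisym[of "kpart Z" X] by (simp add: kpart_ppart)
  then have "d\<pi> (br X Z) = - d\<pi> (br (kpart Z) X)" by (simp add: linear_diff[OF d\<pi>_linear] 1)
  then show ?thesis using 3 bounded_bilinear.minus_right[OF gori_bilinear] by simp
qed

lemma ops_scale:
  assumes c: "ops c X" shows "ops (\<lambda>t. c (r * t)) (r *\<^sub>R X)"
  unfolding ops_def
proof (intro conjI allI)
  note c' = opsD[OF c]
  have sm: "smooth_on UNIV (\<lambda>t::real. r * t)"
    using smooth_on_bounded_linear[OF bounded_linear_mult_right open_UNIV smooth_on_id[OF open_UNIV]] by blast
  show "plot A UNIV (\<lambda>t. c (r * t))" by (rule plot_compose[OF c'(1) sm open_UNIV]) simp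
  show "c (r * (s + t)) = c (r * s) \<otimes> c (r * t)" for s t by (simp add: distrib_left c'(2))
  have D: "D (\<lambda>t. r * t) 0 = (\<lambda>v. r * v)" by (rule D_eqI) (auto intro!: derivative_eq_intros)
  have "pd A (\<lambda>t. c (r * t)) 0 1 = pd A c (r * 0) (D (\<lambda>t. r * t) 0 1)"
    by (rule pd_compose[OF A c'(1) UNIV_I smooth_on_differentiable[OF sm UNIV_I]])
  also have "\<dots> = pd A c 0 (r *\<^sub>R 1)" by (simp add: D)
  also have "\<dots> = r *\<^sub>R X" using linear_scale[OF linear_pd[OF A c'(1) UNIV_I[of 0]], of r 1] c'(3) by simp
  finally show "pd A (\<lambda>t. c (r * t)) 0 1 = r *\<^sub>R X" .
qed

lemma ops_prj_plot: "b \<in> carrier U \<Longrightarrow> ops c X \<Longrightarrow> plot M UNIV (\<lambda>t. prj (b \<otimes> c t))"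
  by (intro plot_map[OF charted_A prj_mult_smooth] opsD(1))

lemma pd_ops_prj:
  assumes b: "b \<in> carrier U" and c: "ops c X"
  shows "pd M (\<lambda>t. prj (b \<otimes> c t)) t 1 = lam (b \<otimes> c t) X"
proof -
  note c' = opsD[OF c]
  have bc: "b \<otimes> c t \<in> carrier U" using b c'(4) by simp
  have "lam (b \<otimes> c t) X = pd M (\<lambda>r. prj (b \<otimes> c t \<otimes> c r)) 0 1"
    using lam_curve[OF bc c'(1,5), of 1] c'(3) by simp
  also have "(\<lambda>r. prj (b \<otimes> c t \<otimes> c r)) = (\<lambda>r. prj (b \<otimes> c (t + r)))"
    using b c'(4) by (simp add: c'(2) m_assoc)
  also have "pd M (\<lambda>r. prj (b \<otimes> c (t + r))) 0 = pd M (\<lambda>t. prj (b \<otimes> c t)) t"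
    unfolding pd_def using D_shift[of "\<lambda>s. chart M (prj (b \<otimes> c t)) (prj (b \<otimes> c s))" t 0] by simp
  finally show ?thesis by simp
qed

text \<open>The exponential curves are geodesics because they satisfy the conservation laws
  \<open>\<langle>\<gamma>', Z\<rangle> = const\<close> of all Killing fields \<open>Z\<close>, and the Killing fields span every tangent space.\<close>

lemma exp_curve_geodesic_eq:
  assumes b: "b \<in> carrier U" and X: "X \<in> \<pp>" and c: "ops c X" and q: "q \<in> points M" "prj b \<in> chart_dom M q"
  defines "u \<equiv> \<lambda>s. chart M q (prj (b \<otimes> c s))"
  shows "D (\<lambda>s. D u s 1) 0 1 = - \<Gamma> q (u 0) (D u 0 1) (D u 0 1)"
proof -
  note c' = opsD[OF c]
  have bp: "prj b \<in> points M" by (rule prj_points[OF b])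
  have bd: "prj b \<in> chart_dom M (prj b)" by (rule chartedD(1)[OF charted_M bp])
  have u0: "u 0 = chart M q (prj b)" using b by (simp add: u_def c'(5))
  have u0E: "u 0 \<in> E q" unfolding u0 using q(2) by blast
  let ?utt = "D (\<lambda>s. D u s 1) 0 1" and ?ut = "D u 0 1"
  \<comment> \<open>\<open>F\<close> moves the curve by the isometries b d(s) b^-1, so its
    s-derivative at s = 0 is a Killing field along the curve. The length of the t-derivative is
    constant in s, and its product with the Killing field has zero t-derivative at 0. Eliminating
    the mixed derivative from these two facts leaves the geodesic equation tested against
    \<open>lam b Z\<close>.\<close>
  have key: "G q (u 0) (?utt + \<Gamma> q (u 0) ?ut ?ut) (tangent_change M (prj b) q (prj b) (lam b Z)) = 0" for Z
  proof -
    obtain d where d: "ops d Z" using ops_exists by blast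
    note d' = opsD[OF d]
    define F where "F = (\<lambda>z::real\<times>real. prj (b \<otimes> d (fst z) \<otimes> c (snd z)))"
    have sm: "smooth_on UNIV (\<lambda>z::real\<times>real. fst z)" "smooth_on UNIV (\<lambda>z::real\<times>real. snd z)"
      by (intro smooth_on_fst smooth_on_snd smooth_on_id open_UNIV)+
    have F: "plot M UNIV F" unfolding F_def
      by (intro plot_map[OF charted_A prj_smooth] plot_mult plot_const_A b open_UNIV
          plot_compose[OF d'(1) sm(1) open_UNIV] plot_compose[OF c'(1) sm(2) open_UNIV] subset_UNIV)
    define v where "v = (\<lambda>z. chart M q (F z))"
    define W where "W = {z\<in>UNIV. F z \<in> chart_dom M q}"
    have F0: "F (0, t) = prj (b \<otimes> c t)" for t using b by (simp add: F_def d'(5))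
    have W: "open W" "smooth_on W v" "(0, 0) \<in> W"
      using plotD(3,4)[OF F q(1)] q(2) b by (simp_all add: W_def v_def F0 c'(5))
    have vE: "v z \<in> E q" if "z \<in> W" for z using that by (auto simp: v_def W_def)
    have v0: "v (0, t) = u t" for t by (simp add: v_def F0 u_def)
    define vs where "vs = (\<lambda>z. D v z (1, 0))"
    define vt where "vt = (\<lambda>z. D v z (0, 1))"
    have svs: "smooth_on W vs" and svt: "smooth_on W vt" unfolding vs_def vt_def by (rule smooth_on_D[OF W(2)])+
    have pt: "pd M F (s, t) (0, 1) = lam (b \<otimes> d s \<otimes> c t) X" for s t
    proof -
      have bd: "b \<otimes> d s \<in> carrier U" using b d'(4) by simp
      have h: "((\<lambda>t::real. (s, t)) has_derivative (\<lambda>v. (0, v))) (at t)" by (auto intro!: derivative_eq_intros)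
      then have "(\<lambda>t::real. (s, t)) differentiable (at t)" by (auto simp: differentiable_def)
      from pd_compose[OF M F UNIV_I this, of 1] have "pd M (\<lambda>t. F (s, t)) t 1 = pd M F (s, t) (0, 1)" by (simp add: D_eqI[OF h])
      moreover have "(\<lambda>t. F (s, t)) = (\<lambda>t. prj (b \<otimes> d s \<otimes> c t))" by (simp add: F_def)
      ultimately show ?thesis using pd_ops_prj[OF bd c, of t] by simp
    qed
    have ps: "pd M F (0, t) (1, 0) = lam (b \<otimes> c t) (ad (c (- t)) Z)" for t
    proof -
      have bc: "b \<otimes> c t \<in> carrier U" using b c'(4) by simp
      note o = opsD[OF ops_conj[OF c'(4)[of "- t"] d]]
      have h: "((\<lambda>s::real. (s, t)) has_derivative (\<lambda>v. (v, 0))) (at 0)" by (auto intro!: derivative_eq_intros)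
      then have "(\<lambda>s::real. (s, t)) differentiable (at 0)" by (auto simp: differentiable_def)
      from pd_compose[OF M F UNIV_I this, of 1] have "pd M (\<lambda>s. F (s, t)) 0 1 = pd M F (0, t) (1, 0)" by (simp add: D_eqI[OF h])
      moreover have "F (s, t) = prj (b \<otimes> c t \<otimes> (c (- t) \<otimes> d s \<otimes> inv (c (- t))))" for s
      proof -
        have "c t \<otimes> (inv (c t) \<otimes> (d s \<otimes> c t)) = d s \<otimes> c t"
          using c'(4) d'(4) by (simp add: m_assoc[symmetric])
        then show ?thesis using b c'(4) d'(4) by (simp add: F_def c'(6) m_assoc)
      qed
      moreover have "pd M (\<lambda>s. prj (b \<otimes> c t \<otimes> (c (- t) \<otimes> d s \<otimes> inv (c (- t))))) 0 1 = lam (b \<otimes> c t) (ad (c (- t)) Z)"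
        using lam_curve[OF bc o(1,5), of 1] o(3) by simp
      ultimately show ?thesis by simp
    qed
    have Gv: "G q (v z) (D v z e) (D v z e') = g (F z) (pd M F z e) (pd M F z e')" if "z \<in> W" for z e e'
      unfolding v_def by (rule G_plot[OF F UNIV_I q(1)]) (use that in \<open>simp add: W_def\<close>)
    have dG: "((\<lambda>z. G q (v z) (k z) (l z)) has_derivative (\<lambda>e. D (\<lambda>y. G q y (k (0, 0)) (l (0, 0))) (v (0, 0)) (D v (0, 0) e)
        + G q (v (0, 0)) (D k (0, 0) e) (l (0, 0)) + G q (v (0, 0)) (k (0, 0)) (D l (0, 0) e))) (at (0, 0))"
      if "smooth_on W k" "smooth_on W l" for k l
      by (rule has_derivative_G[OF q(1) vE[OF W(3)] smooth_on_has_derivative[OF W(2,3)]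
            smooth_on_has_derivative[OF that(1) W(3)] smooth_on_has_derivative[OF that(2) W(3)]])
    have com: "D vt (0, 0) (1, 0) = D vs (0, 0) (0, 1)"
      unfolding vt_def vs_def by (rule D_D_commute[OF W])
    have "D (\<lambda>z. G q (v z) (vt z) (vt z)) (0, 0) = D (\<lambda>z. g ori (d\<pi> X) (d\<pi> X)) (0, 0)"
    proof (rule D_cong_open[OF W(1,3)])
      fix z assume z: "z \<in> W"
      obtain s t where st: "z = (s, t)" by (cases z) blast
      have "b \<otimes> d s \<otimes> c t \<in> carrier U" using b c'(4) d'(4) by simp
      then show "G q (v z) (vt z) (vt z) = g ori (d\<pi> X) (d\<pi> X)"
        unfolding vt_def Gv[OF z] unfolding st pt by (simp add: F_def g_lam)
    qed
    from fun_cong[OF this, of "(1, 0)"] fun_cong[OF D_eqI[OF dG[OF svt svt]], of "(1, 0)"]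
    have 1: "D (\<lambda>y. G q y (vt (0, 0)) (vt (0, 0))) (v (0, 0)) (vs (0, 0)) + 2 * G q (v (0, 0)) (D vs (0, 0) (0, 1)) (vt (0, 0)) = 0"
      using G_sym[OF q(1) vE[OF W(3)], of "vt (0, 0)" "D vs (0, 0) (0, 1)"]
      by (simp add: frechet_derivative_const com vs_def[symmetric] fun_cong[OF vs_def, of "(0, 0)", symmetric])
    have sl: "((\<lambda>t::real. (0, t)) has_derivative (\<lambda>v. (0, v))) (at 0)" by (auto intro!: derivative_eq_intros)
    let ?f = "\<lambda>t. G q (v (0, t)) (vt (0, t)) (vs (0, t))"
    have f1: "(?f has_derivative (\<lambda>e. D (\<lambda>y. G q y (vt (0, 0)) (vs (0, 0))) (v (0, 0)) (D v (0, 0) (0, e))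
        + G q (v (0, 0)) (D vt (0, 0) (0, e)) (vs (0, 0)) + G q (v (0, 0)) (vt (0, 0)) (D vs (0, 0) (0, e)))) (at 0)"
      by (rule has_derivative_compose[OF sl dG[OF svt svs]])
    \<comment> \<open>In the frame at b c t the Killing field is Ad (c(- t)) Z; its product with
      \<open>X\<close> has derivative - g(X, [X, Z]) at 0, which vanishes by invariance of the
      metric.\<close>
    have f2: "((\<lambda>t. g ori (d\<pi> X) (d\<pi> (ad (c (- t)) Z))) has_derivative (\<lambda>e. e *\<^sub>R 0)) (at 0)"
    proof -
      have o: "ops (\<lambda>t. c (- 1 * t)) (- 1 *\<^sub>R X)" by (rule ops_scale[OF c])
      have bl: "bounded_linear (\<lambda>Y. g ori (d\<pi> X) (d\<pi> Y))"
        using bounded_linear_compose[OF bounded_bilinear.bounded_linear_right[OF gori_bilinear]] d\<pi>_linear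
        by (simp add: linear_conv_bounded_linear)
      from bounded_linear.has_vector_derivative[OF bl Ad_ops(2)[OF o, of Z 0]]
      have "((\<lambda>t. g ori (d\<pi> X) (d\<pi> (ad (c (- t)) Z))) has_vector_derivative g ori (d\<pi> X) (d\<pi> (br (- X) Z))) (at 0)"
        by (simp add: c'(5) Ad_one)
      moreover have "g ori (d\<pi> X) (d\<pi> (br (- X) Z)) = 0"
        using g_bracket_orthogonal[OF X, of Z] bounded_bilinear.minus_right[OF gori_bilinear]
        by (simp add: br_minus linear_neg[OF d\<pi>_linear])
      ultimately show ?thesis unfolding has_vector_derivative_def by simp
    qed
    define T where "T = {t. (0, t) \<in> W}"
    have "open ((\<lambda>t::real. (0::real, t)) -` W)" using W(1) by (intro open_vimage continuous_intros)
    then have T: "open T" "0 \<in> T" using W(3) by (simp_all add: T_def vimage_def)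
    have "?f t = g ori (d\<pi> X) (d\<pi> (ad (c (- t)) Z))" if "t \<in> T" for t
    proof -
      have z: "(0, t) \<in> W" using that by (simp add: T_def)
      have "b \<otimes> c t \<in> carrier U" using b c'(4) by simp
      then show ?thesis
        unfolding vt_def vs_def Gv[OF z] unfolding pt ps using b by (simp add: F_def d'(5) g_lam)
    qed
    then have "D ?f 0 = D (\<lambda>t. g ori (d\<pi> X) (d\<pi> (ad (c (- t)) Z))) 0" by (rule D_cong_open[OF T])
    then have "D ?f 0 1 = 0" by (simp add: D_eqI[OF f2])
    then have 2: "D (\<lambda>y. G q y (vt (0, 0)) (vs (0, 0))) (v (0, 0)) (vt (0, 0)) + G q (v (0, 0)) (D vt (0, 0) (0, 1)) (vs (0, 0))
        + G q (v (0, 0)) (vt (0, 0)) (D vs (0, 0) (0, 1)) = 0"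
      unfolding D_eqI[OF f1] by (simp add: fun_cong[OF vt_def, of "(0, 0)", symmetric])
    have ut: "vt (0, 0) = ?ut"
    proof -
      have "D (\<lambda>t. v (0, t)) 0 1 = D v (0, 0) (0, 1)"
        by (rule fun_cong[OF D_eqI[OF has_derivative_compose[OF sl smooth_on_has_derivative[OF W(2,3)]]]])
      then show ?thesis by (simp add: v0 vt_def)
    qed
    have utt: "D vt (0, 0) (0, 1) = ?utt"
    using D_D_linear_compose W(1,2) W(3) by (fastforce simp: v0 linear_iff vt_def)
    have us: "vs (0, 0) = tangent_change M (prj b) q (prj b) (lam b Z)"
    using b D_chart_plot M F UNIV_I q(1) by (fastforce simp: Ad_one v_def q(2) ps F0 c'(5) vs_def)
    have "2 * G q (u 0) (\<Gamma> q (u 0) ?ut ?ut) (vs (0, 0)) =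
      2 * D (\<lambda>y. G q y ?ut (vs (0, 0))) (u 0) ?ut - D (\<lambda>y. G q y ?ut ?ut) (u 0) (vs (0, 0))"
      by (simp add: christoffel_eq[OF q(1) u0E])
    then have "G q (u 0) ?utt (vs (0, 0)) + G q (u 0) (\<Gamma> q (u 0) ?ut ?ut) (vs (0, 0)) = 0"
      using 1 2 G_sym[OF q(1) u0E, of ?ut "D vs (0, 0) (0, 1)"] unfolding v0 ut utt by simp
    then show ?thesis by (simp add: us linear_add[OF G_linear(1)[OF q(1) u0E]])
  qed
  have "?utt + \<Gamma> q (u 0) ?ut ?ut = 0"
  proof (rule G_eq_imp_eq[OF q(1) u0E])
    fix w
    obtain Z where Z: "lam b Z = tangent_change M q (prj b) (prj b) w" using lam_surj[OF b] by blast
    have "tangent_change M (prj b) q (prj b) (lam b Z) = w"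
      unfolding Z by (rule tangent_change_inverse[OF q bp bd])
    then show "G q (u 0) (?utt + \<Gamma> q (u 0) ?ut ?ut) w = G q (u 0) 0 w"
      using key[of Z] linear_0[OF G_linear(1)[OF q(1) u0E]] by simp
  qed
  then show ?thesis by (simp add: eq_neg_iff_add_eq_0)
qed

text \<open>On the diagonal this is the geodesic equation of exponential curves. Polarization then
  fixes the symmetric part, and the antisymmetric part is the image of [X, Y], which lies in
  \<open>\<kk>\<close> and projects to 0.\<close>

lemma mixed_christoffel:
  assumes b: "b \<in> carrier U" and q: "q \<in> points M" "prj b \<in> chart_dom M q"
  defines "J \<equiv> \<lambda>X. tangent_change M (prj b) q (prj b) (lam b X)"
  assumes X: "X \<in> \<pp>" and Y: "Y \<in> \<pp>"
  shows "mixed M (\<lambda>u. prj (b \<otimes> u)) q X Y = - \<Gamma> q (chart M q (prj b)) (J X) (J Y)"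
proof -
  let ?F = "\<lambda>u. prj (b \<otimes> u)"
  let ?x = "chart M q (prj b)"
  note F = prj_mult_smooth[OF b]
  have Fq: "?F \<one> \<in> chart_dom M q" using q(2) b by simp
  have bp: "prj b \<in> points M" by (rule prj_points[OF b])
  have xE: "?x \<in> E q" using q(2) by blast
  have bil: "bilinear (mixed M ?F q)" by (rule mixed_bilinear[OF F q(1) Fq])
  have l: "linear (\<lambda>X. mixed M ?F q X Y)" "linear (mixed M ?F q X)" for X Y using bil by (simp_all add: bilinear_def)
  have bilG: "bilinear (\<Gamma> q ?x)" by (rule christoffel_bilinear[OF q(1) xE])
  have lG: "linear (\<lambda>X. \<Gamma> q ?x X Y)" "linear (\<Gamma> q ?x X)" for X Y using bilG by (simp_all add: bilinear_def)
  have lJ: "linear J" unfolding J_def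
    using linear_compose[OF lam_linear[OF b] linear_tangent_change[OF M bp q(1) chartedD(1)[OF charted_M bp] q(2)]] by (simp add: comp_def)
  have diag: "mixed M ?F q X X = - \<Gamma> q ?x (J X) (J X)" if X: "X \<in> \<pp>" for X
  using ops_exists b D_chart_plot M ops_prj_plot UNIV_I q(1) q(2) mixed_ops F Fq exp_curve_geodesic_eq X q by (fastforce simp: J_def pd_ops_prj opsD(5))
  have XY: "X + Y \<in> \<pp>" using X Y by (simp add: linear_add[OF \<theta>_linear])
  have 1: "mixed M ?F q X Y + mixed M ?F q Y X = - \<Gamma> q ?x (J X) (J Y) - \<Gamma> q ?x (J Y) (J X)"
  proof -
    have gen: "m + n = - p - r" if "e + m + (n + f) = - (a + p + (r + k))" "e = - a" "f = - k" for m n p r e f a k :: 'b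
    using that by simp
    have "mixed M ?F q X X + mixed M ?F q X Y + (mixed M ?F q Y X + mixed M ?F q Y Y) = mixed M ?F q (X + Y) (X + Y)"
      by (simp add: linear_add[OF l(1)] linear_add[OF l(2)])
    also have "\<dots> = - (\<Gamma> q ?x (J X) (J X) + \<Gamma> q ?x (J X) (J Y) + (\<Gamma> q ?x (J Y) (J X) + \<Gamma> q ?x (J Y) (J Y)))"
      unfolding diag[OF XY] by (simp add: linear_add[OF lJ] linear_add[OF lG(1)] linear_add[OF lG(2)])
    finally show ?thesis by (rule gen[OF _ diag[OF X] diag[OF Y]])
  qed
  have "mixed M ?F q X Y - mixed M ?F q Y X = D (\<lambda>x. chart M q (prj (b \<otimes> \<iota> x))) e0 (br X Y)"
    by (rule mixed_commutator[OF F q(1) Fq])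
  also have "\<dots> = J (br X Y)"
    using D_chart_plot[OF M plot_map[OF charted_A F plot_\<iota>] e0 q(1), of "br X Y"] Fq b by (simp add: \<iota>_e0 lam_pd J_def)
  also have "\<dots> = 0"
    using lam_kk[OF b br_pp[OF X Y]] linear_0[OF linear_tangent_change[OF M bp q(1) chartedD(1)[OF charted_M bp] q(2)]]
    by (simp add: J_def)
  finally have 2: "mixed M ?F q Y X = mixed M ?F q X Y" by simp
  have "2 *\<^sub>R mixed M ?F q X Y = 2 *\<^sub>R (- \<Gamma> q ?x (J X) (J Y))"
    using 1 unfolding 2 christoffel_sym[OF q(1) xE, of "J Y" "J X"] by (simp add: scaleR_2)
  from iffD1[OF scaleR_cancel_left this] show ?thesis by simp
qed

subsubsection \<open>Vector fields along exponential curves\<close>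

text \<open>\<open>J t Y\<close> is the frame vector \<open>lam (b \<otimes> c t) Y\<close> in the
  fixed chart at \<open>q\<close>. For fixed \<open>Y\<close> in \<open>\<pp>\<close> its
  t-derivative is a mixed derivative of the projection, hence minus a Christoffel symbol; this is
  what makes the frame parallel.\<close>

lemma along_exp_curve:
  assumes b: "b \<in> carrier U" and X: "X \<in> \<pp>" and c: "ops c X"
    and W: "smooth_on UNIV W" "\<And>t. W t \<in> \<pp>" and q: "q \<in> points M"
  defines "\<gamma> \<equiv> \<lambda>t. prj (b \<otimes> c t)" and "V \<equiv> \<lambda>t. lam (b \<otimes> c t) (W t)"
    and "J \<equiv> \<lambda>t Y. tangent_change M (prj (b \<otimes> c t)) q (prj (b \<otimes> c t)) (lam (b \<otimes> c t) Y)"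
  shows "smooth_on {t. \<gamma> t \<in> chart_dom M q} (along_rep M \<gamma> V q)" (is ?th1)
    and "\<gamma> t \<in> chart_dom M q \<Longrightarrow> (along_rep M \<gamma> V q has_vector_derivative
      (J t (D W t 1) - \<Gamma> q (chart M q (\<gamma> t)) (J t X) (J t (W t)))) (at t)" (is "_ \<Longrightarrow> ?th2")
    and "\<gamma> t \<in> chart_dom M q \<Longrightarrow> D (\<lambda>s. chart M q (\<gamma> s)) t 1 = J t X" (is "_ \<Longrightarrow> ?th3")
    and "along_rep M \<gamma> V q t = J t (W t)" (is ?th4)
proof -
  note c' = opsD[OF c]
  have bc: "b \<otimes> c t \<in> carrier U" for t using b c'(4) by simp
  have bp: "\<gamma> t \<in> points M" for t unfolding \<gamma>_def by (rule prj_points[OF bc])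
  show ?th4 by (simp add: along_rep_def \<gamma>_def V_def J_def)
  show ?th3 if d: "\<gamma> t \<in> chart_dom M q"
    using D_chart_plot[OF M ops_prj_plot[OF b c] UNIV_I q d[unfolded \<gamma>_def], of 1] by (simp add: pd_ops_prj[OF b c] J_def \<gamma>_def)
  have o: "open (UNIV \<times> EU :: (real \<times> 'a) set)" by (intro open_Times open_EU open_UNIV)
  define P where "P = (\<lambda>z::real\<times>'a. prj (b \<otimes> c (fst z) \<otimes> \<iota> (snd z)))"
  have P: "plot M (UNIV \<times> EU) P" unfolding P_def
    by (intro plot_map[OF charted_A prj_smooth] plot_mult plot_const_A o b
        plot_compose[OF c'(1) smooth_on_fst[OF o smooth_on_id[OF o]] o]
        plot_compose[OF plot_\<iota> smooth_on_snd[OF o smooth_on_id[OF o]] o]) auto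
  define S where "S = {z\<in>UNIV \<times> EU. P z \<in> chart_dom M q}"
  define \<Psi> where "\<Psi> = (\<lambda>z. chart M q (P z))"
  have P0: "P (t, e0) = \<gamma> t" for t using bc by (simp add: P_def \<gamma>_def \<iota>_e0)
  have S: "open S" "smooth_on S \<Psi>" "\<gamma> t \<in> chart_dom M q \<Longrightarrow> (t, e0) \<in> S" for t
    using plotD(3,4)[OF P q] e0 by (simp_all add: S_def \<Psi>_def P0)
  define T where "T = {t. \<gamma> t \<in> chart_dom M q}"
  have T: "open T" using plotD(3)[OF ops_prj_plot[OF b c] q] by (simp add: T_def \<gamma>_def)
  have D\<Psi>: "D \<Psi> (t, e0) (0, Y) = J t Y" if t: "\<gamma> t \<in> chart_dom M q" for t Y
  proof -
    have "((\<lambda>y. (t, y)) has_derivative (\<lambda>v. (0, v))) (at e0)" by (auto intro!: derivative_eq_intros)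
    from fun_cong[OF D_eqI[OF has_derivative_compose[OF this smooth_on_has_derivative[OF S(2) S(3)[OF t]]]], of Y]
    have "D \<Psi> (t, e0) (0, Y) = D (\<lambda>y. \<Psi> (t, y)) e0 Y" by simp
    also have "\<dots> = D (\<lambda>y. chart M q (prj (b \<otimes> c t \<otimes> \<iota> y))) e0 Y" by (simp add: \<Psi>_def P_def)
    also have "\<dots> = J t Y"
      using D_chart_plot[OF M plot_map[OF charted_A prj_mult_smooth[OF bc] plot_\<iota>] e0 q, of t Y] t bc[of t]
      by (simp add: \<iota>_e0 lam_pd J_def \<gamma>_def)
    finally show ?thesis .
  qed
  have rep: "D \<Psi> (t, e0) (0, W t) = along_rep M \<gamma> V q t" if "t \<in> T" for t
    using D\<Psi>[of t "W t"] that by (simp add: T_def along_rep_def V_def J_def \<gamma>_def)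
  have sW: "smooth_on T W" by (rule smooth_on_subset[OF W(1) subset_UNIV])
  have "smooth_on T (\<lambda>t. D \<Psi> (t, e0) (0, W t))"
  proof (rule smooth_on_D_joint[OF T S(1,2)])
    show "smooth_on T (\<lambda>t. (t, e0))" "smooth_on T (\<lambda>t. (0::real, W t))"
      by (intro smooth_on_Pair smooth_on_id smooth_on_const T sW)+
    show "(\<lambda>t. (t, e0)) ` T \<subseteq> S" using S(3) unfolding T_def by blast
  qed
  from smooth_on_cong[OF T rep this] have "smooth_on T (along_rep M \<gamma> V q)" .
  then show ?th1 by (simp add: T_def)
  assume t: "\<gamma> t \<in> chart_dom M q"
  have tT: "t \<in> T" using t by (simp add: T_def)
  \<comment> \<open>The base point is moved to b c t. The second slot is already a coordinate, so
    the derivative of \<kappa> in the direction (0, Y) is constant and the second-order chain rule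
    contributes no further term.\<close>
  have mx: "D (\<lambda>z. D \<Psi> z (0, Y)) (t, e0) (1, 0) = mixed M (\<lambda>u. prj (b \<otimes> c t \<otimes> u)) q X Y" for Y
  proof -
    let ?F = "\<lambda>u. prj (b \<otimes> c t \<otimes> u)"
    have F: "smooth_map A M ?F" by (rule prj_mult_smooth[OF bc])
    have F1: "?F \<one> \<in> chart_dom M q" using t bc[of t] by (simp add: \<gamma>_def)
    define Om where "Om = {z \<in> EU \<times> EU. ?F (\<iota> (fst z) \<otimes> \<iota> (snd z)) \<in> chart_dom M q}"
    note Om = mixed_domain[OF F q F1, folded Om_def]
    define h where "h = (\<lambda>z. chart M q (?F (\<iota> (fst z) \<otimes> \<iota> (snd z))))"
    have sh: "smooth_on Om h" using Om(2) by (simp add: h_def)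
    define Tc where "Tc = {s\<in>UNIV. c s \<in> chart_dom A \<one>}"
    define c1 where "c1 = (\<lambda>s. chart A \<one> (c s))"
    have Tc: "open Tc" "smooth_on Tc c1" "0 \<in> Tc"
      using plotD(3,4)[OF c'(1) one_points] one_dom by (simp_all add: Tc_def c1_def c'(5))
    define \<kappa> where "\<kappa> = (\<lambda>z::real\<times>'a. (c1 (fst z), snd z))"
    have oT: "open (Tc \<times> EU)" by (intro open_Times Tc(1) open_EU)
    have s\<kappa>: "smooth_on (Tc \<times> EU) \<kappa>" unfolding \<kappa>_def
      by (intro smooth_on_Pair oT smooth_on_snd smooth_on_id
          smooth_on_compose[OF oT Tc(1,2) smooth_on_fst[OF oT smooth_on_id[OF oT]]]) auto
    define N where "N = (Tc \<times> EU) \<inter> \<kappa> -` Om"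
    have \<kappa>0: "\<kappa> (0, e0) = (e0, e0)" by (simp add: \<kappa>_def c1_def c'(5))
    have N: "open N" "smooth_on N \<kappa>" "\<kappa> ` N \<subseteq> Om" "(0, e0) \<in> N"
      unfolding N_def using continuous_open_preimage[OF smooth_on_continuous[OF s\<kappa>] oT Om(1)] smooth_on_subset[OF s\<kappa>]
        Tc(3) e0 \<kappa>0 Om(3) by auto
    have eq: "h (\<kappa> z) = \<Psi> ((t, 0) + z)" if z: "z \<in> N" for z
    proof -
      have d: "c (fst z) \<in> chart_dom A \<one>" "snd z \<in> EU" using z by (auto simp: N_def Tc_def)
      then have "\<iota> (c1 (fst z)) = c (fst z)" "\<iota> (snd z) \<in> carrier U"
        using plot_carrier[OF plot_\<iota>] by (simp_all add: c1_def chart_inv_chart[OF charted_A one_points])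
      then show ?thesis using b c'(4) by (simp add: h_def \<kappa>_def \<Psi>_def P_def c'(2) m_assoc)
    qed
    have eqD: "D (\<lambda>z. h (\<kappa> z)) z v = D \<Psi> ((t, 0) + z) v" if z: "z \<in> N" for z v
      using D_cong_open[OF N(1) z eq] by (simp add: D_shift)
    have D\<kappa>: "D \<kappa> z v = (D c1 (fst z) (fst v), snd v)" if z: "z \<in> N" for z v
    proof -
      have "fst z \<in> Tc" using z by (auto simp: N_def)
      from has_derivative_compose[OF has_derivative_fst[OF has_derivative_ident] smooth_on_has_derivative[OF Tc(2) this]]
      have "((\<lambda>z::real\<times>'a. c1 (fst z)) has_derivative (\<lambda>v. D c1 (fst z) (fst v))) (at z)" .
      from has_derivative_Pair[OF this has_derivative_snd[OF has_derivative_ident]]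
      show ?thesis unfolding \<kappa>_def by (simp add: D_eqI)
    qed
    have Dc0: "D c1 s 0 = 0" if "s \<in> Tc" for s by (rule linear_0[OF smooth_on_linear_D[OF Tc(2) that]])
    have "D (\<lambda>z. D \<Psi> z (0, Y)) (t, e0) = D (\<lambda>z. D \<Psi> ((t, 0) + z) (0, Y)) (0, e0)"
      using D_shift[of "\<lambda>z. D \<Psi> z (0, Y)" "(t, 0)" "(0, e0)"] by simp
    also have "\<dots> = D (\<lambda>z. D (\<lambda>z. h (\<kappa> z)) z (0, Y)) (0, e0)"
      by (rule D_cong_open[OF N(1,4) eqD[symmetric]])
    finally have "D (\<lambda>z. D \<Psi> z (0, Y)) (t, e0) (1, 0) = D (\<lambda>z. D (\<lambda>z. h (\<kappa> z)) z (0, Y)) (0, e0) (1, 0)" by simp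
    also have "\<dots> = D (\<lambda>y. D h y (D \<kappa> (0, e0) (0, Y))) (\<kappa> (0, e0)) (D \<kappa> (0, e0) (1, 0)) +
        D h (\<kappa> (0, e0)) (D (\<lambda>z. D \<kappa> z (0, Y)) (0, e0) (1, 0))"
      by (rule D_D_compose[OF N(1) Om(1) sh N(2,3,4)])
    also have "D (\<lambda>z. D \<kappa> z (0, Y)) (0, e0) = D (\<lambda>z. (0, Y)) (0, e0)"
      by (rule D_cong_open[OF N(1,4)]) (use D\<kappa> Dc0 in \<open>auto simp: N_def\<close>)
    also have "D \<kappa> (0, e0) (0, Y) = (0, Y)" using D\<kappa>[OF N(4)] Dc0[OF Tc(3)] by simp
    also have "D \<kappa> (0, e0) (1, 0) = (X, 0)" using D\<kappa>[OF N(4)] c'(3) by (simp add: pd_def c'(5) c1_def)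
    finally show ?thesis
      using linear_0[OF smooth_on_linear_D[OF sh Om(3)]]
      by (simp add: frechet_derivative_const \<kappa>0 mixed_def h_def zero_prod_def)
  qed
  have g: "((\<lambda>t. (t, e0)) has_derivative (\<lambda>v. (v, 0))) (at t)" by (auto intro!: derivative_eq_intros)
  have k: "((\<lambda>t. (0::real, W t)) has_derivative (\<lambda>v. (0, v *\<^sub>R D W t 1))) (at t)"
    using smooth_on_has_vector_derivative[OF W(1) UNIV_I, of t] unfolding has_vector_derivative_def
    by (intro has_derivative_Pair has_derivative_const)
  have "((\<lambda>t. D \<Psi> (t, e0) (0, W t)) has_derivative
      (\<lambda>v. D (\<lambda>y. D \<Psi> y (0, W t)) (t, e0) (v, 0) + D \<Psi> (t, e0) (0, v *\<^sub>R D W t 1))) (at t)"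
    by (rule has_derivative_D_joint[OF S(1,2) S(3)[OF t] g k])
  then have hd: "(along_rep M \<gamma> V q has_derivative
      (\<lambda>v. D (\<lambda>y. D \<Psi> y (0, W t)) (t, e0) (v, 0) + D \<Psi> (t, e0) (0, v *\<^sub>R D W t 1))) (at t)"
    by (rule has_derivative_transform_within_open[OF _ T tT]) (rule rep)
  from fun_cong[OF D_eqI[OF hd], of 1]
  have "D (along_rep M \<gamma> V q) t 1 = mixed M (\<lambda>u. prj (b \<otimes> c t \<otimes> u)) q X (W t) + J t (D W t 1)"
    by (simp add: mx D\<Psi>[OF t])
  also have "mixed M (\<lambda>u. prj (b \<otimes> c t \<otimes> u)) q X (W t) = - \<Gamma> q (chart M q (\<gamma> t)) (J t X) (J t (W t))"
    using mixed_christoffel[OF bc q t[unfolded \<gamma>_def] X W(2)] by (simp add: J_def \<gamma>_def)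
  finally have "D (along_rep M \<gamma> V q) t 1 = J t (D W t 1) - \<Gamma> q (chart M q (\<gamma> t)) (J t X) (J t (W t))" by simp
  moreover have "along_rep M \<gamma> V q differentiable (at t)" using hd by (auto simp: differentiable_def)
  ultimately show ?th2 using has_vector_derivative_D[of "along_rep M \<gamma> V q" t] by simp
qed

text \<open>The Christoffel term from the derivative of the frame cancels the one in the covariant
  derivative, so only the coefficients \<open>W\<close> are differentiated.\<close>

lemma covariant_derivative_exp_curve:
  assumes b: "b \<in> carrier U" and X: "X \<in> \<pp>" and c: "ops c X"
    and W: "smooth_on UNIV W" "\<And>t. W t \<in> \<pp>"
  shows "covariant_derivative M g (\<lambda>t. prj (b \<otimes> c t)) (\<lambda>t. lam (b \<otimes> c t) (W t)) t = lam (b \<otimes> c t) (D W t 1)"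
proof -
  have bc: "b \<otimes> c t \<in> carrier U" using b opsD(4)[OF c] by simp
  note bp = prj_points[OF bc]
  note d = chartedD(1)[OF charted_M bp]
  note a = along_exp_curve[OF b X c W bp]
  show ?thesis
    using covariant_derivative_in_chart[OF ops_prj_plot[OF b c] bp d a(2)[OF d]]
    by (simp add: a(3)[OF d] a(4) tangent_change_self[OF bp d])
qed

lemma velocity_exp_curve:
  "b \<in> carrier U \<Longrightarrow> ops c X \<Longrightarrow> velocity M (\<lambda>t. prj (b \<otimes> c t)) = (\<lambda>t. lam (b \<otimes> c t) X)"
  by (rule ext) (simp add: velocity_eq_pd pd_ops_prj)

lemma exp_curve_geodesic:
  assumes b: "b \<in> carrier U" and X: "X \<in> \<pp>" and c: "ops c X"
  shows "geodesic M g (\<lambda>t. prj (b \<otimes> c t))"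
  unfolding geodesic_def smooth_map_real_line velocity_exp_curve[OF b c]
proof (intro conjI allI ops_prj_plot[OF b c])
  fix t
  have "lam (b \<otimes> c t) 0 = 0" using linear_0[OF lam_linear] b opsD(4)[OF c] by simp
  then show "covariant_derivative M g (\<lambda>t. prj (b \<otimes> c t)) (\<lambda>t. lam (b \<otimes> c t) X) t = 0"
    using covariant_derivative_exp_curve[OF b X c smooth_on_const[of _ X], of t] X by (simp add: frechet_derivative_const)
qed

lemma exp_curve_geodesic_eq_at:
  assumes b: "b \<in> carrier U" and X: "X \<in> \<pp>" and c: "ops c X" and q: "q \<in> points M" "prj (b \<otimes> c t) \<in> chart_dom M q"
  defines "u \<equiv> \<lambda>s. chart M q (prj (b \<otimes> c s))"
  shows "D (\<lambda>s. D u s 1) t 1 = - \<Gamma> q (u t) (D u t 1) (D u t 1)"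
proof -
  have bc: "b \<otimes> c t \<in> carrier U" using b opsD(4)[OF c] by simp
  have e: "chart M q (prj (b \<otimes> c t \<otimes> c s)) = u (t + s)" for s
    using b opsD(4)[OF c] by (simp add: u_def opsD(2)[OF c] m_assoc)
  show ?thesis
    using exp_curve_geodesic_eq[OF bc X c q] D_shift[of "\<lambda>s. D u s 1" t 0] by (simp add: e D_shift)
qed

lemma ops_zero: "ops (\<lambda>t. \<one>) 0"
  unfolding ops_def using plot_const_A[OF open_UNIV one_closed] by (simp add: pd_const)

lemma pp_zero: "0 \<in> \<pp>" by (simp add: linear_0[OF \<theta>_linear])

lemma pp_scale: "X \<in> \<pp> \<Longrightarrow> r *\<^sub>R X \<in> \<pp>" by (simp add: linear_scale[OF \<theta>_linear])

lemma pp_diff: "X \<in> \<pp> \<Longrightarrow> Y \<in> \<pp> \<Longrightarrow> X - Y \<in> \<pp>" by (simp add: linear_diff[OF \<theta>_linear])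

lemma D_pp:
  assumes W: "smooth_on UNIV W" "\<And>t::real. W t \<in> \<pp>"
  shows "D W t 1 \<in> \<pp>"
proof -
  have bl: "bounded_linear \<theta>" using \<theta>_linear by (simp add: linear_conv_bounded_linear)
  note d = smooth_on_has_vector_derivative[OF W(1) UNIV_I, of t]
  have "((\<lambda>t. \<theta> (W t)) has_vector_derivative \<theta> (D W t 1)) (at t)" by (rule bounded_linear.has_vector_derivative[OF bl d])
  moreover have "((\<lambda>t. \<theta> (W t)) has_vector_derivative - D W t 1) (at t)"
    using has_vector_derivative_minus[OF d] W(2) by simp
  ultimately show ?thesis using vector_derivative_unique_at by blast
qed

text \<open>The curvature is read off from a Jacobi field instead of being expanded in Christoffel
  symbols. Isometries with initial direction \<open>lam b Z\<close> move the geodesic through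
  geodesics; in the parallel frame the resulting field has as coefficient the
  \<open>\<pp>\<close>-part of Ad (c(- t)) Z, whose second derivative at 0 is [X, [X, Z]].\<close>

lemma curvature_exp:
  assumes b: "b \<in> carrier U" and X: "X \<in> \<pp>" and Z: "Z \<in> \<pp>"
  shows "curvature M g (prj b) (lam b Z) (lam b X) (lam b X) = - lam b (br X (br X Z))"
proof -
  obtain c d where c: "ops c X" and d: "ops d Z" using ops_exists by blast
  note c' = opsD[OF c] and d' = opsD[OF d]
  define q where "q = prj b"
  have q: "q \<in> points M" unfolding q_def by (rule prj_points[OF b])
  have qd: "q \<in> chart_dom M q" by (rule chartedD(1)[OF charted_M q])
  define F where "F = (\<lambda>z::real\<times>real. prj (b \<otimes> d (fst z) \<otimes> c (snd z)))"
  have sm: "smooth_on UNIV (\<lambda>z::real\<times>real. fst z)" "smooth_on UNIV (\<lambda>z::real\<times>real. snd z)"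
    by (intro smooth_on_fst smooth_on_snd smooth_on_id open_UNIV)+
  have F: "plot M UNIV F" unfolding F_def
    by (intro plot_map[OF charted_A prj_smooth] plot_mult plot_const_A b open_UNIV
        plot_compose[OF d'(1) sm(1) open_UNIV] plot_compose[OF c'(1) sm(2) open_UNIV] subset_UNIV)
  define v where "v = (\<lambda>z. chart M q (F z))"
  define W where "W = {z\<in>UNIV. F z \<in> chart_dom M q}"
  have F0: "F (0, t) = prj (b \<otimes> c t)" for t using b by (simp add: F_def d'(5))
  have W: "open W" "smooth_on W v" "(0, 0) \<in> W"
    using plotD(3,4)[OF F q] qd b by (simp_all add: W_def v_def F0 c'(5) q_def)
  have vE: "v ` W \<subseteq> E q" by (auto simp: v_def W_def)
  have v00: "v (0, 0) = chart M q q" using b by (simp add: v_def F0 c'(5) q_def)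
  define vs where "vs = (\<lambda>z. D v z (1, 0))"
  define vt where "vt = (\<lambda>z. D v z (0, 1))"
  have svs: "smooth_on W vs" and svt: "smooth_on W vt" unfolding vs_def vt_def by (rule smooth_on_D[OF W(2)])+
  have sl: "((\<lambda>r::real. (s::real, r)) has_derivative (\<lambda>v. (0, v))) (at t)" for s t by (auto intro!: derivative_eq_intros)
  have sect: "open {r. (s, r) \<in> W}" for s
    using open_vimage[OF W(1), of "\<lambda>r::real. (s, r)"] by (simp add: vimage_def continuous_on_Pair)
  have line: "D (\<lambda>r. k (s, r)) t 1 = D k (s, t) (0, 1)" if "smooth_on W k" "(s, t) \<in> W" for k :: "real \<times> real \<Rightarrow> 'b" and s t
    by (rule fun_cong[OF D_eqI[OF has_derivative_compose[OF sl smooth_on_has_derivative[OF that]]]])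
  have geo: "D vt z (0, 1) = - \<Gamma> q (v z) (vt z) (vt z)" if z: "z \<in> W" for z
  proof -
    obtain s t where st: "z = (s, t)" by (cases z) blast
    have W': "(s, t) \<in> W" using z st by simp
    have bd: "b \<otimes> d s \<in> carrier U" using b d'(4) by simp
    have "prj (b \<otimes> d s \<otimes> c t) \<in> chart_dom M q" using W' by (simp add: W_def F_def)
    from exp_curve_geodesic_eq_at[OF bd X c q this]
    have "D (\<lambda>r. D (\<lambda>r. v (s, r)) r 1) t 1 = - \<Gamma> q (v (s, t)) (D (\<lambda>r. v (s, r)) t 1) (D (\<lambda>r. v (s, r)) t 1)"
      by (simp add: v_def F_def)
    moreover have "D (\<lambda>r. D (\<lambda>r. v (s, r)) r 1) t = D (\<lambda>r. vt (s, r)) t"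
      by (rule D_cong_open[OF sect]) (use W' line[OF W(2)] in \<open>simp_all add: vt_def\<close>)
    ultimately show ?thesis using line[OF W(2) W'] line[OF svt W'] by (simp add: st vt_def)
  qed
  define Aa where "Aa = (\<lambda>z. D vs z (0, 1) + \<Gamma> q (v z) (vt z) (vs z))"
  have var: "D Aa (0, 0) (0, 1) + \<Gamma> q (v (0, 0)) (vt (0, 0)) (Aa (0, 0)) = - curvature M g q (vs (0, 0)) (vt (0, 0)) (vt (0, 0))"
    using jacobi_variation[OF q W(1,2) vE geo[unfolded vt_def] W(3) v00] unfolding Aa_def vs_def vt_def .
  \<comment> \<open>The subgroup t \<mapsto> c(- t) is generated by - X; the two signs cancel in the
    second derivative.\<close>
  have o: "ops (\<lambda>t. c (- 1 * t)) (- 1 *\<^sub>R X)" by (rule ops_scale[OF c])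
  have blp: "bounded_linear ppart" using ppart_linear by (simp add: linear_conv_bounded_linear)
  define Y where "Y = (\<lambda>t. ppart (ad (c (- 1 * t)) Z))"
  define Y1 where "Y1 = (\<lambda>t. ppart (ad (c (- 1 * t)) (br (- 1 *\<^sub>R X) Z)))"
  have sY: "smooth_on UNIV Y" "smooth_on UNIV Y1"
    unfolding Y_def Y1_def by (intro smooth_on_bounded_linear[OF blp open_UNIV] Ad_ops(1)[OF o])+
  have pY: "Y t \<in> \<pp>" "Y1 t \<in> \<pp>" for t unfolding Y_def Y1_def by (rule ppart)+
  have DY: "D Y t 1 = Y1 t" for t
    using D_eq_vector_derivative[OF bounded_linear.has_vector_derivative[OF blp Ad_ops(2)[OF o, of Z t]], of 1]
    unfolding Y_def Y1_def by simp
  have DY1: "D Y1 0 1 = ppart (br X (br X Z))"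
    using D_eq_vector_derivative[OF bounded_linear.has_vector_derivative[OF blp Ad_ops(2)[OF o, of "br (- 1 *\<^sub>R X) Z" 0]], of 1]
    unfolding Y1_def by (simp add: c'(5) Ad_one br_minus)
  define J where "J = (\<lambda>t Y. tangent_change M (prj (b \<otimes> c t)) q (prj (b \<otimes> c t)) (lam (b \<otimes> c t) Y))"
  define \<gamma> where "\<gamma> = (\<lambda>t. prj (b \<otimes> c t))"
  have a2: "(along_rep M \<gamma> (\<lambda>t. lam (b \<otimes> c t) (Y t)) q has_vector_derivative
      (J t (D Y t 1) - \<Gamma> q (chart M q (\<gamma> t)) (J t X) (J t (Y t)))) (at t)"
    if "smooth_on UNIV Y" "\<And>t. Y t \<in> \<pp>" "\<gamma> t \<in> chart_dom M q" for Y t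
    using along_exp_curve(2)[OF b X c that(1,2) q, of t] that(3) unfolding J_def \<gamma>_def by simp
  have a3: "D (\<lambda>s. chart M q (\<gamma> s)) t 1 = J t X" if "\<gamma> t \<in> chart_dom M q" for t
    using along_exp_curve(3)[OF b X c sY(1) pY(1) q, of t] that unfolding J_def \<gamma>_def by simp
  have a4: "along_rep M \<gamma> (\<lambda>t. lam (b \<otimes> c t) (Y t)) q t = J t (Y t)" for Y t
    by (simp add: along_rep_def J_def \<gamma>_def)
  have J0: "J 0 Y = lam b Y" for Y
    using b tangent_change_self[OF q qd] by (simp add: J_def c'(5) q_def)
  define T where "T = {t. (0, t) \<in> W}"
  have T: "open T" "0 \<in> T" using sect[of 0] W(3) by (simp_all add: T_def)
  have Td: "\<gamma> t \<in> chart_dom M q" "(0, t) \<in> W" if "t \<in> T" for t using that by (simp_all add: T_def W_def F0 \<gamma>_def)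
  have v0: "v (0, t) = chart M q (\<gamma> t)" for t by (simp add: v_def F0 \<gamma>_def)
  have vt0: "vt (0, t) = J t X" if t: "t \<in> T" for t
    using a3[OF Td(1)[OF t]] line[OF W(2) Td(2)[OF t]] by (simp add: vt_def v0)
  have vs0: "vs (0, t) = J t (Y t)" if t: "t \<in> T" for t
  proof -
    have bc: "b \<otimes> c t \<in> carrier U" using b c'(4) by simp
    note oc = opsD[OF ops_conj[OF c'(4)[of "- 1 * t"] d]]
    have h: "((\<lambda>s::real. (s, t)) has_derivative (\<lambda>v. (v, 0))) (at 0)" by (auto intro!: derivative_eq_intros)
    then have "(\<lambda>s::real. (s, t)) differentiable (at 0)" by (auto simp: differentiable_def)
    from pd_compose[OF M F UNIV_I this, of 1] have "pd M (\<lambda>s. F (s, t)) 0 1 = pd M F (0, t) (1, 0)" by (simp add: D_eqI[OF h])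
    moreover have "F (s, t) = prj (b \<otimes> c t \<otimes> (c (- 1 * t) \<otimes> d s \<otimes> inv (c (- 1 * t))))" for s
    proof -
      have "c t \<otimes> (inv (c t) \<otimes> (d s \<otimes> c t)) = d s \<otimes> c t"
        using c'(4) d'(4) by (simp add: m_assoc[symmetric])
      then show ?thesis using b c'(4) d'(4) by (simp add: F_def c'(6) m_assoc)
    qed
    moreover have "pd M (\<lambda>s. prj (b \<otimes> c t \<otimes> (c (- 1 * t) \<otimes> d s \<otimes> inv (c (- 1 * t))))) 0 1 = lam (b \<otimes> c t) (ad (c (- 1 * t)) Z)"
      using lam_curve[OF bc oc(1,5), of 1] oc(3) by simp
    ultimately have "pd M F (0, t) (1, 0) = lam (b \<otimes> c t) (Y t)" by (simp add: Y_def lam_ppart[OF bc])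
    moreover have "D v (0, t) (1, 0) = tangent_change M (F (0, t)) q (F (0, t)) (pd M F (0, t) (1, 0))"
      unfolding v_def by (rule D_chart_plot[OF M F UNIV_I q]) (use Td(1)[OF t] in \<open>simp add: F0 \<gamma>_def\<close>)
    ultimately show ?thesis by (simp add: vs_def J_def F0)
  qed
  have Aa0: "Aa (0, t) = J t (Y1 t)" if t: "t \<in> T" for t
  proof -
    have "D (\<lambda>r. vs (0, r)) t = D (along_rep M \<gamma> (\<lambda>t. lam (b \<otimes> c t) (Y t)) q) t"
      by (rule D_cong_open[OF T(1) t]) (simp add: vs0 a4)
    then have "D vs (0, t) (0, 1) = J t (Y1 t) - \<Gamma> q (chart M q (\<gamma> t)) (J t X) (J t (Y t))"
      using D_eq_vector_derivative[OF a2[OF sY(1) pY(1) Td(1)[OF t]], of 1] line[OF svs Td(2)[OF t]] by (simp add: DY)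
    then show ?thesis by (simp add: Aa_def v0 vt0[OF t] vs0[OF t])
  qed
  have sAa: "smooth_on W Aa" unfolding Aa_def
    by (intro smooth_on_add W(1) smooth_on_D[OF svs] smooth_on_bilinear_family[OF W(1) open_E[OF q] christoffel_bilinear[OF q]
        christoffel_smooth[OF q] W(2) vE svt svs])
  have "D (\<lambda>r. Aa (0, r)) 0 = D (along_rep M \<gamma> (\<lambda>t. lam (b \<otimes> c t) (Y1 t)) q) 0"
    by (rule D_cong_open[OF T]) (simp add: Aa0 a4)
  then have "D Aa (0, 0) (0, 1) = J 0 (D Y1 0 1) - \<Gamma> q (chart M q (\<gamma> 0)) (J 0 X) (J 0 (Y1 0))"
    using D_eq_vector_derivative[OF a2[OF sY(2) pY(2) Td(1)[OF T(2)]], of 1] line[OF sAa W(3)] by simp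
  then have "lam b (br X (br X Z)) = - curvature M g q (J 0 (Y 0)) (J 0 X) (J 0 X)"
    using var by (simp add: v0 vt0[OF T(2)] vs0[OF T(2)] Aa0[OF T(2)] J0 DY1 lam_ppart[OF b])
  moreover have "J 0 (Y 0) = lam b Z" by (simp add: J0 Y_def c'(5) Ad_one ppart_pp[OF Z])
  ultimately show ?thesis by (simp add: J0 q_def)
qed

text \<open>A vanishing translate forces \<open>d\<pi> X\<close> to be 0, so the geodesic t
  \<mapsto> c t K has zero initial velocity and is constant by uniqueness. Then \<open>c\<close>
  stays in \<open>K\<close>, and \<open>X\<close> lies in both eigenspaces of \<theta>.\<close>

lemma lam_pp_injective:
  assumes b: "b \<in> carrier U" and X: "X \<in> \<pp>" and 0: "lam b X = 0"
  shows "X = 0"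
proof -
  have "g ori (d\<pi> X) (d\<pi> X) = 0"
    using g_lam[OF b, of X X] linear_0[of "g (prj b) 0"] metricD(1)[OF prj_points[OF b]] by (simp add: 0 bilinear_def)
  then have d: "d\<pi> X = 0" using metricD(3)[OF ori_points, of "d\<pi> X"] by force
  obtain c where c: "ops c X" using ops_exists by blast
  have "(\<lambda>t. prj (\<one> \<otimes> c t)) = (\<lambda>t. prj (\<one> \<otimes> \<one>))"
  proof (rule geodesic_unique[OF exp_curve_geodesic[OF one_closed X c] exp_curve_geodesic[OF one_closed pp_zero ops_zero]])
    show "prj (\<one> \<otimes> c 0) = prj (\<one> \<otimes> \<one>)" by (simp add: opsD(5)[OF c])
    show "velocity M (\<lambda>t. prj (\<one> \<otimes> c t)) 0 = velocity M (\<lambda>t. prj (\<one> \<otimes> \<one>)) 0"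
      by (simp add: velocity_exp_curve[OF one_closed c] velocity_eq_pd pd_const opsD(5)[OF c] lam_one d)
  qed
  then have "prj (c t) = ori" for t using opsD(4)[OF c] by (simp add: fun_eq_iff)
  moreover have "c t \<in> prj (c t)" for t
  proof -
    have "c t \<otimes> \<one> \<in> prj (c t)" using subgroup.one_closed[OF K] unfolding l_coset_def by blast
    then show ?thesis using opsD(4)[OF c] by simp
  qed
  ultimately have "c t \<in> K" for t using lcos_mult_one[OF K_sub] by simp
  then have "X \<in> subgroup_lie_algebra U A K"
    using c unfolding subgroup_lie_algebra_def one_parameter_subgroup_def
    by (intro CollectI exI[of _ c]) (simp add: ops_def smooth_map_real_line velocity_eq_pd)
  then have "X = - X" using X by (simp add: lieK)
  then have "X + X = 0" by (simp only: eq_neg_iff_add_eq_0)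
  then have "2 *\<^sub>R X = 0" by (simp only: scaleR_2)
  then show ?thesis by simp
qed

text \<open>Lifts of the coordinate basis are chosen in \<open>\<pp>\<close> and extended linearly;
  being linear, the section turns smooth curves of tangent vectors at the origin into smooth curves
  in \<open>\<pp>\<close>.\<close>

lemma d\<pi>_section:
  obtains \<sigma> where "linear \<sigma>" "\<And>v. \<sigma> v \<in> \<pp>" "\<And>v. d\<pi> (\<sigma> v) = v"
proof -
  have "\<exists>X. X \<in> \<pp> \<and> d\<pi> X = v" for v
  proof -
    obtain X where "lam \<one> X = v" using lam_surj[OF one_closed] by blast
    then have "d\<pi> (ppart X) = v" using lam_ppart[OF one_closed, of X] by (simp add: lam_one)
    then show ?thesis using ppart by blast
  qed
  then obtain f where f: "\<And>v. f v \<in> \<pp>" "\<And>v. d\<pi> (f v) = v" by metis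
  define \<sigma> where "\<sigma> v = (\<Sum>b\<in>Basis. (v \<bullet> b) *\<^sub>R f b)" for v
  show thesis
  proof
    show "linear \<sigma>" by (rule linearI) (simp_all add: \<sigma>_def inner_left_distrib scaleR_left_distrib sum.distrib scaleR_sum_right)
    fix v
    show "d\<pi> (\<sigma> v) = v" by (simp add: \<sigma>_def linear_sum[OF d\<pi>_linear] linear_scale[OF d\<pi>_linear] f(2) euclidean_representation)
    have "\<theta> (f b) = - f b" for b using f(1) by simp
    then show "\<sigma> v \<in> \<pp>" by (simp add: \<sigma>_def linear_sum[OF \<theta>_linear] linear_scale[OF \<theta>_linear] sum_negf)
  qed
qed

text \<open>In the parallel frame two covariant derivatives become W'' and the curvature term
  becomes - ad(X)^2 W; injectivity of the frame on \<open>\<pp>\<close> strips it from the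
  equation.\<close>

lemma jacobi_field_exp_iff:
  assumes X: "X \<in> \<pp>" and c: "ops c X" and W: "smooth_on UNIV W" "\<And>t. W t \<in> \<pp>"
  shows "jacobi_field M g (\<lambda>t. prj (c t)) (\<lambda>t. lam (c t) (W t)) \<longleftrightarrow> (\<forall>t. D (\<lambda>t. D W t 1) t 1 = br X (br X (W t)))"
proof -
  note c' = opsD[OF c]
  have one: "\<one> \<otimes> c t = c t" for t by (rule l_one[OF c'(4)])
  have 1: "covariant_derivative M g (\<lambda>t. prj (c t)) (\<lambda>t. lam (c t) (Y t)) = (\<lambda>t. lam (c t) (D Y t 1))"
    if "smooth_on UNIV Y" "\<And>t. Y t \<in> \<pp>" for Y
    using covariant_derivative_exp_curve[OF one_closed X c that] by (simp add: one fun_eq_iff)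
  have vel: "velocity M (\<lambda>t. prj (c t)) = (\<lambda>t. lam (c t) X)" using velocity_exp_curve[OF one_closed c] by (simp add: one)
  have sm: "smooth_along M (\<lambda>t. prj (c t)) (\<lambda>t. lam (c t) (W t))"
    unfolding smooth_along_def using along_exp_curve(1)[OF one_closed X c W] by (simp add: one)
  have "br X (br X (W t)) \<in> \<pp>" for t by (rule br_pk[OF X br_pp[OF X W(2)]])
  then have p: "D (\<lambda>t. D W t 1) t 1 - br X (br X (W t)) \<in> \<pp>" for t
    by (intro pp_diff D_pp smooth_on_D W)
  have "lam (c t) (D (\<lambda>t. D W t 1) t 1) + curvature M g (prj (c t)) (lam (c t) (W t)) (lam (c t) X) (lam (c t) X) = 0 \<longleftrightarrow>
    D (\<lambda>t. D W t 1) t 1 = br X (br X (W t))" for t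
  proof -
    have "lam (c t) (D (\<lambda>t. D W t 1) t 1) + curvature M g (prj (c t)) (lam (c t) (W t)) (lam (c t) X) (lam (c t) X) =
      lam (c t) (D (\<lambda>t. D W t 1) t 1 - br X (br X (W t)))"
      by (simp add: curvature_exp[OF c'(4) X W(2)] linear_diff[OF lam_linear[OF c'(4)]])
    then show ?thesis using lam_pp_injective[OF c'(4) p[of t]] linear_0[OF lam_linear[OF c'(4)]] by auto
  qed
  then show ?thesis
    unfolding jacobi_field_def using sm by (simp add: 1[OF W] 1[OF smooth_on_D[OF W(1)] D_pp[OF W]] vel)
qed

text \<open>The coefficients of \<open>V\<close> exist pointwise. Their products with constant
  vectors at the origin equal products of \<open>V\<close> with smooth frame fields, hence are
  smooth in \<open>t\<close>; the coefficients follow by solving a linear system with the constant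
  Gram operator at the origin.\<close>

lemma smooth_along_exp_curve:
  assumes X: "X \<in> \<pp>" and c: "ops c X" and V: "smooth_along M (\<lambda>t. prj (c t)) V"
  obtains W :: "real \<Rightarrow> 'a" where "smooth_on UNIV W" "\<And>t. W t \<in> \<pp>" "\<And>t. V t = lam (c t) (W t)"
proof -
  note c' = opsD[OF c]
  have one: "\<one> \<otimes> c t = c t" for t by (rule l_one[OF c'(4)])
  obtain \<sigma> where \<sigma>: "linear \<sigma>" "\<And>v. \<sigma> v \<in> \<pp>" "\<And>v. d\<pi> (\<sigma> v) = v" using d\<pi>_section by blast
  define A' where "A' t = differential M M (\<lambda>q. act (c t) q) ori" for t
  have lam\<sigma>: "lam (c t) (\<sigma> v) = A' t v" for t v by (simp add: lam_act[OF c'(4)] \<sigma>(3) A'_def)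
  have "\<exists>w. A' t w = V t" for t using surjD[OF act_differential_surj[OF c'(4)], of "V t"] unfolding A'_def by metis
  then obtain w where w: "\<And>t. A' t (w t) = V t" by metis
  have gw: "smooth_on UNIV (\<lambda>t. g ori (w t) v)" for v
  proof (rule smooth_on_local)
    fix t0
    define q where "q = prj (c t0)"
    have q: "q \<in> points M" unfolding q_def by (rule prj_points[OF c'(4)])
    define T where "T = {t\<in>UNIV. prj (c t) \<in> chart_dom M q}"
    have pl: "plot M UNIV (\<lambda>t. prj (c t))" using ops_prj_plot[OF one_closed c] by (simp add: one)
    have T: "open T" "smooth_on T (\<lambda>t. chart M q (prj (c t)))" using plotD(3,4)[OF pl q] by (simp_all add: T_def)
    have t0: "t0 \<in> T" using chartedD(1)[OF charted_M q] by (simp add: T_def q_def)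
    let ?r1 = "along_rep M (\<lambda>t. prj (c t)) V q" and ?r2 = "along_rep M (\<lambda>t. prj (c t)) (\<lambda>t. lam (c t) (\<sigma> v)) q"
    have s1: "smooth_on T ?r1" using V q by (simp add: smooth_along_def T_def)
    have s2: "smooth_on T ?r2"
      using along_exp_curve(1)[OF one_closed X c smooth_on_const \<sigma>(2) q] by (simp add: one T_def)
    have sG: "smooth_on T (\<lambda>t. G q (chart M q (prj (c t))) (?r1 t) (?r2 t))"
      by (rule smooth_on_bilinear_family[OF T(1) open_E[OF q] G_bilinear[OF q] metricD(4)[OF q] T(2) _ s1 s2])
        (auto simp: T_def)
    have eq: "G q (chart M q (prj (c t))) (?r1 t) (?r2 t) = g ori (w t) v" if t: "t \<in> T" for t
    proof -
      have d: "prj (c t) \<in> chart_dom M q" using t by (simp add: T_def)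
      have p: "prj (c t) \<in> points M" by (rule prj_points[OF c'(4)])
      have "G q (chart M q (prj (c t))) (?r1 t) (?r2 t) = g (prj (c t)) (V t) (lam (c t) (\<sigma> v))"
        unfolding metric_rep_def Let_def chart_inv_chart[OF charted_M q d] along_rep_def
          tangent_change_inverse[OF p chartedD(1)[OF charted_M p] q d] ..
      also have "\<dots> = g ori (w t) v"
        unfolding lam\<sigma> w[symmetric] A'_def by (rule act_differential_metric[OF c'(4)])
      finally show ?thesis .
    qed
    have "smooth_on T (\<lambda>t. g ori (w t) v)" by (rule smooth_on_cong[OF T(1) eq sG])
    then show "\<exists>T. open T \<and> t0 \<in> T \<and> smooth_on T (\<lambda>t. g ori (w t) v)" using T(1) t0 by blast
  qed
  have gl: "linear (g ori v)" "linear (\<lambda>v. g ori v u)" for v u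
    using metricD(1)[OF ori_points] by (simp_all add: bilinear_def)
  define Q where "Q z = (\<Sum>b\<in>Basis. g ori z b *\<^sub>R b)" for z
  have sw: "smooth_on UNIV w"
  proof (rule linear_solve_smooth[of UNIV "\<lambda>_. Q" "\<lambda>t. Q (w t)"])
    show "linear Q" by (rule linearI) (simp_all add: Q_def linear_add[OF gl(2)] linear_scale[OF gl(2)] scaleR_left_distrib sum.distrib scaleR_sum_right)
    fix z assume z: "Q z = 0"
    have "g ori z b = 0" if "b \<in> Basis" for b
    proof -
      have "Q z \<bullet> b = g ori z b" using that by (simp add: Q_def inner_sum_left inner_Basis if_distrib cong: if_cong)
      then show ?thesis using z by simp
    qed
    then have "g ori z z = 0" using linear_eq_stdbasis[OF gl(1) linear_zero, of z] by metis
    then show "z = 0" using metricD(3)[OF ori_points, of z] by force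
  next
    show "smooth_on UNIV (\<lambda>t. Q (w t))" unfolding Q_def by (intro smooth_on_sum smooth_on_scaleR gw smooth_on_const open_UNIV)
  qed (simp_all add: smooth_on_const)
  show thesis
  proof (rule that[of "\<lambda>t. \<sigma> (w t)"])
    show "smooth_on UNIV (\<lambda>t. \<sigma> (w t))" by (rule smooth_on_linear[OF \<sigma>(1) open_UNIV sw])
    show "\<sigma> (w t) \<in> \<pp>" for t by (rule \<sigma>(2))
    show "V t = lam (c t) (\<sigma> (w t))" for t by (simp add: lam\<sigma> w)
  qed
qed

section \<open>Conjugate points as a boundary value problem on the -1-eigenspace\<close>

definition conj_ode :: "'a \<Rightarrow> bool" where
  "conj_ode X \<longleftrightarrow> (\<exists>W. smooth_on UNIV W \<and> (\<forall>t. W t \<in> \<pp>) \<and> (\<forall>t::real. D (\<lambda>t. D W t 1) t 1 = br X (br X (W t))) \<and>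
     (\<exists>t. W t \<noteq> 0) \<and> W 0 = 0 \<and> W 1 = 0)"

lemma conjugate_point_iff:
  assumes X: "X \<in> \<pp>"
  shows "conjugate_point M g ori (d\<pi> X) \<longleftrightarrow> conj_ode X"
proof -
  obtain c where c: "ops c X" using ops_exists by blast
  note c' = opsD[OF c]
  \<comment> \<open>The rescaled subgroup s \<mapsto> c (t s) gives the geodesic with initial
    velocity t times \<open>d\<pi> X\<close>, so the exponential of the whole ray follows one
    orbit.\<close>
  have ex: "riem_exp M g ori (t *\<^sub>R d\<pi> X) = prj (c t)" for t
  proof -
    have o: "ops (\<lambda>s. c (t * s)) (t *\<^sub>R X)" by (rule ops_scale[OF c])
    have "riem_exp M g ori (t *\<^sub>R d\<pi> X) = prj (\<one> \<otimes> c (t * 1))"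
    using riem_exp_eq exp_curve_geodesic one_closed pp_scale X o d\<pi>_linear by (fastforce simp: velocity_exp_curve c'(5) lam_one linear_scale)
    then show ?thesis using c'(4) by simp
  qed
  have z: "lam (c t) Y = 0 \<longleftrightarrow> Y = 0" if "Y \<in> \<pp>" for t Y
    using lam_pp_injective[OF c'(4) that] linear_0[OF lam_linear[OF c'(4)]] by auto
  show ?thesis
  proof
    assume "conjugate_point M g ori (d\<pi> X)"
    then obtain V where V: "jacobi_field M g (\<lambda>t. prj (c t)) V" "\<exists>t. V t \<noteq> 0" "V 0 = 0" "V 1 = 0"
      unfolding conjugate_point_def ex by blast
    have sa: "smooth_along M (\<lambda>t. prj (c t)) V" using V(1) by (simp add: jacobi_field_def)
    obtain W where W: "smooth_on UNIV W" "\<And>t. W t \<in> \<pp>" "\<And>t. V t = lam (c t) (W t)"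
      by (rule smooth_along_exp_curve[OF X c sa]) (rule that; assumption)
    have "V = (\<lambda>t. lam (c t) (W t))" using W(3) by blast
    then have "\<forall>t. D (\<lambda>t. D W t 1) t 1 = br X (br X (W t))" using V(1) jacobi_field_exp_iff[OF X c W(1,2)] by simp
    then show "conj_ode X"
      unfolding conj_ode_def using W V(2-4) z[OF W(2)] by (intro exI[of _ W]) simp
  next
    assume "conj_ode X"
    then obtain W :: "real \<Rightarrow> 'a" where W: "smooth_on UNIV W" "\<And>t. W t \<in> \<pp>" "\<forall>t. D (\<lambda>t. D W t 1) t 1 = br X (br X (W t))"
      "\<exists>t. W t \<noteq> 0" "W 0 = 0" "W 1 = 0" unfolding conj_ode_def by blast
    show "conjugate_point M g ori (d\<pi> X)"
      unfolding conjugate_point_def ex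
      using jacobi_field_exp_iff[OF X c W(1,2)] W(3-6) z[OF W(2)] linear_0[OF lam_linear[OF c'(4)]]
      by (intro exI[of _ "\<lambda>t. lam (c t) (W t)"]) simp
  qed
qed

lemma first_conjugate_locus_eq:
  "first_conjugate_locus M g ori = d\<pi> ` {X \<in> \<pp>. conj_ode X \<and> (\<forall>t\<in>{0<..<1}. \<not> conj_ode (t *\<^sub>R X))}"
proof -
  obtain \<sigma> where \<sigma>: "linear \<sigma>" "\<And>v. \<sigma> v \<in> \<pp>" "\<And>v. d\<pi> (\<sigma> v) = v" using d\<pi>_section by blast
  have 1: "v \<in> first_conjugate_locus M g ori \<longleftrightarrow> conj_ode X \<and> (\<forall>t\<in>{0<..<1}. \<not> conj_ode (t *\<^sub>R X))"
    if "X \<in> \<pp>" "v = d\<pi> X" for v X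
    unfolding first_conjugate_locus_def using conjugate_point_iff[OF that(1)] conjugate_point_iff[OF pp_scale[OF that(1)]] that(2)
    by (simp add: linear_scale[OF d\<pi>_linear])
  show ?thesis
  proof (rule equalityI; rule subsetI)
    fix v assume v: "v \<in> first_conjugate_locus M g ori"
    show "v \<in> d\<pi> ` {X \<in> \<pp>. conj_ode X \<and> (\<forall>t\<in>{0<..<1}. \<not> conj_ode (t *\<^sub>R X))}"
    proof (rule image_eqI[of _ _ "\<sigma> v"])
      show e: "v = d\<pi> (\<sigma> v)" by (rule \<sigma>(3)[symmetric])
      show "\<sigma> v \<in> {X \<in> \<pp>. conj_ode X \<and> (\<forall>t\<in>{0<..<1}. \<not> conj_ode (t *\<^sub>R X))}"
        by (rule CollectI, rule conjI[OF \<sigma>(2) iffD1[OF 1[OF \<sigma>(2) e] v]])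
    qed
  next
    fix v assume "v \<in> d\<pi> ` {X \<in> \<pp>. conj_ode X \<and> (\<forall>t\<in>{0<..<1}. \<not> conj_ode (t *\<^sub>R X))}"
    then obtain X where "X \<in> \<pp>" "v = d\<pi> X" "conj_ode X \<and> (\<forall>t\<in>{0<..<1}. \<not> conj_ode (t *\<^sub>R X))" by blast
    then show "v \<in> first_conjugate_locus M g ori" using 1[of X v] by blast
  qed
qed

end

subsection \<open>The first conjugate locus\<close>

locale compact_symmetric_space = hom_space +
  fixes hk hp :: "'b set" and P :: "'b cplx set"
  assumes compact: "compact_space (manifold_topology A)" and ss: "semisimple (lie_bracket U A)"
    and closed_K: "closedin (manifold_topology A) K"
    and hp_max: "maximal_abelian_in (lie_bracket U A) {X. \<theta> X = - X} hp"
    and hk_kk: "hk \<subseteq> {X. \<theta> X = X}"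
    and cartan_max: "maximal_abelian_in (lie_bracket U A) UNIV (sum_subspace hk hp)"
    and P_ordering: "vector_ordering (imag_part hp) P"
begin

text \<open>Continuity in \<open>u\<close> and compactness bound the image of each basis vector;
  summing over the basis gives one constant for all \<open>v\<close>. The added 1 makes it
  positive.\<close>

lemma Ad_bounded: "\<exists>C>0. \<forall>u\<in>carrier U. \<forall>v. norm (ad u v) \<le> C * norm v"
proof -
  have b: "\<exists>B. \<forall>u\<in>carrier U. norm (ad u v) \<le> B" for v
  proof -
    have "compactin (manifold_topology A) (points A)" using compact by (simp add: compact_space_def topspace_manifold[OF A])
    from image_compactin[OF this Ad_continuous[of v]] have "compact ((\<lambda>u. ad u v) ` points A)" by simp
    then have "bounded ((\<lambda>u. ad u v) ` points A)" by (rule compact_imp_bounded)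
    then show ?thesis unfolding bounded_iff carrier by simp
  qed
  obtain B where B: "\<And>v u. u \<in> carrier U \<Longrightarrow> norm (ad u v) \<le> B v"
  using choice b that by fast
  have B0: "B v \<ge> 0" for v by (rule order_trans[OF norm_ge_zero B[OF one_closed]])
  define C where "C = (\<Sum>i\<in>Basis. B i) + 1"
  have C: "C > 0" using sum_nonneg[of Basis B, OF B0] by (simp add: C_def)
  have "norm (ad u v) \<le> C * norm v" if u: "u \<in> carrier U" for u v
  proof -
    have "ad u v = ad u (\<Sum>i\<in>Basis. (v \<bullet> i) *\<^sub>R i)" by (simp only: euclidean_representation)
    also have "\<dots> = (\<Sum>i\<in>Basis. (v \<bullet> i) *\<^sub>R ad u i)" by (simp add: linear_sum[OF Ad_linear[OF u]] linear_scale[OF Ad_linear[OF u]])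
    finally have "norm (ad u v) \<le> (\<Sum>i\<in>Basis. norm ((v \<bullet> i) *\<^sub>R ad u i))" using norm_sum by metis
    also have "\<dots> \<le> (\<Sum>i\<in>Basis. norm v * B i)"
    proof (rule sum_mono)
      fix i :: 'b assume "i \<in> Basis"
      then have "\<bar>v \<bullet> i\<bar> * norm (ad u i) \<le> norm v * B i" by (intro mult_mono Basis_le_norm B[OF u]) auto
      then show "norm ((v \<bullet> i) *\<^sub>R ad u i) \<le> norm v * B i" by simp
    qed
    also have "\<dots> = (\<Sum>i\<in>Basis. B i) * norm v" by (subst sum_distrib_left[symmetric]) (rule mult.commute)
    also have "\<dots> \<le> C * norm v" by (intro mult_right_mono) (simp_all add: C_def)
    finally show ?thesis .
  qed
  then show ?thesis using C by blast
qed

sublocale alg: lie_algebra br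
  by standard (rule br_bilinear br_antisym br_jacobi)+

text \<open>ad X generates the bounded group Ad (c t), the lower bound coming from inverses, so the
  trace of its square is at most 0. If the trace is 0 then ad X = 0, so \<open>X\<close> is in the
  radical of the Killing form, which is trivial by semisimplicity.\<close>

lemma killing_neg:
  assumes X: "X \<noteq> 0"
  shows "killing_form br X X < 0"
proof -
  obtain c where c: "ops c X" using ops_exists by blast
  note c' = opsD[OF c]
  obtain C where C: "C > 0" "\<forall>u\<in>carrier U. \<forall>v. norm (ad u v) \<le> C * norm v" using Ad_bounded by blast
  interpret bounded_flow "\<lambda>t. ad (c t)" "br X" C
  proof (rule bounded_flow.intro)
    show "linear (ad (c t))" for t by (rule Ad_linear[OF c'(4)])
    show "linear (br X)" by (rule alg.br_lin(1))
    show "((\<lambda>t. ad (c t) v) has_vector_derivative ad (c t) (br X v)) (at t)" for t v by (rule Ad_ops(2)[OF c])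
    show "C > 0" by (rule C(1))
    show "norm (ad (c t) v) \<le> C * norm v" for t v using C(2) c'(4) by blast
    show "norm v \<le> C * norm (ad (c t) v)" for t v
    using C(2) inv_closed c'(4) by (metis Ad_inv(1))
  qed
  have le: "killing_form br X X \<le> 0" unfolding killing_form_def by (rule generator_trace(1))
  moreover have "killing_form br X X \<noteq> 0"
  proof
    assume "killing_form br X X = 0"
    then have z: "br X Z = 0" for Z unfolding killing_form_def by (rule generator_trace(2))
    have "killing_form br X Y = 0" for Y by (simp add: killing_form_def z linear_trace_def)
    then show False using ss X by (simp add: semisimple_def)
  qed
  ultimately show ?thesis by simp
qed

sublocale alg: ordered_flat br \<theta> hp hk P
  by unfold_locales (rule \<theta> killing_neg hp_max hk_kk cartan_max P_ordering; assumption?)+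

lemma ip_Ad:
  assumes u: "u \<in> carrier U"
  shows "alg.ip (ad u X) (ad u Y) = alg.ip X Y"
  unfolding alg.ip_def
  using alg.killing_automorphism[OF Ad_linear[OF u] Ad_br[OF u] Ad_linear[OF inv_closed[OF u]] Ad_inv(2)[OF u] Ad_inv(1)[OF u]] by simp

section \<open>The adjoint action of K on the -1-eigenspace\<close>

lemma K_inv: "k \<in> K \<Longrightarrow> inv k \<in> K"
  by (rule subgroup.m_inv_closed[OF K])

lemma K_carrier: "k \<in> K \<Longrightarrow> k \<in> carrier U"
  using subgroup.subset[OF K] by blast

text \<open>Ad k preserves both the invariant form and \<open>\<kk>\<close>, the latter by
  conjugating one-parameter subgroups of \<open>K\<close>. So the \<open>\<kk>\<close>-part of Ad k
  X is orthogonal to Ad k X, hence to itself.\<close>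

lemma Ad_pp:
  assumes k: "k \<in> K" and X: "X \<in> \<pp>"
  shows "ad k X \<in> \<pp>"
proof -
  let ?Y = "ad k X"
  have kc: "k \<in> carrier U" by (rule K_carrier[OF k])
  have "alg.kpt ?Y \<in> \<kk>" by (rule alg.kpt_ppt(1))
  then have "ad (inv k) (alg.kpt ?Y) \<in> \<kk>" by (rule Ad_kk[OF K_inv[OF k]])
  then have "alg.ip (ad (inv k) (alg.kpt ?Y)) X = 0" by (rule alg.ip_kk_pp[OF _ X])
  then have "alg.ip (alg.kpt ?Y) ?Y = 0"
    using ip_Ad[OF kc, of "ad (inv k) (alg.kpt ?Y)" X] by (simp add: Ad_inv(2)[OF kc])
  moreover have "alg.ip (alg.kpt ?Y) (alg.ppt ?Y) = 0" by (rule alg.ip_kk_pp[OF alg.kpt_ppt(1,2)])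
  moreover have "alg.ip (alg.kpt ?Y) ?Y = alg.ip (alg.kpt ?Y) (alg.kpt ?Y) + alg.ip (alg.kpt ?Y) (alg.ppt ?Y)"
    using alg.kpt_ppt(3)[of ?Y] linear_add[OF alg.Q_linear(1)[of "alg.kpt ?Y"], of "alg.kpt ?Y" "alg.ppt ?Y"] by simp
  ultimately have "alg.kpt ?Y = 0" by (simp add: alg.Q_eq_0)
  then have "alg.ppt ?Y = ?Y" using alg.kpt_ppt(3)[of ?Y] by simp
  then show ?thesis using alg.kpt_ppt(2)[of ?Y] by simp
qed

lemma spec_Ad:
  assumes k: "k \<in> K" and s: "alg.spec X l"
  shows "alg.spec (ad k X) l"
proof (rule alg.spec_automorphism[OF _ _ _ _ s])
  have kc: "k \<in> carrier U" by (rule K_carrier[OF k])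
  show "linear (ad k)" by (rule Ad_linear[OF kc])
  show "ad k (br X Y) = br (ad k X) (ad k Y)" for X Y by (rule Ad_br[OF kc])
  show "ad k X \<in> \<pp>" if "X \<in> \<pp>" for X by (rule Ad_pp[OF k that])
  show "X = 0" if "ad k X = 0" for X
    using Ad_inv(1)[OF kc, of X] that linear_0[OF Ad_linear[OF inv_closed[OF kc]]] by simp
qed

lemma spec_Ad_iff: "k \<in> K \<Longrightarrow> alg.spec (ad k X) l \<longleftrightarrow> alg.spec X l"
  using spec_Ad[of k X l] spec_Ad[of "inv k" "ad k X" l] K_inv[of k] Ad_inv(1)[OF K_carrier, of k X] by auto

text \<open>One direction is \<open>jacobi_conj_spec\<close>; for the other, W t = sin(k \<pi> t) V
  is an explicit solution with the required zeros.\<close>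

lemma conj_ode_iff:
  assumes X: "X \<in> \<pp>"
  shows "conj_ode X \<longleftrightarrow> alg.conj_spec X"
proof
  assume "conj_ode X"
  then obtain W :: "real \<Rightarrow> 'b" where W: "smooth_on UNIV W" "\<And>t. W t \<in> \<pp>" "\<forall>t. D (\<lambda>t. D W t 1) t 1 = br X (br X (W t))"
      "\<exists>t. W t \<noteq> 0" "W 0 = 0" "W 1 = 0" unfolding conj_ode_def by blast
  obtain t0 where t0: "W t0 \<noteq> 0" using W(4) by (elim exE)
  have s: "smooth_on UNIV (\<lambda>t. D W t 1)" by (rule smooth_on_D[OF W(1)])
  show "alg.conj_spec X"
  proof (rule alg.jacobi_conj_spec[OF X _ _ W(2) W(5,6) t0])
    show "(W has_vector_derivative D W t 1) (at t)" for t by (rule smooth_on_has_vector_derivative[OF W(1) UNIV_I])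
    show "((\<lambda>t. D W t 1) has_vector_derivative br X (br X (W t))) (at t)" for t
      using smooth_on_has_vector_derivative[OF s UNIV_I, of t] by (simp only: W(3)[rule_format])
  qed
next
  assume "alg.conj_spec X"
  then obtain k :: nat and V where k: "k \<ge> 1" and V: "V \<in> \<pp>" "V \<noteq> 0" "br X (br X V) = - ((real k * pi)\<^sup>2 *\<^sub>R V)"
    unfolding alg.conj_spec_def alg.spec_def by blast
  define m where "m = real k * pi"
  define W where "W = (\<lambda>t::real. sin (m * t) *\<^sub>R V)"
  define W1 where "W1 = (\<lambda>t::real. (m * cos (m * t)) *\<^sub>R V)"
  have d: "(W has_vector_derivative W1 t) (at t)" for t
    unfolding W_def W1_def by (auto intro!: derivative_eq_intros simp: mult.commute)
  have d1: "(W1 has_vector_derivative - (m\<^sup>2 *\<^sub>R W t)) (at t)" for t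
    unfolding W_def W1_def by (auto intro!: derivative_eq_intros simp: power2_eq_square mult_ac)
  have D1: "D W t 1 = W1 t" for t using D_eq_vector_derivative[OF d[of t], of 1] by simp
  have D2: "D (\<lambda>t. D W t 1) t 1 = - (m\<^sup>2 *\<^sub>R W t)" for t
    unfolding D1 using D_eq_vector_derivative[OF d1[of t], of 1] by simp
  show "conj_ode X" unfolding conj_ode_def
  proof (intro exI[of _ W] conjI allI)
    \<comment> \<open>Smoothness is inherited from the linear first-order system solved by the pair
      (W, W').\<close>
    show "smooth_on UNIV W"
    proof -
      let ?F = "\<lambda>z::'b \<times> 'b. (snd z, - (m\<^sup>2 *\<^sub>R fst z))"
      have "linear ?F" by (rule linearI) (simp_all add: scaleR_add_right)
      then have F: "smooth_on UNIV ?F" by (rule smooth_on_linear[OF _ open_UNIV smooth_on_id[OF open_UNIV]])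
      have "smooth_on UNIV (\<lambda>t. (W t, W1 t))"
      proof (rule ode_solution_smooth[OF open_UNIV F open_UNIV])
        fix t :: real
        have "((\<lambda>t. (W t, W1 t)) has_vector_derivative (W1 t, - (m\<^sup>2 *\<^sub>R W t))) (at t)"
          by (rule has_vector_derivative_Pair[OF d d1])
        then show "(W t, W1 t) \<in> UNIV \<and> ((\<lambda>t. (W t, W1 t)) has_vector_derivative ?F (W t, W1 t)) (at t)" by simp
      qed
      from smooth_on_fst[OF open_UNIV this] show ?thesis by simp
    qed
    show "W t \<in> \<pp>" for t unfolding W_def by (rule pp_scale[OF V(1)])
    show "D (\<lambda>t. D W t 1) t 1 = br X (br X (W t))" for t
      unfolding D2 using V(3) by (simp add: W_def m_def alg.br_simps)
    show "\<exists>t. W t \<noteq> 0"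
    \<comment> \<open>At this time the argument of the sine is \<pi> / 2.\<close>
    proof (rule exI[of _ "1 / (2 * real k)"])
      have "m * (1 / (2 * real k)) = pi / 2" using k by (simp add: m_def)
      then have "sin (m * (1 / (2 * real k))) = 1" by (simp only: sin_pi_half)
      then show "W (1 / (2 * real k)) \<noteq> 0" using V(2) by (simp only: W_def scaleR_one not_False_eq_True)
    qed
    show "W 0 = 0" by (simp add: W_def)
    have "sin (real k * pi) = 0" by (rule sin_npi)
    then show "W 1 = 0" by (simp add: W_def m_def)
  qed
qed

text \<open>\<open>K\<close> is compact as a closed subset of the compact group, and the product
  with \<open>H\<close> depends continuously on the group element.\<close>

lemma Ad_maximum:
  "\<exists>k\<in>K. \<forall>k'\<in>K. alg.ip (ad k' X) H \<le> alg.ip (ad k X) H"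
proof -
  have "linear (\<lambda>v. alg.ip v H)" by (rule alg.Q_linear(2))
  then have c: "continuous_map euclidean euclidean (\<lambda>v. alg.ip v H)"
    unfolding continuous_map_iff_continuous2 by (intro linear_continuous_on) (simp add: linear_conv_bounded_linear)
  have "continuous_map (manifold_topology A) euclidean ((\<lambda>v. alg.ip v H) \<circ> (\<lambda>u. ad u X))"
    by (rule continuous_map_compose[OF Ad_continuous c])
  then have cont: "continuous_map (manifold_topology A) euclidean (\<lambda>u. alg.ip (ad u X) H)" by (simp add: comp_def)
  have "compactin (manifold_topology A) K" by (rule closedin_compact_space[OF compact closed_K])
  from image_compactin[OF this cont] have "compact ((\<lambda>u. alg.ip (ad u X) H) ` K)" by simp
  moreover have "(\<lambda>u. alg.ip (ad u X) H) ` K \<noteq> {}" using subgroup.one_closed[OF K] by blast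
  ultimately have "\<exists>s\<in>(\<lambda>u. alg.ip (ad u X) H) ` K. \<forall>t\<in>(\<lambda>u. alg.ip (ad u X) H) ` K. t \<le> s" by (rule compact_attains_sup)
  then show ?thesis by simp
qed

text \<open>A maximum of \<open>k \<mapsto> \<langle>Ad(k) X, H\<rangle>\<close> over \<open>K\<close> lies in the flat containing \<open>H\<close>, and the second
  variation puts it into the chamber of \<open>H\<close>.\<close>

lemma conjugate_into_chamber:
  assumes X: "X \<in> \<pp>" and H: "alg.regular H"
  shows "\<exists>k\<in>K. ad k X \<in> hp \<and> (\<forall>a\<in>alg.rroots. alg.ip (ad k X) a * alg.ip a H \<ge> 0)"
proof -
  obtain k where k: "k \<in> K" "\<And>k'. k' \<in> K \<Longrightarrow> alg.ip (ad k' X) H \<le> alg.ip (ad k X) H"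
    using Ad_maximum[of X H] by blast
  let ?Y = "ad k X"
  have kc: "k \<in> carrier U" by (rule K_carrier[OF k(1)])
  have Y: "?Y \<in> \<pp>" by (rule Ad_pp[OF k(1) X])
  have var: "alg.ip (br T ?Y) H = 0 \<and> alg.ip (br T (br T ?Y)) H \<le> 0" if T: "T \<in> \<kk>" for T
  proof -
    obtain c where c: "ops c T" "\<forall>t. c t \<in> K" using kk_ops[OF T] by blast
    note c' = opsD[OF c(1)]
    \<comment> \<open>This family is closed under differentiation: the derivative of
      \<open>h Z\<close> is \<open>h (br T Z)\<close>. So the first two derivatives at 0 are the
      products of \<open>H\<close> with [T, Y] and [T, [T, Y]].\<close>
    define h where "h Z t = alg.ip (ad (c t) Z) H" for Z t
    have bl: "bounded_linear (\<lambda>v. alg.ip v H)" using alg.Q_linear(2) by (simp add: linear_conv_bounded_linear)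
    have d: "(h Z has_real_derivative h (br T Z) t) (at t)" for Z t
    proof -
      have "((\<lambda>t. alg.ip (ad (c t) Z) H) has_vector_derivative alg.ip (ad (c t) (br T Z)) H) (at t)"
        by (rule bounded_linear.has_vector_derivative[OF bl Ad_ops(2)[OF c(1)]])
      then show ?thesis by (simp add: h_def[abs_def] has_real_derivative_iff_has_vector_derivative)
    qed
    have h0: "h Z 0 = alg.ip Z H" for Z by (simp add: h_def c'(5) Ad_one)
    have mx: "h ?Y t \<le> h ?Y 0" for t
    using subgroup.m_closed K c(2) k(1) k(2) c'(4) kc by (metis h_def Ad_mult h0)
    show ?thesis
      using second_derivative_at_maximum[of "h ?Y" "h (br T ?Y)", OF d d mx] by (simp add: h0)
  qed
  have "?Y \<in> hp" by (rule alg.critical_dominant(1)[OF H Y]) (use var in blast)+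
  moreover have "alg.ip ?Y a * alg.ip a H \<ge> 0" if "a \<in> alg.rroots" for a
    by (rule alg.critical_dominant(2)[OF H Y _ _ that]) (use var in blast)+
  ultimately show ?thesis using k(1) by blast
qed

text \<open>The pair (0, x) is i x, so \<pi> i times it is the real vector - \<pi> x; this sign
  reverses the chamber.\<close>

lemma cembed_pi:
  "cembed Y = cscale (of_real pi * \<i>) (0, x) \<longleftrightarrow> Y = - (pi *\<^sub>R x)"
  by (simp add: cembed_def cscale_def)

lemma spec_scaled_hp:
  assumes x: "x \<in> hp" and l: "l > 0"
  shows "alg.spec (- (pi *\<^sub>R x)) l \<longleftrightarrow> (\<exists>a\<in>alg.rroots. \<bar>alg.ip x a\<bar> = l / pi)"
using x alg.hp(2) subspace_neg subspace_scale l alg.spec_hp_iff by (fastforce simp: abs_mult mult.commute eq_divide_eq alg.Q_simps)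

text \<open>The positive frequencies of - \<pi> x are the positive values of \<pi> |ip x a|, so the
  threshold \<pi> becomes the threshold 1 of the polyhedron.\<close>

lemma first_spec_iff:
  assumes x: "x \<in> hp"
  shows "alg.spec (- (pi *\<^sub>R x)) pi \<and> (\<forall>l>pi. \<not> alg.spec (- (pi *\<^sub>R x)) l) \<longleftrightarrow>
    (\<forall>a\<in>alg.rroots. \<bar>alg.ip x a\<bar> \<le> 1) \<and> (\<exists>a\<in>alg.rroots. \<bar>alg.ip x a\<bar> = 1)"
proof -
  have 1: "alg.spec (- (pi *\<^sub>R x)) pi \<longleftrightarrow> (\<exists>a\<in>alg.rroots. \<bar>alg.ip x a\<bar> = 1)"
    using spec_scaled_hp[OF x pi_gt_zero] by simp
  have "(\<forall>l>pi. \<not> alg.spec (- (pi *\<^sub>R x)) l) \<longleftrightarrow> (\<forall>a\<in>alg.rroots. \<bar>alg.ip x a\<bar> \<le> 1)"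
  proof
    assume h: "\<forall>l>pi. \<not> alg.spec (- (pi *\<^sub>R x)) l"
    show "\<forall>a\<in>alg.rroots. \<bar>alg.ip x a\<bar> \<le> 1"
    proof (rule ballI, rule ccontr)
      fix a assume a: "a \<in> alg.rroots" and "\<not> \<bar>alg.ip x a\<bar> \<le> 1"
      then have l: "pi * \<bar>alg.ip x a\<bar> > pi" by simp
      then have "pi * \<bar>alg.ip x a\<bar> > 0" using pi_gt_zero by linarith
      then have "alg.spec (- (pi *\<^sub>R x)) (pi * \<bar>alg.ip x a\<bar>)" using a spec_scaled_hp[OF x] by auto
      then show False using h l by blast
    qed
  next
    assume h: "\<forall>a\<in>alg.rroots. \<bar>alg.ip x a\<bar> \<le> 1"
    show "\<forall>l>pi. \<not> alg.spec (- (pi *\<^sub>R x)) l"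
    proof (intro allI impI notI)
      fix l assume l: "pi < l" "alg.spec (- (pi *\<^sub>R x)) l"
      have "l > 0" using l(1) pi_gt_zero by linarith
      then obtain a where a: "a \<in> alg.rroots" "\<bar>alg.ip x a\<bar> = l / pi" using spec_scaled_hp[OF x] l(2) by blast
      have "l / pi \<le> 1" using h[rule_format, OF a(1)] a(2) by simp
      then show False using l(1) by (simp add: pos_divide_le_eq)
    qed
  qed
  then show ?thesis using 1 by blast
qed

lemma first_conjugate_locus_polyhedron:
  "first_conjugate_locus M g ori = d\<pi> ` {ad k Y | k Y x. k \<in> K \<and>
     x \<in> cartan_polyhedron_face br \<theta> hk hp P \<and> cembed Y = cscale (of_real pi * \<i>) x}"
proof -
  have 1: "conj_ode X \<and> (\<forall>t\<in>{0<..<1}. \<not> conj_ode (t *\<^sub>R X)) \<longleftrightarrow> alg.spec X pi \<and> (\<forall>l>pi. \<not> alg.spec X l)"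
    if X: "X \<in> \<pp>" for X
    using alg.first_conj_spec[of X] conj_ode_iff[OF X] conj_ode_iff[OF pp_scale[OF X]] by simp
  have "{X \<in> \<pp>. alg.spec X pi \<and> (\<forall>l>pi. \<not> alg.spec X l)} =
    {ad k Y | k Y x. k \<in> K \<and> x \<in> cartan_polyhedron_face br \<theta> hk hp P \<and> cembed Y = cscale (of_real pi * \<i>) x}" (is "?L = ?R")
  proof (intro equalityI subsetI)
    fix X assume "X \<in> ?L"
    then have X: "X \<in> \<pp>" "alg.spec X pi" "\<forall>l>pi. \<not> alg.spec X l" by auto
    obtain H where H: "H \<in> hp" "\<forall>a\<in>alg.rroots. if (0, a) \<in> P then alg.ip a H > 0 else alg.ip a H < 0"
      using alg.regular_vector by blast
    \<comment> \<open>The search runs with - H because \<open>x\<close> will be a negative multiple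
      of Ad k X: position in the chamber of - H for Ad k X is dominance for
      \<open>x\<close>.\<close>
    have "alg.regular (- H)" unfolding alg.regular_def
    proof (intro conjI ballI)
      show "- H \<in> hp" by (rule subspace_neg[OF alg.hp(2) H(1)])
      fix a assume "a \<in> alg.rroots"
      from H(2)[rule_format, OF this] show "alg.ip a (- H) \<noteq> 0" by (auto simp: alg.Q_simps split: if_splits)
    qed
    from conjugate_into_chamber[OF X(1) this]
    obtain k where k: "k \<in> K" "ad k X \<in> hp" "\<forall>a\<in>alg.rroots. alg.ip (ad k X) a * alg.ip a (- H) \<ge> 0" by blast
    define x where "x = - ((1 / pi) *\<^sub>R ad k X)"
    have Yx: "ad k X = - (pi *\<^sub>R x)" by (simp add: x_def)
    have xhp: "x \<in> hp" unfolding x_def using k(2) alg.hp(2) by (intro subspace_neg subspace_scale)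
    have "alg.spec (- (pi *\<^sub>R x)) pi \<and> (\<forall>l>pi. \<not> alg.spec (- (pi *\<^sub>R x)) l)"
      unfolding Yx[symmetric] spec_Ad_iff[OF k(1)] using X(2,3) by blast
    then have b: "\<forall>a\<in>alg.rroots. \<bar>alg.ip x a\<bar> \<le> 1" "\<exists>a\<in>alg.rroots. \<bar>alg.ip x a\<bar> = 1"
      unfolding first_spec_iff[OF xhp] by auto
    have "(0, x) \<in> cartan_polyhedron_face br \<theta> hk hp P"
    proof (rule alg.faceI[OF xhp _ b])
      fix a assume a: "a \<in> alg.rroots" "(0, a) \<in> P"
      have p: "alg.ip a H > 0" using H(2)[rule_format, OF a(1)] a(2) by simp
      have "alg.ip x a * alg.ip a H = (1 / pi) * (alg.ip (ad k X) a * alg.ip a (- H))"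
        by (simp add: x_def alg.Q_simps)
      also have "\<dots> \<ge> 0" by (rule mult_nonneg_nonneg[OF _ k(3)[rule_format, OF a(1)]]) simp
      finally show "alg.ip x a \<ge> 0" using p by (simp add: zero_le_mult_iff)
    qed
    moreover have "X = ad (inv k) (- (pi *\<^sub>R x))"
      unfolding Yx[symmetric] by (rule Ad_inv(1)[OF K_carrier[OF k(1)], symmetric])
    moreover have "cembed (- (pi *\<^sub>R x)) = cscale (of_real pi * \<i>) (0, x)" by (simp only: cembed_pi)
    ultimately show "X \<in> ?R" using K_inv[OF k(1)] by blast
  next
    fix X assume "X \<in> ?R"
    then obtain k Y E where kY: "X = ad k Y" "k \<in> K" "E \<in> cartan_polyhedron_face br \<theta> hk hp P"
      "cembed Y = cscale (of_real pi * \<i>) E" by blast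
    obtain x where E: "E = (0, x)" using kY(3) unfolding alg.face_iff by blast
    have f: "x \<in> hp" "\<forall>a\<in>alg.rroots. \<bar>alg.ip x a\<bar> \<le> 1" "\<exists>a\<in>alg.rroots. \<bar>alg.ip x a\<bar> = 1"
      using alg.face_bound[OF kY(3)[unfolded E]] by auto
    have Y: "Y = - (pi *\<^sub>R x)" using kY(4) unfolding E cembed_pi .
    have "Y \<in> hp" unfolding Y using f(1) alg.hp(2) by (intro subspace_neg subspace_scale)
    then have "X \<in> \<pp>" unfolding kY(1) using alg.hp(3) by (intro Ad_pp kY(2)) blast
    moreover have "alg.spec X pi \<and> (\<forall>l>pi. \<not> alg.spec X l)"
      unfolding kY(1) spec_Ad_iff[OF kY(2)] Y first_spec_iff[OF f(1)] using f by blast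
    ultimately show "X \<in> ?L" by blast
  qed
  moreover have "{X \<in> \<pp>. conj_ode X \<and> (\<forall>t\<in>{0<..<1}. \<not> conj_ode (t *\<^sub>R X))} = {X \<in> \<pp>. alg.spec X pi \<and> (\<forall>l>pi. \<not> alg.spec X l)}"
    by (rule Collect_cong) (rule conj_cong[OF refl 1])
  ultimately show ?thesis unfolding first_conjugate_locus_eq by simp
qed

end

theorem theorem1p2:
  fixes U :: "'u monoid"
    and A :: "('u, 'a::euclidean_space) manifold"
    and K :: "'u set"
    and M :: "('u set, 'b::euclidean_space) manifold"
    and g :: "('u set, 'b) metric"
    and \<theta> :: "'a \<Rightarrow> 'a"
    and hk hp :: "'a set"
    and P :: "'a cplx set"
  assumes "lie_group U A"
    and "compact_space (manifold_topology A)"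
    and "semisimple (lie_bracket U A)"
    and "subgroup K U"
    and "closedin (manifold_topology A) K"
    and "quotient_manifold U A K M"
    and "riemannian_metric M g"
    and "invariant_metric U M g"
    and "riemannian_symmetric M g"
    and "involutive_automorphism (lie_bracket U A) \<theta>"
    and "subgroup_lie_algebra U A K = {X. \<theta> X = X}"
    and "maximal_abelian_in (lie_bracket U A) {X. \<theta> X = - X} hp"
    and "abelian_subspace (lie_bracket U A) hk"
    and "hk \<subseteq> {X. \<theta> X = X}"
    and "maximal_abelian_in (lie_bracket U A) UNIV (sum_subspace hk hp)"
    and "vector_ordering (imag_part hp) P"
  shows "first_conjugate_locus M g (\<one>\<^bsub>U\<^esub> <#\<^bsub>U\<^esub> K) =
    differential A M (\<lambda>u. u <#\<^bsub>U\<^esub> K) \<one>\<^bsub>U\<^esub> `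
      {Ad U A k Y | k Y x. k \<in> K \<and>
         x \<in> cartan_polyhedron_face (lie_bracket U A) \<theta> hk hp P \<and>
         cembed Y = cscale (of_real pi * \<i>) x}"
proof -
  have M: "smooth_manifold M" using assms(6) by (simp add: quotient_manifold_def)
  interpret compact_symmetric_space U A M g K \<theta> hk hp P
    by (intro compact_symmetric_space.intro hom_space.intro lie_group_loc.intro riemannian_manifold.intro
        hom_space_axioms.intro compact_symmetric_space_axioms.intro; fact M assms)
  show ?thesis using first_conjugate_locus_polyhedron unfolding d\<pi>_def .
qed

end
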